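(* Let $d\ge 1$. (i) Let $f\in C(\mathbb T^d)$. Then there exists a self-homeomorphism $h$ of $\mathbb T^d$ such that $f\circ h\in M_p(\mathbb T^d)$ for all $p$ with $1<p<\infty$. (ii) Moreover, if a family $K\subseteq C(\mathbb T^d)$ is uniformly equicontinuous on $\mathbb T^d$, then there exists a single self-homeomorphism $h$ of $\mathbb T^d$ such that $f\circ h\in M_p(\mathbb T^d)$ for all $f\in K$ and all $p$ with $1<p<\infty$.
   Context: $\mathbb T=\mathbb R/2\pi\mathbb Z$, and $C(\mathbb T^d)$ denotes the class of continuous (complex-valued) functions on the torus $\mathbb T^d$. A self-homeomorphism of $\mathbb T^d$ is a homeomorphism of $\mathbb T^d$ onto itself. Modulus of continuity: for a function $f$ on $\mathbb T^d$, $\omega(f,\mathbb T^d,\delta)=\sup\{|f(t_1)-f(t_2)| : t_1,t_2\in \mathbb T^d,\ |t_1-t_2|\le\delta\}$, $\delta\ge 0$, where $|t_1-t_2|$ is the usual (Euclidean quotient) distance on $\mathbb T^d$. For a family $K$ of functions on $\mathbb T^d$, $\omega(K,\mathbb T^d,\delta)=\sup_{f\in K}\omega(f,\mathbb T^d,\delta)$; $K$ is called uniformly equicontinuous on $\mathbb T^d$ if $\omega(K,\mathbb T^d,\delta)\to 0$ as $\delta\to+0$. Fourier multipliers: let $1\le p\le\infty$. The torus $\mathbb T^d$ is the dual group of $\mathbb Z^d$. A function $m\in L^\infty(\mathbb T^d)$ is an $L^p$ multiplier, written $m\in M_p(\mathbb T^d)$, if the operator $Q$ defined by $\widehat{Qf}=m\cdot\widehat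 f$ for $f\in L^p\cap L^2(\mathbb Z^d)$ (i.e. $f\in l^p\cap l^2(\mathbb Z^d)$; here $\widehat{\ }$ is the Fourier transform on $\mathbb Z^d$, taking functions on $\mathbb Z^d$ to functions on $\mathbb T^d$) satisfies $\|Qf\|_{l^p(\mathbb Z^d)}\le c\|f\|_{l^p(\mathbb Z^d)}$ for all $f\in l^p\cap l^2(\mathbb Z^d)$, with a constant $c>0$ not depending on $f$. *)

theory Defs
  imports "HOL-Analysis.Analysis"
begin

definition circle_rel :: "real \<Rightarrow> real \<Rightarrow> bool" where
  "circle_rel x y \<longleftrightarrow> (\<exists>k::int. x - y = 2 * pi * of_int k)"

lemma equivp_circle_rel: "equivp circle_rel"
proof (rule equivpI)
  show "reflp circle_rel"
    by (auto simp: reflp_def circle_rel_def intro: exI[of _ 0])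
  show "symp circle_rel"
  proof (rule sympI)
    fix x y assume "circle_rel x y"
    then obtain k :: int where "x - y = 2 * pi * of_int k" by (auto simp: circle_rel_def)
    then have "y - x = 2 * pi * of_int (- k)" by simp
    then show "circle_rel y x" unfolding circle_rel_def by blast
  qed
  show "transp circle_rel"
  proof (rule transpI)
    fix x y z assume "circle_rel x y" "circle_rel y z"
    then obtain k l :: int where "x - y = 2 * pi * of_int k" "y - z = 2 * pi * of_int l"
      by (auto simp: circle_rel_def)
    then have "x - z = 2 * pi * of_int (k + l)" by (simp add: algebra_simps)
    then show "circle_rel x z" unfolding circle_rel_def by blast
  qed
qed

quotient_type circle = real / circle_rel
  by (rule equivp_circle_rel)

lemma circle_dist_attained:
  fixes x y :: real
  shows "(INF k::int. \<bar>x - y - 2 * pi * of_int k\<bar>)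
           = \<bar>x - y - 2 * pi * of_int (round ((x - y) / (2 * pi)))\<bar>"
proof (rule antisym)
  show "(INF k::int. \<bar>x - y - 2 * pi * of_int k\<bar>)
           \<le> \<bar>x - y - 2 * pi * of_int (round ((x - y) / (2 * pi)))\<bar>"
    by (rule cINF_lower) (auto intro!: bdd_belowI[of _ 0])
  show "\<bar>x - y - 2 * pi * of_int (round ((x - y) / (2 * pi)))\<bar>
           \<le> (INF k::int. \<bar>x - y - 2 * pi * of_int k\<bar>)"
  proof (rule cINF_greatest)
    fix k :: int
    have *: "\<bar>x - y - 2 * pi * of_int j\<bar> = 2 * pi * \<bar>(x - y) / (2 * pi) - of_int j\<bar>" for j :: int
    proof -
      have "x - y - 2 * pi * of_int j = 2 * pi * ((x - y) / (2 * pi) - of_int j)"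
        by (simp add: field_simps)
      then show ?thesis by (simp add: abs_mult)
    qed
    show "\<bar>x - y - 2 * pi * of_int (round ((x - y) / (2 * pi)))\<bar> \<le> \<bar>x - y - 2 * pi * of_int k\<bar>"
      unfolding * by (intro mult_left_mono round_diff_minimal) simp
  qed simp
qed

lemma circle_dist_le:
  fixes x y :: real and k :: int
  shows "(INF k::int. \<bar>x - y - 2 * pi * of_int k\<bar>) \<le> \<bar>x - y - 2 * pi * of_int k\<bar>"
  by (rule cINF_lower) (auto intro!: bdd_belowI[of _ 0])

instantiation circle :: metric_space
begin

lift_definition dist_circle :: "circle \<Rightarrow> circle \<Rightarrow> real" is
  "\<lambda>x y. INF k::int. \<bar>x - y - 2 * pi * of_int k\<bar>"
proof -
  fix x x' y y' :: real
  assume "circle_rel x x'" "circle_rel y y'"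
  then obtain k l :: int where kl: "x - x' = 2 * pi * of_int k" "y - y' = 2 * pi * of_int l"
    by (auto simp: circle_rel_def)
  have "range (\<lambda>j::int. \<bar>x - y - 2 * pi * of_int j\<bar>)
          = range ((\<lambda>j::int. \<bar>x' - y' - 2 * pi * of_int j\<bar>) \<circ> (\<lambda>j. j - (k - l)))"
    using kl by (intro image_cong) (auto simp: algebra_simps)
  also have "\<dots> = range (\<lambda>j::int. \<bar>x' - y' - 2 * pi * of_int j\<bar>)"
  proof -
    have "surj (\<lambda>j::int. j - (k - l))"
      by (rule surjI[of _ "\<lambda>j. j + (k - l)"]) simp
    then show ?thesis by (simp only: image_comp [symmetric])
  qed
  finally show "(INF j::int. \<bar>x - y - 2 * pi * of_int j\<bar>)
                  = (INF j::int. \<bar>x' - y' - 2 * pi * of_int j\<bar>)"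
    by simp
qed

definition uniformity_circle :: "(circle \<times> circle) filter" where
  "uniformity_circle = (INF e\<in>{0<..}. principal {(x, y). dist x y < e})"

definition open_circle :: "circle set \<Rightarrow> bool" where
  "open_circle U \<longleftrightarrow> (\<forall>x\<in>U. eventually (\<lambda>(x', y). x' = x \<longrightarrow> y \<in> U) uniformity)"

instance
proof
  show "uniformity = (INF e\<in>{0<..}. principal {(x :: circle, y). dist x y < e})"
    by (rule uniformity_circle_def)
  show "open U \<longleftrightarrow> (\<forall>x\<in>U. eventually (\<lambda>(x', y). x' = x \<longrightarrow> y \<in> U) uniformity)"
    for U :: "circle set"
    by (rule open_circle_def)
  show "dist x y = 0 \<longleftrightarrow> x = y" for x y :: circle
  proof transfer
    fix x y :: real
    show "(INF k::int. \<bar>x - y - 2 * pi * of_int k\<bar>) = 0 \<longleftrightarrow> circle_rel x y"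
    proof
      assume "(INF k::int. \<bar>x - y - 2 * pi * of_int k\<bar>) = 0"
      then have "x - y = 2 * pi * of_int (round ((x - y) / (2 * pi)))"
        unfolding circle_dist_attained by simp
      then show "circle_rel x y" unfolding circle_rel_def by blast
    next
      assume "circle_rel x y"
      then obtain k :: int where "x - y = 2 * pi * of_int k" by (auto simp: circle_rel_def)
      then have "(INF k::int. \<bar>x - y - 2 * pi * of_int k\<bar>) \<le> 0"
        using circle_dist_le[of x y k] by simp
      then show "(INF k::int. \<bar>x - y - 2 * pi * of_int k\<bar>) = 0"
        unfolding circle_dist_attained by simp
    qed
  qed
  show "dist x y \<le> dist x z + dist y z" for x y z :: circle
  proof transfer
    fix x y z :: real
    let ?k = "round ((x - z) / (2 * pi))" and ?l = "round ((y - z) / (2 * pi))"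
    have "(INF k::int. \<bar>x - y - 2 * pi * of_int k\<bar>) \<le> \<bar>x - y - 2 * pi * of_int (?k - ?l)\<bar>"
      by (rule circle_dist_le)
    also have "\<dots> \<le> \<bar>x - z - 2 * pi * of_int ?k\<bar> + \<bar>y - z - 2 * pi * of_int ?l\<bar>"
      by (simp add: algebra_simps)
    finally show "(INF k::int. \<bar>x - y - 2 * pi * of_int k\<bar>)
        \<le> (INF k::int. \<bar>x - z - 2 * pi * of_int k\<bar>) + (INF k::int. \<bar>y - z - 2 * pi * of_int k\<bar>)"
      by (simp only: circle_dist_attained[of x z] circle_dist_attained[of y z])
  qed
qed

end

text \<open>
  The torus is the \<open>d\<close>-fold product of the circle, \<open>d = CARD('n)\<close>. The library's metric
  on \<open>_ ^ 'n\<close> is the \<open>L2_set\<close> combination of the coordinate distances, which here is the Euclidean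
  quotient distance, since the minimum over the lattice of periods is taken coordinatewise.
\<close>

type_synonym 'n torus = "circle ^ 'n"

definition torus_proj :: "real ^ 'n \<Rightarrow> 'n torus" where
  "torus_proj x = (\<chi> i. abs_circle (x $ i))"

lemma continuous_on_abs_circle: "continuous_on A abs_circle"
proof -
  have "dist (abs_circle x) (abs_circle y) \<le> dist x y" for x y
    using circle_dist_le[of x y 0] by (simp add: dist_circle.abs_eq dist_real_def)
  then show ?thesis
    unfolding continuous_on_iff by (meson le_less_trans)
qed

lemma torus_proj_measurable [measurable]: "torus_proj \<in> borel_measurable borel"
proof (rule borel_measurable_continuous_onI)
  show "continuous_on UNIV (torus_proj :: real ^ 'n \<Rightarrow> 'n torus)"
    unfolding torus_proj_def
    by (intro continuous_on_vec_lambda continuous_on_compose2[OF continuous_on_abs_circle[of UNIV]]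
        continuous_intros) auto
qed

text \<open>Haar measure, of total mass \<open>(2 * pi) ^ CARD('n)\<close>, on the Borel sets.\<close>

definition torus_measure :: "('n::finite) torus measure" where
  "torus_measure =
     distr (restrict_space lborel {x. \<forall>i. 0 \<le> x $ i \<and> x $ i < 2 * pi}) borel torus_proj"

definition self_homeomorphism :: "(('n::finite) torus \<Rightarrow> 'n torus) \<Rightarrow> bool" where
  "self_homeomorphism h \<longleftrightarrow> (\<exists>g. homeomorphism UNIV UNIV h g)"

definition modulus_of_continuity :: "(('n::finite) torus \<Rightarrow> complex) \<Rightarrow> real \<Rightarrow> ennreal" where
  "modulus_of_continuity f \<delta> =
     (SUP (s, t) \<in> {(s, t). dist s t \<le> \<delta>}. ennreal (cmod (f s - f t)))"

definition family_modulus_of_continuity ::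
    "(('n::finite) torus \<Rightarrow> complex) set \<Rightarrow> real \<Rightarrow> ennreal" where
  "family_modulus_of_continuity K \<delta> = (SUP f\<in>K. modulus_of_continuity f \<delta>)"

definition uniformly_equicontinuous :: "(('n::finite) torus \<Rightarrow> complex) set \<Rightarrow> bool" where
  "uniformly_equicontinuous K \<longleftrightarrow> (family_modulus_of_continuity K \<longlongrightarrow> 0) (at_right 0)"

definition lp_space :: "real \<Rightarrow> (int ^ 'n \<Rightarrow> complex) set" where
  "lp_space p = {a. (\<lambda>k. cmod (a k) powr p) summable_on UNIV}"

definition lp_norm :: "real \<Rightarrow> (int ^ 'n \<Rightarrow> complex) \<Rightarrow> real" where
  "lp_norm p a = (\<Sum>\<^sub>\<infinity>k. cmod (a k) powr p) powr (1 / p)"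

lift_definition circle_character :: "int \<Rightarrow> circle \<Rightarrow> complex" is "\<lambda>k x. cis (of_int k * x)"
proof -
  fix k :: int and x y :: real
  assume "circle_rel x y"
  then obtain l :: int where "x = y + 2 * pi * of_int l"
    by (auto simp: circle_rel_def algebra_simps)
  then have "of_int k * x = of_int k * y + 2 * pi * of_int (k * l)"
    by (simp add: algebra_simps)
  then show "cis (of_int k * x) = cis (of_int k * y)"
    by (simp add: cis_mult [symmetric] cis_multiple_2pi)
qed

definition torus_character :: "int ^ 'n \<Rightarrow> ('n::finite) torus \<Rightarrow> complex" where
  "torus_character k t = (\<Prod>i\<in>UNIV. circle_character (k $ i) (t $ i))"

text \<open>
  \<open>is_fourier_transform a F\<close>: \<open>F\<close> represents the Fourier transform of the square-summable
  function \<open>a\<close>, i.e. \<open>\<Sum>k. a k * exp (- \<i> * (k \<bullet> t))\<close> with the sum taken in \<open>L\<^sup>2\<close> of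
  the torus (unconditionally, over the net of finite index sets). It determines \<open>F\<close> up to a null
  set.
\<close>

definition is_fourier_transform ::
    "(int ^ 'n \<Rightarrow> complex) \<Rightarrow> (('n::finite) torus \<Rightarrow> complex) \<Rightarrow> bool" where
  "is_fourier_transform a F \<longleftrightarrow>
     a \<in> lp_space 2 \<and>
     F \<in> borel_measurable torus_measure \<and>
     (\<integral>\<^sup>+ t. ennreal ((cmod (F t))\<^sup>2) \<partial>torus_measure) < \<infinity> \<and>
     ((\<lambda>A. \<integral>\<^sup>+ t. ennreal ((cmod ((\<Sum>k\<in>A. a k * torus_character (- k) t) - F t))\<^sup>2)
              \<partial>torus_measure) \<longlongrightarrow> 0)
       (finite_subsets_at_top UNIV)"

definition L_infinity :: "(('n::finite) torus \<Rightarrow> complex) set" where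
  "L_infinity =
     {m. m \<in> borel_measurable torus_measure \<and> (\<exists>C. AE t in torus_measure. cmod (m t) \<le> C)}"

text \<open>
  For \<open>m\<close> in \<open>L_infinity\<close> the condition on the transforms determines the values \<open>Q a\<close>
  for \<open>a\<close> in the intersection of \<open>lp_space p\<close> and \<open>lp_space 2\<close> uniquely, so \<open>Q\<close> is
  the multiplier operator. Intended for finite exponents \<open>p \<ge> 1\<close>.
\<close>

definition Lp_multipliers :: "real \<Rightarrow> (('n::finite) torus \<Rightarrow> complex) set" where
  "Lp_multipliers p = {m \<in> L_infinity.
     \<exists>Q :: (int ^ 'n \<Rightarrow> complex) \<Rightarrow> (int ^ 'n \<Rightarrow> complex).
       (\<forall>a \<in> lp_space p \<inter> lp_space 2.
          \<exists>F. is_fourier_transform a F \<and> is_fourier_transform (Q a) (\<lambda>t. m t * F t)) \<and>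
       (\<exists>c>0. \<forall>a \<in> lp_space p \<inter> lp_space 2.
          Q a \<in> lp_space p \<and> lp_norm p (Q a) \<le> c * lp_norm p a)}"

end

theory Submission
  imports Defs
begin

text \<open>
  The homeomorphism is a product of copies of one homeomorphism of the circle, which maps a nested
  sequence of lacunary partitions onto uniform partitions: in passing from one generation to the
  next, the division points of a cell accumulate at superexponential speed at its two ends.
  Littlewood-Paley theory then shows that every function bounded by 1 which is constant on the cells
  of generation \<open>n\<close> is an \<open>L\<^sup>p\<close> multiplier, with a norm that depends on \<open>n\<close>, \<open>p\<close> and the dimension
  but not on the number of cells. By equicontinuity the numbers of cells can be chosen so large that
  the oscillations of \<open>f \<circ> h\<close> on the cells are summable against these norms, and \<open>f \<circ> h\<close> is
  a convergent telescoping series of multipliers.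

  The multiplier estimates are proved on the finite groups \<open>(\<int> / 2 ^ \<rho>) ^ d\<close>, with constants
  independent of \<open>\<rho>\<close>, and are transferred to \<open>\<int> ^ d\<close> by Riemann sums. They are proved for
  \<open>p = 2\<close> and \<open>p = 2 * 2 ^ q\<close>; interpolation and duality give the other exponents. Sharp cut-offs to
  arcs come from Cotlar's identity for the discrete Hilbert transform. The randomised sums over the
  lacunary arcs are compared with martingale transforms built from products of Fejer kernels, which
  are bounded by means of Burkholder's function.
\<close>

section \<open>Multipliers on the finite torus\<close>

definition grid :: "nat \<Rightarrow> (int ^ 'n) set" where
  "grid M = {x. \<forall>i. 0 \<le> x $ i \<and> x $ i < int M}"

definition chr :: "nat \<Rightarrow> int ^ 'n \<Rightarrow> int ^ 'n \<Rightarrow> complex" where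
  "chr M k x = cis (2 * pi * real_of_int (\<Sum>i\<in>UNIV. k $ i * x $ i) / real M)"

definition periodic :: "nat \<Rightarrow> (int ^ 'n \<Rightarrow> 'b) \<Rightarrow> bool" where
  "periodic M f \<longleftrightarrow> (\<forall>x y. (\<forall>i. x $ i mod int M = y $ i mod int M) \<longrightarrow> f x = f y)"

definition mult_op :: "nat \<Rightarrow> (int ^ 'n \<Rightarrow> complex) \<Rightarrow> (int ^ 'n \<Rightarrow> complex) \<Rightarrow> int ^ 'n \<Rightarrow> complex" where
  "mult_op M m a x =
     (\<Sum>k\<in>grid M. \<Sum>y\<in>grid M. m k * chr M k (x - y) * a y) / of_nat (card (grid M :: (int ^ 'n) set))"

definition nrm :: "nat \<Rightarrow> real \<Rightarrow> (int ^ 'n \<Rightarrow> complex) \<Rightarrow> real" where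
  "nrm M p a = (\<Sum>x\<in>grid M. cmod (a x) powr p) powr (1 / p)"

definition mult_bound :: "nat \<Rightarrow> real \<Rightarrow> real \<Rightarrow> (int ^ 'n \<Rightarrow> complex) \<Rightarrow> bool" where
  "mult_bound M p C m \<longleftrightarrow> (\<forall>a. nrm M p (mult_op M m a) \<le> C * nrm M p a)"

lemma bij_grid: "bij_betw (\<lambda>f. \<chi> i. f i) (UNIV \<rightarrow>\<^sub>E {0..<int M}) (grid M :: (int ^ 'n::finite) set)"
  by (rule bij_betwI[where g = vec_nth]) (auto simp: grid_def PiE_def extensional_def)

lemma finite_grid [simp]: "finite (grid M :: (int ^ 'n::finite) set)"
  using bij_betw_finite[OF bij_grid[where 'n='n and M=M]] finite_PiE[of "UNIV::'n set" "\<lambda>_. {0..<int M}"]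
  by auto

lemma card_grid: "card (grid M :: (int ^ 'n::finite) set) = M ^ CARD('n)"
  using bij_betw_same_card[OF bij_grid[where 'n='n and M=M]]
  by (simp add: card_PiE)

lemma grid_mod: "M > 0 \<Longrightarrow> (\<chi> i. x $ i mod int M) \<in> grid M"
  by (simp add: grid_def)

lemma sum_grid_shift:
  fixes F :: "int ^ 'n::finite \<Rightarrow> 'b::comm_monoid_add"
  assumes M: "M > 0" and F: "periodic M F"
  shows "(\<Sum>k\<in>grid M. F (k + v)) = (\<Sum>k\<in>grid M. F k)"
proof -
  have bij: "bij_betw (\<lambda>k. \<chi> i. (k $ i + v $ i) mod int M) (grid M) (grid M :: (int ^ 'n) set)"
    using M
    by (intro bij_betwI[where g = "\<lambda>k. \<chi> i. (k $ i - v $ i) mod int M"])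
       (auto simp: grid_def vec_eq_iff mod_simps)
  have "(\<Sum>k\<in>grid M. F (k + v)) = (\<Sum>k\<in>grid M. F (\<chi> i. (k $ i + v $ i) mod int M))"
    using F by (intro sum.cong refl) (auto simp: periodic_def)
  also have "\<dots> = (\<Sum>k\<in>grid M. F k)"
    by (rule sum.reindex_bij_betw[OF bij])
  finally show ?thesis .
qed

lemma chr_add_left: "chr M (k + l) x = chr M k x * chr M l x"
  by (simp add: chr_def cis_mult algebra_simps sum.distrib add_divide_distrib)

lemma chr_commute: "chr M k x = chr M x k"
  by (simp add: chr_def mult.commute)

lemma chr_add_right: "chr M k (x + y) = chr M k x * chr M k y"
  by (metis chr_add_left chr_commute)

lemma chr_zero [simp]: "chr M 0 x = 1" "chr M k 0 = 1"
  by (simp_all add: chr_def)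

lemma chr_minus: "chr M (- k) x = cnj (chr M k x)" "chr M k (- x) = cnj (chr M k x)"
  by (simp_all add: chr_def sum_negf cis_cnj)

lemma norm_chr [simp]: "cmod (chr M k x) = 1"
  by (simp add: chr_def)

lemma chr_diff_right: "chr M k (x - y) = chr M k x * cnj (chr M k y)"
  by (metis chr_add_right chr_minus(2) diff_conv_add_uminus)

lemma cis_period: "M > 0 \<Longrightarrow> int M dvd n - m \<Longrightarrow> cis (2 * pi * of_int n / real M) = cis (2 * pi * of_int m / real M)"
proof -
  assume "M > 0" "int M dvd n - m"
  then obtain q where "n = m + int M * q" by (metis dvdE add_diff_cancel_left' diff_add_cancel add.commute)
  then have "2 * pi * of_int n / real M = 2 * pi * of_int m / real M + 2 * pi * of_int q"
    using \<open>M > 0\<close> by (simp add: field_simps)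
  then show ?thesis by (simp add: cis_mult[symmetric] cis_multiple_2pi)
qed

lemma periodic_chr: "M > 0 \<Longrightarrow> periodic M (chr M k)" for k :: "int ^ 'n"
  unfolding periodic_def
proof (intro allI impI)
  fix x y :: "int ^ 'n" assume M: "M > 0" and xy: "\<forall>i. x $ i mod int M = y $ i mod int M"
  have "int M dvd (\<Sum>i\<in>UNIV. k $ i * x $ i) - (\<Sum>i\<in>UNIV. k $ i * y $ i)"
    unfolding sum_subtractf[symmetric] right_diff_distrib[symmetric]
    by (intro dvd_sum dvd_mult) (use xy in \<open>auto simp: mod_eq_dvd_iff\<close>)
  then show "chr M k x = chr M k y"
    unfolding chr_def by (rule cis_period[OF M])
qed

lemma periodic_chr_left: "M > 0 \<Longrightarrow> periodic M (\<lambda>k. chr M k x)"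
  using periodic_chr[of M x] by (simp add: chr_commute[of M x, abs_def] periodic_def)

lemma periodic_mod: "periodic M f \<Longrightarrow> f (\<chi> i. x $ i mod int M) = f x"
  by (auto simp: periodic_def)

lemma cis_eq_1_int:
  assumes "M > 0" "cis (2 * pi * of_int n / real M) = 1"
  shows "int M dvd n"
proof -
  have "cos (2 * pi * of_int n / real M) = 1"
    using assms(2) by (metis cis.simps(1) one_complex.simps(1))
  then obtain q :: int where "2 * pi * of_int n / real M = of_int q * 2 * pi"
    using cos_one_2pi_int by blast
  then have "real_of_int n = of_int (q * int M)" using assms(1) by (simp add: field_simps)
  then have "n = q * int M" by (simp only: of_int_eq_iff)
  then show ?thesis by simp
qed

lemma sum_chr:
  fixes x :: "int ^ 'n::finite"
  assumes M: "M > 0"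
  shows "(\<Sum>k\<in>grid M. chr M k x) = (if \<forall>i. int M dvd x $ i then of_nat (card (grid M :: (int^'n) set)) else 0)"
proof (cases "\<forall>i. int M dvd x $ i")
  case True
  then have "chr M k x = 1" for k :: "int ^ 'n"
    using periodic_chr[OF M, of k] unfolding periodic_def
    by (metis chr_zero(2) dvd_imp_mod_0 mod_0 zero_index)
  then show ?thesis using True by simp
next
  case False
  then obtain i where i: "\<not> int M dvd x $ i" by auto
  have per: "periodic M (\<lambda>k. chr M k x)" by (rule periodic_chr_left[OF M])
  have "(\<Sum>k\<in>grid M. chr M k x) = (\<Sum>k\<in>grid M. chr M (k + axis i 1) x)"
    using sum_grid_shift[OF M per, of "axis i 1"] by simp
  also have "\<dots> = (\<Sum>k\<in>grid M. chr M k x) * chr M (axis i 1) x"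
    by (simp add: chr_add_left sum_distrib_right)
  also have "chr M (axis i 1) x = cis (2 * pi * of_int (x $ i) / real M)"
  proof -
    have "(\<Sum>j\<in>UNIV. axis i 1 $ j * x $ j) = (\<Sum>j\<in>UNIV. if j = i then x $ j else 0)"
      by (intro sum.cong) (auto simp: axis_def)
    then show ?thesis by (simp add: chr_def)
  qed
  finally show ?thesis using cis_eq_1_int[OF M, of "x $ i"] i False by auto
qed

lemma sum_chr_grid:
  fixes x :: "int ^ 'n::finite"
  assumes "M > 0" "x \<in> grid M" "y \<in> grid M"
  shows "(\<Sum>k\<in>grid M. chr M k (x - y)) = (if x = y then of_nat (card (grid M :: (int^'n) set)) else 0)"
proof -
  have "(\<forall>i. int M dvd (x - y) $ i) \<longleftrightarrow> x = y"
  proof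
    assume "\<forall>i. int M dvd (x - y) $ i"
    then have "x $ i mod int M = y $ i mod int M" for i by (simp add: mod_eq_dvd_iff)
    then show "x = y" using assms(2,3) by (simp add: grid_def vec_eq_iff)
  qed simp
  then show ?thesis using sum_chr[OF assms(1), of "x - y"] by simp
qed

lemma mult_op_one:
  fixes x :: "int ^ 'n::finite"
  assumes "M > 0" "x \<in> grid M"
  shows "mult_op M (\<lambda>_. 1) a x = a x"
proof -
  have "(\<Sum>k\<in>grid M. \<Sum>y\<in>grid M. 1 * chr M k (x - y) * a y) =
        (\<Sum>y\<in>grid M. (\<Sum>k\<in>grid M. chr M k (x - y)) * a y)"
    by (subst sum.swap) (simp add: sum_distrib_right)
  also have "\<dots> = (\<Sum>y\<in>grid M. if y = x then of_nat (card (grid M :: (int^'n) set)) * a y else 0)"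
    using assms by (intro sum.cong) (auto simp: sum_chr_grid)
  also have "\<dots> = of_nat (card (grid M :: (int^'n) set)) * a x" using assms by simp
  finally show ?thesis using assms by (auto simp: mult_op_def card_gt_0_iff)
qed

definition dft :: "nat \<Rightarrow> (int ^ 'n \<Rightarrow> complex) \<Rightarrow> int ^ 'n \<Rightarrow> complex" where
  "dft M a k = (\<Sum>y\<in>grid M. cnj (chr M k y) * a y)"

lemma mult_op_dft:
  "mult_op M m a x = (\<Sum>k\<in>grid M. m k * chr M k x * dft M a k) / of_nat (card (grid M :: (int ^ 'n) set))"
  for x :: "int ^ 'n::finite"
  by (simp add: mult_op_def dft_def sum_distrib_left chr_diff_right mult.assoc)

lemma dft_mult_op:
  fixes k :: "int ^ 'n::finite"
  assumes M: "M > 0" and k: "k \<in> grid M"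
  shows "dft M (mult_op M m a) k = m k * dft M a k"
proof -
  let ?N = "of_nat (card (grid M :: (int ^ 'n) set)) :: complex"
  have N: "?N \<noteq> 0" using k by auto
  have "dft M (mult_op M m a) k * ?N = (\<Sum>y\<in>grid M. \<Sum>l\<in>grid M. cnj (chr M k y) * (m l * chr M l y * dft M a l))"
    using N by (simp add: dft_def[of M "mult_op M m a"] mult_op_dft sum_divide_distrib[symmetric] sum_distrib_left del: sum_divide_distrib)
  also have "\<dots> = (\<Sum>l\<in>grid M. (\<Sum>y\<in>grid M. chr M y (l - k)) * (m l * dft M a l))"
    by (subst sum.swap) (simp add: sum_distrib_left sum_distrib_right chr_diff_right chr_commute[of M k] chr_commute[of M _ _] ac_simps)
  also have "\<dots> = (\<Sum>l\<in>grid M. if l = k then ?N * (m l * dft M a l) else 0)"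
    using k by (intro sum.cong) (auto simp: sum_chr_grid[OF M])
  also have "\<dots> = m k * dft M a k * ?N" using k by simp
  finally show ?thesis using N by simp
qed

lemma mult_op_cong:
  assumes "\<And>k. k \<in> grid M \<Longrightarrow> m k = m' k" "\<And>k. k \<in> grid M \<Longrightarrow> a k = a' k"
  shows "mult_op M m a x = mult_op M m' a' x"
  by (simp add: mult_op_def assms cong: sum.cong)

lemma mult_op_mult:
  fixes x :: "int ^ 'n::finite"
  assumes "M > 0"
  shows "mult_op M (\<lambda>k. m k * m' k) a x = mult_op M m (mult_op M m' a) x"
  by (simp add: mult_op_dft[of M m] mult_op_dft[of M "\<lambda>k. m k * m' k"] dft_mult_op[OF assms] ac_simps cong: sum.cong)

lemma mult_op_add: "mult_op M (\<lambda>k. m k + m' k) a x = mult_op M m a x + mult_op M m' a x"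
  by (simp add: mult_op_def algebra_simps sum.distrib add_divide_distrib)

lemma mult_op_diff: "mult_op M (\<lambda>k. m k - m' k) a x = mult_op M m a x - mult_op M m' a x"
  by (simp add: mult_op_def algebra_simps sum_subtractf diff_divide_distrib)

lemma mult_op_scale: "mult_op M (\<lambda>k. c * m k) a x = c * mult_op M m a x"
  by (simp add: mult_op_def sum_distrib_left mult.assoc)

lemma mult_op_sum: "mult_op M (\<lambda>k. \<Sum>j\<in>J. m j k) a x = (\<Sum>j\<in>J. mult_op M (m j) a x)"
  by (induction J rule: infinite_finite_induct) (simp_all add: mult_op_add, simp_all add: mult_op_def)

lemma mult_op_add_arg: "mult_op M m (\<lambda>y. a y + b y) x = mult_op M m a x + mult_op M m b x"
  by (simp add: mult_op_def algebra_simps sum.distrib add_divide_distrib)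

lemma mult_op_scale_arg: "mult_op M m (\<lambda>y. c * a y) x = c * mult_op M m a x"
  by (simp add: mult_op_def sum_distrib_left ac_simps)

lemma mult_op_sum_arg: "mult_op M m (\<lambda>y. \<Sum>j\<in>J. a j y) x = (\<Sum>j\<in>J. mult_op M m (a j) x)"
  by (induction J rule: infinite_finite_induct) (simp_all add: mult_op_add_arg, simp_all add: mult_op_def)

lemma mult_op_shift:
  fixes x :: "int ^ 'n::finite"
  assumes M: "M > 0" and m: "periodic M m"
  shows "mult_op M (\<lambda>k. m (k - v)) a x = chr M v x * mult_op M m (\<lambda>y. cnj (chr M v y) * a y) x"
proof -
  define F where "F k = m (k - v) * (\<Sum>y\<in>grid M. chr M k (x - y) * a y)" for k
  have "periodic M (\<lambda>k. chr M k z)" for z :: "int ^ 'n" by (rule periodic_chr_left[OF M])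
  then have per: "periodic M F"
    using m unfolding periodic_def F_def
    by (smt (verit, best) mod_diff_cong sum.cong vector_minus_component)
  have "(\<Sum>k\<in>grid M. \<Sum>y\<in>grid M. m (k - v) * chr M k (x - y) * a y) = (\<Sum>k\<in>grid M. F k)"
    by (simp add: F_def sum_distrib_left mult.assoc)
  also have "\<dots> = (\<Sum>k\<in>grid M. F (k + v))" by (rule sum_grid_shift[OF M per, symmetric])
  also have "\<dots> = chr M v x * (\<Sum>k\<in>grid M. \<Sum>y\<in>grid M. m k * chr M k (x - y) * (cnj (chr M v y) * a y))"
    by (simp add: F_def sum_distrib_left chr_add_left chr_diff_right[of M v] ac_simps)
  finally show ?thesis by (simp add: mult_op_def)
qed

lemma nrm_nonneg [simp]: "0 \<le> nrm M p a"
  by (simp add: nrm_def)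

lemma nrm_cong: "(\<And>x. x \<in> grid M \<Longrightarrow> cmod (a x) = cmod (b x)) \<Longrightarrow> nrm M p a = nrm M p b"
  by (simp add: nrm_def cong: sum.cong)

lemma nrm_powr: "p > 0 \<Longrightarrow> nrm M p a powr p = (\<Sum>x\<in>grid M. cmod (a x) powr p)"
  by (simp add: nrm_def powr_powr sum_nonneg)

lemma nrm_mono:
  fixes a b :: "int ^ 'n::finite \<Rightarrow> complex"
  assumes "p > 0" "\<And>x. x \<in> grid M \<Longrightarrow> cmod (a x) \<le> cmod (b x)"
  shows "nrm M p a \<le> nrm M p b"
  using assms by (auto simp: nrm_def intro!: powr_mono2 sum_mono sum_nonneg)

lemma nrm_scale:
  fixes a :: "int ^ 'n::finite \<Rightarrow> complex"
  assumes "p > 0" shows "nrm M p (\<lambda>x. c * a x) = cmod c * nrm M p a"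
  using assms
  by (simp add: nrm_def norm_mult powr_mult sum_distrib_left[symmetric] sum_nonneg powr_powr)

lemma nrm_zero [simp]: "nrm M p (\<lambda>x. 0) = 0"
  by (simp add: nrm_def)

lemma nrm_eq_0:
  fixes a :: "int ^ 'n::finite \<Rightarrow> complex"
  assumes "nrm M p a = 0" "x \<in> grid M" shows "a x = 0"
proof -
  have "(\<Sum>x\<in>grid M. cmod (a x) powr p) = 0" using assms(1) by (simp add: nrm_def)
  then have "cmod (a x) powr p = 0" using assms(2) by (simp add: sum_nonneg_eq_0_iff)
  then show ?thesis by simp
qed

lemma convex_powr_nonneg:
  assumes "p \<ge> 1" "0 \<le> x" "0 \<le> y" "0 \<le> t" "t \<le> 1"
  shows "((1 - t) * x + t * y) powr p \<le> (1 - t) * x powr p + t * y powr (p::real)"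
proof -
  have aux: "(s * z) powr p \<le> s * z powr p" if "0 \<le> s" "s \<le> 1" "0 \<le> z" for s z
  proof -
    have "s powr p \<le> s" using that assms(1) by (metis powr_mono' powr_one_gt_zero_iff powr_one)
    then show ?thesis using that by (simp add: powr_mult mult_right_mono)
  qed
  consider "x = 0" | "y = 0" | "x > 0" "y > 0" using assms by fastforce
  then show ?thesis
  proof cases
    case 3
    then show ?thesis
      using convex_onD[OF powr_convex[OF assms(1)], of t x y] assms by simp
  qed (use aux[of t y] aux[of "1 - t" x] assms in auto)
qed

lemma nrm_triangle:
  fixes a b :: "int ^ 'n::finite \<Rightarrow> complex"
  assumes p: "p \<ge> 1"
  shows "nrm M p (\<lambda>x. a x + b x) \<le> nrm M p a + nrm M p b"
proof (cases "nrm M p a = 0 \<or> nrm M p b = 0")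
  case True
  then show ?thesis
  proof
    assume "nrm M p a = 0"
    then have "nrm M p (\<lambda>x. a x + b x) = nrm M p b" by (intro nrm_cong) (simp add: nrm_eq_0)
    then show ?thesis by simp
  next
    assume "nrm M p b = 0"
    then have "nrm M p (\<lambda>x. a x + b x) = nrm M p a" by (intro nrm_cong) (simp add: nrm_eq_0)
    then show ?thesis by simp
  qed
next
  case False
  define A B where "A = nrm M p a" and "B = nrm M p b"
  have pos: "A > 0" "B > 0" using False nrm_nonneg by (auto simp: A_def B_def less_le)
  define t where "t = B / (A + B)"
  have t: "0 \<le> t" "t \<le> 1" "1 - t = A / (A + B)" using pos by (auto simp: t_def field_simps)
  have pt: "cmod (a x + b x) powr p \<le> (A + B) powr p * ((1 - t) * (cmod (a x) powr p / A powr p) + t * (cmod (b x) powr p / B powr p))" for x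
  proof -
    have "cmod (a x + b x) powr p \<le> (cmod (a x) + cmod (b x)) powr p"
      using p by (intro powr_mono2 norm_triangle_ineq) auto
    also have "cmod (a x) + cmod (b x) = (A + B) * ((1 - t) * (cmod (a x) / A) + t * (cmod (b x) / B))"
      proof -
      have "(A + B) * (1 - t) = A" "(A + B) * t = B" using pos by (auto simp: t_def field_simps)
      then show ?thesis using pos by (simp add: distrib_left mult.assoc[symmetric])
    qed
    also have "\<dots> powr p = (A + B) powr p * ((1 - t) * (cmod (a x) / A) + t * (cmod (b x) / B)) powr p"
      using pos t by (simp add: powr_mult)
    also have "\<dots> \<le> (A + B) powr p * ((1 - t) * (cmod (a x) / A) powr p + t * (cmod (b x) / B) powr p)"
      using pos t p by (intro mult_left_mono convex_powr_nonneg) auto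
    finally show ?thesis using pos by (simp add: powr_divide)
  qed
  have A: "(\<Sum>x\<in>grid M. cmod (a x) powr p) = A powr p" "(\<Sum>x\<in>grid M. cmod (b x) powr p) = B powr p"
    using p by (simp_all add: A_def B_def nrm_powr)
  have "(\<Sum>x\<in>grid M. cmod (a x + b x) powr p) \<le> (\<Sum>x\<in>grid M. (A + B) powr p * ((1 - t) * (cmod (a x) powr p / A powr p) + t * (cmod (b x) powr p / B powr p)))"
    by (intro sum_mono pt)
  also have "\<dots> = (A + B) powr p * ((1 - t) * ((\<Sum>x\<in>grid M. cmod (a x) powr p) / A powr p) + t * ((\<Sum>x\<in>grid M. cmod (b x) powr p) / B powr p))"
    by (simp only: sum_distrib_left sum.distrib[symmetric] sum_divide_distrib)
  also have "\<dots> = (A + B) powr p" using pos by (simp add: A)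
  finally have "nrm M p (\<lambda>x. a x + b x) \<le> ((A + B) powr p) powr (1 / p)"
    unfolding nrm_def using p by (intro powr_mono2) (auto intro: sum_nonneg)
  also have "\<dots> = A + B" using pos p by (simp add: powr_powr)
  finally show ?thesis by (simp add: A_def B_def)
qed

lemma nrm_sum:
  fixes a :: "'i \<Rightarrow> int ^ 'n::finite \<Rightarrow> complex"
  assumes p: "p \<ge> 1"
  shows "nrm M p (\<lambda>x. \<Sum>j\<in>J. a j x) \<le> (\<Sum>j\<in>J. nrm M p (a j))"
proof (induction J rule: infinite_finite_induct)
  case (insert j J)
  then show ?case using nrm_triangle[OF p, of M "a j" "\<lambda>x. \<Sum>j\<in>J. a j x"] by simp
qed simp_all

lemma nrm_diff:
  fixes a b :: "int ^ 'n::finite \<Rightarrow> complex"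
  assumes p: "p \<ge> 1"
  shows "nrm M p (\<lambda>x. a x - b x) \<le> nrm M p a + nrm M p b"
proof -
  have "nrm M p (\<lambda>x. - b x) = nrm M p b" by (intro nrm_cong) simp
  then show ?thesis using nrm_triangle[OF p, of M a "\<lambda>x. - b x"] by simp
qed

lemma mult_boundD: "mult_bound M p C m \<Longrightarrow> nrm M p (mult_op M m a) \<le> C * nrm M p a"
  by (simp add: mult_bound_def)

lemma mult_bound_mono:
  "mult_bound M p C m \<Longrightarrow> C \<le> C' \<Longrightarrow> mult_bound M p C' m"
  unfolding mult_bound_def by (meson mult_right_mono nrm_nonneg order_trans)

lemma mult_bound_cong:
  assumes "mult_bound M p C m" "\<And>k. k \<in> grid M \<Longrightarrow> m k = m' k"
  shows "mult_bound M p C m'"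
proof -
  have "mult_op M m' a = mult_op M m a" for a
    using assms(2) by (intro ext mult_op_cong) auto
  then show ?thesis using assms(1) by (simp add: mult_bound_def)
qed

lemma mult_bound_add:
  fixes m :: "int ^ 'n::finite \<Rightarrow> complex"
  assumes "p \<ge> 1" "mult_bound M p C m" "mult_bound M p C' m'"
  shows "mult_bound M p (C + C') (\<lambda>k. m k + m' k)"
  unfolding mult_bound_def mult_op_add distrib_right
proof
  fix a
  show "nrm M p (\<lambda>x. mult_op M m a x + mult_op M m' a x) \<le> C * nrm M p a + C' * nrm M p a"
    using nrm_triangle[OF assms(1), of M "mult_op M m a" "mult_op M m' a"]
      mult_boundD[OF assms(2), of a] mult_boundD[OF assms(3), of a] by linarith
qed

lemma mult_bound_scale:
  fixes m :: "int ^ 'n::finite \<Rightarrow> complex"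
  assumes "p > 0" "mult_bound M p C m"
  shows "mult_bound M p (cmod c * C) (\<lambda>k. c * m k)"
  unfolding mult_bound_def mult_op_scale nrm_scale[OF assms(1)] mult.assoc
  using mult_boundD[OF assms(2)] by (meson mult_left_mono norm_ge_zero)

lemma mult_bound_minus:
  fixes m :: "int ^ 'n::finite \<Rightarrow> complex"
  assumes "p > 0" "mult_bound M p C m"
  shows "mult_bound M p C (\<lambda>k. - m k)"
  using mult_bound_scale[OF assms, of "-1"] by simp

lemma mult_bound_diff:
  fixes m :: "int ^ 'n::finite \<Rightarrow> complex"
  assumes "p \<ge> 1" "mult_bound M p C m" "mult_bound M p C' m'"
  shows "mult_bound M p (C + C') (\<lambda>k. m k - m' k)"
  using mult_bound_add[OF assms(1,2) mult_bound_minus[OF _ assms(3)]] assms(1) by simp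

lemma mult_bound_zero: "mult_bound M p 0 (\<lambda>k. 0)"
  by (simp add: mult_bound_def mult_op_def[abs_def])

lemma mult_bound_sum:
  fixes m :: "'i \<Rightarrow> int ^ 'n::finite \<Rightarrow> complex"
  assumes p: "p \<ge> 1" and "\<And>j. j \<in> J \<Longrightarrow> mult_bound M p (C j) (m j)"
  shows "mult_bound M p (\<Sum>j\<in>J. C j) (\<lambda>k. \<Sum>j\<in>J. m j k)"
  using assms(2)
proof (induction J rule: infinite_finite_induct)
  case (insert j J)
  then show ?case using mult_bound_add[OF p, of M "C j" "m j" "\<Sum>j\<in>J. C j" "\<lambda>k. \<Sum>j\<in>J. m j k"] by simp
qed (simp_all add: mult_bound_zero)

lemma mult_bound_const:
  fixes m :: "int ^ 'n::finite \<Rightarrow> complex"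
  assumes "M > 0" "p > 0"
  shows "mult_bound M p (cmod c) (\<lambda>k :: int ^ 'n. c)"
proof -
  have "nrm M p (mult_op M (\<lambda>_ :: int ^ 'n. 1) a) = nrm M p a" for a :: "int ^ 'n \<Rightarrow> complex"
    by (intro nrm_cong) (simp add: mult_op_one assms)
  then show ?thesis
    using mult_bound_scale[OF assms(2), of M 1 "\<lambda>_ :: int ^ 'n. 1" c] by (simp add: mult_bound_def)
qed

lemma nrm_chr_mult: "nrm M p (\<lambda>y. chr M v y * a y) = nrm M p a" "nrm M p (\<lambda>y. cnj (chr M v y) * a y) = nrm M p a"
  by (auto intro!: nrm_cong simp: norm_mult)

lemma mult_bound_shift:
  fixes m :: "int ^ 'n::finite \<Rightarrow> complex"
  assumes "M > 0" "periodic M m" "mult_bound M p C m"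
  shows "mult_bound M p C (\<lambda>k. m (k - v))"
  unfolding mult_bound_def mult_op_shift[OF assms(1,2)] nrm_chr_mult
  using mult_boundD[OF assms(3)] by (metis nrm_chr_mult(2))

section \<open>Khintchine's inequality and Littlewood-Paley partitions\<close>

definition sg :: "'z set \<Rightarrow> 'z \<Rightarrow> real" where
  "sg A z = (if z \<in> A then 1 else - 1)"

definition rav :: "'z set \<Rightarrow> ('z set \<Rightarrow> real) \<Rightarrow> real" where
  "rav Z \<phi> = (\<Sum>A\<in>Pow Z. \<phi> A) / 2 ^ card Z"

lemma abs_sg [simp]: "\<bar>sg A z\<bar> = 1" "sg A z * sg A z = 1"
  by (auto simp: sg_def)

lemma rav_empty [simp]: "rav {} \<phi> = \<phi> {}"
  by (simp add: rav_def)

lemma rav_insert: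
  assumes "finite Z" "z \<notin> Z"
  shows "rav (insert z Z) \<phi> = (rav Z \<phi> + rav Z (\<lambda>A. \<phi> (insert z A))) / 2"
proof -
  have "inj_on (insert z) (Pow Z)" using assms(2) by (auto simp: inj_on_def)
  then have "(\<Sum>A\<in>insert z ` Pow Z. \<phi> A) = (\<Sum>A\<in>Pow Z. \<phi> (insert z A))"
    by (simp add: sum.reindex)
  moreover have "(\<Sum>A\<in>Pow (insert z Z). \<phi> A) = (\<Sum>A\<in>Pow Z. \<phi> A) + (\<Sum>A\<in>insert z ` Pow Z. \<phi> A)"
    unfolding Pow_insert by (rule sum.union_disjoint) (use assms in auto)
  ultimately show ?thesis using assms by (simp add: rav_def add_divide_distrib)
qed

lemma rav_mono: "finite Z \<Longrightarrow> (\<And>A. A \<subseteq> Z \<Longrightarrow> \<phi> A \<le> \<psi> A) \<Longrightarrow> rav Z \<phi> \<le> rav Z \<psi>"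
  unfolding rav_def by (intro divide_right_mono sum_mono) auto

lemma rav_cong: "(\<And>A. A \<subseteq> Z \<Longrightarrow> \<phi> A = \<psi> A) \<Longrightarrow> rav Z \<phi> = rav Z \<psi>"
  unfolding rav_def by (auto intro!: sum.cong)

lemma rav_const [simp]: "finite Z \<Longrightarrow> rav Z (\<lambda>_. c) = c"
  by (simp add: rav_def card_Pow)

lemma rav_add: "rav Z (\<lambda>A. \<phi> A + \<psi> A) = rav Z \<phi> + rav Z \<psi>"
  by (simp add: rav_def sum.distrib add_divide_distrib)

lemma rav_scale: "rav Z (\<lambda>A. c * \<phi> A) = c * rav Z \<phi>"
  by (simp add: rav_def sum_distrib_left)

lemma rav_sum: "rav Z (\<lambda>A. \<Sum>x\<in>X. \<phi> x A) = (\<Sum>x\<in>X. rav Z (\<phi> x))"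
  by (simp add: rav_def sum.swap[of _ X] sum_divide_distrib)

lemma sg_insert_sum:
  fixes w :: "'z \<Rightarrow> 'b::real_vector"
  assumes "finite Z" "z \<notin> Z" "A \<subseteq> Z"
  shows "(\<Sum>y\<in>insert z Z. sg A y *\<^sub>R w y) = (\<Sum>y\<in>Z. sg A y *\<^sub>R w y) - w z"
    and "(\<Sum>y\<in>insert z Z. sg (insert z A) y *\<^sub>R w y) = (\<Sum>y\<in>Z. sg A y *\<^sub>R w y) + w z"
proof -
  have "(\<Sum>y\<in>Z. sg (insert z A) y *\<^sub>R w y) = (\<Sum>y\<in>Z. sg A y *\<^sub>R w y)"
    using assms by (intro sum.cong) (auto simp: sg_def)
  moreover have "z \<notin> A" using assms by auto
  ultimately show "(\<Sum>y\<in>insert z Z. sg A y *\<^sub>R w y) = (\<Sum>y\<in>Z. sg A y *\<^sub>R w y) - w z"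
    "(\<Sum>y\<in>insert z Z. sg (insert z A) y *\<^sub>R w y) = (\<Sum>y\<in>Z. sg A y *\<^sub>R w y) + w z"
    using assms by (simp_all add: sg_def)
qed

lemma convex_power_nonneg: "convex_on {0..} (\<lambda>x::real. x ^ r)"
proof (cases "r \<le> 1")
  case True
  then consider "r = 0" | "r = 1" by linarith
  then show ?thesis by cases (auto simp: convex_on_def)
next
  case False
  then obtain q where q: "r = Suc (Suc q)" by (metis Suc_le_D not_less_eq_eq One_nat_def)
  show ?thesis unfolding q
  proof (rule f''_ge0_imp_convex[where f' = "\<lambda>x. real (Suc (Suc q)) * x ^ Suc q" and f'' = "\<lambda>x. real (Suc (Suc q)) * (real (Suc q) * x ^ q)"])
    fix x :: real assume "x \<in> {0..}"
    then show "real (Suc (Suc q)) * (real (Suc q) * x ^ q) \<ge> 0" by simp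
    show "((\<lambda>x. x ^ Suc (Suc q)) has_real_derivative real (Suc (Suc q)) * x ^ Suc q) (at x)"
      using DERIV_pow[of "Suc (Suc q)" x UNIV] by simp
    show "((\<lambda>x. real (Suc (Suc q)) * x ^ Suc q) has_real_derivative real (Suc (Suc q)) * (real (Suc q) * x ^ q)) (at x)"
      using DERIV_cmult[OF DERIV_pow[of "Suc q" x UNIV], of "real (Suc (Suc q))"] by simp
  qed simp
qed

lemma power_mean_le:
  assumes "finite S" "\<And>s. s \<in> S \<Longrightarrow> 0 \<le> w s" "(\<Sum>s\<in>S. w s) = (1::real)" "\<And>s. s \<in> S \<Longrightarrow> 0 \<le> \<phi> s"
  shows "(\<Sum>s\<in>S. w s * \<phi> s) ^ r \<le> (\<Sum>s\<in>S. w s * \<phi> s ^ r)"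
proof -
  have "S \<noteq> {}" using assms(3) by auto
  then show ?thesis
    using convex_on_sum[OF assms(1) _ convex_power_nonneg assms(3), of \<phi> r] assms(2,4) by simp
qed

lemma rav_power_mean:
  assumes "finite Z" "\<And>A. 0 \<le> \<phi> A"
  shows "rav Z \<phi> ^ r \<le> rav Z (\<lambda>A. \<phi> A ^ r)"
proof -
  have "rav Z \<psi> = (\<Sum>A\<in>Pow Z. (1 / 2 ^ card Z) * \<psi> A)" for \<psi>
    by (simp add: rav_def sum_divide_distrib)
  then show ?thesis
    using power_mean_le[of "Pow Z" "\<lambda>_. 1 / 2 ^ card Z" \<phi> r] assms by (simp add: card_Pow)
qed

lemma rav_square:
  fixes w :: "'z \<Rightarrow> complex"
  assumes "finite Z"
  shows "rav Z (\<lambda>A. (cmod (\<Sum>z\<in>Z. sg A z *\<^sub>R w z))\<^sup>2) = (\<Sum>z\<in>Z. (cmod (w z))\<^sup>2)"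
  using assms
proof (induction Z rule: finite_induct)
  case (insert z Z)
  let ?X = "\<lambda>A. \<Sum>y\<in>Z. sg A y *\<^sub>R w y"
  have par: "(cmod (a - b))\<^sup>2 + (cmod (a + b))\<^sup>2 = 2 * (cmod a)\<^sup>2 + 2 * (cmod b)\<^sup>2" for a b :: complex
    unfolding cmod_power2 by (simp add: power2_eq_square algebra_simps)
  have "rav (insert z Z) (\<lambda>A. (cmod (\<Sum>y\<in>insert z Z. sg A y *\<^sub>R w y))\<^sup>2) =
     (rav Z (\<lambda>A. (cmod (?X A - w z))\<^sup>2) + rav Z (\<lambda>A. (cmod (?X A + w z))\<^sup>2)) / 2"
    unfolding rav_insert[OF insert(1,2)]
    by (auto intro!: arg_cong2[where f="(+)"] rav_cong arg_cong2[where f="(/)"] simp: sg_insert_sum[OF insert(1,2)] simp del: sum.insert)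
  also have "\<dots> = rav Z (\<lambda>A. (cmod (?X A))\<^sup>2 + (cmod (w z))\<^sup>2)"
    unfolding rav_add[symmetric] par
    by (simp add: rav_add rav_scale)
  finally show ?case using insert by (simp add: rav_add)
qed simp

lemma khinchine_lower:
  fixes w :: "'z \<Rightarrow> complex"
  assumes "finite Z"
  shows "(\<Sum>z\<in>Z. (cmod (w z))\<^sup>2) ^ r \<le> rav Z (\<lambda>A. cmod (\<Sum>z\<in>Z. sg A z *\<^sub>R w z) ^ (2 * r))"
  using rav_power_mean[OF assms, of "\<lambda>A. (cmod (\<Sum>z\<in>Z. sg A z *\<^sub>R w z))\<^sup>2" r]
  by (simp add: rav_square[OF assms] power_mult)

lemma cosh_le_exp_square: "cosh x \<le> exp (x\<^sup>2)" for x :: real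
proof -
  have *: "cosh x \<le> exp (x\<^sup>2)" if "x \<ge> 0" for x :: real
  proof (cases "x \<le> 1")
    case True
    have "exp x \<le> 1 + x + x\<^sup>2" by (rule exp_bound) (use that True in auto)
    moreover have "exp (- x) \<le> 1 - x + x\<^sup>2"
    proof -
      have "(1 + x) * (1 - x + x\<^sup>2) = 1 + x * x\<^sup>2" by (simp add: algebra_simps power2_eq_square)
      then have "1 \<le> (1 + x) * (1 - x + x\<^sup>2)" using that by simp
      also have "\<dots> \<le> exp x * (1 - x + x\<^sup>2)"
      proof (rule mult_right_mono)
        show "0 \<le> 1 - x + x\<^sup>2" using True that by (smt (verit) zero_le_power2)
      qed (rule exp_ge_add_one_self)
      finally have "exp (- x) * 1 \<le> exp (- x) * (exp x * (1 - x + x\<^sup>2))" by simp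
      then show ?thesis by (simp add: mult.assoc[symmetric] exp_add[symmetric])
    qed
    ultimately have "cosh x \<le> 1 + x\<^sup>2" by (simp add: cosh_def)
    then show ?thesis using exp_ge_add_one_self[of "x\<^sup>2"] by linarith
  next
    case False
    then have "x \<le> x\<^sup>2" by (simp add: power2_eq_square)
    moreover have "exp (- x) \<le> exp x" using that by simp
    ultimately show ?thesis by (simp add: cosh_def) (smt (verit) exp_le_cancel_iff)
  qed
  show ?thesis using *[of x] *[of "- x"] by (cases "x \<ge> 0") auto
qed

lemma power_le_cosh: "x ^ (2 * r) \<le> 2 * fact (2 * r) * cosh x" for x :: real
proof -
  have *: "y ^ n / fact n \<le> exp y" if "y \<ge> 0" for y :: real and n
  proof -
    have "(\<Sum>i\<in>{n}. y ^ i /\<^sub>R fact i) \<le> (\<Sum>i. y ^ i /\<^sub>R fact i)"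
      using that by (intro sum_le_suminf summable_exp_generic) auto
    then show ?thesis by (simp add: exp_def divide_inverse mult.commute)
  qed
  have "x ^ (2 * r) = \<bar>x\<bar> ^ (2 * r)" by (simp add: power_even_abs)
  also have "\<dots> \<le> fact (2 * r) * exp \<bar>x\<bar>" using *[of "\<bar>x\<bar>" "2 * r"] by (simp add: field_simps)
  also have "exp \<bar>x\<bar> \<le> 2 * cosh x" by (auto simp: cosh_def abs_if)
  finally show ?thesis by (simp add: mult_ac)
qed

lemma rav_exp:
  fixes w :: "'z \<Rightarrow> real"
  assumes "finite Z"
  shows "rav Z (\<lambda>A. exp (\<Sum>z\<in>Z. sg A z *\<^sub>R w z)) = (\<Prod>z\<in>Z. cosh (w z))"
  using assms
proof (induction Z rule: finite_induct)
  case (insert z Z)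
  let ?X = "\<lambda>A. \<Sum>y\<in>Z. sg A y *\<^sub>R w y"
  have "rav (insert z Z) (\<lambda>A. exp (\<Sum>y\<in>insert z Z. sg A y *\<^sub>R w y)) =
     (rav Z (\<lambda>A. exp (?X A - w z)) + rav Z (\<lambda>A. exp (?X A + w z))) / 2"
    unfolding rav_insert[OF insert(1,2)]
    by (auto intro!: arg_cong2[where f="(+)"] rav_cong arg_cong2[where f="(/)"] simp: sg_insert_sum[OF insert(1,2)] simp del: sum.insert real_scaleR_def)
  also have "\<dots> = rav Z (\<lambda>A. cosh (w z) * exp (?X A))"
    unfolding rav_add[symmetric]
    by (simp add: rav_def sum_divide_distrib cosh_def exp_diff exp_add exp_minus field_simps)
  finally show ?case using insert by (simp add: rav_scale)
qed simp

lemma khinchine_upper_real: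
  fixes w :: "'z \<Rightarrow> real"
  assumes Z: "finite Z"
  shows "rav Z (\<lambda>A. (\<Sum>z\<in>Z. sg A z *\<^sub>R w z) ^ (2 * r)) \<le> 2 * fact (2 * r) * exp 1 * (\<Sum>z\<in>Z. (w z)\<^sup>2) ^ r"
proof (cases "(\<Sum>z\<in>Z. (w z)\<^sup>2) = 0")
  case True
  then have w: "w z = 0" if "z \<in> Z" for z using that Z by (simp add: sum_nonneg_eq_0_iff)
  have "(1::real) \<le> 2 * fact (2 * r) * exp 1"
  proof -
    have "1 * 1 * 1 \<le> (2::real) * fact (2 * r) * exp 1"
      by (intro mult_mono) (auto simp: fact_ge_1)
    then show ?thesis by simp
  qed
  then show ?thesis using w True Z by (cases r) auto
next
  case False
  define s where "s = sqrt (\<Sum>z\<in>Z. (w z)\<^sup>2)"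
  have s2: "s\<^sup>2 = (\<Sum>z\<in>Z. (w z)\<^sup>2)" by (simp add: s_def sum_nonneg)
  have s: "s > 0" using False by (auto simp: s_def less_le sum_nonneg)
  define u where "u z = w z / s" for z
  have u1: "(\<Sum>z\<in>Z. (u z)\<^sup>2) = 1"
    using s by (simp add: u_def power_divide sum_divide_distrib[symmetric] s2[symmetric])
  have cosh: "rav Z (\<lambda>A. cosh (\<Sum>z\<in>Z. sg A z *\<^sub>R u z)) = (\<Prod>z\<in>Z. cosh (u z))"
  proof -
    have "rav Z (\<lambda>A. cosh (\<Sum>z\<in>Z. sg A z *\<^sub>R u z)) =
      rav Z (\<lambda>A. (1/2) * exp (\<Sum>z\<in>Z. sg A z *\<^sub>R u z) + (1/2) * exp (\<Sum>z\<in>Z. sg A z *\<^sub>R (- u z)))"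
      by (intro rav_cong) (simp add: cosh_def sum_negf)
    also have "\<dots> = (1/2) * (\<Prod>z\<in>Z. cosh (u z)) + (1/2) * (\<Prod>z\<in>Z. cosh (- u z))"
      unfolding rav_add rav_scale rav_exp[OF Z] ..
    finally show ?thesis by simp
  qed
  have "rav Z (\<lambda>A. (\<Sum>z\<in>Z. sg A z *\<^sub>R u z) ^ (2 * r)) \<le> rav Z (\<lambda>A. 2 * fact (2 * r) * cosh (\<Sum>z\<in>Z. sg A z *\<^sub>R u z))"
    by (intro rav_mono Z power_le_cosh)
  also have "\<dots> = 2 * fact (2 * r) * (\<Prod>z\<in>Z. cosh (u z))" by (simp only: rav_scale cosh)
  also have "(\<Prod>z\<in>Z. cosh (u z)) \<le> (\<Prod>z\<in>Z. exp ((u z)\<^sup>2))"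
    by (intro prod_mono) (auto simp: cosh_le_exp_square cosh_real_nonneg)
  also have "\<dots> = exp 1" using Z by (simp add: exp_sum[symmetric] u1)
  finally have "rav Z (\<lambda>A. (\<Sum>z\<in>Z. sg A z *\<^sub>R u z) ^ (2 * r)) \<le> 2 * fact (2 * r) * exp 1" by simp
  then have "s ^ (2 * r) * rav Z (\<lambda>A. (\<Sum>z\<in>Z. sg A z *\<^sub>R u z) ^ (2 * r)) \<le> s ^ (2 * r) * (2 * fact (2 * r) * exp 1)"
    using s by (intro mult_left_mono) auto
  moreover have "s ^ (2 * r) * rav Z (\<lambda>A. (\<Sum>z\<in>Z. sg A z *\<^sub>R u z) ^ (2 * r)) = rav Z (\<lambda>A. (\<Sum>z\<in>Z. sg A z *\<^sub>R w z) ^ (2 * r))"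
    unfolding rav_scale[symmetric] power_mult_distrib[symmetric] sum_distrib_left
    using s by (simp add: u_def)
  moreover have "s ^ (2 * r) = (\<Sum>z\<in>Z. (w z)\<^sup>2) ^ r" by (simp only: power_mult s2)
  ultimately show ?thesis by (simp only: mult_ac)
qed

definition Kh :: "nat \<Rightarrow> real" where
  "Kh r = 2 ^ (r + 1) * (2 * fact (2 * r) * exp 1)"

lemma Kh_ge_1: "Kh r \<ge> 1"
proof -
  have "(1::real) \<le> 2 ^ (r + 1)" by (rule one_le_power) simp
  then have "1 * (1 * 1 * 1) \<le> Kh r" unfolding Kh_def by (intro mult_mono) (auto simp: fact_ge_1)
  then show ?thesis by simp
qed

lemma khinchine_upper:
  fixes w :: "'z \<Rightarrow> complex"
  assumes Z: "finite Z"
  shows "rav Z (\<lambda>A. cmod (\<Sum>z\<in>Z. sg A z *\<^sub>R w z) ^ (2 * r)) \<le> Kh r * (\<Sum>z\<in>Z. (cmod (w z))\<^sup>2) ^ r"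
proof -
  let ?X = "\<lambda>A. \<Sum>z\<in>Z. sg A z *\<^sub>R Re (w z)" and ?Y = "\<lambda>A. \<Sum>z\<in>Z. sg A z *\<^sub>R Im (w z)"
  let ?c = "2 * fact (2 * r) * exp 1 :: real"
  have pt: "cmod u ^ (2 * r) \<le> 2 ^ r * (Re u ^ (2 * r)) + 2 ^ r * (Im u ^ (2 * r))" for u
  proof -
    have "(a + b) ^ r \<le> 2 ^ r * a ^ r + 2 ^ r * b ^ r" if "0 \<le> a" "0 \<le> b" for a b :: real
    proof -
      have "(a + b) ^ r \<le> (2 * max a b) ^ r" using that by (intro power_mono) auto
      also have "\<dots> \<le> 2 ^ r * a ^ r + 2 ^ r * b ^ r"
        using that by (cases "a \<le> b") (auto simp: max_def power_mult_distrib)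
      finally show ?thesis .
    qed
    from this[of "(Re u)\<^sup>2" "(Im u)\<^sup>2"] show ?thesis by (simp add: power_mult cmod_power2)
  qed
  have "rav Z (\<lambda>A. cmod (\<Sum>z\<in>Z. sg A z *\<^sub>R w z) ^ (2 * r)) \<le>
        rav Z (\<lambda>A. 2 ^ r * (?X A ^ (2 * r)) + 2 ^ r * (?Y A ^ (2 * r)))"
    using pt[of "\<Sum>z\<in>Z. sg _ z *\<^sub>R w z"] by (intro rav_mono Z) simp
  also have "\<dots> = 2 ^ r * rav Z (\<lambda>A. ?X A ^ (2 * r)) + 2 ^ r * rav Z (\<lambda>A. ?Y A ^ (2 * r))"
    by (simp add: rav_add rav_scale)
  also have "\<dots> \<le> 2 ^ r * (?c * (\<Sum>z\<in>Z. (Re (w z))\<^sup>2) ^ r) + 2 ^ r * (?c * (\<Sum>z\<in>Z. (Im (w z))\<^sup>2) ^ r)"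
    by (intro add_mono mult_left_mono khinchine_upper_real[OF Z]) auto
  also have "\<dots> \<le> 2 ^ r * (?c * (\<Sum>z\<in>Z. (cmod (w z))\<^sup>2) ^ r) + 2 ^ r * (?c * (\<Sum>z\<in>Z. (cmod (w z))\<^sup>2) ^ r)"
  proof -
    have "(Re (w z))\<^sup>2 \<le> (cmod (w z))\<^sup>2" "(Im (w z))\<^sup>2 \<le> (cmod (w z))\<^sup>2" for z by (auto simp: cmod_power2)
    then have "(\<Sum>z\<in>Z. (Re (w z))\<^sup>2) \<le> (\<Sum>z\<in>Z. (cmod (w z))\<^sup>2)" "(\<Sum>z\<in>Z. (Im (w z))\<^sup>2) \<le> (\<Sum>z\<in>Z. (cmod (w z))\<^sup>2)"
      by (simp_all add: sum_mono)
    then have "(\<Sum>z\<in>Z. (Re (w z))\<^sup>2) ^ r \<le> (\<Sum>z\<in>Z. (cmod (w z))\<^sup>2) ^ r" "(\<Sum>z\<in>Z. (Im (w z))\<^sup>2) ^ r \<le> (\<Sum>z\<in>Z. (cmod (w z))\<^sup>2) ^ r"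
      by (simp_all add: power_mono sum_nonneg)
    then show ?thesis by (intro add_mono mult_left_mono) auto
  qed
  also have "\<dots> = Kh r * (\<Sum>z\<in>Z. (cmod (w z))\<^sup>2) ^ r" by (simp add: Kh_def)
  finally show ?thesis .
qed

lemma chaos_lower:
  fixes w :: "'z \<Rightarrow> 'y \<Rightarrow> complex"
  assumes "finite Z" "finite Y"
  shows "(\<Sum>z\<in>Z. \<Sum>y\<in>Y. (cmod (w z y))\<^sup>2) ^ r \<le>
    rav Z (\<lambda>A. rav Y (\<lambda>D. cmod (\<Sum>y\<in>Y. sg D y *\<^sub>R (\<Sum>z\<in>Z. sg A z *\<^sub>R w z y)) ^ (2 * r)))"
proof -
  have "(\<Sum>z\<in>Z. \<Sum>y\<in>Y. (cmod (w z y))\<^sup>2) = (\<Sum>y\<in>Y. rav Z (\<lambda>A. (cmod (\<Sum>z\<in>Z. sg A z *\<^sub>R w z y))\<^sup>2))"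
    by (subst sum.swap) (simp add: rav_square[OF assms(1)])
  also have "\<dots> = rav Z (\<lambda>A. \<Sum>y\<in>Y. (cmod (\<Sum>z\<in>Z. sg A z *\<^sub>R w z y))\<^sup>2)" by (simp add: rav_sum)
  also have "\<dots> ^ r \<le> rav Z (\<lambda>A. (\<Sum>y\<in>Y. (cmod (\<Sum>z\<in>Z. sg A z *\<^sub>R w z y))\<^sup>2) ^ r)"
    by (intro rav_power_mean assms sum_nonneg) auto
  also have "\<dots> \<le> rav Z (\<lambda>A. rav Y (\<lambda>D. cmod (\<Sum>y\<in>Y. sg D y *\<^sub>R (\<Sum>z\<in>Z. sg A z *\<^sub>R w z y)) ^ (2 * r)))"
    by (intro rav_mono assms khinchine_lower)
  finally show ?thesis .
qed

lemma chaos_upper: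
  fixes w :: "'z \<Rightarrow> 'y \<Rightarrow> complex"
  assumes Z: "finite Z" and Y: "finite Y" and r: "r \<ge> 1"
  shows "rav Z (\<lambda>A. rav Y (\<lambda>D. cmod (\<Sum>y\<in>Y. sg D y *\<^sub>R (\<Sum>z\<in>Z. sg A z *\<^sub>R w z y)) ^ (2 * r)))
    \<le> Kh r * (Kh r * (\<Sum>z\<in>Z. \<Sum>y\<in>Y. (cmod (w z y))\<^sup>2) ^ r)"
proof -
  define V where "V A y = (\<Sum>z\<in>Z. sg A z *\<^sub>R w z y)" for A y
  define s where "s y = (\<Sum>z\<in>Z. (cmod (w z y))\<^sup>2)" for y
  define S where "S = (\<Sum>y\<in>Y. s y)"
  have s0: "s y \<ge> 0" for y by (simp add: s_def sum_nonneg)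
  have S0: "S \<ge> 0" by (simp add: S_def sum_nonneg s0)
  have S_eq: "S = (\<Sum>z\<in>Z. \<Sum>y\<in>Y. (cmod (w z y))\<^sup>2)"
    unfolding S_def s_def by (rule sum.swap)
  have V0: "V A y = 0" if "s y = 0" for A y
    using that Z unfolding V_def s_def by (intro sum.neutral) (simp add: sum_nonneg_eq_0_iff)
  have sq: "rav Z (\<lambda>A. (\<Sum>y\<in>Y. (cmod (V A y))\<^sup>2) ^ r) \<le> Kh r * S ^ r"
  proof (cases "S = 0")
    case True
    then have "s y = 0" if "y \<in> Y" for y using that Y s0 by (auto simp: S_def sum_nonneg_eq_0_iff)
    then have "(\<Sum>y\<in>Y. (cmod (V A y))\<^sup>2) = 0" for A using V0 by (intro sum.neutral) auto
    then show ?thesis using r True Z by (simp add: power_0_left)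
  next
    case False
    with S0 have S: "S > 0" by simp
    define \<omega> where "\<omega> y = s y / S" for y
    have \<omega>: "\<omega> y \<ge> 0" "(\<Sum>y\<in>Y. \<omega> y) = 1" for y
      using S s0 by (auto simp: \<omega>_def sum_divide_distrib[symmetric] S_def[symmetric])
    have "(\<Sum>y\<in>Y. (cmod (V A y))\<^sup>2) ^ r \<le> (\<Sum>y\<in>Y. \<omega> y * ((cmod (V A y))\<^sup>2 / \<omega> y) ^ r)" for A
    proof -
      have "(\<Sum>y\<in>Y. (cmod (V A y))\<^sup>2) = (\<Sum>y\<in>Y. \<omega> y * ((cmod (V A y))\<^sup>2 / \<omega> y))"
        using S by (intro sum.cong) (auto simp: \<omega>_def V0)
      then show ?thesis using power_mean_le[OF Y _ \<omega>(2), of "\<lambda>y. (cmod (V A y))\<^sup>2 / \<omega> y" r] \<omega>(1) by simp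
    qed
    then have "rav Z (\<lambda>A. (\<Sum>y\<in>Y. (cmod (V A y))\<^sup>2) ^ r) \<le>
          rav Z (\<lambda>A. \<Sum>y\<in>Y. \<omega> y * ((cmod (V A y))\<^sup>2 / \<omega> y) ^ r)"
      by (intro rav_mono Z)
    also have "\<dots> = (\<Sum>y\<in>Y. (\<omega> y / \<omega> y ^ r) * rav Z (\<lambda>A. cmod (V A y) ^ (2 * r)))"
      by (simp add: rav_sum rav_scale[symmetric] power_divide power_mult)
    also have "\<dots> \<le> (\<Sum>y\<in>Y. (\<omega> y / \<omega> y ^ r) * (Kh r * s y ^ r))"
      unfolding V_def s_def by (intro sum_mono mult_left_mono khinchine_upper Z) (use \<omega> in auto)
    also have "\<dots> \<le> (\<Sum>y\<in>Y. \<omega> y * (Kh r * S ^ r))"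
    proof (rule sum_mono)
      fix y
      show "(\<omega> y / \<omega> y ^ r) * (Kh r * s y ^ r) \<le> \<omega> y * (Kh r * S ^ r)"
      proof (cases "s y = 0")
        case True then show ?thesis using r by (simp add: \<omega>_def)
      next
        case False
        then show ?thesis using S by (simp add: \<omega>_def power_divide mult_ac)
      qed
    qed
    also have "\<dots> = Kh r * S ^ r" using \<omega>(2) by (simp add: sum_distrib_right[symmetric])
    finally show ?thesis .
  qed
  have "rav Z (\<lambda>A. rav Y (\<lambda>D. cmod (\<Sum>y\<in>Y. sg D y *\<^sub>R V A y) ^ (2 * r))) \<le>
        rav Z (\<lambda>A. Kh r * (\<Sum>y\<in>Y. (cmod (V A y))\<^sup>2) ^ r)"
    by (intro rav_mono Z khinchine_upper Y)
  also have "\<dots> \<le> Kh r * (Kh r * S ^ r)"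
    unfolding rav_scale using Kh_ge_1[of r] by (intro mult_left_mono sq) auto
  finally show ?thesis by (simp add: V_def S_eq)
qed

definition psum :: "nat \<Rightarrow> nat \<Rightarrow> (int ^ 'n \<Rightarrow> complex) \<Rightarrow> real" where
  "psum M r a = (\<Sum>x\<in>grid M. cmod (a x) ^ (2 * r))"

definition rnorm :: "nat \<Rightarrow> nat \<Rightarrow> 'z set \<Rightarrow> ('z \<Rightarrow> int ^ 'n \<Rightarrow> complex) \<Rightarrow> real" where
  "rnorm M r Z F = rav Z (\<lambda>A. psum M r (\<lambda>x. \<Sum>z\<in>Z. sg A z *\<^sub>R F z x))"

lemma psum_nonneg [simp]: "0 \<le> psum M r a"
  by (simp add: psum_def sum_nonneg)

lemma psum_cong: "(\<And>x. x \<in> grid M \<Longrightarrow> cmod (a x) = cmod (b x)) \<Longrightarrow> psum M r a = psum M r b"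
  by (simp add: psum_def)

lemma rnorm_cong: "(\<And>z x. z \<in> Z \<Longrightarrow> x \<in> grid M \<Longrightarrow> F z x = G z x) \<Longrightarrow> rnorm M r Z F = rnorm M r Z G"
  by (auto simp: rnorm_def intro!: rav_cong psum_cong arg_cong[where f=cmod] sum.cong)

lemma psum_nrm: "r \<ge> 1 \<Longrightarrow> psum M r a = nrm M (real (2 * r)) a ^ (2 * r)"
proof -
  assume r: "r \<ge> 1"
  have "nrm M (real (2 * r)) a ^ (2 * r) = nrm M (real (2 * r)) a powr real (2 * r)"
    using r by (subst powr_realpow') auto
  also have "\<dots> = (\<Sum>x\<in>grid M. cmod (a x) powr real (2 * r))" using r by (intro nrm_powr) auto
  also have "\<dots> = psum M r a" using r unfolding psum_def by (intro sum.cong refl) (subst powr_realpow', auto)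
  finally show ?thesis by simp
qed

lemma mult_bound_psum:
  assumes "r \<ge> 1" "C \<ge> 0"
  shows "mult_bound M (real (2 * r)) C m \<longleftrightarrow> (\<forall>a. psum M r (mult_op M m a) \<le> C ^ (2 * r) * psum M r a)"
proof -
  have "nrm M (real (2 * r)) (mult_op M m a) \<le> C * nrm M (real (2 * r)) a \<longleftrightarrow>
     psum M r (mult_op M m a) \<le> C ^ (2 * r) * psum M r a" for a
    unfolding psum_nrm[OF assms(1)] power_mult_distrib[symmetric]
    using assms by (subst power_mono_iff) auto
  then show ?thesis by (simp add: mult_bound_def)
qed

lemma rnorm_contraction:
  fixes F G :: "'z \<Rightarrow> int ^ 'n::finite \<Rightarrow> complex"
  assumes Z: "finite Z" and FG: "\<And>z x. z \<in> Z \<Longrightarrow> x \<in> grid M \<Longrightarrow> cmod (G z x) \<le> cmod (F z x)"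
  shows "rnorm M r Z G \<le> Kh r * rnorm M r Z F"
proof -
  have "rnorm M r Z G = (\<Sum>x\<in>grid M. rav Z (\<lambda>A. cmod (\<Sum>z\<in>Z. sg A z *\<^sub>R G z x) ^ (2 * r)))"
    by (simp add: rnorm_def psum_def rav_sum)
  also have "\<dots> \<le> (\<Sum>x\<in>grid M. Kh r * rav Z (\<lambda>A. cmod (\<Sum>z\<in>Z. sg A z *\<^sub>R F z x) ^ (2 * r)))"
  proof (rule sum_mono)
    fix x :: "int ^ 'n" assume x: "x \<in> grid M"
    have "rav Z (\<lambda>A. cmod (\<Sum>z\<in>Z. sg A z *\<^sub>R G z x) ^ (2 * r)) \<le> Kh r * (\<Sum>z\<in>Z. (cmod (G z x))\<^sup>2) ^ r"
      by (rule khinchine_upper[OF Z])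
    also have "\<dots> \<le> Kh r * (\<Sum>z\<in>Z. (cmod (F z x))\<^sup>2) ^ r"
      using FG x Kh_ge_1[of r] by (intro mult_left_mono power_mono sum_mono sum_nonneg) auto
    also have "\<dots> \<le> Kh r * rav Z (\<lambda>A. cmod (\<Sum>z\<in>Z. sg A z *\<^sub>R F z x) ^ (2 * r))"
      using Kh_ge_1[of r] by (intro mult_left_mono khinchine_lower Z) auto
    finally show "rav Z (\<lambda>A. cmod (\<Sum>z\<in>Z. sg A z *\<^sub>R G z x) ^ (2 * r)) \<le> Kh r * rav Z (\<lambda>A. cmod (\<Sum>z\<in>Z. sg A z *\<^sub>R F z x) ^ (2 * r))" .
  qed
  also have "\<dots> = Kh r * rnorm M r Z F"
    by (simp add: rnorm_def psum_def rav_sum sum_distrib_left)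
  finally show ?thesis .
qed

lemma mult_op_sg_sum:
  "mult_op M m (\<lambda>x. \<Sum>z\<in>Z. sg A z *\<^sub>R F z x) y = (\<Sum>z\<in>Z. sg A z *\<^sub>R mult_op M m (F z) y)"
  by (simp add: mult_op_sum_arg scaleR_conv_of_real mult_op_scale_arg)

lemma rnorm_mult_op:
  fixes F :: "'z \<Rightarrow> int ^ 'n::finite \<Rightarrow> complex"
  assumes "finite Z" "r \<ge> 1" "C \<ge> 0" "mult_bound M (real (2 * r)) C m"
  shows "rnorm M r Z (\<lambda>z. mult_op M m (F z)) \<le> C ^ (2 * r) * rnorm M r Z F"
  unfolding rnorm_def rav_scale[symmetric] mult_op_sg_sum[symmetric]
  using assms(4) unfolding mult_bound_psum[OF assms(2,3)] by (intro rav_mono assms) auto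

lemma rnorm_mult_op_shift:
  fixes F :: "'z \<Rightarrow> int ^ 'n::finite \<Rightarrow> complex"
  assumes M: "M > 0" and Z: "finite Z" and r: "r \<ge> 1" "C \<ge> 0" and m: "periodic M m" "mult_bound M (real (2 * r)) C m"
  shows "rnorm M r Z (\<lambda>z. mult_op M (\<lambda>k. m (k - v z)) (F z)) \<le> Kh r * Kh r * C ^ (2 * r) * rnorm M r Z F"
proof -
  let ?G = "\<lambda>z x. cnj (chr M (v z) x) * F z x"
  have "rnorm M r Z (\<lambda>z. mult_op M (\<lambda>k. m (k - v z)) (F z)) \<le> Kh r * rnorm M r Z (\<lambda>z. mult_op M m (?G z))"
    by (intro rnorm_contraction Z) (simp add: mult_op_shift[OF M m(1)] norm_mult)
  also have "\<dots> \<le> Kh r * (C ^ (2 * r) * rnorm M r Z ?G)"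
    using Kh_ge_1[of r] by (intro mult_left_mono rnorm_mult_op Z r m) auto
  also have "\<dots> \<le> Kh r * (C ^ (2 * r) * (Kh r * rnorm M r Z F))"
    using Kh_ge_1[of r] r by (intro mult_left_mono rnorm_contraction Z) (auto simp: norm_mult)
  finally show ?thesis by (simp add: mult_ac)
qed

definition lp_partition :: "nat \<Rightarrow> real \<Rightarrow> real \<Rightarrow> (int ^ 'n \<Rightarrow> 'z) \<Rightarrow> bool" where
  "lp_partition M p K \<pi> \<longleftrightarrow> (\<forall>c. (\<forall>z. cmod (c z) \<le> 1) \<longrightarrow> mult_bound M p K (\<lambda>k. c (\<pi> k)))"

definition piece :: "(int ^ 'n \<Rightarrow> 'z) \<Rightarrow> 'z \<Rightarrow> int ^ 'n \<Rightarrow> complex" where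
  "piece \<pi> z k = (if \<pi> k = z then 1 else 0)"

lemma piece_sum: "finite Z \<Longrightarrow> \<pi> k \<in> Z \<Longrightarrow> (\<Sum>z\<in>Z. c z * piece \<pi> z k) = c (\<pi> k)"
  by (simp add: piece_def if_distrib cong: if_cong)

lemma lp_partition_sg:
  assumes "lp_partition M p K \<pi>" shows "mult_bound M p K (\<lambda>k. of_real (sg A (\<pi> k)))"
  using assms[unfolded lp_partition_def, rule_format, of "\<lambda>z. of_real (sg A z)"] by simp

lemma lp_partition_forward:
  fixes \<pi> :: "int ^ 'n::finite \<Rightarrow> 'z"
  assumes "r \<ge> 1" "K \<ge> 0" "lp_partition M (real (2 * r)) K \<pi>"
  shows "rnorm M r (\<pi> ` grid M) (\<lambda>z. mult_op M (piece \<pi> z) f) \<le> K ^ (2 * r) * psum M r f"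
proof -
  let ?Z = "\<pi> ` grid M"
  have Z: "finite ?Z" by simp
  have "(\<Sum>z\<in>?Z. sg A z *\<^sub>R mult_op M (piece \<pi> z) f x) = mult_op M (\<lambda>k. of_real (sg A (\<pi> k))) f x" for A x
  proof -
    have "mult_op M (\<lambda>k. of_real (sg A (\<pi> k))) f x = mult_op M (\<lambda>k. \<Sum>z\<in>?Z. of_real (sg A z) * piece \<pi> z k) f x"
      using piece_sum[OF Z, of \<pi> _ "\<lambda>z. of_real (sg A z)"] by (intro mult_op_cong) auto
    then show ?thesis by (simp add: mult_op_sum mult_op_scale scaleR_conv_of_real)
  qed
  then have "rnorm M r ?Z (\<lambda>z. mult_op M (piece \<pi> z) f) = rav ?Z (\<lambda>A. psum M r (mult_op M (\<lambda>k. of_real (sg A (\<pi> k))) f))"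
    by (simp add: rnorm_def)
  also have "\<dots> \<le> rav ?Z (\<lambda>A. K ^ (2 * r) * psum M r f)"
    using lp_partition_sg[OF assms(3)] unfolding mult_bound_psum[OF assms(1,2)] by (intro rav_mono Z) auto
  finally show ?thesis using Z by simp
qed

lemma lp_partition_reverse:
  fixes \<pi> :: "int ^ 'n::finite \<Rightarrow> 'z"
  assumes M: "M > 0" and "r \<ge> 1" "K \<ge> 0" "lp_partition M (real (2 * r)) K \<pi>"
  shows "psum M r (\<lambda>x. \<Sum>z\<in>\<pi> ` grid M. mult_op M (piece \<pi> z) (g z) x)
    \<le> K ^ (2 * r) * rnorm M r (\<pi> ` grid M) (\<lambda>z. mult_op M (piece \<pi> z) (g z))"
proof -
  let ?Z = "\<pi> ` grid M"
  have Z: "finite ?Z" by simp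
  have eq: "(\<Sum>z\<in>?Z. mult_op M (piece \<pi> z) (g z) x) =
    mult_op M (\<lambda>k. of_real (sg A (\<pi> k))) (\<lambda>x. \<Sum>z\<in>?Z. sg A z *\<^sub>R mult_op M (piece \<pi> z) (g z) x) x" for A x
  proof -
    have "mult_op M (\<lambda>k. of_real (sg A (\<pi> k))) (mult_op M (piece \<pi> z) (g z)) x = sg A z *\<^sub>R mult_op M (piece \<pi> z) (g z) x" for z
    proof -
      have "(\<lambda>k. of_real (sg A (\<pi> k)) * piece \<pi> z k) = (\<lambda>k. of_real (sg A z) * piece \<pi> z k)"
        by (auto simp: piece_def)
      then show ?thesis
        unfolding mult_op_mult[OF M, symmetric] by (simp add: mult_op_scale scaleR_conv_of_real)
    qed
    then show ?thesis by (simp add: mult_op_sg_sum)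
  qed
  have "psum M r (\<lambda>x. \<Sum>z\<in>?Z. mult_op M (piece \<pi> z) (g z) x) = rav ?Z (\<lambda>A. psum M r (\<lambda>x. \<Sum>z\<in>?Z. mult_op M (piece \<pi> z) (g z) x))"
    using Z by simp
  also have "\<dots> \<le> rav ?Z (\<lambda>A. K ^ (2 * r) * psum M r (\<lambda>x. \<Sum>z\<in>?Z. sg A z *\<^sub>R mult_op M (piece \<pi> z) (g z) x))"
  proof (rule rav_mono[OF Z])
    fix A
    show "psum M r (\<lambda>x. \<Sum>z\<in>?Z. mult_op M (piece \<pi> z) (g z) x) \<le> K ^ (2 * r) * psum M r (\<lambda>x. \<Sum>z\<in>?Z. sg A z *\<^sub>R mult_op M (piece \<pi> z) (g z) x)"
      unfolding eq[of _ A]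
      using lp_partition_sg[OF assms(4), of A] unfolding mult_bound_psum[OF assms(2,3)] by blast
  qed
  finally show ?thesis by (simp add: rnorm_def rav_scale)
qed

lemma lp_partition_coarsen:
  fixes \<pi> :: "int ^ 'n::finite \<Rightarrow> 'z" and \<rho> :: "int ^ 'n \<Rightarrow> 'y"
  assumes "lp_partition M p K \<pi>" "\<And>k l. k \<in> grid M \<Longrightarrow> l \<in> grid M \<Longrightarrow> \<pi> k = \<pi> l \<Longrightarrow> \<rho> k = \<rho> l"
  shows "lp_partition M p K \<rho>"
  unfolding lp_partition_def
proof (intro allI impI)
  fix c :: "'y \<Rightarrow> complex" assume c: "\<forall>z. cmod (c z) \<le> 1"
  define g where "g z = \<rho> (SOME k. k \<in> grid M \<and> \<pi> k = z)" for z
  have "g (\<pi> k) = \<rho> k" if "k \<in> grid M" for k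
    unfolding g_def by (rule assms(2)) (use that someI[of "\<lambda>l. l \<in> grid M \<and> \<pi> l = \<pi> k" k] in auto)
  moreover have "mult_bound M p K (\<lambda>k. c (g (\<pi> k)))"
    using assms(1)[unfolded lp_partition_def, rule_format, of "\<lambda>z. c (g z)"] c by simp
  ultimately show "mult_bound M p K (\<lambda>k. c (\<rho> k))"
    using mult_bound_cong[of M p K "\<lambda>k. c (g (\<pi> k))" "\<lambda>k. c (\<rho> k)"] by simp
qed

theorem lp_partition_refine:
  fixes \<pi> :: "int ^ 'n::finite \<Rightarrow> 'z" and \<upsilon> :: "int ^ 'n \<Rightarrow> 'y"
  assumes M: "M > 0" and r: "r \<ge> 1" and K: "K \<ge> 0" "lp_partition M (real (2 * r)) K \<pi>"
    and K': "K' \<ge> 0" "lp_partition M (real (2 * r)) K' \<upsilon>" and \<upsilon>: "periodic M \<upsilon>"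
  shows "lp_partition M (real (2 * r)) (Kh r ^ 4 * (K * K')\<^sup>2) (\<lambda>k. (\<pi> k, \<upsilon> (k - a (\<pi> k))))"
  unfolding lp_partition_def
proof (intro allI impI)
  fix c :: "'z \<times> 'y \<Rightarrow> complex" assume c: "\<forall>z. cmod (c z) \<le> 1"
  let ?Z = "\<pi> ` grid M" and ?Y = "\<upsilon> ` grid M"
  have Z: "finite ?Z" and Y: "finite ?Y" by simp_all
  have per: "periodic M (piece \<upsilon> y)" for y
    unfolding periodic_def
  proof (intro allI impI)
    fix k l :: "int ^ 'n" assume "\<forall>i. k $ i mod int M = l $ i mod int M"
    then have "\<upsilon> k = \<upsilon> l" using \<upsilon> by (simp add: periodic_def)
    then show "piece \<upsilon> y k = piece \<upsilon> y l" by (simp add: piece_def)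
  qed
  have Kh: "Kh r \<ge> 0" using Kh_ge_1[of r] by simp
  have "psum M r (mult_op M (\<lambda>k. c (\<pi> k, \<upsilon> (k - a (\<pi> k)))) f) \<le> (Kh r ^ 4 * (K * K')\<^sup>2) ^ (2 * r) * psum M r f" for f
  proof -
    define S where "S z = mult_op M (piece \<pi> z) f" for z
    define h where "h z x = cnj (chr M (a z) x) * S z x" for z x
    define g where "g z = mult_op M (\<lambda>k. \<Sum>y\<in>?Y. c (z, y) * piece \<upsilon> y (k - a z)) f" for z
    have fk: "\<upsilon> k \<in> ?Y" for k
    proof -
      have "\<upsilon> k = \<upsilon> (\<chi> i. k $ i mod int M)" using periodic_mod[OF \<upsilon>] by metis
      then show ?thesis using grid_mod[OF M] by blast
    qed
    have gS: "mult_op M (piece \<pi> z) (g z) x = chr M (a z) x * (\<Sum>y\<in>?Y. c (z, y) * mult_op M (piece \<upsilon> y) (h z) x)" for z x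
    proof -
      have "mult_op M (piece \<pi> z) (g z) x = mult_op M (\<lambda>k. \<Sum>y\<in>?Y. c (z, y) * piece \<upsilon> y (k - a z)) (S z) x"
        unfolding g_def S_def mult_op_mult[OF M, symmetric] by (simp add: mult.commute)
      also have "\<dots> = (\<Sum>y\<in>?Y. c (z, y) * mult_op M (\<lambda>k. piece \<upsilon> y (k - a z)) (S z) x)"
        by (simp add: mult_op_sum mult_op_scale)
      finally show ?thesis by (simp add: mult_op_shift[OF M per] h_def[abs_def] sum_distrib_left mult_ac)
    qed
    have "mult_op M (\<lambda>k. c (\<pi> k, \<upsilon> (k - a (\<pi> k)))) f x = (\<Sum>z\<in>?Z. mult_op M (piece \<pi> z) (g z) x)" for x
    proof -
      have "mult_op M (\<lambda>k. c (\<pi> k, \<upsilon> (k - a (\<pi> k)))) f x =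
          mult_op M (\<lambda>k. \<Sum>z\<in>?Z. piece \<pi> z k * (\<Sum>y\<in>?Y. c (z, y) * piece \<upsilon> y (k - a z))) f x"
      proof (intro mult_op_cong refl)
        fix k :: "int ^ 'n" assume k: "k \<in> grid M"
        have "(\<Sum>y\<in>?Y. c (z, y) * piece \<upsilon> y (k - a z)) = c (z, \<upsilon> (k - a z))" for z
          by (rule piece_sum[OF Y fk])
        then show "c (\<pi> k, \<upsilon> (k - a (\<pi> k))) = (\<Sum>z\<in>?Z. piece \<pi> z k * (\<Sum>y\<in>?Y. c (z, y) * piece \<upsilon> y (k - a z)))"
          using piece_sum[OF Z, of \<pi> k "\<lambda>z. c (z, \<upsilon> (k - a z))"] k by (simp add: mult.commute)
      qed
      then show ?thesis by (simp add: mult_op_sum mult_op_mult[OF M] g_def)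
    qed
    then have "psum M r (mult_op M (\<lambda>k. c (\<pi> k, \<upsilon> (k - a (\<pi> k)))) f) = psum M r (\<lambda>x. \<Sum>z\<in>?Z. mult_op M (piece \<pi> z) (g z) x)"
      by (intro psum_cong) simp
    also have "\<dots> \<le> K ^ (2 * r) * rnorm M r ?Z (\<lambda>z. mult_op M (piece \<pi> z) (g z))"
      by (rule lp_partition_reverse[OF M r K])
    also have "rnorm M r ?Z (\<lambda>z. mult_op M (piece \<pi> z) (g z)) \<le>
        Kh r * rnorm M r ?Z (\<lambda>z x. \<Sum>y\<in>?Y. c (z, y) * mult_op M (piece \<upsilon> y) (h z) x)"
      by (intro rnorm_contraction Z) (simp add: gS norm_mult)
    also have "rnorm M r ?Z (\<lambda>z x. \<Sum>y\<in>?Y. c (z, y) * mult_op M (piece \<upsilon> y) (h z) x) \<le>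
       rav ?Z (\<lambda>A. K' ^ (2 * r) * rnorm M r ?Y (\<lambda>y x. \<Sum>z\<in>?Z. sg A z *\<^sub>R (c (z, y) * mult_op M (piece \<upsilon> y) (h z) x)))"
      unfolding rnorm_def[of M r ?Z]
    proof (intro rav_mono Z)
      fix A
      have "(\<Sum>z\<in>?Z. sg A z *\<^sub>R (\<Sum>y\<in>?Y. c (z, y) * mult_op M (piece \<upsilon> y) (h z) x)) =
         (\<Sum>y\<in>?Y. mult_op M (piece \<upsilon> y) (\<lambda>x. \<Sum>z\<in>?Z. sg A z *\<^sub>R (c (z, y) * h z x)) x)" for x
        unfolding mult_op_sg_sum mult_op_scale_arg scaleR_sum_right by (rule sum.swap)
      then show "psum M r (\<lambda>x. \<Sum>z\<in>?Z. sg A z *\<^sub>R (\<Sum>y\<in>?Y. c (z, y) * mult_op M (piece \<upsilon> y) (h z) x)) \<le>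
        K' ^ (2 * r) * rnorm M r ?Y (\<lambda>y x. \<Sum>z\<in>?Z. sg A z *\<^sub>R (c (z, y) * mult_op M (piece \<upsilon> y) (h z) x))"
        using lp_partition_reverse[OF M r K', of "\<lambda>y x. \<Sum>z\<in>?Z. sg A z *\<^sub>R (c (z, y) * h z x)"]
        unfolding mult_op_sg_sum mult_op_scale_arg by simp
    qed
    also have "\<dots> = K' ^ (2 * r) * (\<Sum>x\<in>grid M. rav ?Z (\<lambda>A. rav ?Y (\<lambda>D. cmod (\<Sum>y\<in>?Y. sg D y *\<^sub>R (\<Sum>z\<in>?Z. sg A z *\<^sub>R (c (z, y) * mult_op M (piece \<upsilon> y) (h z) x))) ^ (2 * r))))"
      by (simp add: rav_scale rnorm_def psum_def rav_sum)
    also have "\<dots> \<le> K' ^ (2 * r) * (\<Sum>x\<in>grid M. Kh r * (Kh r * rav ?Z (\<lambda>A. rav ?Y (\<lambda>D. cmod (\<Sum>y\<in>?Y. sg D y *\<^sub>R (\<Sum>z\<in>?Z. sg A z *\<^sub>R (mult_op M (piece \<upsilon> y) (h z) x))) ^ (2 * r)))))"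
    proof (intro mult_left_mono sum_mono)
      fix x
      let ?w = "\<lambda>z y. mult_op M (piece \<upsilon> y) (h z) x"
      have "rav ?Z (\<lambda>A. rav ?Y (\<lambda>D. cmod (\<Sum>y\<in>?Y. sg D y *\<^sub>R (\<Sum>z\<in>?Z. sg A z *\<^sub>R (c (z, y) * ?w z y))) ^ (2 * r)))
        \<le> Kh r * (Kh r * (\<Sum>z\<in>?Z. \<Sum>y\<in>?Y. (cmod (c (z, y) * ?w z y))\<^sup>2) ^ r)"
        by (rule chaos_upper[OF Z Y r])
      also have "\<dots> \<le> Kh r * (Kh r * (\<Sum>z\<in>?Z. \<Sum>y\<in>?Y. (cmod (?w z y))\<^sup>2) ^ r)"
        using c Kh by (intro mult_left_mono power_mono sum_mono sum_nonneg) (auto simp: norm_mult intro: mult_left_le_one_le)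
      also have "\<dots> \<le> Kh r * (Kh r * rav ?Z (\<lambda>A. rav ?Y (\<lambda>D. cmod (\<Sum>y\<in>?Y. sg D y *\<^sub>R (\<Sum>z\<in>?Z. sg A z *\<^sub>R ?w z y)) ^ (2 * r))))"
        using Kh by (intro mult_left_mono chaos_lower Z Y)
      finally show "rav ?Z (\<lambda>A. rav ?Y (\<lambda>D. cmod (\<Sum>y\<in>?Y. sg D y *\<^sub>R (\<Sum>z\<in>?Z. sg A z *\<^sub>R (c (z, y) * ?w z y))) ^ (2 * r)))
        \<le> Kh r * (Kh r * rav ?Z (\<lambda>A. rav ?Y (\<lambda>D. cmod (\<Sum>y\<in>?Y. sg D y *\<^sub>R (\<Sum>z\<in>?Z. sg A z *\<^sub>R ?w z y)) ^ (2 * r))))" .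
    qed (use K' in auto)
    also have "\<dots> = K' ^ (2 * r) * (Kh r * (Kh r * rav ?Z (\<lambda>A. rnorm M r ?Y (\<lambda>y. mult_op M (piece \<upsilon> y) (\<lambda>x. \<Sum>z\<in>?Z. sg A z *\<^sub>R h z x)))))"
      by (simp add: rnorm_def psum_def rav_sum mult_op_sg_sum sum_distrib_left)
    also have "\<dots> \<le> K' ^ (2 * r) * (Kh r * (Kh r * rav ?Z (\<lambda>A. K' ^ (2 * r) * psum M r (\<lambda>x. \<Sum>z\<in>?Z. sg A z *\<^sub>R h z x))))"
      using Kh K' by (intro mult_left_mono rav_mono Z lp_partition_forward r) auto
    also have "\<dots> = K' ^ (2 * r) * (Kh r * (Kh r * (K' ^ (2 * r) * rnorm M r ?Z h)))"
      by (simp add: rav_scale rnorm_def)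
    also have "\<dots> \<le> K' ^ (2 * r) * (Kh r * (Kh r * (K' ^ (2 * r) * (Kh r * rnorm M r ?Z S))))"
      using Kh K' by (intro mult_left_mono rnorm_contraction Z) (auto simp: h_def norm_mult)
    also have "\<dots> \<le> K' ^ (2 * r) * (Kh r * (Kh r * (K' ^ (2 * r) * (Kh r * (K ^ (2 * r) * psum M r f)))))"
      unfolding S_def using Kh K' by (intro mult_left_mono lp_partition_forward r K) auto
    finally have "psum M r (mult_op M (\<lambda>k. c (\<pi> k, \<upsilon> (k - a (\<pi> k)))) f) \<le>
       K ^ (2 * r) * (Kh r * (K' ^ (2 * r) * (Kh r * (Kh r * (K' ^ (2 * r) * (Kh r * (K ^ (2 * r) * psum M r f)))))))"
      using Kh K by (simp add: mult_left_mono)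
    also have "\<dots> = Kh r ^ 4 * ((K * K')\<^sup>2) ^ (2 * r) * psum M r f"
      by (simp add: power_mult_distrib power2_eq_square power4_eq_xxxx mult_ac)
    also have "\<dots> \<le> (Kh r ^ 4) ^ (2 * r) * ((K * K')\<^sup>2) ^ (2 * r) * psum M r f"
    proof (intro mult_right_mono)
      have "1 \<le> Kh r ^ 4" using Kh_ge_1[of r] by simp
      then show "Kh r ^ 4 \<le> (Kh r ^ 4) ^ (2 * r)" using r by (intro self_le_power) auto
    qed auto
    finally show ?thesis by (simp add: power_mult_distrib)
  qed
  then show "mult_bound M (real (2 * r)) (Kh r ^ 4 * (K * K')\<^sup>2) (\<lambda>k. c (case (\<pi> k, \<upsilon> (k - a (\<pi> k))) of x \<Rightarrow> x))"
    using Kh by (subst mult_bound_psum[OF r]) auto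
qed

section \<open>The discrete Hilbert transform\<close>

lemma inner_mult_op:
  fixes a b :: "int ^ 'n::finite \<Rightarrow> complex"
  shows "(\<Sum>x\<in>grid M. mult_op M m a x * cnj (b x)) =
    (\<Sum>k\<in>grid M. m k * dft M a k * cnj (dft M b k)) / of_nat (card (grid M :: (int ^ 'n) set))"
proof -
  have "(\<Sum>x\<in>grid M. mult_op M m a x * cnj (b x)) =
     (\<Sum>x\<in>grid M. \<Sum>k\<in>grid M. m k * chr M k x * dft M a k * cnj (b x)) / of_nat (card (grid M :: (int ^ 'n) set))"
    by (simp add: mult_op_dft sum_divide_distrib sum_distrib_right)
  also have "(\<Sum>x\<in>grid M. \<Sum>k\<in>grid M. m k * chr M k x * dft M a k * cnj (b x)) = (\<Sum>k\<in>grid M. m k * dft M a k * cnj (dft M b k))"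
    by (subst sum.swap) (simp add: dft_def[of M b] sum_distrib_left mult_ac)
  finally show ?thesis .
qed

lemma parseval:
  fixes a :: "int ^ 'n::finite \<Rightarrow> complex"
  assumes "M > 0"
  shows "(\<Sum>x\<in>grid M. (cmod (a x))\<^sup>2) = (\<Sum>k\<in>grid M. (cmod (dft M a k))\<^sup>2) / real (card (grid M :: (int ^ 'n) set))"
proof -
  have "(\<Sum>x\<in>grid M. mult_op M (\<lambda>_. 1) a x * cnj (a x)) = of_real (\<Sum>x\<in>grid M. (cmod (a x))\<^sup>2)"
    using assms by (simp add: mult_op_one del: of_real_power flip: complex_norm_square)
  moreover have "(\<Sum>k\<in>grid M. 1 * dft M a k * cnj (dft M a k)) = of_real (\<Sum>k\<in>grid M. (cmod (dft M a k))\<^sup>2)"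
    by (simp add: mult.assoc del: of_real_power flip: complex_norm_square)
  ultimately have "complex_of_real (\<Sum>x\<in>grid M. (cmod (a x))\<^sup>2) = of_real ((\<Sum>k\<in>grid M. (cmod (dft M a k))\<^sup>2) / real (card (grid M :: (int ^ 'n) set)))"
    using inner_mult_op[of M "\<lambda>_. 1" a a] by simp
  then show ?thesis by (simp only: of_real_eq_iff)
qed

lemma mult_bound_2:
  fixes m :: "int ^ 'n::finite \<Rightarrow> complex"
  assumes M: "M > 0" and C: "C \<ge> 0" and m: "\<And>k. k \<in> grid M \<Longrightarrow> cmod (m k) \<le> C"
  shows "mult_bound M 2 C m"
proof -
  have "psum M 1 (mult_op M m a) \<le> C ^ (2 * 1) * psum M 1 a" for a :: "int ^ 'n \<Rightarrow> complex"
  proof -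
    have "(\<Sum>k\<in>grid M. (cmod (m k * dft M a k))\<^sup>2) \<le> (\<Sum>k\<in>grid M. C\<^sup>2 * (cmod (dft M a k))\<^sup>2)"
      unfolding norm_mult power_mult_distrib
      using m by (intro sum_mono mult_right_mono power_mono) auto
    then show ?thesis
      using parseval[OF M, of "mult_op M m a"] parseval[OF M, of a]
      by (simp add: psum_def dft_mult_op[OF M] sum_distrib_left[symmetric] divide_right_mono cong: sum.cong)
  qed
  then show ?thesis using mult_bound_psum[of 1 C M m] C by simp
qed

lemma nrm_Cauchy_Schwarz:
  fixes a b :: "int ^ 'n::finite \<Rightarrow> complex"
  assumes "q > 0"
  shows "nrm M q (\<lambda>x. a x * b x) \<le> nrm M (2 * q) a * nrm M (2 * q) b"
proof -
  have sq: "(cmod z powr q)\<^sup>2 = cmod z powr (2 * q)" for z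
    by (simp add: power2_eq_square powr_add[symmetric])
  have rt: "s powr (1 / q) = (s\<^sup>2) powr (1 / (2 * q))" if "s \<ge> 0" for s
    proof -
    have "s\<^sup>2 = s powr 2" using that by (simp add: powr_numeral)
    then show ?thesis by (simp add: powr_powr)
  qed
  let ?s = "\<Sum>x\<in>grid M. cmod (a x) powr q * cmod (b x) powr q"
  have "?s\<^sup>2 \<le> (\<Sum>x\<in>grid M. (cmod (a x) powr q)\<^sup>2) * (\<Sum>x\<in>grid M. (cmod (b x) powr q)\<^sup>2)"
    by (rule Cauchy_Schwarz_ineq_sum)
  then have *: "?s\<^sup>2 \<le> (\<Sum>x\<in>grid M. cmod (a x) powr (2 * q)) * (\<Sum>x\<in>grid M. cmod (b x) powr (2 * q))"
    by (simp add: sq)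
  have "nrm M q (\<lambda>x. a x * b x) = ?s powr (1 / q)" by (simp add: nrm_def norm_mult powr_mult)
  also have "\<dots> = (?s\<^sup>2) powr (1 / (2 * q))" by (rule rt) (simp add: sum_nonneg)
  also have "\<dots> \<le> ((\<Sum>x\<in>grid M. cmod (a x) powr (2 * q)) * (\<Sum>x\<in>grid M. cmod (b x) powr (2 * q))) powr (1 / (2 * q))"
    using assms * by (intro powr_mono2) auto
  also have "\<dots> = nrm M (2 * q) a * nrm M (2 * q) b"
    by (simp add: nrm_def powr_mult sum_nonneg)
  finally show ?thesis .
qed

lemma nrm_square:
  fixes a :: "int ^ 'n::finite \<Rightarrow> complex"
  assumes "q > 0"
  shows "nrm M q (\<lambda>x. (a x)\<^sup>2) = (nrm M (2 * q) a)\<^sup>2"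
proof -
  have "cmod ((a x)\<^sup>2) powr q = cmod (a x) powr (2 * q)" for x
    using powr_powr[of "cmod (a x)" 2 q] by (simp add: norm_power powr_numeral)
  then have "nrm M q (\<lambda>x. (a x)\<^sup>2) = (\<Sum>x\<in>grid M. cmod (a x) powr (2 * q)) powr (1 / q)"
    by (simp add: nrm_def)
  also have "\<dots> = ((\<Sum>x\<in>grid M. cmod (a x) powr (2 * q)) powr (1 / (2 * q))) powr 2"
    by (simp add: powr_powr)
  also have "\<dots> = (nrm M (2 * q) a)\<^sup>2" by (simp add: nrm_def powr_numeral)
  finally show ?thesis .
qed

definition upd :: "int ^ 'n \<Rightarrow> 'n \<Rightarrow> int \<Rightarrow> int ^ 'n" where
  "upd x i s = (\<chi> j. if j = i then s else x $ j)"

definition ec :: "nat \<Rightarrow> int \<Rightarrow> complex" where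
  "ec M n = cis (2 * pi * of_int n / real M)"

definition line_conv :: "nat \<Rightarrow> 'n \<Rightarrow> (int \<Rightarrow> complex) \<Rightarrow> (int ^ 'n \<Rightarrow> complex) \<Rightarrow> int ^ 'n \<Rightarrow> complex" where
  "line_conv M i \<kappa> a x = (\<Sum>s\<in>{0..<int M}. \<kappa> (x $ i - s) * a (upd x i s))"

definition dker :: "nat \<Rightarrow> (int \<Rightarrow> complex) \<Rightarrow> int \<Rightarrow> complex" where
  "dker M \<mu> n = (\<Sum>k\<in>{0..<int M}. \<mu> k * ec M (k * n))"

lemma upd_simps [simp]: "upd x i s $ i = s" "upd (upd x i s) i t = upd x i t" "upd x i (x $ i) = x"
  by (auto simp: upd_def vec_eq_iff)

lemma upd_grid: "x \<in> grid M \<Longrightarrow> s \<in> {0..<int M} \<Longrightarrow> upd x i s \<in> grid M"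
  by (auto simp: upd_def grid_def)

lemma grid_coord: "x \<in> grid M \<Longrightarrow> x $ i \<in> {0..<int M}"
  by (auto simp: grid_def)

lemma ec_add: "ec M (m + n) = ec M m * ec M n"
  by (simp add: ec_def cis_mult algebra_simps add_divide_distrib)

lemma ec_0 [simp]: "ec M 0 = 1"
  by (simp add: ec_def)

lemma norm_ec [simp]: "cmod (ec M n) = 1"
  by (simp add: ec_def)

lemma ec_minus: "ec M (- n) = cnj (ec M n)"
  by (simp add: ec_def cis_cnj)

lemma ec_cong: "M > 0 \<Longrightarrow> int M dvd n - m \<Longrightarrow> ec M n = ec M m"
  unfolding ec_def by (rule cis_period)

lemma ec_eq_1: "M > 0 \<Longrightarrow> ec M n = 1 \<longleftrightarrow> int M dvd n"
  using cis_eq_1_int[of M n] ec_cong[of M n 0] by (auto simp: ec_def)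

lemma sum_int_reflect:
  fixes F :: "int \<Rightarrow> 'b::comm_monoid_add"
  assumes "M > 0" "\<And>n. F (n mod int M) = F n"
  shows "(\<Sum>s\<in>{0..<int M}. F (v - s)) = (\<Sum>s\<in>{0..<int M}. F s)"
proof -
  have bij: "bij_betw (\<lambda>s. (v - s) mod int M) {0..<int M} {0..<int M}"
    using assms(1) by (intro bij_betwI[where g = "\<lambda>s. (v - s) mod int M"]) (auto simp: mod_simps)
  have "(\<Sum>s\<in>{0..<int M}. F (v - s)) = (\<Sum>s\<in>{0..<int M}. F ((v - s) mod int M))"
    by (simp add: assms(2))
  also have "\<dots> = (\<Sum>s\<in>{0..<int M}. F s)" by (rule sum.reindex_bij_betw[OF bij])
  finally show ?thesis .
qed

lemma sum_ec_nat: "(\<Sum>s\<in>{0..<int M}. F s) = (\<Sum>k<M. F (int k))"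
proof -
  have "{0..<int M} = int ` {..<M}" by (simp add: image_int_atLeastLessThan flip: atLeast0LessThan)
  then show ?thesis by (simp add: sum.reindex)
qed

lemma ec_power: "ec M (int k * n) = ec M n ^ k"
  by (induction k) (simp_all add: ec_add algebra_simps)

lemma ec_power_M: "M > 0 \<Longrightarrow> ec M n ^ M = 1"
  using ec_eq_1[of M "int M * n"] ec_power[of M M n] by simp

lemma sum_ec:
  assumes "M > 0"
  shows "(\<Sum>s\<in>{0..<int M}. ec M (s * n)) = (if int M dvd n then of_nat M else 0)"
proof (cases "int M dvd n")
  case True
  then have "ec M (s * n) = 1" for s using assms by (simp add: ec_eq_1)
  then show ?thesis using True by simp
next
  case False
  then have w: "ec M n \<noteq> 1" using assms by (simp add: ec_eq_1)
  have "ec M n ^ M = 1" using assms by (rule ec_power_M)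
  then have "(\<Sum>k<M. ec M n ^ k) = 0" using w by (simp add: geometric_sum)
  then show ?thesis using False by (simp add: sum_ec_nat ec_power)
qed

lemma sum_ec_reflect:
  assumes "M > 0"
  shows "(\<Sum>s\<in>{0..<int M}. ec M ((v - s) * n)) = (if int M dvd n then of_nat M else 0)"
proof -
  have "ec M (s mod int M * n) = ec M (s * n)" for s
  proof (rule ec_cong[OF assms])
    have "int M dvd (s mod int M - s) * n" by (intro dvd_mult2) (simp add: mod_eq_dvd_iff[symmetric])
    then show "int M dvd s mod int M * n - s * n" by (simp add: left_diff_distrib)
  qed
  then show ?thesis using sum_int_reflect[OF assms, of "\<lambda>s. ec M (s * n)" v] sum_ec[OF assms] by simp
qed

lemma chr_upd: "chr M k (upd x i s) = chr M k x * ec M (k $ i * (s - x $ i))"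
proof -
  have "upd x i s = x + axis i (s - x $ i)" by (auto simp: vec_eq_iff upd_def axis_def)
  moreover have "(\<Sum>j\<in>UNIV. k $ j * axis i (s - x $ i) $ j) = k $ i * (s - x $ i)"
  proof -
    have "(\<Sum>j\<in>UNIV. k $ j * axis i (s - x $ i) $ j) = (\<Sum>j\<in>UNIV. if j = i then k $ j * (s - x $ i) else 0)"
      by (intro sum.cong) (auto simp: axis_def)
    then show ?thesis by simp
  qed
  ultimately show ?thesis by (simp add: chr_add_right) (simp add: chr_def ec_def)
qed

lemma dker_inversion:
  assumes M: "M > 0" and q: "q \<in> {0..<int M}"
  shows "(\<Sum>s\<in>{0..<int M}. dker M \<mu> (t - s) * ec M (q * (s - t))) = of_nat M * \<mu> q"
proof -
  have "(\<Sum>s\<in>{0..<int M}. dker M \<mu> (t - s) * ec M (q * (s - t))) =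
    (\<Sum>s\<in>{0..<int M}. \<Sum>k\<in>{0..<int M}. \<mu> k * ec M ((t - s) * (k - q)))"
  proof -
    have "ec M (k * (t - s)) * ec M (q * (s - t)) = ec M ((t - s) * (k - q))" for k s
      by (simp add: ec_add[symmetric] algebra_simps)
    then show ?thesis by (simp add: dker_def sum_distrib_right mult.assoc)
  qed
  also have "\<dots> = (\<Sum>k\<in>{0..<int M}. \<mu> k * (\<Sum>s\<in>{0..<int M}. ec M ((t - s) * (k - q))))"
    by (subst sum.swap) (simp add: sum_distrib_left)
  also have "\<dots> = (\<Sum>k\<in>{0..<int M}. if k = q then \<mu> q * of_nat M else 0)"
  proof (intro sum.cong refl)
    fix k assume k: "k \<in> {0..<int M}"
    have "int M dvd k - q \<longleftrightarrow> k = q"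
      using k q by (auto simp: mod_eq_dvd_iff[symmetric])
    then show "\<mu> k * (\<Sum>s\<in>{0..<int M}. ec M ((t - s) * (k - q))) = (if k = q then \<mu> q * of_nat M else 0)"
      by (simp add: sum_ec_reflect[OF M])
  qed
  also have "\<dots> = of_nat M * \<mu> q" using q by (simp add: mult.commute)
  finally show ?thesis .
qed

lemma mult_op_line:
  fixes x :: "int ^ 'n::finite"
  assumes M: "M > 0" and x: "x \<in> grid M"
  shows "mult_op M (\<lambda>k. \<mu> (k $ i)) a x = line_conv M i (\<lambda>n. dker M \<mu> n / of_nat M) a x"
proof -
  let ?N = "of_nat (card (grid M :: (int ^ 'n) set)) :: complex"
  have inv: "a y = (\<Sum>k\<in>grid M. chr M k y * dft M a k) / ?N" if "y \<in> grid M" for y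
    using mult_op_one[OF M that, of a] by (simp add: mult_op_dft)
  have "line_conv M i (\<lambda>n. dker M \<mu> n / of_nat M) a x =
    (\<Sum>s\<in>{0..<int M}. dker M \<mu> (x $ i - s) / of_nat M * ((\<Sum>k\<in>grid M. chr M k (upd x i s) * dft M a k) / ?N))"
    unfolding line_conv_def by (intro sum.cong refl arg_cong2[where f="(*)"] inv upd_grid x)
  also have "\<dots> = (\<Sum>s\<in>{0..<int M}. \<Sum>k\<in>grid M. (dker M \<mu> (x $ i - s) * ec M (k $ i * (s - x $ i))) * (chr M k x * dft M a k / (of_nat M * ?N)))"
    by (simp add: chr_upd sum_distrib_left sum_divide_distrib mult_ac)
  also have "\<dots> = (\<Sum>k\<in>grid M. (\<Sum>s\<in>{0..<int M}. dker M \<mu> (x $ i - s) * ec M (k $ i * (s - x $ i))) * (chr M k x * dft M a k / (of_nat M * ?N)))"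
    by (subst sum.swap) (simp only: sum_distrib_right)
  also have "\<dots> = (\<Sum>k\<in>grid M. of_nat M * \<mu> (k $ i) * (chr M k x * dft M a k / (of_nat M * ?N)))"
    by (intro sum.cong refl) (simp only: dker_inversion[OF M grid_coord])
  also have "\<dots> = mult_op M (\<lambda>k. \<mu> (k $ i)) a x"
    using M by (simp add: mult_op_dft sum_divide_distrib mult_ac)
  finally show ?thesis by simp
qed

lemma dker_mod: "M > 0 \<Longrightarrow> dker M \<mu> (n mod int M) = dker M \<mu> n"
  unfolding dker_def
proof (intro sum.cong refl arg_cong2[where f="(*)"])
  fix k assume "M > 0"
  moreover have "int M dvd k * (n mod int M - n)" by (intro dvd_mult) (simp add: mod_eq_dvd_iff[symmetric])
  ultimately show "ec M (k * (n mod int M)) = ec M (k * n)" by (intro ec_cong) (simp_all add: right_diff_distrib)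
qed

lemma nrm_line_conv:
  fixes a :: "int ^ 'n::finite \<Rightarrow> complex"
  assumes M: "M > 0" and p: "p \<ge> 1" and \<kappa>: "\<And>n. \<kappa> (n mod int M) = \<kappa> n"
  shows "nrm M p (line_conv M i \<kappa> a) \<le> (\<Sum>n\<in>{0..<int M}. cmod (\<kappa> n)) * nrm M p a"
proof -
  let ?sh = "\<lambda>n x. upd x i ((x $ i - n) mod int M)"
  have eq: "line_conv M i \<kappa> a x = (\<Sum>n\<in>{0..<int M}. \<kappa> n * a (?sh n x))" if "x \<in> grid M" for x
  proof -
    have "(\<Sum>n\<in>{0..<int M}. \<kappa> n * a (?sh n x)) = (\<Sum>n\<in>{0..<int M}. \<kappa> (x $ i - n) * a (?sh (x $ i - n) x))"
      by (rule sum_int_reflect[OF M, symmetric]) (simp add: \<kappa> mod_simps)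
    also have "\<dots> = line_conv M i \<kappa> a x"
      unfolding line_conv_def by (intro sum.cong refl) auto
    finally show ?thesis by simp
  qed
  have iso: "nrm M p (\<lambda>x. a (?sh n x)) = nrm M p a" for n
  proof -
    have "bij_betw (?sh n) (grid M) (grid M :: (int ^ 'n) set)"
      using M by (intro bij_betwI[where g = "?sh (- n)"])
        (auto simp: grid_def upd_def vec_eq_iff mod_simps)
    from sum.reindex_bij_betw[OF this, of "\<lambda>x. cmod (a x) powr p"] show ?thesis by (simp add: nrm_def)
  qed
  have "nrm M p (line_conv M i \<kappa> a) = nrm M p (\<lambda>x. \<Sum>n\<in>{0..<int M}. \<kappa> n * a (?sh n x))"
    by (intro nrm_cong) (simp add: eq)
  also have "\<dots> \<le> (\<Sum>n\<in>{0..<int M}. nrm M p (\<lambda>x. \<kappa> n * a (?sh n x)))" by (rule nrm_sum[OF p])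
  also have "\<dots> = (\<Sum>n\<in>{0..<int M}. cmod (\<kappa> n) * nrm M p a)" using p by (simp add: nrm_scale iso)
  finally show ?thesis by (simp add: sum_distrib_right)
qed

lemma dker_parseval:
  assumes M: "M > 0" and \<mu>: "\<And>k. cmod (\<mu> k) \<le> 1"
  shows "(\<Sum>n\<in>{0..<int M}. (cmod (dker M \<mu> n))\<^sup>2) \<le> (real M)\<^sup>2"
proof -
  have "of_real (\<Sum>n\<in>{0..<int M}. (cmod (dker M \<mu> n))\<^sup>2) =
    (\<Sum>n\<in>{0..<int M}. \<Sum>k\<in>{0..<int M}. \<Sum>l\<in>{0..<int M}. \<mu> k * cnj (\<mu> l) * ec M (n * (k - l)))"
  proof -
    have "of_real ((cmod (dker M \<mu> n))\<^sup>2) = (\<Sum>k\<in>{0..<int M}. \<Sum>l\<in>{0..<int M}. \<mu> k * cnj (\<mu> l) * ec M (n * (k - l)))" for n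
    proof -
      have "ec M (n * (k - l)) = ec M (k * n) * cnj (ec M (l * n))" for k l
        unfolding ec_minus[symmetric] ec_add[symmetric] by (simp add: algebra_simps)
      then show ?thesis
        unfolding complex_norm_square dker_def cnj_sum sum_product by (simp add: mult_ac)
    qed
    then show ?thesis by simp
  qed
  also have "\<dots> = (\<Sum>k\<in>{0..<int M}. \<Sum>l\<in>{0..<int M}. \<mu> k * cnj (\<mu> l) * (\<Sum>n\<in>{0..<int M}. ec M (n * (k - l))))"
  proof -
    let ?f = "\<lambda>n k l. \<mu> k * cnj (\<mu> l) * ec M (n * (k - l))"
    have "(\<Sum>n\<in>{0..<int M}. \<Sum>k\<in>{0..<int M}. \<Sum>l\<in>{0..<int M}. ?f n k l) = (\<Sum>k\<in>{0..<int M}. \<Sum>n\<in>{0..<int M}. \<Sum>l\<in>{0..<int M}. ?f n k l)"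
      by (rule sum.swap)
    also have "\<dots> = (\<Sum>k\<in>{0..<int M}. \<Sum>l\<in>{0..<int M}. \<Sum>n\<in>{0..<int M}. ?f n k l)"
      by (intro sum.cong refl sum.swap)
    finally show ?thesis by (simp only: sum_distrib_left)
  qed
  also have "\<dots> = (\<Sum>k\<in>{0..<int M}. \<Sum>l\<in>{0..<int M}. if l = k then \<mu> k * cnj (\<mu> k) * of_nat M else 0)"
  proof (intro sum.cong refl)
    fix k l assume "k \<in> {0..<int M}" "l \<in> {0..<int M}"
    then have "int M dvd k - l \<longleftrightarrow> l = k" by (auto simp: mod_eq_dvd_iff[symmetric])
    then show "\<mu> k * cnj (\<mu> l) * (\<Sum>n\<in>{0..<int M}. ec M (n * (k - l))) = (if l = k then \<mu> k * cnj (\<mu> k) * of_nat M else 0)"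
      by (simp add: sum_ec[OF M])
  qed
  also have "\<dots> = of_real (\<Sum>k\<in>{0..<int M}. (cmod (\<mu> k))\<^sup>2 * real M)"
    by (simp add: del: of_real_power flip: complex_norm_square)
  finally have "(\<Sum>n\<in>{0..<int M}. (cmod (dker M \<mu> n))\<^sup>2) = (\<Sum>k\<in>{0..<int M}. (cmod (\<mu> k))\<^sup>2 * real M)"
    by (simp only: of_real_eq_iff)
  also have "\<dots> \<le> (\<Sum>k\<in>{0..<int M}. 1 * real M)"
    using \<mu> by (intro sum_mono mult_right_mono) (auto simp: power_le_one)
  finally show ?thesis by (simp add: power2_eq_square)
qed

text \<open>The sawtooth is the multiplier of the discrete Hilbert transform; differences of its translates give the indicators of arcs.\<close>

definition saw :: "nat \<Rightarrow> int \<Rightarrow> complex" where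
  "saw M k = (if k mod int M = 0 then 0 else of_real (1 - 2 * of_int (k mod int M) / real M))"

lemma norm_saw: "M > 0 \<Longrightarrow> cmod (saw M k) \<le> 1"
proof -
  assume "M > 0"
  then have "0 \<le> k mod int M" "k mod int M < int M" by simp_all
  then have "0 \<le> real_of_int (k mod int M)" "real_of_int (k mod int M) \<le> real M" by linarith+
  then have "0 \<le> 2 * real_of_int (k mod int M) / real M" "2 * real_of_int (k mod int M) / real M \<le> 2"
    using \<open>M > 0\<close> by (auto simp: field_simps)
  then have "\<bar>1 - 2 * real_of_int (k mod int M) / real M\<bar> \<le> 1" by (simp add: abs_le_iff)
  then show ?thesis by (cases "k mod int M = 0") (simp_all only: saw_def if_True if_False norm_of_real norm_zero, simp_all)
qed

lemma sum_k_power: "(w - 1) * (\<Sum>k<n. of_nat k * w ^ k) = of_nat n * w ^ n - w * (\<Sum>k<n. w ^ k)" for w :: complex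
  by (induction n) (simp_all add: algebra_simps)

lemma dker_saw:
  assumes M: "M > 0" and n: "\<not> int M dvd n"
  shows "dker M (saw M) n = (1 + ec M n) / (1 - ec M n)"
proof -
  let ?w = "ec M n"
  have w: "?w \<noteq> 1" using M n by (simp add: ec_eq_1)
  have wM: "?w ^ M = 1" using M by (rule ec_power_M)
  have s0: "(\<Sum>k<M. ?w ^ k) = 0" using w wM by (simp add: geometric_sum)
  have s1: "(\<Sum>k<M. of_nat k * ?w ^ k) = of_nat M / (?w - 1)"
    using sum_k_power[of ?w M] w s0 wM by (simp add: field_simps)
  have "dker M (saw M) n = (\<Sum>k<M. saw M (int k) * ?w ^ k)"
    by (simp add: dker_def sum_ec_nat ec_power)
  also have "\<dots> = (\<Sum>k<M. (?w ^ k - 2 / of_nat M * (of_nat k * ?w ^ k)) - (if k = 0 then 1 else 0))"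
    by (intro sum.cong refl) (auto simp: saw_def field_simps)
  also have "\<dots> = (\<Sum>k<M. ?w ^ k) - 2 / of_nat M * (\<Sum>k<M. of_nat k * ?w ^ k) - 1"
    using M by (simp add: sum_subtractf sum_distrib_left)
  also have "\<dots> = (1 + ec M n) / (1 - ec M n)" using M w by (simp add: s0 s1 field_simps)
  finally show ?thesis .
qed

lemma dker_saw_0:
  assumes M: "M > 0" and n: "int M dvd n"
  shows "dker M (saw M) n = 0"
proof -
  have gauss: "(\<Sum>k<M. real k) = real M * (real M - 1) / 2" by (induction M) (simp_all add: field_simps)
  have "ec M (int k * n) = 1" for k using M n by (simp add: ec_eq_1)
  then have "dker M (saw M) n = (\<Sum>k<M. saw M (int k))"
    by (simp add: dker_def sum_ec_nat)
  also have "\<dots> = (\<Sum>k<M. of_real ((1 - 2 / real M * real k) - (if k = 0 then 1 else 0)))"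
    by (intro sum.cong refl) (auto simp: saw_def)
  also have "\<dots> = of_real ((\<Sum>k<M. 1) - 2 / real M * (\<Sum>k<M. real k) - (\<Sum>k<M. if k = 0 then 1 else 0))"
    unfolding of_real_sum[symmetric] sum_subtractf sum_distrib_left ..
  also have "\<dots> = 0" unfolding gauss using M by (simp add: field_simps)
  finally show ?thesis .
qed

lemma dker_saw_odd: "M > 0 \<Longrightarrow> dker M (saw M) (- n) = - dker M (saw M) n"
proof (cases "int M dvd n")
  case False
  assume M: "M > 0"
  have w: "ec M n \<noteq> 1" using M False by (simp add: ec_eq_1)
  have inv: "ec M (- n) = 1 / ec M n" "ec M n \<noteq> 0"
  proof -
    show nz: "ec M n \<noteq> 0" using norm_ec[of M n] by (metis norm_zero zero_neq_one)
    have "ec M n * ec M (- n) = 1" using ec_add[of M n "- n"] by simp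
    with nz show "ec M (- n) = 1 / ec M n" by (simp add: field_simps)
  qed
  show ?thesis using M False w inv(2) by (simp add: dker_saw inv(1) divide_simps) (simp add: algebra_simps)
qed (simp add: dker_saw_0)

lemma dker_saw_product:
  assumes M: "M > 0" and n: "\<not> int M dvd t - s" "\<not> int M dvd t - l" "\<not> int M dvd l - s"
  shows "dker M (saw M) (t - s) * dker M (saw M) (t - l) =
    1 - dker M (saw M) (l - s) * (dker M (saw M) (t - s) - dker M (saw M) (t - l))"
proof -
  define x y where "x = ec M (l - s)" and "y = ec M (t - l)"
  have xy: "ec M (t - s) = x * y" unfolding x_def y_def ec_add[symmetric] by simp
  have "x \<noteq> 1" "y \<noteq> 1" "x * y \<noteq> 1" using M n xy unfolding x_def y_def by (auto simp: ec_eq_1)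
  then have "(1 + x * y) / (1 - x * y) * ((1 + y) / (1 - y)) = 1 - (1 + x) / (1 - x) * ((1 + x * y) / (1 - x * y) - (1 + y) / (1 - y))"
    by (simp add: divide_simps) (simp add: algebra_simps)
  then show ?thesis using M n by (simp add: dker_saw xy) (simp add: x_def y_def)
qed

lemma cotlar_identity:
  fixes \<alpha> :: "int \<Rightarrow> complex"
  assumes M: "M > 0" and t: "t \<in> {0..<int M}"
  defines "c \<equiv> dker M (saw M)" and "I \<equiv> {0..<int M}"
  defines "H \<equiv> \<lambda>\<beta> t. \<Sum>s\<in>I. c (t - s) * \<beta> s"
  shows "(H \<alpha> t)\<^sup>2 = 2 * H (\<lambda>s. \<alpha> s * H \<alpha> s) t + 2 * \<alpha> t * (\<Sum>s\<in>I. (c (t - s))\<^sup>2 * \<alpha> s)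
    + (\<Sum>s\<in>I. (c (t - s))\<^sup>2 * (\<alpha> s)\<^sup>2) + ((\<Sum>s\<in>I. \<alpha> s) - \<alpha> t)\<^sup>2 - ((\<Sum>s\<in>I. (\<alpha> s)\<^sup>2) - (\<alpha> t)\<^sup>2)"
proof -
  define J where "J = I - {t}"
  have fin: "finite I" "finite J" and tI: "t \<in> I" using t by (auto simp: I_def J_def)
  have c0: "c 0 = 0" using M by (simp add: c_def dker_saw_0)
  have odd: "c (s - l) = - c (l - s)" for s l
    using dker_saw_odd[OF M, of "l - s"] by (simp add: c_def)
  have split: "(\<Sum>s\<in>I. F s) = F t + (\<Sum>s\<in>J. F s)" for F :: "int \<Rightarrow> complex"
    unfolding J_def using fin tI by (simp add: sum.remove)
  have key: "c (t - s) * c (t - l) = (if s = l then (c (t - s))\<^sup>2 - 1 else 0) + 1 - c (t - s) * c (l - s) + c (t - l) * c (l - s)"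
    if "s \<in> J" "l \<in> J" for s l
  proof (cases "s = l")
    case True then show ?thesis by (simp add: c0 power2_eq_square)
  next
    case False
    have nd: "\<not> int M dvd u - v" if "u \<in> I" "v \<in> I" "u \<noteq> v" for u v
      using that by (auto simp: I_def mod_eq_dvd_iff[symmetric])
    have "c (t - s) * c (t - l) = 1 - c (l - s) * (c (t - s) - c (t - l))"
      unfolding c_def using that False tI by (intro dker_saw_product M nd) (auto simp: J_def)
    then show ?thesis using False by (simp add: algebra_simps)
  qed
  have HJ: "H \<beta> t = (\<Sum>s\<in>J. c (t - s) * \<beta> s)" for \<beta> by (simp add: H_def split c0)
  have Hs: "(\<Sum>l\<in>J. c (s - l) * \<alpha> l) = H \<alpha> s + c (t - s) * \<alpha> t" for s
    unfolding H_def split using odd[of s t] by (simp add: algebra_simps)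
  have "(H \<alpha> t)\<^sup>2 = (\<Sum>s\<in>J. \<Sum>l\<in>J. (c (t - s) * c (t - l)) * (\<alpha> s * \<alpha> l))"
    by (simp add: HJ power2_eq_square sum_product mult_ac)
  also have "\<dots> = (\<Sum>s\<in>J. \<Sum>l\<in>J. (if s = l then ((c (t - s))\<^sup>2 - 1) * (\<alpha> s * \<alpha> l) else 0) + \<alpha> s * \<alpha> l
      + c (t - s) * \<alpha> s * (c (s - l) * \<alpha> l) + c (t - l) * \<alpha> l * (c (l - s) * \<alpha> s))"
  proof (intro sum.cong refl)
    fix s l assume "s \<in> J" "l \<in> J"
    then show "c (t - s) * c (t - l) * (\<alpha> s * \<alpha> l) = (if s = l then ((c (t - s))\<^sup>2 - 1) * (\<alpha> s * \<alpha> l) else 0) + \<alpha> s * \<alpha> l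
      + c (t - s) * \<alpha> s * (c (s - l) * \<alpha> l) + c (t - l) * \<alpha> l * (c (l - s) * \<alpha> s)"
      unfolding odd[of s l] by (subst key) (auto simp: algebra_simps)
  qed
  also have "\<dots> = (\<Sum>s\<in>J. ((c (t - s))\<^sup>2 - 1) * (\<alpha> s * \<alpha> s)) + (\<Sum>s\<in>J. \<alpha> s) * (\<Sum>s\<in>J. \<alpha> s)
      + (\<Sum>s\<in>J. c (t - s) * \<alpha> s * (\<Sum>l\<in>J. c (s - l) * \<alpha> l)) + (\<Sum>l\<in>J. c (t - l) * \<alpha> l * (\<Sum>s\<in>J. c (l - s) * \<alpha> s))"
  proof -
    have "(\<Sum>s\<in>J. \<Sum>l\<in>J. if s = l then ((c (t - s))\<^sup>2 - 1) * (\<alpha> s * \<alpha> l) else 0) = (\<Sum>s\<in>J. ((c (t - s))\<^sup>2 - 1) * (\<alpha> s * \<alpha> s))"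
      using fin by simp
    moreover have "(\<Sum>s\<in>J. \<Sum>l\<in>J. \<alpha> s * \<alpha> l) = (\<Sum>s\<in>J. \<alpha> s) * (\<Sum>s\<in>J. \<alpha> s)" by (simp only: sum_product)
    moreover have "(\<Sum>s\<in>J. \<Sum>l\<in>J. c (t - s) * \<alpha> s * (c (s - l) * \<alpha> l)) = (\<Sum>s\<in>J. c (t - s) * \<alpha> s * (\<Sum>l\<in>J. c (s - l) * \<alpha> l))"
      by (simp only: sum_distrib_left)
    moreover have "(\<Sum>s\<in>J. \<Sum>l\<in>J. c (t - l) * \<alpha> l * (c (l - s) * \<alpha> s)) = (\<Sum>l\<in>J. c (t - l) * \<alpha> l * (\<Sum>s\<in>J. c (l - s) * \<alpha> s))"
      unfolding sum_distrib_left by (rule sum.swap)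
    ultimately show ?thesis by (simp only: sum.distrib)
  qed
  also have "\<dots> = (\<Sum>s\<in>J. (c (t - s))\<^sup>2 * (\<alpha> s)\<^sup>2) - (\<Sum>s\<in>J. (\<alpha> s)\<^sup>2) + (\<Sum>s\<in>J. \<alpha> s)\<^sup>2
      + 2 * ((\<Sum>s\<in>J. c (t - s) * (\<alpha> s * H \<alpha> s)) + \<alpha> t * (\<Sum>s\<in>J. (c (t - s))\<^sup>2 * \<alpha> s))"
    unfolding Hs by (simp add: power2_eq_square algebra_simps sum.distrib sum_subtractf sum_distrib_left)
  finally show ?thesis by (simp add: HJ split c0 algebra_simps)
qed

fun cotlar :: "nat \<Rightarrow> real" where
  "cotlar 0 = 1"
| "cotlar (Suc k) = 2 * cotlar k + 8"

lemma cotlar_ge_1: "cotlar k \<ge> 1"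
  by (induction k) auto

lemma cotlar_step:
  assumes M: "M > 0" and q: "q \<ge> 1" and C: "C \<ge> 0"
    and b: "mult_bound M q C (\<lambda>k :: int ^ 'n::finite. saw M (k $ i))"
  shows "mult_bound M (2 * q) (2 * C + 8) (\<lambda>k :: int ^ 'n. saw M (k $ i))"
  unfolding mult_bound_def
proof
  fix a :: "int ^ 'n \<Rightarrow> complex"
  let ?m = "\<lambda>k :: int ^ 'n. saw M (k $ i)"
  define c where "c = dker M (saw M)"
  define K2 where "K2 n = (c n)\<^sup>2 / of_nat (M\<^sup>2)" for n
  define E where "E = line_conv M i (\<lambda>_. 1 / of_nat M :: complex)"
  let ?H = "mult_op M ?m"
  define \<alpha> h where "\<alpha> = nrm M (2 * q) a" and "h = nrm M (2 * q) (?H a)"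
  have K2_sum: "(\<Sum>n\<in>{0..<int M}. cmod (K2 n)) \<le> 1"
    using dker_parseval[OF M norm_saw[OF M]] M
    by (simp add: K2_def c_def norm_divide norm_power sum_divide_distrib[symmetric])
  have K2_mod: "K2 (n mod int M) = K2 n" for n by (simp add: K2_def c_def dker_mod[OF M])
  have nK2: "nrm M p (line_conv M i K2 f) \<le> nrm M p f" if "p \<ge> 1" for p f
    using nrm_line_conv[OF M that, of K2 i f] K2_mod mult_right_mono[OF K2_sum nrm_nonneg[of M p f]] by simp
  have nE: "nrm M p (E f) \<le> nrm M p f" if "p \<ge> 1" for p f
    unfolding E_def using nrm_line_conv[OF M that, of "\<lambda>_. 1 / of_nat M :: complex" i f] M by (simp add: norm_divide)
  have id: "(?H a x)\<^sup>2 = 2 * ?H (\<lambda>x. a x * ?H a x) x + 2 * (a x * line_conv M i K2 a x) + line_conv M i K2 (\<lambda>x. (a x)\<^sup>2) x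
      + (E a x - 1 / of_nat M * a x)\<^sup>2 - (1 / of_nat M) * E (\<lambda>x. (a x)\<^sup>2) x + (1 / of_nat (M\<^sup>2)) * (a x)\<^sup>2" if x: "x \<in> grid M" for x
  proof -
    let ?I = "{0..<int M}"
    let ?\<alpha> = "\<lambda>s. a (upd x i s)"
    have H: "?H b y = (\<Sum>s\<in>?I. c (y $ i - s) * b (upd y i s)) / of_nat M" if "y \<in> grid M" for b y
      using mult_op_line[OF M that, of "saw M" i b] by (simp add: line_conv_def c_def sum_divide_distrib)
    have H1: "of_nat M * ?H a x = (\<Sum>s\<in>?I. c (x $ i - s) * ?\<alpha> s)" using H[OF x] M by simp
    have H2: "(of_nat M)\<^sup>2 * ?H (\<lambda>x. a x * ?H a x) x = (\<Sum>s\<in>?I. c (x $ i - s) * (?\<alpha> s * (\<Sum>l\<in>?I. c (s - l) * ?\<alpha> l)))"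
    proof -
      have "?H a (upd x i s) = (\<Sum>l\<in>?I. c (s - l) * ?\<alpha> l) / of_nat M" if "s \<in> ?I" for s
        using H[OF upd_grid[OF x that]] by simp
      then have "(\<Sum>s\<in>?I. c (x $ i - s) * (?\<alpha> s * ?H a (upd x i s))) = (\<Sum>s\<in>?I. c (x $ i - s) * (?\<alpha> s * (\<Sum>l\<in>?I. c (s - l) * ?\<alpha> l)) / of_nat M)"
        by (intro sum.cong refl) simp
      then have "(\<Sum>s\<in>?I. c (x $ i - s) * (?\<alpha> s * ?H a (upd x i s))) * of_nat M = (\<Sum>s\<in>?I. c (x $ i - s) * (?\<alpha> s * (\<Sum>l\<in>?I. c (s - l) * ?\<alpha> l)))"
        unfolding sum_divide_distrib[symmetric] using M by simp
      then show ?thesis using M by (simp add: H[OF x] power2_eq_square mult.commute)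
    qed
    have dummy: True
    proof -
      show ?thesis ..
    qed
    have E1: "of_nat M * E a x = (\<Sum>s\<in>?I. ?\<alpha> s)" "of_nat M * E (\<lambda>x. (a x)\<^sup>2) x = (\<Sum>s\<in>?I. (?\<alpha> s)\<^sup>2)"
      using M by (simp_all add: E_def line_conv_def sum_divide_distrib[symmetric])
    have K1: "(of_nat M)\<^sup>2 * line_conv M i K2 a x = (\<Sum>s\<in>?I. (c (x $ i - s))\<^sup>2 * ?\<alpha> s)"
      "(of_nat M)\<^sup>2 * line_conv M i K2 (\<lambda>x. (a x)\<^sup>2) x = (\<Sum>s\<in>?I. (c (x $ i - s))\<^sup>2 * (?\<alpha> s)\<^sup>2)"
      using M by (simp_all add: K2_def line_conv_def sum_divide_distrib[symmetric])
    have "(of_nat M * ?H a x)\<^sup>2 = 2 * ((of_nat M)\<^sup>2 * ?H (\<lambda>x. a x * ?H a x) x) + 2 * a x * ((of_nat M)\<^sup>2 * line_conv M i K2 a x)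
      + (of_nat M)\<^sup>2 * line_conv M i K2 (\<lambda>x. (a x)\<^sup>2) x + (of_nat M * E a x - a x)\<^sup>2 - (of_nat M * E (\<lambda>x. (a x)\<^sup>2) x - (a x)\<^sup>2)"
      unfolding H1 H2 E1 K1 using cotlar_identity[OF M grid_coord[OF x, of i], of ?\<alpha>] by (simp add: c_def)
    moreover have "h\<^sup>2 = 2 * A + 2 * (u * B) + D + (F - 1 / N * u)\<^sup>2 - (1 / N) * G + (1 / N\<^sup>2) * u\<^sup>2"
      if N: "N \<noteq> 0" and eq: "(N * h)\<^sup>2 = 2 * (N\<^sup>2 * A) + 2 * u * (N\<^sup>2 * B) + N\<^sup>2 * D + (N * F - u)\<^sup>2 - (N * G - u\<^sup>2)"
      for N h A u B D F G :: complex
    proof -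
      define j where "j = 1 / N"
      have j: "N * j = 1" "1 / N\<^sup>2 = j\<^sup>2" using N by (simp_all add: j_def power_divide)
      have "N\<^sup>2 * h\<^sup>2 = N\<^sup>2 * (2 * A + 2 * (u * B) + D + (F - j * u)\<^sup>2 - j * G + j\<^sup>2 * u\<^sup>2)"
        using eq j(1) by algebra
      then show ?thesis using N by (simp add: j(2) j_def)
    qed
    moreover have "of_nat M \<noteq> (0::complex)" using M by simp
    ultimately show ?thesis unfolding of_nat_power by blast
  qed
  have q0: "q > 0" and q2: "2 * q \<ge> 1" using q by auto
  have M1: "1 / real M \<le> 1" using M by (simp add: field_simps)
  have n1: "nrm M q (\<lambda>x. 2 * ?H (\<lambda>x. a x * ?H a x) x) \<le> 2 * (C * (\<alpha> * h))"
  proof -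
    have "nrm M q (?H (\<lambda>x. a x * ?H a x)) \<le> C * nrm M q (\<lambda>x. a x * ?H a x)" by (rule mult_boundD[OF b])
    also have "\<dots> \<le> C * (\<alpha> * h)" unfolding \<alpha>_def h_def by (intro mult_left_mono nrm_Cauchy_Schwarz q0 C)
    finally show ?thesis using q0 by (simp add: nrm_scale)
  qed
  have n2: "nrm M q (\<lambda>x. 2 * (a x * line_conv M i K2 a x)) \<le> 2 * \<alpha>\<^sup>2"
  proof -
    have "nrm M q (\<lambda>x. a x * line_conv M i K2 a x) \<le> \<alpha> * nrm M (2 * q) (line_conv M i K2 a)"
      unfolding \<alpha>_def by (rule nrm_Cauchy_Schwarz[OF q0])
    also have "\<dots> \<le> \<alpha> * \<alpha>" unfolding \<alpha>_def by (intro mult_left_mono nK2 q2) simp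
    finally show ?thesis using q0 by (simp add: nrm_scale power2_eq_square)
  qed
  have n3: "nrm M q (line_conv M i K2 (\<lambda>x. (a x)\<^sup>2)) \<le> \<alpha>\<^sup>2"
    using nK2[OF q, of "\<lambda>x. (a x)\<^sup>2"] by (simp add: nrm_square[OF q0] \<alpha>_def)
  have na: "nrm M p (\<lambda>x. 1 / of_nat M * f x) \<le> nrm M p f" if "p > 0" for p f
    using nrm_scale[OF that, of M "1 / of_nat M" f] M1 mult_right_mono[OF M1 nrm_nonneg[of M p f]] by (simp add: norm_divide)
  have n4: "nrm M q (\<lambda>x. (E a x - 1 / of_nat M * a x)\<^sup>2) \<le> (2 * \<alpha>)\<^sup>2"
    unfolding nrm_square[OF q0]
  proof (intro power_mono nrm_nonneg)
    show "nrm M (2 * q) (\<lambda>x. E a x - 1 / of_nat M * a x) \<le> 2 * \<alpha>"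
      using nrm_diff[OF q2, of M "E a" "\<lambda>x. 1 / of_nat M * a x"] nE[OF q2, of a] na[of "2 * q" a] q0 by (simp add: \<alpha>_def)
  qed
  have n5: "nrm M q (\<lambda>x. (1 / of_nat M) * E (\<lambda>x. (a x)\<^sup>2) x) \<le> \<alpha>\<^sup>2"
    using na[OF q0, of "E (\<lambda>x. (a x)\<^sup>2)"] nE[OF q, of "\<lambda>x. (a x)\<^sup>2"] by (simp add: nrm_square[OF q0] \<alpha>_def)
  have n6: "nrm M q (\<lambda>x. (1 / of_nat (M\<^sup>2)) * (a x)\<^sup>2) \<le> \<alpha>\<^sup>2"
  proof -
    have "nrm M q (\<lambda>x. (1 / of_nat (M\<^sup>2)) * (a x)\<^sup>2) = nrm M q (\<lambda>x. 1 / of_nat M * (1 / of_nat M * (a x)\<^sup>2))"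
      by (simp add: power2_eq_square)
    also have "\<dots> \<le> nrm M q (\<lambda>x. (a x)\<^sup>2)" using na[OF q0, of "\<lambda>x. 1 / of_nat M * (a x)\<^sup>2"] na[OF q0, of "\<lambda>x. (a x)\<^sup>2"] by linarith
    finally show ?thesis by (simp add: nrm_square[OF q0] \<alpha>_def)
  qed
  have "h\<^sup>2 = nrm M q (\<lambda>x. (?H a x)\<^sup>2)" by (simp add: h_def nrm_square[OF q0])
  also have "\<dots> = nrm M q (\<lambda>x. 2 * ?H (\<lambda>x. a x * ?H a x) x + 2 * (a x * line_conv M i K2 a x) + line_conv M i K2 (\<lambda>x. (a x)\<^sup>2) x
      + (E a x - 1 / of_nat M * a x)\<^sup>2 - (1 / of_nat M) * E (\<lambda>x. (a x)\<^sup>2) x + (1 / of_nat (M\<^sup>2)) * (a x)\<^sup>2)"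
    by (intro nrm_cong) (simp only: id)
  also have "\<dots> \<le> nrm M q (\<lambda>x. 2 * ?H (\<lambda>x. a x * ?H a x) x) + nrm M q (\<lambda>x. 2 * (a x * line_conv M i K2 a x))
     + nrm M q (line_conv M i K2 (\<lambda>x. (a x)\<^sup>2)) + nrm M q (\<lambda>x. (E a x - 1 / of_nat M * a x)\<^sup>2)
     + nrm M q (\<lambda>x. (1 / of_nat M) * E (\<lambda>x. (a x)\<^sup>2) x) + nrm M q (\<lambda>x. (1 / of_nat (M\<^sup>2)) * (a x)\<^sup>2)"
    by (intro order_trans[OF nrm_triangle[OF q]] order_trans[OF nrm_diff[OF q]] add_mono order_refl)
  also have "\<dots> \<le> 2 * (C * (\<alpha> * h)) + 2 * \<alpha>\<^sup>2 + \<alpha>\<^sup>2 + (2 * \<alpha>)\<^sup>2 + \<alpha>\<^sup>2 + \<alpha>\<^sup>2"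
    by (intro add_mono n1 n2 n3 n4 n5 n6)
  finally have hh: "h * h \<le> 2 * C * \<alpha> * h + 9 * (\<alpha> * \<alpha>)" by (simp add: power2_eq_square algebra_simps)
  have a0: "\<alpha> \<ge> 0" "h \<ge> 0" by (simp_all add: \<alpha>_def h_def)
  show "h \<le> (2 * C + 8) * \<alpha>"
  proof (rule ccontr)
    assume "\<not> h \<le> (2 * C + 8) * \<alpha>"
    then have gt: "h > (2 * C + 8) * \<alpha>" by simp
    have "(2 * C + 8) * \<alpha> = 2 * (C * \<alpha>) + 8 * \<alpha>" "C * \<alpha> \<ge> 0" using C a0 by (simp_all add: algebra_simps)
    then have ha: "h > 8 * \<alpha>" using gt by linarith
    then have h0: "h > 0" using a0 by linarith
    have "h * h > (2 * C + 8) * \<alpha> * h" using gt h0 by simp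
    moreover have "8 * \<alpha> * h \<ge> 64 * (\<alpha> * \<alpha>)"
      using mult_left_mono[of "8 * \<alpha>" h "8 * \<alpha>"] ha a0 by simp
    moreover have "64 * (\<alpha> * \<alpha>) \<ge> 9 * (\<alpha> * \<alpha>)" using a0 by (intro mult_right_mono) auto
    ultimately show False using hh by (simp add: algebra_simps)
  qed
qed

lemma mult_bound_saw:
  assumes M: "M > 0"
  shows "mult_bound M (real (2 * 2 ^ k)) (cotlar k) (\<lambda>l :: int ^ 'n::finite. saw M (l $ i))"
proof (induction k)
  case 0
  then show ?case using norm_saw[OF M] by (auto intro!: mult_bound_2[OF M])
next
  case (Suc k)
  have "real (2 * 2 ^ k) \<ge> 1" using one_le_power[of "2::real" "Suc k"] by simp
  from cotlar_step[OF M this _ Suc] cotlar_ge_1[of k] show ?case by (simp add: mult_ac)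
qed

definition arcm :: "nat \<Rightarrow> 'n \<Rightarrow> int \<Rightarrow> int \<Rightarrow> int ^ 'n \<Rightarrow> complex" where
  "arcm M i u L k = (if (k $ i - u) mod int M < L then 1 else 0)"

lemma periodic_coord: "(\<And>n. \<mu> (n mod int M) = \<mu> n) \<Longrightarrow> periodic M (\<lambda>k. \<mu> (k $ i))"
  unfolding periodic_def by metis

lemma mult_bound_arcm:
  assumes M: "M > 0" and p: "p = real (2 * 2 ^ q)"
  shows "mult_bound M p (cotlar q + 2) (arcm M i u L :: int ^ 'n::finite \<Rightarrow> complex)"
proof -
  have p1: "p \<ge> 1" using one_le_power[of "2::real" "Suc q"] by (simp add: p)
  define \<delta> where "\<delta> k = (if k mod int M = 0 then 1 else 0 :: complex)" for k
  have d: "mult_bound M p 1 (\<lambda>k :: int ^ 'n. \<delta> (k $ i))"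
    unfolding mult_bound_def
  proof
    fix a :: "int ^ 'n \<Rightarrow> complex"
    have ker: "dker M \<delta> n = 1" for n
    proof -
      have "dker M \<delta> n = (\<Sum>k\<in>{0..<int M}. if k = 0 then 1 else 0)"
        unfolding dker_def by (intro sum.cong) (auto simp: \<delta>_def)
      then show ?thesis using M by simp
    qed
    have "nrm M p (mult_op M (\<lambda>k. \<delta> (k $ i)) a) = nrm M p (line_conv M i (\<lambda>n. dker M \<delta> n / of_nat M) a)"
      by (intro nrm_cong) (simp add: mult_op_line[OF M])
    also have "\<dots> \<le> (\<Sum>n\<in>{0..<int M}. cmod (dker M \<delta> n / of_nat M)) * nrm M p a"
      by (intro nrm_line_conv M p1) (simp add: ker)
    also have "\<dots> = 1 * nrm M p a" using M by (simp add: ker norm_divide)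
    finally show "nrm M p (mult_op M (\<lambda>k. \<delta> (k $ i)) a) \<le> 1 * nrm M p a" .
  qed
  have s: "mult_bound M p (cotlar q) (\<lambda>k :: int ^ 'n. saw M (k $ i))" unfolding p by (rule mult_bound_saw[OF M])
  have ps: "periodic M (\<lambda>k :: int ^ 'n. saw M (k $ i))" by (rule periodic_coord) (simp add: saw_def)
  have pd: "periodic M (\<lambda>k :: int ^ 'n. \<delta> (k $ i))" by (rule periodic_coord) (simp add: \<delta>_def)
  have c0: "cotlar q \<ge> 1" by (rule cotlar_ge_1)
  have arc0: "mult_bound M p (cotlar q + 2) (arcm M i 0 L :: int ^ 'n \<Rightarrow> complex)"
  proof -
    consider "L \<le> 0" | "L \<ge> int M" | "0 < L" "L < int M" by linarith
    then show ?thesis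
    proof cases
      case 1
      have "0 \<le> (k $ i) mod int M" for k :: "int ^ 'n" using M by simp
      then have "\<not> (k $ i) mod int M < L" for k :: "int ^ 'n" using 1 by (meson not_less order_trans)
      then have "(arcm M i 0 L :: int ^ 'n \<Rightarrow> complex) = (\<lambda>k. 0)" by (simp add: arcm_def fun_eq_iff)
      then show ?thesis using c0 by (auto intro: mult_bound_mono[OF mult_bound_zero])
    next
      case 2
      have "(k $ i) mod int M < int M" for k :: "int ^ 'n" using M by simp
      then have "(k $ i) mod int M < L" for k :: "int ^ 'n" using 2 by (meson less_le_trans)
      then have "(arcm M i 0 L :: int ^ 'n \<Rightarrow> complex) = (\<lambda>k. 1)" by (simp add: arcm_def fun_eq_iff)
      then show ?thesis using mult_bound_mono[OF mult_bound_const[OF M, of p 1], of "cotlar q + 2"] c0 p1 by simp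
    next
      case 3
      have "mult_bound M p (cmod (1/2) * (((cotlar q + cotlar q) + cmod (of_real (2 * real_of_int L / real M))) + (1 + 1)))
        (\<lambda>k :: int ^ 'n. (1/2) * (((saw M (k $ i) - saw M ((k - axis i L) $ i)) + of_real (2 * real_of_int L / real M)) + (\<delta> (k $ i) - \<delta> ((k - axis i L) $ i))))"
        using p1
        by (intro mult_bound_scale mult_bound_add mult_bound_diff s d mult_bound_shift[OF M ps s, unfolded mult_bound_def[symmetric]] mult_bound_shift[OF M pd d] mult_bound_const M) auto
      moreover have "cmod (1/2) * (((cotlar q + cotlar q) + cmod (of_real (2 * real_of_int L / real M))) + (1 + 1)) \<le> cotlar q + 2"
      proof -
        have "2 * real_of_int L / real M \<le> 2" using 3 M by (simp add: field_simps)
        moreover have "2 * real_of_int L / real M \<ge> 0" using 3 M by simp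
        ultimately show ?thesis unfolding norm_of_real by simp
      qed
      ultimately have "mult_bound M p (cotlar q + 2)
        (\<lambda>k :: int ^ 'n. (1/2) * (((saw M (k $ i) - saw M ((k - axis i L) $ i)) + of_real (2 * real_of_int L / real M)) + (\<delta> (k $ i) - \<delta> ((k - axis i L) $ i))))"
        by (rule mult_bound_mono)
      moreover have "(1/2) * (((saw M (k $ i) - saw M ((k - axis i L) $ i)) + of_real (2 * real_of_int L / real M)) + (\<delta> (k $ i) - \<delta> ((k - axis i L) $ i)))
         = arcm M i 0 L k" if "k \<in> grid M" for k :: "int ^ 'n"
      proof -
        define \<kappa> where "\<kappa> = k $ i"
        have \<kappa>: "0 \<le> \<kappa>" "\<kappa> < int M" using that by (auto simp: \<kappa>_def grid_def)
        have m1: "\<kappa> mod int M = \<kappa>" using \<kappa> by simp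
        have m2: "(\<kappa> - L) mod int M = (if \<kappa> < L then \<kappa> - L + int M else \<kappa> - L)"
        proof (cases "\<kappa> < L")
          case True
          have "(\<kappa> - L) mod int M = (\<kappa> - L + int M) mod int M" by simp
          also have "\<dots> = \<kappa> - L + int M" using True \<kappa> 3 by (intro mod_pos_pos_trivial) auto
          finally show ?thesis using True by simp
        next
          case False then show ?thesis using \<kappa> 3 by simp
        qed
        have "(k - axis i L) $ i = \<kappa> - L" by (simp add: \<kappa>_def)
        then show ?thesis
          unfolding arcm_def saw_def \<delta>_def \<kappa>_def[symmetric] diff_0_right m1 \<open>(k - axis i L) $ i = \<kappa> - L\<close> m2
          using M \<kappa> 3 by (auto simp: complex_eq_iff field_simps)
      qed
      ultimately show ?thesis by (rule mult_bound_cong)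
    qed
  qed
  have per: "periodic M (arcm M i 0 L :: int ^ 'n \<Rightarrow> complex)"
    unfolding arcm_def diff_0_right by (rule periodic_coord) simp
  have "arcm M i u L = (\<lambda>k. arcm M i 0 L (k - axis i u))" by (simp add: arcm_def fun_eq_iff)
  then show ?thesis using mult_bound_shift[OF M per arc0, of "axis i u"] by simp
qed

section \<open>Transforms of products of Fejer kernels\<close>

definition bua :: "nat \<Rightarrow> real" where "bua m = real (m + 4) * real (m + 3)"

definition bub :: "nat \<Rightarrow> real" where "bub m = (4 * real (m + 2)) ^ (m + 2)"

text \<open>Burkholder's function for the exponent \<open>m + 4\<close>. Its concavity along directions of slope at most one is what bounds martingale transforms.\<close>

definition burk :: "nat \<Rightarrow> real \<Rightarrow> real \<Rightarrow> real" where
  "burk m x y = y ^ (m + 4) - bua m * (x\<^sup>2 * y ^ (m + 2)) - bub m * x ^ (m + 4)"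

lemma burk_second:
  fixes X Y c :: real
  assumes "even m" "\<bar>c\<bar> \<le> 1"
  shows "bua m * (c\<^sup>2 * Y ^ (m + 2)) - bua m * (2 * Y ^ (m + 2) + 4 * real (m + 2) * c * X * Y ^ (m + 1) + real (m + 2) * real (m + 1) * c\<^sup>2 * X\<^sup>2 * Y ^ m)
     - bua m * (bub m * X ^ (m + 2)) \<le> 0"
proof -
  define k where "k = 4 * real (m + 2)"
  have k: "k > 0" by (simp add: k_def)
  have ev: "Y ^ (m + 2) = \<bar>Y\<bar> ^ (m + 2)" "X ^ (m + 2) = \<bar>X\<bar> ^ (m + 2)" "Y ^ m \<ge> 0"
    using assms(1) by (simp_all add: power_even_abs zero_le_even_power)
  have c2: "c\<^sup>2 \<le> 1" using assms(2) by (simp add: abs_square_le_1)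
  have 1: "c\<^sup>2 * Y ^ (m + 2) \<le> \<bar>Y\<bar> ^ (m + 2)"
    unfolding ev using c2 by (intro mult_left_le_one_le) auto
  have 2: "- (4 * real (m + 2) * c * X * Y ^ (m + 1)) \<le> k * \<bar>X\<bar> * \<bar>Y\<bar> ^ (m + 1)"
  proof -
    have "- (4 * real (m + 2) * c * X * Y ^ (m + 1)) \<le> \<bar>4 * real (m + 2) * c * X * Y ^ (m + 1)\<bar>" by simp
    also have "\<dots> = \<bar>c\<bar> * (k * \<bar>X\<bar> * \<bar>Y\<bar> ^ (m + 1))" by (simp add: abs_mult k_def power_abs)
    also have "\<dots> \<le> k * \<bar>X\<bar> * \<bar>Y\<bar> ^ (m + 1)" using assms(2) k by (intro mult_left_le_one_le) auto
    finally show ?thesis .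
  qed
  have 3: "real (m + 2) * real (m + 1) * c\<^sup>2 * X\<^sup>2 * Y ^ m \<ge> 0" using ev by simp
  have 4: "k * \<bar>X\<bar> * \<bar>Y\<bar> ^ (m + 1) \<le> \<bar>Y\<bar> ^ (m + 2) + bub m * \<bar>X\<bar> ^ (m + 2)"
  proof (cases "k * \<bar>X\<bar> \<le> \<bar>Y\<bar>")
    case True
    then have "k * \<bar>X\<bar> * \<bar>Y\<bar> ^ (m + 1) \<le> \<bar>Y\<bar> * \<bar>Y\<bar> ^ (m + 1)" by (intro mult_right_mono) auto
    also have "\<dots> = \<bar>Y\<bar> ^ (m + 2)" by simp
    also have "\<dots> \<le> \<bar>Y\<bar> ^ (m + 2) + bub m * \<bar>X\<bar> ^ (m + 2)" by (simp add: bub_def)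
    finally show ?thesis .
  next
    case False
    have "k * \<bar>X\<bar> * \<bar>Y\<bar> ^ (m + 1) \<le> k * \<bar>X\<bar> * (k * \<bar>X\<bar>) ^ (m + 1)"
      using False k by (intro mult_left_mono power_mono) auto
    also have "\<dots> = bub m * \<bar>X\<bar> ^ (m + 2)" unfolding bub_def k_def[symmetric] by (simp add: power_mult_distrib)
    also have "\<dots> \<le> \<bar>Y\<bar> ^ (m + 2) + bub m * \<bar>X\<bar> ^ (m + 2)" by (simp only: le_add_same_cancel2 zero_le_power abs_ge_zero)
    finally show ?thesis .
  qed
  have "c\<^sup>2 * Y ^ (m + 2) - (2 * Y ^ (m + 2) + 4 * real (m + 2) * c * X * Y ^ (m + 1) + real (m + 2) * real (m + 1) * c\<^sup>2 * X\<^sup>2 * Y ^ m) - bub m * X ^ (m + 2) \<le> 0"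
  proof -
    have *: "u - (2 * A + v + t) - B \<le> 0" if "u \<le> A" "- v \<le> s" "t \<ge> 0" "s \<le> A + B" for u A v t B s :: real
      using that by linarith
    show ?thesis by (rule *[OF 1[folded ev(1)] 2 3 4[folded ev(1,2)]])
  qed
  moreover have "bua m \<ge> 0" by (simp add: bua_def)
  ultimately have "bua m * (c\<^sup>2 * Y ^ (m + 2) - (2 * Y ^ (m + 2) + 4 * real (m + 2) * c * X * Y ^ (m + 1) + real (m + 2) * real (m + 1) * c\<^sup>2 * X\<^sup>2 * Y ^ m) - bub m * X ^ (m + 2)) \<le> 0"
    by (rule mult_nonneg_nonpos[rotated])
  then show ?thesis by (simp only: right_diff_distrib)
qed

lemma burk_concave:
  fixes q u :: "'s \<Rightarrow> real"
  assumes m: "even m" and c: "\<bar>c\<bar> \<le> 1" and S: "finite S" "\<And>s. s \<in> S \<Longrightarrow> 0 \<le> q s" "(\<Sum>s\<in>S. q s) = 1"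
  defines "v \<equiv> (\<Sum>s\<in>S. q s * u s)"
  shows "(\<Sum>s\<in>S. q s * burk m (u s) (y + c * (u s - v))) \<le> burk m v y"
proof -
  define \<phi> where "\<phi> t = - burk m (v + t) (y + c * t)" for t
  define \<phi>1 where "\<phi>1 t = - (real (m + 4) * c * (y + c * t) ^ (m + 3) - bua m * (2 * (v + t) * (y + c * t) ^ (m + 2) + real (m + 2) * c * (v + t)\<^sup>2 * (y + c * t) ^ (m + 1)) - bub m * real (m + 4) * (v + t) ^ (m + 3))" for t
  define \<phi>2 where "\<phi>2 t = - (bua m * (c\<^sup>2 * (y + c * t) ^ (m + 2)) - bua m * (2 * (y + c * t) ^ (m + 2) + 4 * real (m + 2) * c * (v + t) * (y + c * t) ^ (m + 1) + real (m + 2) * real (m + 1) * c\<^sup>2 * (v + t)\<^sup>2 * (y + c * t) ^ m)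
     - bua m * (bub m * (v + t) ^ (m + 2)))" for t
  have lin: "((\<lambda>t. v + t) has_real_derivative 1) (at t)" "((\<lambda>t. y + c * t) has_real_derivative c) (at t)" for t
    by (auto intro!: derivative_eq_intros)
  have pX: "((\<lambda>t. (v + t) ^ k) has_real_derivative real k * (v + t) ^ n) (at t)"
    and pY: "((\<lambda>t. (y + c * t) ^ k) has_real_derivative real k * c * (y + c * t) ^ n) (at t)" if "k = Suc n" for k n t
    using DERIV_power_Suc[OF lin(1), of n t] DERIV_power_Suc[OF lin(2), of n t] that by (simp_all add: mult_ac)
  have "convex_on UNIV \<phi>"
  proof (rule f''_ge0_imp_convex)
    fix t :: real
    define X Y where "X = v + t" and "Y = y + c * t"
    have k: "m + 4 = Suc (m + 3)" "m + 3 = Suc (m + 2)" "m + 2 = Suc (m + 1)" "m + 1 = Suc m" "2 = Suc 1" by simp_all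
    note D1 = DERIV_minus[OF DERIV_diff[OF DERIV_diff[OF pY[OF k(1)] DERIV_cmult[OF DERIV_mult[OF pX[OF k(5)] pY[OF k(3)]], of "bua m"]] DERIV_cmult[OF pX[OF k(1)], of "bub m"]], of t]
    show "(\<phi> has_real_derivative \<phi>1 t) (at t)"
      unfolding \<phi>_def[abs_def] burk_def
      by (rule DERIV_cong[OF D1]) (simp add: \<phi>1_def X_def[symmetric] Y_def[symmetric] algebra_simps)
    note D2 = DERIV_minus[OF DERIV_diff[OF DERIV_diff[OF DERIV_cmult[OF pY[OF k(2)], of "real (m + 4) * c"]
         DERIV_cmult[OF DERIV_add[OF DERIV_mult[OF DERIV_cmult[OF lin(1), of 2] pY[OF k(3)]]
            DERIV_mult[OF DERIV_cmult[OF pX[OF k(5)], of "real (m + 2) * c"] pY[OF k(4)]]], of "bua m"]]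
         DERIV_cmult[OF pX[OF k(2)], of "bub m * real (m + 4)"]], of t]
    show "(\<phi>1 has_real_derivative \<phi>2 t) (at t)"
      unfolding \<phi>1_def[abs_def]
      by (rule DERIV_cong[OF D2]) (simp add: \<phi>2_def bua_def X_def[symmetric] Y_def[symmetric] power2_eq_square algebra_simps)
    show "\<phi>2 t \<ge> 0" using burk_second[OF m c] unfolding \<phi>2_def by simp
  qed simp
  then have "\<phi> (\<Sum>s\<in>S. q s *\<^sub>R (u s - v)) \<le> (\<Sum>s\<in>S. q s * \<phi> (u s - v))"
    using S by (intro convex_on_sum) auto
  moreover have "(\<Sum>s\<in>S. q s *\<^sub>R (u s - v)) = 0"
    using S(3) by (simp add: right_diff_distrib sum_subtractf sum_distrib_right[symmetric] v_def)
  ultimately show ?thesis by (simp add: \<phi>_def sum_negf)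
qed

definition buC :: "nat \<Rightarrow> real" where
  "buC m = 2 * (bua m * (2 * bua m) ^ (m div 2 + 1) + bub m)"

lemma burk_lower:
  assumes m: "even m"
  shows "y ^ (m + 4) \<le> 2 * burk m x y + buC m * x ^ (m + 4)"
proof -
  obtain l where l: "m = 2 * l" using m by blast
  have a: "bua m \<ge> 0" by (simp add: bua_def)
  have eq: "y ^ (m + 2) = (y\<^sup>2) ^ (l + 1)" "y ^ (m + 4) = (y\<^sup>2) ^ (l + 2)" "x ^ (m + 4) = (x\<^sup>2) ^ (l + 2)"
  proof -
    have "m + 2 = 2 * (l + 1)" "m + 4 = 2 * (l + 2)" using l by auto
    then show "y ^ (m + 2) = (y\<^sup>2) ^ (l + 1)" "y ^ (m + 4) = (y\<^sup>2) ^ (l + 2)" "x ^ (m + 4) = (x\<^sup>2) ^ (l + 2)"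
      by (simp_all only: power_mult)
  qed
  have "2 * (bua m * (x\<^sup>2 * y ^ (m + 2))) \<le> y ^ (m + 4) + 2 * (bua m * (2 * bua m) ^ (l + 1)) * x ^ (m + 4)"
  proof (cases "2 * bua m * x\<^sup>2 \<le> y\<^sup>2")
    case True
    then have "2 * bua m * x\<^sup>2 * y ^ (m + 2) \<le> y\<^sup>2 * y ^ (m + 2)" by (intro mult_right_mono) (simp_all only: eq zero_le_power zero_le_power2)
    moreover have "y\<^sup>2 * y ^ (m + 2) = y ^ (m + 4)" proof -
      have "2 + (m + 2) = m + 4" by simp
      then show ?thesis by (simp only: power_add[symmetric])
    qed
    moreover have "2 * (bua m * (2 * bua m) ^ (l + 1)) * x ^ (m + 4) \<ge> 0" using a by (simp add: eq)
    ultimately show ?thesis unfolding mult.assoc by linarith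
  next
    case False
    have "2 * (bua m * (x\<^sup>2 * y ^ (m + 2))) \<le> 2 * (bua m * (x\<^sup>2 * (2 * bua m * x\<^sup>2) ^ (l + 1)))"
      unfolding eq using False a by (intro mult_left_mono power_mono) auto
    also have "\<dots> = 2 * (bua m * (2 * bua m) ^ (l + 1)) * x ^ (m + 4)"
      unfolding eq by (simp add: power_mult_distrib)
    finally show ?thesis using eq(2) by (simp add: zero_le_power add_increasing)
  qed
  then show ?thesis by (simp add: burk_def buC_def l algebra_simps)
qed

lemma martingale_transform:
  fixes P :: "nat \<Rightarrow> 'x \<Rightarrow> 'x \<Rightarrow> real" and F G :: "nat \<Rightarrow> 'x \<Rightarrow> real"
  assumes X: "finite X" and P0: "\<And>j x s. x \<in> X \<Longrightarrow> s \<in> X \<Longrightarrow> 0 \<le> P j x s"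
    and P1: "\<And>j x. x \<in> X \<Longrightarrow> (\<Sum>s\<in>X. P j x s) = 1" and P2: "\<And>j s. s \<in> X \<Longrightarrow> (\<Sum>x\<in>X. P j x s) = 1"
    and F: "\<And>j x. x \<in> X \<Longrightarrow> F (Suc j) x = (\<Sum>s\<in>X. P j x s * F j s)"
    and G: "\<And>j x. x \<in> X \<Longrightarrow> G (Suc j) x = (\<Sum>s\<in>X. P j x s * G j s)"
    and c: "\<And>j. \<bar>c j\<bar> \<le> 1" and m: "even m"
    and w: "\<And>x. x \<in> X \<Longrightarrow> G 0 x = w x ^ (m + 3)"
  shows "real (m + 4) * (\<Sum>j<N. c j * ((\<Sum>x\<in>X. F j x * G j x) - (\<Sum>x\<in>X. F (Suc j) x * G (Suc j) x)))
    \<le> real (m + 3) * (\<Sum>x\<in>X. w x ^ (m + 4)) + buC m * (\<Sum>x\<in>X. F 0 x ^ (m + 4))"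
proof -
  define S where "S = rec_nat (\<lambda>x. - real (m + 3) * w x ^ (m + 4))
    (\<lambda>j Sj x. \<Sum>s\<in>X. P j x s * (real (m + 4) * G j s * (c j * (F j s - F (Suc j) x)) + Sj s))"
  define R where "R = rec_nat (\<lambda>x. buC m * F 0 x ^ (m + 4)) (\<lambda>j Rj x. \<Sum>s\<in>X. P j x s * Rj s)"
  have S0: "S 0 x = - real (m + 3) * w x ^ (m + 4)"
    and SS: "S (Suc j) x = (\<Sum>s\<in>X. P j x s * (real (m + 4) * G j s * (c j * (F j s - F (Suc j) x)) + S j s))" for j x
    by (simp_all add: S_def)
  have R0: "R 0 x = buC m * F 0 x ^ (m + 4)" and RS: "R (Suc j) x = (\<Sum>s\<in>X. P j x s * R j s)" for j x
    by (simp_all add: R_def)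
  have young: "real (m + 4) * a ^ (m + 3) * y - real (m + 3) * a ^ (m + 4) \<le> y ^ (m + 4)" for a y :: real
  proof -
    have "convex_on UNIV (\<lambda>x::real. x ^ (m + 4))" using m by (intro convex_power_even) simp
    moreover have "((\<lambda>x::real. x ^ (m + 4)) has_real_derivative real (m + 4) * a ^ (m + 3)) (at a)"
      using DERIV_pow[of "m + 4" a UNIV] by (simp add: numeral_eq_Suc)
    ultimately have "y ^ (m + 4) - a ^ (m + 4) \<ge> real (m + 4) * a ^ (m + 3) * (y - a)"
      by (intro convex_on_imp_above_tangent) auto
    moreover have "a ^ (m + 4) = a ^ (m + 3) * a" by (simp add: numeral_eq_Suc)
    ultimately show ?thesis by (simp add: algebra_simps)
  qed
  have main: "real (m + 4) * G j x * y + S j x \<le> 2 * burk m (F j x) y + R j x" if "x \<in> X" for j x y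
    using that
  proof (induction j arbitrary: x y)
    case 0
    have "real (m + 4) * G 0 x * y + S 0 x \<le> y ^ (m + 4)" using young[of "w x" y] unfolding w[OF 0] S0 mult_minus_left by linarith
    also have "\<dots> \<le> 2 * burk m (F 0 x) y + R 0 x" using burk_lower[OF m] R0 by simp
    finally show ?case .
  next
    case (Suc j)
    let ?y = "\<lambda>s. y + c j * (F j s - F (Suc j) x)"
    have "real (m + 4) * G (Suc j) x * y + S (Suc j) x = (\<Sum>s\<in>X. P j x s * (real (m + 4) * G j s * ?y s + S j s))"
      unfolding G[OF Suc.prems] SS by (simp add: sum_distrib_left sum_distrib_right sum.distrib[symmetric] algebra_simps)
    also have "\<dots> \<le> (\<Sum>s\<in>X. P j x s * (2 * burk m (F j s) (?y s) + R j s))"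
      using Suc P0 by (intro sum_mono mult_left_mono) auto
    also have "\<dots> = 2 * (\<Sum>s\<in>X. P j x s * burk m (F j s) (?y s)) + R (Suc j) x"
      by (simp add: RS sum.distrib sum_distrib_left algebra_simps)
    also have "\<dots> \<le> 2 * burk m (F (Suc j) x) y + R (Suc j) x"
      unfolding F[OF Suc.prems] using P0 P1 Suc.prems c by (intro add_right_mono mult_left_mono burk_concave X m) auto
    finally show ?case .
  qed
  have sumS: "(\<Sum>x\<in>X. S N x) = real (m + 4) * (\<Sum>j<N. c j * ((\<Sum>x\<in>X. F j x * G j x) - (\<Sum>x\<in>X. F (Suc j) x * G (Suc j) x))) + (\<Sum>x\<in>X. S 0 x)" for N
  proof (induction N)
    case (Suc j)
    have "(\<Sum>x\<in>X. S (Suc j) x) = (\<Sum>x\<in>X. \<Sum>s\<in>X. P j x s * (real (m + 4) * c j * (F j s * G j s))) - (\<Sum>x\<in>X. \<Sum>s\<in>X. real (m + 4) * c j * (F (Suc j) x * (P j x s * G j s))) + (\<Sum>x\<in>X. \<Sum>s\<in>X. P j x s * S j s)"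
      by (simp add: SS sum.distrib[symmetric] sum_subtractf[symmetric] algebra_simps)
    also have "(\<Sum>x\<in>X. \<Sum>s\<in>X. P j x s * (real (m + 4) * c j * (F j s * G j s))) = (\<Sum>s\<in>X. real (m + 4) * c j * (F j s * G j s))"
      by (subst sum.swap) (simp add: sum_distrib_right[symmetric] P2)
    also have "(\<Sum>x\<in>X. \<Sum>s\<in>X. real (m + 4) * c j * (F (Suc j) x * (P j x s * G j s))) = (\<Sum>x\<in>X. real (m + 4) * c j * (F (Suc j) x * G (Suc j) x))"
      by (intro sum.cong refl) (simp add: G sum_distrib_left)
    also have "(\<Sum>x\<in>X. \<Sum>s\<in>X. P j x s * S j s) = (\<Sum>x\<in>X. S j x)"
      by (subst sum.swap) (simp add: sum_distrib_right[symmetric] P2)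
    finally show ?case using Suc by (simp add: sum_distrib_left algebra_simps)
  qed simp
  have sumR: "(\<Sum>x\<in>X. R N x) = (\<Sum>x\<in>X. R 0 x)" for N
  proof (induction N)
    case (Suc j)
    have "(\<Sum>x\<in>X. R (Suc j) x) = (\<Sum>x\<in>X. R j x)"
      unfolding RS by (subst sum.swap) (simp add: sum_distrib_right[symmetric] P2)
    then show ?case using Suc by simp
  qed simp
  have "(\<Sum>x\<in>X. S N x) \<le> (\<Sum>x\<in>X. R N x)"
  proof (rule sum_mono)
    fix x assume x: "x \<in> X"
    have "burk m (F N x) 0 \<le> 0" using m by (simp add: burk_def bub_def zero_le_even_power power_0_left)
    then show "S N x \<le> R N x" using main[OF x, of N 0] by simp
  qed
  then show ?thesis 
    unfolding sumS[of N] sumR[of N] S0 R0 mult_minus_left sum_negf sum_distrib_left[symmetric] by linarith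
qed

definition tent :: "nat \<Rightarrow> int \<Rightarrow> int \<Rightarrow> real" where
  "tent M w k = max 0 (1 - of_int (min (k mod int M) (int M - k mod int M)) / of_int w)"

lemma tent_0: "w > 0 \<Longrightarrow> M > 0 \<Longrightarrow> tent M w 0 = 1"
  by (simp add: tent_def)

lemma sum_int_shift:
  fixes F :: "int \<Rightarrow> 'b::comm_monoid_add"
  assumes "M > 0" "\<And>n. F (n mod int M) = F n"
  shows "(\<Sum>s\<in>{0..<int M}. F (s + v)) = (\<Sum>s\<in>{0..<int M}. F s)"
proof -
  have bij: "bij_betw (\<lambda>s. (s + v) mod int M) {0..<int M} {0..<int M}"
    using assms(1) by (intro bij_betwI[where g = "\<lambda>s. (s - v) mod int M"]) (auto simp: mod_simps)
  have "(\<Sum>s\<in>{0..<int M}. F (s + v)) = (\<Sum>s\<in>{0..<int M}. F ((s + v) mod int M))"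
    by (simp add: assms(2))
  also have "\<dots> = (\<Sum>s\<in>{0..<int M}. F s)" by (rule sum.reindex_bij_betw[OF bij])
  finally show ?thesis .
qed

lemma dker_tent:
  assumes M: "M > 0" and w: "w > 0" "2 * w \<le> int M"
  shows "dker M (\<lambda>k. of_real (tent M w k)) n = of_real ((cmod (\<Sum>a\<in>{0..<w}. ec M (a * n)))\<^sup>2 / of_int w)"
proof -
  let ?I = "{0..<int M}"
  have shift: "(\<Sum>a\<in>{0..<w}. ec M ((a - b) * n)) = (\<Sum>k\<in>?I. if (k + b) mod int M < w then ec M (k * n) else 0)" for b
  proof -
    define F where "F k = (if k mod int M < w then ec M ((k - b) * n) else 0)" for k
    have F_mod: "F (k mod int M) = F k" for k
    proof -
      have "int M dvd (k mod int M - b) * n - (k - b) * n"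
        by (auto simp: left_diff_distrib[symmetric] mod_eq_dvd_iff[symmetric] intro!: dvd_mult2)
      then have "ec M ((k mod int M - b) * n) = ec M ((k - b) * n)" by (rule ec_cong[OF M])
      then show ?thesis by (simp add: F_def)
    qed
    have "(\<Sum>k\<in>?I. if (k + b) mod int M < w then ec M (k * n) else 0) = (\<Sum>k\<in>?I. F (k + b))"
      by (intro sum.cong refl) (simp add: F_def)
    also have "\<dots> = (\<Sum>k\<in>?I. F k)" by (rule sum_int_shift[where F = F, OF M F_mod])
    also have "\<dots> = (\<Sum>k\<in>{0..<w}. F k)"
      using w by (intro sum.mono_neutral_right) (auto simp: F_def)
    also have "\<dots> = (\<Sum>a\<in>{0..<w}. ec M ((a - b) * n))"
      using w by (intro sum.cong) (auto simp: F_def)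
    finally show ?thesis by simp
  qed
  have count: "(\<Sum>b\<in>{0..<w}. if (k + b) mod int M < w then 1 else 0 :: complex) = of_int w * of_real (tent M w k)" if k: "k \<in> ?I" for k
  proof -
    have "{b \<in> {0..<w}. (k + b) mod int M < w} = {0..<w - k} \<union> {int M - k..<w}"
    proof -
      have "(k + b) mod int M < w \<longleftrightarrow> k + b < w \<or> int M \<le> k + b" if b: "b \<in> {0..<w}" for b
      proof (cases "k + b < int M")
        case True then show ?thesis using k b by auto
      next
        case False
        have "(k + b) mod int M = (k + b - int M) mod int M" by simp
        also have "\<dots> = k + b - int M" using False k b w by (intro mod_pos_pos_trivial) auto
        finally show ?thesis using False k b by auto
      qed
      then show ?thesis using k w by (auto simp: set_eq_iff)
    qed
    moreover have "{0..<w - k} \<inter> {int M - k..<w} = {}" using w by auto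
    ultimately have "card {b \<in> {0..<w}. (k + b) mod int M < w} = nat (w - k) + nat (w - (int M - k))"
      by (simp add: card_Un_disjoint)
    moreover have "(\<Sum>b\<in>{0..<w}. if (k + b) mod int M < w then 1 else 0 :: complex) = of_nat (card {b \<in> {0..<w}. (k + b) mod int M < w})"
      by (simp add: sum.inter_filter[symmetric])
    moreover have "of_nat (nat (w - k) + nat (w - (int M - k))) = complex_of_real (of_int w * tent M w k)"
    proof -
      have "real (nat (w - k) + nat (w - (int M - k))) = of_int w * tent M w k"
        using k w by (auto simp: tent_def max_def min_def field_simps)
      then show ?thesis by (metis of_real_of_nat_eq)
    qed
    ultimately show ?thesis by simp
  qed
  have "of_real ((cmod (\<Sum>a\<in>{0..<w}. ec M (a * n)))\<^sup>2) = (\<Sum>b\<in>{0..<w}. \<Sum>a\<in>{0..<w}. ec M ((a - b) * n))"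
  proof -
    have "ec M ((a - b) * n) = ec M (a * n) * cnj (ec M (b * n))" for a b
      unfolding ec_minus[symmetric] ec_add[symmetric] by (simp add: algebra_simps)
    then have "of_real ((cmod (\<Sum>a\<in>{0..<w}. ec M (a * n)))\<^sup>2) = (\<Sum>a\<in>{0..<w}. \<Sum>b\<in>{0..<w}. ec M ((a - b) * n))"
      unfolding complex_norm_square by (simp add: cnj_sum sum_product)
    then show ?thesis by (subst sum.swap)
  qed
  also have "\<dots> = (\<Sum>k\<in>?I. (\<Sum>b\<in>{0..<w}. if (k + b) mod int M < w then 1 else 0) * ec M (k * n))"
    unfolding shift by (subst sum.swap) (auto simp: sum_distrib_right intro!: sum.cong)
  also have "\<dots> = of_int w * dker M (\<lambda>k. of_real (tent M w k)) n"
    unfolding dker_def sum_distrib_left by (intro sum.cong refl) (simp only: count mult.assoc)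
  finally show ?thesis using w by (simp add: field_simps)
qed

definition gker :: "nat \<Rightarrow> (int ^ 'n \<Rightarrow> complex) \<Rightarrow> int ^ 'n \<Rightarrow> int ^ 'n \<Rightarrow> complex" where
  "gker M m x y = (\<Sum>k\<in>grid M. m k * chr M k (x - y)) / of_nat (card (grid M :: (int ^ 'n) set))"

lemma mult_op_gker: "mult_op M m a x = (\<Sum>y\<in>grid M. gker M m x y * a y)" for x :: "int ^ 'n::finite"
  unfolding mult_op_def gker_def by (subst sum.swap) (simp add: sum_distrib_right sum_divide_distrib)

lemma gker_delta:
  fixes x :: "int ^ 'n::finite"
  assumes "y \<in> grid M" shows "gker M m x y = mult_op M m (\<lambda>z. if z = y then 1 else 0) x"
  using assms by (simp add: mult_op_gker if_distrib cong: if_cong)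

lemma mult_op_const:
  fixes x :: "int ^ 'n::finite"
  assumes M: "M > 0"
  shows "mult_op M m (\<lambda>_. 1) x = m 0"
proof -
  let ?N = "of_nat (card (grid M :: (int ^ 'n) set)) :: complex"
  have z: "(0 :: int ^ 'n) \<in> grid M" using M by (simp add: grid_def)
  then have N: "?N \<noteq> 0" by auto
  have "dft M (\<lambda>_. 1) k = (if k = 0 then ?N else 0)" if "k \<in> grid M" for k :: "int ^ 'n"
  proof -
    have "cnj (dft M (\<lambda>_. 1) k) = (\<Sum>y\<in>grid M. chr M y (k - 0))" by (simp add: dft_def chr_commute[of M k])
    also have "\<dots> = (if k = 0 then ?N else 0)" by (rule sum_chr_grid[OF M that z])
    finally show ?thesis by (metis complex_cnj_cnj complex_cnj_of_nat complex_cnj_zero)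
  qed
  then have "(\<Sum>k\<in>grid M. m k * chr M k x * dft M (\<lambda>_. 1) k) = (\<Sum>k\<in>(grid M :: (int ^ 'n) set). if k = 0 then m 0 * ?N else 0)"
    by (intro sum.cong refl) auto
  then show ?thesis using z N by (simp add: mult_op_dft)
qed

lemma gker_tent:
  fixes x y :: "int ^ 'n::finite" and i :: 'n
  assumes M: "M > 0" and w: "w > 0" "2 * w \<le> int M" and x: "x \<in> grid M" and y: "y \<in> grid M"
  defines "K \<equiv> gker M (\<lambda>k. of_real (tent M w (k $ i)))"
  shows "K x y = of_real (Re (K x y))" "Re (K x y) \<ge> 0" "K x y = K y x"
proof -
  have "K x y = line_conv M i (\<lambda>n. dker M (\<lambda>k. of_real (tent M w k)) n / of_nat M) (\<lambda>z. if z = y then 1 else 0) x"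
    unfolding K_def gker_delta[OF y] by (rule mult_op_line[OF M x])
  also have "\<dots> = of_real (\<Sum>s\<in>{0..<int M}. (cmod (\<Sum>a\<in>{0..<w}. ec M (a * (x $ i - s))))\<^sup>2 / of_int w / real M * (if upd x i s = y then 1 else 0))"
    unfolding line_conv_def dker_tent[OF M w] of_real_sum by (intro sum.cong refl) simp
  finally have eq: "K x y = of_real (\<Sum>s\<in>{0..<int M}. (cmod (\<Sum>a\<in>{0..<w}. ec M (a * (x $ i - s))))\<^sup>2 / of_int w / real M * (if upd x i s = y then 1 else 0))" .
  show re: "K x y = of_real (Re (K x y))" unfolding eq by simp
  show "Re (K x y) \<ge> 0" unfolding eq Re_complex_of_real using w M by (intro sum_nonneg) auto
  have "chr M k (y - x) = cnj (chr M k (x - y))" for k by (metis chr_minus(2) minus_diff_eq)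
  then have "K y x = cnj (K x y)" by (simp add: K_def gker_def)
  then show "K x y = K y x" using re by (metis complex_cnj_complex_of_real)
qed

definition tprod :: "nat \<Rightarrow> 'n \<Rightarrow> (nat \<Rightarrow> int) \<Rightarrow> nat \<Rightarrow> int ^ 'n \<Rightarrow> real" where
  "tprod M i w j k = (\<Prod>l<j. tent M (w l) (k $ i))"

lemma inner_mult_op_real:
  fixes f g :: "int ^ 'n::finite \<Rightarrow> complex"
  assumes M: "M > 0"
  shows "(\<Sum>x\<in>grid M. mult_op M (\<lambda>k. of_real ((\<psi> k)\<^sup>2)) f x * cnj (g x)) =
    (\<Sum>x\<in>grid M. mult_op M (\<lambda>k. of_real (\<psi> k)) f x * cnj (mult_op M (\<lambda>k. of_real (\<psi> k)) g x))"
  unfolding inner_mult_op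
  by (simp add: dft_mult_op[OF M] power2_eq_square mult_ac cong: sum.cong)

lemma tent_transform_real:
  fixes f :: "int ^ 'n::finite \<Rightarrow> real" and i :: 'n and N :: nat
  assumes M: "M > 0" and w: "\<And>j. w j > 0" "\<And>j. 2 * w j \<le> int M" and c: "\<And>j. \<bar>c j\<bar> \<le> 1" and m: "even m"
  defines "T \<equiv> \<lambda>k. of_real (\<Sum>j<N. c j * ((tprod M i w j k)\<^sup>2 - (tprod M i w (Suc j) k)\<^sup>2)) :: complex"
  shows "(\<Sum>x\<in>grid M. cmod (mult_op M T (\<lambda>x. of_real (f x)) x) ^ (m + 4)) \<le> buC m * (\<Sum>x\<in>grid M. f x ^ (m + 4))"
proof -
  let ?A = "\<lambda>j. mult_op M (\<lambda>k. of_real (tprod M i w j k))"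
  let ?X = "grid M :: (int ^ 'n) set"
  define P where "P j x y = Re (gker M (\<lambda>k. of_real (tent M (w j) (k $ i))) x y)" for j and x y :: "int ^ 'n"
  have step: "?A (Suc j) (\<lambda>x. of_real (u x)) x = (\<Sum>s\<in>?X. of_real (P j x s) * ?A j (\<lambda>x. of_real (u x)) s)" if x: "x \<in> ?X" for j x and u :: "int ^ 'n \<Rightarrow> real"
  proof -
    have "?A (Suc j) (\<lambda>x. of_real (u x)) x = mult_op M (\<lambda>k. of_real (tent M (w j) (k $ i))) (?A j (\<lambda>x. of_real (u x))) x"
      unfolding mult_op_mult[OF M, symmetric] by (simp add: tprod_def mult.commute)
    then show ?thesis
      unfolding mult_op_gker[of M _ "?A j _"] P_def
      using gker_tent(1)[OF M w x] by (auto intro!: sum.cong)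
  qed
  have real: "\<exists>v. \<forall>x\<in>?X. ?A j (\<lambda>x. of_real (u x)) x = of_real (v x)" for j and u :: "int ^ 'n \<Rightarrow> real"
  proof (induction j)
    case 0
    have "\<forall>x\<in>?X. ?A 0 (\<lambda>x. of_real (u x)) x = of_real (u x)" by (simp add: tprod_def mult_op_one[OF M])
    then show ?case by blast
  next
    case (Suc j)
    then obtain v where v: "\<forall>x\<in>?X. ?A j (\<lambda>x. of_real (u x)) x = of_real (v x)" by blast
    have "\<forall>x\<in>?X. ?A (Suc j) (\<lambda>x. of_real (u x)) x = of_real (\<Sum>s\<in>?X. P j x s * v s)"
      using v by (simp add: step)
    then show ?case by (intro exI[of _ "\<lambda>x. \<Sum>s\<in>?X. P j x s * v s"])
  qed
  define B where "B j u x = Re (?A j (\<lambda>x. of_real (u x)) x)" for j u x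
  have B: "?A j (\<lambda>x. of_real (u x)) x = of_real (B j u x)" if "x \<in> ?X" for j u x
    using real[of j u] that by (auto simp: B_def)
  have BS: "B (Suc j) u x = (\<Sum>s\<in>?X. P j x s * B j u s)" if "x \<in> ?X" for j u x
  proof -
    have "of_real (B (Suc j) u x) = (\<Sum>s\<in>?X. of_real (P j x s) * ?A j (\<lambda>x. of_real (u x)) s)"
      using step[OF that, of j u] B[OF that] by simp
    also have "\<dots> = complex_of_real (\<Sum>s\<in>?X. P j x s * B j u s)" by (simp add: B)
    finally show ?thesis by (simp only: of_real_eq_iff)
  qed
  have B0: "B 0 u x = u x" if "x \<in> ?X" for u x by (simp add: B_def tprod_def mult_op_one[OF M that])
  have row: "(\<Sum>s\<in>?X. P j x s) = 1" if x: "x \<in> ?X" for j x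
  proof -
    have "of_real (\<Sum>s\<in>?X. P j x s) = (\<Sum>s\<in>?X. gker M (\<lambda>k. of_real (tent M (w j) (k $ i))) x s)"
      unfolding of_real_sum P_def using gker_tent(1)[OF M w x] by (auto intro!: sum.cong)
    also have "\<dots> = 1"
      using mult_op_gker[of M "\<lambda>k. of_real (tent M (w j) (k $ i))" "\<lambda>_. 1" x]
      by (simp add: mult_op_const[OF M] tent_0[OF w(1) M])
    finally show ?thesis by (metis of_real_1 of_real_eq_iff)
  qed
  have sym: "P j x s = P j s x" if "x \<in> ?X" "s \<in> ?X" for j x s
    using gker_tent(3)[OF M w that] by (simp add: P_def)
  have col: "(\<Sum>x\<in>?X. P j x s) = 1" if "s \<in> ?X" for j s
    using row[OF that, of j] sym that by (metis (no_types, lifting) sum.cong)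
  define h where "h x = Re (mult_op M T (\<lambda>x. of_real (f x)) x)" for x
  have quad: "(\<Sum>x\<in>?X. mult_op M (\<lambda>k. of_real ((tprod M i w j k)\<^sup>2)) (\<lambda>x. of_real (f x)) x * of_real (g x)) = of_real (\<Sum>x\<in>?X. B j f x * B j g x)" for j g
    using inner_mult_op_real[OF M, of "tprod M i w j" "\<lambda>x. of_real (f x)" "\<lambda>x. of_real (g x)"] by (simp add: B)
  have Tf: "mult_op M T (\<lambda>x. of_real (f x)) x = (\<Sum>j<N. of_real (c j) * (mult_op M (\<lambda>k. of_real ((tprod M i w j k)\<^sup>2)) (\<lambda>x. of_real (f x)) x - mult_op M (\<lambda>k. of_real ((tprod M i w (Suc j) k)\<^sup>2)) (\<lambda>x. of_real (f x)) x))" for x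
    unfolding T_def of_real_sum of_real_mult of_real_diff mult_op_sum mult_op_scale mult_op_diff ..
  have Tg: "(\<Sum>x\<in>?X. mult_op M T (\<lambda>x. of_real (f x)) x * of_real (g x)) =
     of_real (\<Sum>j<N. c j * ((\<Sum>x\<in>?X. B j f x * B j g x) - (\<Sum>x\<in>?X. B (Suc j) f x * B (Suc j) g x)))" for g
  proof -
    have "(\<Sum>x\<in>?X. mult_op M T (\<lambda>x. of_real (f x)) x * of_real (g x)) =
       (\<Sum>j<N. of_real (c j) * ((\<Sum>x\<in>?X. mult_op M (\<lambda>k. of_real ((tprod M i w j k)\<^sup>2)) (\<lambda>x. of_real (f x)) x * of_real (g x)) - (\<Sum>x\<in>?X. mult_op M (\<lambda>k. of_real ((tprod M i w (Suc j) k)\<^sup>2)) (\<lambda>x. of_real (f x)) x * of_real (g x))))"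
      unfolding Tf sum_distrib_right by (subst sum.swap) (simp add: sum_subtractf[symmetric] sum_distrib_left algebra_simps)
    then show ?thesis by (simp only: quad of_real_sum of_real_mult of_real_diff)
  qed
  have hreal: "mult_op M T (\<lambda>x. of_real (f x)) x = of_real (h x)" if x: "x \<in> ?X" for x
  proof -
    have "(\<Sum>y\<in>?X. mult_op M T (\<lambda>x. of_real (f x)) y * of_real (if y = x then 1 else 0)) = mult_op M T (\<lambda>x. of_real (f x)) x"
      using x by (simp add: if_distrib cong: if_cong)
    note e = trans[OF this[symmetric] Tg[of "\<lambda>y. if y = x then 1 else 0"]]
    show ?thesis unfolding h_def e by simp
  qed
  have "real (m + 4) * (\<Sum>j<N. c j * ((\<Sum>x\<in>?X. B j f x * B j (\<lambda>x. h x ^ (m + 3)) x) - (\<Sum>x\<in>?X. B (Suc j) f x * B (Suc j) (\<lambda>x. h x ^ (m + 3)) x)))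
    \<le> real (m + 3) * (\<Sum>x\<in>?X. h x ^ (m + 4)) + buC m * (\<Sum>x\<in>?X. B 0 f x ^ (m + 4))"
    by (rule martingale_transform[where P = P])
       (use gker_tent(2)[OF M w] row col BS c m B0 in \<open>auto simp: P_def\<close>)
  also have "(\<Sum>j<N. c j * ((\<Sum>x\<in>?X. B j f x * B j (\<lambda>x. h x ^ (m + 3)) x) - (\<Sum>x\<in>?X. B (Suc j) f x * B (Suc j) (\<lambda>x. h x ^ (m + 3)) x))) = (\<Sum>x\<in>?X. h x ^ (m + 4))"
  proof -
    have "complex_of_real (\<Sum>j<N. c j * ((\<Sum>x\<in>?X. B j f x * B j (\<lambda>x. h x ^ (m + 3)) x) - (\<Sum>x\<in>?X. B (Suc j) f x * B (Suc j) (\<lambda>x. h x ^ (m + 3)) x))) =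
       of_real (\<Sum>x\<in>?X. h x * h x ^ (m + 3))"
    proof -
      have "(\<Sum>x\<in>?X. mult_op M T (\<lambda>x. of_real (f x)) x * of_real (h x ^ (m + 3))) = of_real (\<Sum>x\<in>?X. h x * h x ^ (m + 3))"
        by (simp add: hreal)
      then show ?thesis unfolding Tg .
    qed
    moreover have "h x * h x ^ (m + 3) = h x ^ (m + 4)" for x by (simp add: numeral_eq_Suc)
    ultimately show ?thesis by (simp only: of_real_eq_iff)
  qed
  finally have "(\<Sum>x\<in>?X. h x ^ (m + 4)) \<le> buC m * (\<Sum>x\<in>?X. f x ^ (m + 4))"
    by (simp add: B0 algebra_simps cong: sum.cong)
  moreover have "cmod (mult_op M T (\<lambda>x. of_real (f x)) x) ^ (m + 4) = h x ^ (m + 4)" if "x \<in> ?X" for x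
    using m by (simp add: hreal[OF that] power_even_abs)
  ultimately show ?thesis by simp
qed

lemma tent_transform:
  assumes M: "M > 0" and w: "\<And>j. w j > 0" "\<And>j. 2 * w j \<le> int M" and c: "\<And>j. \<bar>c j\<bar> \<le> 1" and r: "r \<ge> 2"
  shows "mult_bound M (real (2 * r)) (2 * (buC (2 * r - 4) + 1))
    (\<lambda>k :: int ^ 'n::finite. of_real (\<Sum>j<N. c j * ((tprod M i w j k)\<^sup>2 - (tprod M i w (Suc j) k)\<^sup>2)))"
    (is "mult_bound M ?p _ ?T")
  unfolding mult_bound_def
proof
  fix a :: "int ^ 'n \<Rightarrow> complex"
  define m where "m = 2 * r - 4"
  have m: "m + 4 = 2 * r" "even m" using r by (auto simp: m_def)
  have C: "buC m \<ge> 0" by (simp add: buC_def bua_def bub_def)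
  have p: "?p \<ge> 1" "?p > 0" and r1: "r \<ge> 1" using r by auto
  have real: "nrm M ?p (mult_op M ?T (\<lambda>x. of_real (f x))) \<le> (buC m + 1) * nrm M ?p (\<lambda>x. of_real (f x))" for f
  proof -
    have "psum M r (mult_op M ?T (\<lambda>x. of_real (f x))) \<le> buC m * psum M r (\<lambda>x. of_real (f x))"
      using tent_transform_real[OF M w c m(2), where N = N and i = i and f = f] m
      by (simp add: psum_def power_even_abs)
    also have "\<dots> \<le> (buC m + 1) ^ (2 * r) * psum M r (\<lambda>x. of_real (f x))"
    proof (rule mult_right_mono)
      have "buC m \<le> (buC m + 1) ^ 1" by simp
      also have "\<dots> \<le> (buC m + 1) ^ (2 * r)" using C r by (intro power_increasing) auto
      finally show "buC m \<le> (buC m + 1) ^ (2 * r)" .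
    qed simp
    finally show ?thesis
      unfolding psum_nrm[OF r1] power_mult_distrib[symmetric]
      using C r by (subst (asm) power_mono_iff) auto
  qed
  have le: "nrm M ?p (\<lambda>x. of_real (Re (a x))) \<le> nrm M ?p a" "nrm M ?p (\<lambda>x. of_real (Im (a x))) \<le> nrm M ?p a"
    using p by (auto intro!: nrm_mono simp: abs_Re_le_cmod abs_Im_le_cmod)
  have "mult_op M ?T a x = mult_op M ?T (\<lambda>x. of_real (Re (a x))) x + \<i> * mult_op M ?T (\<lambda>x. of_real (Im (a x))) x" for x
    unfolding mult_op_scale_arg[symmetric] mult_op_add_arg[symmetric] complex_eq[symmetric] ..
  then have "nrm M ?p (mult_op M ?T a) = nrm M ?p (\<lambda>x. mult_op M ?T (\<lambda>x. of_real (Re (a x))) x + \<i> * mult_op M ?T (\<lambda>x. of_real (Im (a x))) x)"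
    by (intro nrm_cong) simp
  also have "\<dots> \<le> nrm M ?p (mult_op M ?T (\<lambda>x. of_real (Re (a x)))) + nrm M ?p (\<lambda>x. \<i> * mult_op M ?T (\<lambda>x. of_real (Im (a x))) x)"
    by (rule nrm_triangle[OF p(1)])
  also have "nrm M ?p (\<lambda>x. \<i> * mult_op M ?T (\<lambda>x. of_real (Im (a x))) x) = nrm M ?p (mult_op M ?T (\<lambda>x. of_real (Im (a x))))"
    using nrm_scale[OF p(2), of M \<i>] by simp
  also have "nrm M ?p (mult_op M ?T (\<lambda>x. of_real (Re (a x)))) + nrm M ?p (mult_op M ?T (\<lambda>x. of_real (Im (a x))))
     \<le> (buC m + 1) * nrm M ?p a + (buC m + 1) * nrm M ?p a"
    using C by (intro add_mono order_trans[OF real] mult_left_mono le) auto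
  also have "\<dots> = 2 * (buC (2 * r - 4) + 1) * nrm M ?p a" by (simp add: m_def algebra_simps)
  finally show "nrm M ?p (mult_op M ?T a) \<le> 2 * (buC (2 * r - 4) + 1) * nrm M ?p a" .
qed

section \<open>Lacunary partitions\<close>

definition cen :: "nat \<Rightarrow> int \<Rightarrow> int" where
  "cen H n = (n + int H) mod (2 * int H) - int H"

lemma cen_bounds: "H > 0 \<Longrightarrow> - int H \<le> cen H n \<and> cen H n < int H"
  using pos_mod_bound[of "2 * int H" "n + int H"] pos_mod_sign[of "2 * int H" "n + int H"] by (simp add: cen_def)

lemma cen_dvd: "2 * int H dvd cen H n - n"
proof -
  have "2 * int H dvd (n + int H) mod (2 * int H) - (n + int H)" by (simp add: mod_eq_dvd_iff[symmetric])
  then show ?thesis by (simp add: cen_def algebra_simps)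
qed

lemma cen_cong: "n mod (2 * int H) = m mod (2 * int H) \<Longrightarrow> cen H n = cen H m"
  unfolding cen_def by (metis mod_add_left_eq)

lemma cen_id: "- int H \<le> n \<Longrightarrow> n < int H \<Longrightarrow> cen H n = n"
  by (simp add: cen_def)

lemma mod_cen: "(n - u) mod (2 * int H) = (cen H n - u) mod (2 * int H)"
  using cen_dvd[of H n] by (metis mod_diff_left_eq mod_eq_dvd_iff)

lemma mod_pos_neg: "H > 0 \<Longrightarrow> - (2 * int H) \<le> n \<Longrightarrow> n < 2 * int H \<Longrightarrow> n mod (2 * int H) = (if n < 0 then n + 2 * int H else n)"
proof (cases "n < 0")
  case True
  assume "H > 0" "- (2 * int H) \<le> n"
  have "n mod (2 * int H) = (n + 2 * int H) mod (2 * int H)" by simp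
  also have "\<dots> = n + 2 * int H" using True \<open>- (2 * int H) \<le> n\<close> by (intro mod_pos_pos_trivial) auto
  finally show ?thesis using True by simp
qed simp

lemma abs_cen:
  assumes "H > 0"
  shows "min (k mod int (2 * H)) (int (2 * H) - k mod int (2 * H)) = \<bar>cen H k\<bar>"
proof -
  have c: "- int H \<le> cen H k" "cen H k < int H" using cen_bounds[OF assms] by auto
  have "k mod int (2 * H) = cen H k mod (2 * int H)" using mod_cen[of k 0 H] by simp
  also have "\<dots> = (if cen H k < 0 then cen H k + 2 * int H else cen H k)"
    using c assms by (intro mod_pos_neg) auto
  finally show ?thesis using c by (auto simp: min_def)
qed

definition carc :: "nat \<Rightarrow> 'n \<Rightarrow> int \<Rightarrow> int \<Rightarrow> int ^ 'n \<Rightarrow> complex" where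
  "carc H i u v k = (if u \<le> cen H (k $ i) \<and> cen H (k $ i) < v then 1 else 0)"

lemma carc_arcm:
  assumes H: "H > 0" and uv: "- int H \<le> u" "u \<le> v" "v \<le> int H"
  shows "carc H i u v k = arcm (2 * H) i u (v - u) k"
proof -
  have c: "- int H \<le> cen H (k $ i)" "cen H (k $ i) < int H" using cen_bounds[OF H] by auto
  have "(k $ i - u) mod int (2 * H) = (cen H (k $ i) - u) mod (2 * int H)" using mod_cen by simp
  also have "\<dots> = (if cen H (k $ i) - u < 0 then cen H (k $ i) - u + 2 * int H else cen H (k $ i) - u)"
    using c uv H by (intro mod_pos_neg) auto
  finally show ?thesis using c uv by (auto simp: carc_def arcm_def)
qed

lemma mult_bound_carc:
  assumes "H > 0" "p = real (2 * 2 ^ q)" "- int H \<le> u" "u \<le> v" "v \<le> int H"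
  shows "mult_bound (2 * H) p (cotlar q + 2) (carc H i u v :: int ^ 'n::finite \<Rightarrow> complex)"
proof -
  have "(carc H i u v :: int ^ 'n \<Rightarrow> complex) = arcm (2 * H) i u (v - u)" by (rule ext) (rule carc_arcm[OF assms(1,3-5)])
  then show ?thesis using mult_bound_arcm[of "2 * H" p q i u "v - u"] assms(1,2) by simp
qed

lemma mult_bound_carc_mono:
  assumes H: "H > 0" and p: "p = real (2 * 2 ^ q)"
  shows "- int H \<le> u \<Longrightarrow> u \<le> v \<Longrightarrow> v \<le> int H \<Longrightarrow> 0 \<le> \<eta> \<Longrightarrow> (\<And>n. u \<le> n \<Longrightarrow> n < v \<Longrightarrow> 0 \<le> g n \<and> g n \<le> \<eta>) \<Longrightarrow>
    (\<And>n m. u \<le> n \<Longrightarrow> n \<le> m \<Longrightarrow> m < v \<Longrightarrow> g n \<le> g m) \<Longrightarrow>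
    mult_bound (2 * H) p ((cotlar q + 2) * \<eta>) (\<lambda>k :: int ^ 'n::finite. of_real (g (cen H (k $ i))) * carc H i u v k)"
proof (induction "nat (v - u)" arbitrary: u g \<eta>)
  case 0
  then have "(\<lambda>k :: int ^ 'n::finite. of_real (g (cen H (k $ i))) * carc H i u v k) = (\<lambda>k. 0)"
    by (auto simp: carc_def fun_eq_iff)
  moreover have "0 \<le> (cotlar q + 2) * \<eta>" using 0 cotlar_ge_1[of q] by simp
  ultimately show ?case by (auto intro: mult_bound_mono[OF mult_bound_zero])
next
  case (Suc d)
  have p1: "p \<ge> 1" using one_le_power[of "2::real" "Suc q"] by (simp add: p)
  have lt: "u < v" using Suc(2) by simp
  have gu: "0 \<le> g u" "g u \<le> \<eta>" using Suc(7)[of u] lt by auto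
  have 1: "mult_bound (2 * H) p ((cotlar q + 2) * (\<eta> - g u)) (\<lambda>k :: int ^ 'n. of_real (g (cen H (k $ i)) - g u) * carc H i (u + 1) v k)"
    using Suc lt gu by (intro Suc(1)) auto
  have 2: "mult_bound (2 * H) p (cmod (of_real (g u)) * (cotlar q + 2)) (\<lambda>k :: int ^ 'n. of_real (g u) * carc H i u v k)"
    using p1 Suc lt by (intro mult_bound_scale mult_bound_carc[OF H p]) auto
  have "of_real (g u) * carc H i u v k + of_real (g (cen H (k $ i)) - g u) * carc H i (u + 1) v k = of_real (g (cen H (k $ i))) * carc H i u v k" for k :: "int ^ 'n"
    by (cases "cen H (k $ i) = u") (auto simp: carc_def)
  moreover have "cmod (of_real (g u)) * (cotlar q + 2) + (cotlar q + 2) * (\<eta> - g u) = (cotlar q + 2) * \<eta>"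
    using gu by (simp add: algebra_simps)
  ultimately show ?case using mult_bound_add[OF p1 2 1] by simp
qed

lemma mult_bound_carc_antimono:
  assumes H: "H > 0" and p: "p = real (2 * 2 ^ q)"
  shows "- int H \<le> u \<Longrightarrow> u \<le> v \<Longrightarrow> v \<le> int H \<Longrightarrow> 0 \<le> \<eta> \<Longrightarrow> (\<And>n. u \<le> n \<Longrightarrow> n < v \<Longrightarrow> 0 \<le> g n \<and> g n \<le> \<eta>) \<Longrightarrow>
    (\<And>n m. u \<le> n \<Longrightarrow> n \<le> m \<Longrightarrow> m < v \<Longrightarrow> g m \<le> g n) \<Longrightarrow>
    mult_bound (2 * H) p ((cotlar q + 2) * \<eta>) (\<lambda>k :: int ^ 'n::finite. of_real (g (cen H (k $ i))) * carc H i u v k)"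
proof (induction "nat (v - u)" arbitrary: v g \<eta>)
  case 0
  then have "(\<lambda>k :: int ^ 'n::finite. of_real (g (cen H (k $ i))) * carc H i u v k) = (\<lambda>k. 0)"
    by (auto simp: carc_def fun_eq_iff)
  moreover have "0 \<le> (cotlar q + 2) * \<eta>" using 0 cotlar_ge_1[of q] by simp
  ultimately show ?case by (auto intro: mult_bound_mono[OF mult_bound_zero])
next
  case (Suc d)
  have p1: "p \<ge> 1" using one_le_power[of "2::real" "Suc q"] by (simp add: p)
  have lt: "u < v" using Suc(2) by simp
  define z where "z = v - 1"
  have gu: "0 \<le> g z" "g z \<le> \<eta>" using Suc(7)[of z] lt by (auto simp: z_def)
  have 1: "mult_bound (2 * H) p ((cotlar q + 2) * (\<eta> - g z)) (\<lambda>k :: int ^ 'n. of_real (g (cen H (k $ i)) - g z) * carc H i u z k)"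
    using Suc lt gu by (intro Suc(1)) (auto simp: z_def)
  have 2: "mult_bound (2 * H) p (cmod (of_real (g z)) * (cotlar q + 2)) (\<lambda>k :: int ^ 'n. of_real (g z) * carc H i u v k)"
    using p1 Suc lt by (intro mult_bound_scale mult_bound_carc[OF H p]) auto
  have "of_real (g z) * carc H i u v k + of_real (g (cen H (k $ i)) - g z) * carc H i u z k = of_real (g (cen H (k $ i))) * carc H i u v k" for k :: "int ^ 'n"
    by (cases "cen H (k $ i) = z") (auto simp: carc_def z_def)
  moreover have "cmod (of_real (g z)) * (cotlar q + 2) + (cotlar q + 2) * (\<eta> - g z) = (cotlar q + 2) * \<eta>"
    using gu by (simp add: algebra_simps)
  ultimately show ?case using mult_bound_add[OF p1 2 1] by simp
qed

definition lw :: "nat \<Rightarrow> nat \<Rightarrow> int" where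
  "lw s j = 2 ^ (s - j\<^sup>2)"

definition tp :: "nat \<Rightarrow> nat \<Rightarrow> int \<Rightarrow> real" where
  "tp s j n = (\<Prod>l<j. max 0 (1 - of_int \<bar>n\<bar> / of_int (lw s l)))"

definition th :: "nat \<Rightarrow> nat \<Rightarrow> int \<Rightarrow> real" where
  "th s l n = (tp s (Suc l) n)\<^sup>2"

lemma lw_pos [simp]: "lw s j > 0"
  by (simp add: lw_def)

lemma lw_div_nonneg [simp]: "0 \<le> \<bar>real_of_int n\<bar> / real_of_int (lw s j)"
  using lw_pos[of s j] by (intro divide_nonneg_pos) auto

lemma lw_antimono: "j \<le> l \<Longrightarrow> lw s l \<le> lw s j"
  unfolding lw_def by (intro power_increasing diff_le_mono2 power_mono) auto

lemma lw_ratio: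
  assumes "l \<le> j" "(Suc j)\<^sup>2 \<le> s"
  shows "real_of_int (lw s (Suc j)) / real_of_int (lw s l) \<le> (1/2) ^ (2 * j + 1) * (1/2) ^ (j - l)"
proof -
  obtain d where d: "j = l + d" using assms(1) le_Suc_ex by blast
  have e: "(Suc j)\<^sup>2 = l\<^sup>2 + (2 * j + 1 + d) + (2 * l * d + d * d - d)"
    unfolding d by (cases d) (simp_all add: power2_eq_square algebra_simps)
  define e' where "e' = 2 * l * d + d * d - d"
  have "s - l\<^sup>2 = (s - (Suc j)\<^sup>2) + (2 * j + 1 + d) + e'" using assms(2) e by (simp add: e'_def)
  then have "real_of_int (lw s l) = real_of_int (lw s (Suc j)) * 2 ^ (2 * j + 1 + d) * 2 ^ e'"
    by (simp add: lw_def power_add)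
  moreover have "(1::real) \<le> 2 ^ e'" by simp
  ultimately have "real_of_int (lw s (Suc j)) * 2 ^ (2 * j + 1 + d) * 1 \<le> real_of_int (lw s l)"
    by (simp only: mult_left_mono zero_le_mult_iff of_int_0_le_iff less_imp_le[OF lw_pos] zero_le_power zero_le_numeral simp_thms)
  then have "real_of_int (lw s (Suc j)) * 2 ^ (2 * j + 1 + d) \<le> real_of_int (lw s l)" by simp
  moreover have "x / y \<le> 1 / z" if "x * z \<le> y" "y > 0" "z > 0" for x y z :: real
    using that by (simp add: field_simps)
  moreover have "(1/2) ^ (2 * j + 1) * (1/2) ^ (j - l) = 1 / (2::real) ^ (2 * j + 1 + d)"
    using d by (simp only: power_one_over power_add diff_add_inverse) simp
  ultimately show ?thesis using lw_pos[of s l] by simp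
qed

lemma tp_01: "0 \<le> tp s j n" "tp s j n \<le> 1"
  unfolding tp_def by (auto intro!: prod_nonneg prod_le_1)

lemma th_01: "0 \<le> th s l n" "th s l n \<le> 1"
  using tp_01[of s "Suc l" n] by (auto simp: th_def power_le_one)

lemma th_zero:
  assumes "lw s j \<le> \<bar>n\<bar>" "j \<le> l"
  shows "th s l n = 0"
proof -
  have "max 0 (1 - real_of_int \<bar>n\<bar> / real_of_int (lw s j)) = 0"
  proof -
    have "real_of_int (lw s j) \<le> real_of_int \<bar>n\<bar>" using assms(1) by (simp only: of_int_le_iff)
    then have "1 \<le> real_of_int \<bar>n\<bar> / real_of_int (lw s j)" using lw_pos[of s j] by (simp add: le_divide_eq)
    then show ?thesis by simp
  qed
  then have "tp s (Suc l) n = 0" unfolding tp_def using assms(2) by (intro prod_zero) auto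
  then show ?thesis by (simp add: th_def)
qed

lemma th_mono: "\<bar>n\<bar> \<le> \<bar>m\<bar> \<Longrightarrow> th s l m \<le> th s l n"
proof -
  assume "\<bar>n\<bar> \<le> \<bar>m\<bar>"
  then have "real_of_int \<bar>n\<bar> \<le> real_of_int \<bar>m\<bar>" by (simp only: of_int_le_iff)
  then have "real_of_int \<bar>n\<bar> / real_of_int (lw s i) \<le> real_of_int \<bar>m\<bar> / real_of_int (lw s i)" for i
    using lw_pos[of s i] by (intro divide_right_mono) (auto simp: less_imp_le)
  then show ?thesis
    unfolding th_def tp_def by (intro power_mono prod_mono prod_nonneg conjI max.mono) auto
qed

lemma th_near_1:
  assumes n: "\<bar>n\<bar> \<le> lw s (Suc j)" and l: "l \<le> j" and s: "(Suc j)\<^sup>2 \<le> s"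
  shows "1 - th s l n \<le> 2 * (1/4) ^ j"
proof -
  have "1 - tp s q n \<le> (\<Sum>l<q. real_of_int \<bar>n\<bar> / real_of_int (lw s l))" for q
  proof (induction q)
    case (Suc q)
    let ?x = "max 0 (1 - real_of_int \<bar>n\<bar> / real_of_int (lw s q))"
    have t: "0 \<le> tp s q n" "tp s q n \<le> 1" by (rule tp_01)+
    have x: "0 \<le> ?x" "1 - ?x \<le> real_of_int \<bar>n\<bar> / real_of_int (lw s q)" by auto
    have "1 - tp s (Suc q) n = (1 - tp s q n) + tp s q n * (1 - ?x)" by (simp add: tp_def algebra_simps)
    also have "tp s q n * (1 - ?x) \<le> 1 * (real_of_int \<bar>n\<bar> / real_of_int (lw s q))"
      using t x by (intro mult_mono) auto
    finally show ?case using Suc by simp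
  qed (simp add: tp_def)
  then have "1 - tp s (Suc l) n \<le> (\<Sum>i<Suc l. real_of_int \<bar>n\<bar> / real_of_int (lw s i))" .
  also have "\<dots> \<le> (\<Sum>i<Suc l. (1/2) ^ (2 * j + 1) * (1/2) ^ (j - i))"
  proof (rule sum_mono)
    fix i assume "i \<in> {..<Suc l}"
    then have "real_of_int \<bar>n\<bar> / real_of_int (lw s i) \<le> real_of_int (lw s (Suc j)) / real_of_int (lw s i)"
      using n by (intro divide_right_mono) (auto simp: less_imp_le)
    also have "\<dots> \<le> (1/2) ^ (2 * j + 1) * (1/2) ^ (j - i)" using \<open>i \<in> _\<close> l by (intro lw_ratio s) auto
    finally show "real_of_int \<bar>n\<bar> / real_of_int (lw s i) \<le> (1/2) ^ (2 * j + 1) * (1/2) ^ (j - i)" .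
  qed
  also have "\<dots> \<le> (\<Sum>i<Suc j. (1/2) ^ (2 * j + 1) * (1/2) ^ (j - i))"
    using l by (intro sum_mono2) auto
  also have "\<dots> = (1/2) ^ (2 * j + 1) * (\<Sum>i<Suc j. (1/2) ^ i)"
    unfolding sum_distrib_left[symmetric] using sum.nat_diff_reindex[of "\<lambda>i. (1/2::real) ^ i" "Suc j"] by simp
  also have "\<dots> \<le> (1/2) ^ (2 * j + 1) * 2"
    by (intro mult_left_mono) (auto simp: geometric_sum)
  also have "\<dots> = (1/4) ^ j" by (simp add: power_mult power2_eq_square)
  finally have 1: "1 - tp s (Suc l) n \<le> (1/4) ^ j" .
  have t: "0 \<le> tp s (Suc l) n" "tp s (Suc l) n \<le> 1" by (rule tp_01)+
  have "1 - th s l n = (1 - tp s (Suc l) n) * (1 + tp s (Suc l) n)" by (simp add: th_def power2_eq_square algebra_simps)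
  also have "\<dots> \<le> (1/4) ^ j * 2" using 1 t by (intro mult_mono) auto
  finally show ?thesis by simp
qed

lemma tprod_tp: "H > 0 \<Longrightarrow> tprod (2 * H) i (lw s) j k = tp s j (cen H (k $ i))"
  unfolding tprod_def tp_def tent_def abs_cen ..

definition lpC :: "nat \<Rightarrow> real" where
  "lpC r = 2 * (buC (2 * r - 4) + 1)"

lemma lpC_ge_1: "lpC r \<ge> 1"
  by (simp add: lpC_def buC_def bua_def bub_def add_increasing)

lemma smooth_transform:
  assumes H: "H > 0" and s: "2 ^ s \<le> H" and r: "r \<ge> 2" and E: "finite E" and c: "\<And>j. \<bar>c j\<bar> \<le> 1"
  shows "mult_bound (2 * H) (real (2 * r)) (2 * lpC r)
    (\<lambda>k :: int ^ 'n::finite. of_real (\<Sum>j\<in>E. c j * (th s j (cen H (k $ i)) - th s (j + 2) (cen H (k $ i)))))"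
proof -
  have p: "real (2 * r) \<ge> 1" using r by simp
  define D where "D j n = (tp s j n)\<^sup>2 - (tp s (Suc j) n)\<^sup>2" for j n
  have w: "2 * lw s j \<le> int (2 * H)" for j
  proof -
    have "lw s j \<le> 2 ^ s" unfolding lw_def by (intro power_increasing) auto
    also have "\<dots> \<le> int H" using s by (metis of_nat_le_iff of_nat_numeral of_nat_power)
    finally show ?thesis by simp
  qed
  obtain N where N: "\<And>j. j \<in> E \<Longrightarrow> j + 2 < N" using E
    by (metis finite_nat_set_iff_bounded less_add_eq_less add_less_cancel_right)
  have shift: "mult_bound (2 * H) (real (2 * r)) (lpC r) (\<lambda>k :: int ^ 'n. of_real (\<Sum>j\<in>E. c j * D (j + d) (cen H (k $ i))))" if d: "d \<le> 2" for d
  proof -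
    define c' where "c' j = (if d \<le> j \<and> j - d \<in> E then c (j - d) else 0)" for j
    have "mult_bound (2 * H) (real (2 * r)) (lpC r) (\<lambda>k :: int ^ 'n. of_real (\<Sum>j<N. c' j * ((tprod (2 * H) i (lw s) j k)\<^sup>2 - (tprod (2 * H) i (lw s) (Suc j) k)\<^sup>2)))"
      unfolding lpC_def using H w r c by (intro tent_transform) (auto simp: c'_def)
    moreover have "(\<Sum>j<N. c' j * D j n) = (\<Sum>j\<in>E. c j * D (j + d) n)" for n
    proof -
      have "(\<Sum>j<N. c' j * D j n) = (\<Sum>j\<in>(\<lambda>j. j + d) ` E. c' j * D j n)"
      proof (intro sum.mono_neutral_right ballI)
        show "(\<lambda>j. j + d) ` E \<subseteq> {..<N}" using N d by fastforce
        fix j assume "j \<in> {..<N} - (\<lambda>j. j + d) ` E"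
        then have "\<not> (d \<le> j \<and> j - d \<in> E)" by (metis Diff_iff image_eqI le_add_diff_inverse2)
        then show "c' j * D j n = 0" by (auto simp: c'_def)
      qed simp
      also have "\<dots> = (\<Sum>j\<in>E. c j * D (j + d) n)" by (subst sum.reindex) (auto simp: c'_def)
      finally show ?thesis .
    qed
    ultimately show ?thesis unfolding tprod_tp[OF H] D_def by simp
  qed
  have "mult_bound (2 * H) (real (2 * r)) (lpC r + lpC r) (\<lambda>k :: int ^ 'n. of_real (\<Sum>j\<in>E. c j * D (j + 1) (cen H (k $ i))) + of_real (\<Sum>j\<in>E. c j * D (j + 2) (cen H (k $ i))))"
    by (intro mult_bound_add[OF p] shift) auto
  moreover have "(\<Sum>j\<in>E. c j * D (j + 1) n) + (\<Sum>j\<in>E. c j * D (j + 2) n) = (\<Sum>j\<in>E. c j * (th s j n - th s (j + 2) n))" for n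
    by (simp add: D_def th_def sum.distrib[symmetric] algebra_simps numeral_2_eq_2)
  ultimately show ?thesis by (simp only: of_real_add[symmetric] mult_2)
qed

text \<open>
  One parity class of the dyadic rings around the centre. The sharp cut-offs are compared with the
  smooth ones, whose randomised sums are martingale transforms; the errors are monotone on each
  ring and summably small because the scales are superlacunary.
\<close>

definition ringC :: "nat \<Rightarrow> real" where
  "ringC q = 2 * lpC (2 ^ q) * (Kh (2 ^ q) ^ 5 * ((cotlar q + 2) * (cotlar q + 3) * (2 * lpC (2 ^ q))))
     + (2 * lpC (2 ^ q) + 1) * (12 * (cotlar q + 2))"

lemma ring_family:
  fixes c :: "nat \<Rightarrow> complex"
  assumes H: "H > 0" and s: "2 ^ s \<le> H" and q: "q \<ge> 1" and L: "L\<^sup>2 \<le> s"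
    and E: "\<And>j. j \<in> E \<Longrightarrow> j + 2 \<le> L \<and> even (j + e)" and c: "\<And>j. cmod (c j) \<le> 1"
    and uv: "\<And>j. j \<in> E \<Longrightarrow> u j = lw s (j + 2) \<and> v j = lw s (j + 1) \<or> u j = - lw s (j + 1) \<and> v j = - lw s (j + 2)"
  shows "mult_bound (2 * H) (real (2 * 2 ^ q)) (ringC q) (\<lambda>k :: int ^ 'n::finite. \<Sum>j\<in>E. c j * carc H i (u j) (v j) k)"
proof -
  define r where "r = (2::nat) ^ q"
  define p where "p = real (2 * r)"
  define R where "R = cotlar q + 2"
  define S where "S j = (carc H i (u j) (v j) :: int ^ 'n \<Rightarrow> complex)" for j
  define t where "t l k = complex_of_real (th s l (cen H (k $ i)))" for l and k :: "int ^ 'n"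
  define C0 where "C0 = 2 * lpC r"
  define C2 where "C2 = 12 * R"
  define \<eta> where "\<eta> j = 2 * (1/4 :: real) ^ j" for j :: nat
  have M: "2 * H > 0" using H by simp
  have r: "r \<ge> 1" "r \<ge> 2" using q self_le_power[of "2::nat" q] by (auto simp: r_def)
  have p1: "p \<ge> 1" "p > 0" using r by (auto simp: p_def)
  have pq: "p = real (2 * 2 ^ q)" by (simp add: p_def r_def)
  have R0: "R \<ge> 3" using cotlar_ge_1[of q] by (simp add: R_def)
  have C0: "C0 \<ge> 2" using lpC_ge_1[of r] by (simp add: C0_def)
  have EL: "E \<subseteq> {..L}" using E by (meson add_leE atMost_iff subsetI)
  then have finE: "finite E" using finite_subset by blast
  have sq: "(Suc j)\<^sup>2 \<le> s" if "j \<in> E" for j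
  proof -
    have "Suc j \<le> L" using E[OF that] by simp
    then have "(Suc j)\<^sup>2 \<le> L\<^sup>2" by (rule power_mono) simp
    then show ?thesis using L by (rule order_trans)
  qed
  have lwH: "lw s j \<le> int H" for j
  proof -
    have "lw s j \<le> 2 ^ s" unfolding lw_def by (intro power_increasing) auto
    also have "\<dots> \<le> int H" using s by (metis of_nat_le_iff of_nat_numeral of_nat_power)
    finally show ?thesis .
  qed
  have ends: "- int H \<le> u j \<and> u j \<le> v j \<and> v j \<le> int H \<and> v j - u j \<le> int H" if "j \<in> E" for j
  proof -
    have l: "lw s (j + 2) \<le> lw s (j + 1)" by (rule lw_antimono) simp
    show ?thesis
      using uv[OF that]
    proof
      assume "u j = lw s (j + 2) \<and> v j = lw s (j + 1)"
      then show ?thesis using l lwH[of "j + 1"] lw_pos[of s "j + 2"] by linarith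
    next
      assume "u j = - lw s (j + 1) \<and> v j = - lw s (j + 2)"
      then show ?thesis using l lwH[of "j + 1"] lw_pos[of s "j + 2"] by linarith
    qed
  qed
  have ring: "lw s (j + 2) \<le> \<bar>n\<bar> \<and> \<bar>n\<bar> \<le> lw s (Suc j)" if "j \<in> E" "u j \<le> n" "n < v j" for j n
    using uv[OF that(1)]
  proof
    assume "u j = lw s (j + 2) \<and> v j = lw s (j + 1)"
    then show ?thesis using that(2,3) lw_pos[of s "j + 2"] unfolding Suc_eq_plus1 by linarith
  next
    assume "u j = - lw s (j + 1) \<and> v j = - lw s (j + 2)"
    then show ?thesis using that(2,3) lw_pos[of s "j + 2"] unfolding Suc_eq_plus1 by linarith
  qed
  have err: "mult_bound (2 * H) p (R * \<eta> j) (\<lambda>k. (1 - t l k) * S j k)" if j: "j \<in> E" and l: "l \<le> j" for j l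
  proof -
    have b: "0 \<le> 1 - th s l n \<and> 1 - th s l n \<le> \<eta> j" if "u j \<le> n" "n < v j" for n
      using th_near_1[OF conjunct2[OF ring[OF j that]] l sq[OF j]] th_01(2)[of s l n] by (simp add: \<eta>_def)
    have \<eta>0: "\<eta> j \<ge> 0" by (simp add: \<eta>_def)
    have "mult_bound (2 * H) p (R * \<eta> j) (\<lambda>k :: int ^ 'n. of_real (1 - th s l (cen H (k $ i))) * carc H i (u j) (v j) k)"
      using uv[OF j]
    proof
      assume "u j = lw s (j + 2) \<and> v j = lw s (j + 1)"
      then have u0: "0 < u j" by simp
      show ?thesis unfolding R_def using ends[OF j] b \<eta>0
        by (intro mult_bound_carc_mono[OF H pq, where g = "\<lambda>n. 1 - th s l n"]) (use u0 in \<open>auto intro!: th_mono\<close>)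
    next
      assume "u j = - lw s (j + 1) \<and> v j = - lw s (j + 2)"
      then have v0: "v j < 0" by simp
      show ?thesis unfolding R_def using ends[OF j] b \<eta>0
        by (intro mult_bound_carc_antimono[OF H pq, where g = "\<lambda>n. 1 - th s l n"]) (use v0 in \<open>auto intro!: th_mono\<close>)
    qed
    then show ?thesis by (simp add: t_def S_def)
  qed
  have sum_eta: "(\<Sum>j\<in>E. R * \<eta> j * (1 + 2 * real j)) \<le> C2"
  proof -
    have "(\<Sum>j\<in>E. R * \<eta> j * (1 + 2 * real j)) \<le> (\<Sum>j\<in>E. 6 * R * (1/2) ^ j)"
    proof (rule sum_mono)
      fix j
      have "real j < 2 ^ j" by (rule of_nat_less_two_power)
      moreover have "(1::real) \<le> 2 ^ j" by simp
      ultimately have "1 + 2 * real j \<le> 3 * 2 ^ j" by linarith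
      then have "R * \<eta> j * (1 + 2 * real j) \<le> R * \<eta> j * (3 * 2 ^ j)" using R0 by (intro mult_left_mono) (auto simp: \<eta>_def)
      also have "\<dots> = 6 * R * ((1/4) ^ j * 2 ^ j)" by (simp add: \<eta>_def)
      also have "(1/4 :: real) ^ j * 2 ^ j = (1/2) ^ j" unfolding power_mult_distrib[symmetric] by simp
      finally show "R * \<eta> j * (1 + 2 * real j) \<le> 6 * R * (1/2) ^ j" .
    qed
    also have "\<dots> \<le> (\<Sum>j\<in>{..L}. 6 * R * (1/2) ^ j)" using EL R0 by (intro sum_mono2) auto
    also have "\<dots> = 6 * R * (\<Sum>j<Suc L. (1/2) ^ j)" by (simp only: sum_distrib_left lessThan_Suc_atMost)
    also have "\<dots> \<le> 6 * R * 2" using R0 by (intro mult_left_mono) (auto simp: geometric_sum)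
    finally show ?thesis by (simp add: C2_def)
  qed
  have vanish: "t l k * S j k = 0" if "j \<in> E" "j + 2 \<le> l" for j l k
  proof (cases "u j \<le> cen H (k $ i) \<and> cen H (k $ i) < v j")
    case True
    then show ?thesis using ring[OF that(1), of "cen H (k $ i)"] th_zero[of s "j + 2" "cen H (k $ i)" l] that by (simp add: t_def)
  qed (auto simp: S_def carc_def)
  define \<Phi> where "\<Phi> j k = t j k - t (j + 2) k" for j k
  define W where "W A k = (\<Sum>j\<in>E. of_real (sg A j) * \<Phi> j k)" for A k
  have Wb: "mult_bound (2 * H) p C0 (W A)" for A
    using smooth_transform[OF H s r(2) finE, of "sg A" i] by (simp add: p_def C0_def W_def[abs_def] \<Phi>_def t_def)
  have par: "l + 2 \<le> j" if "j \<in> E" "l \<in> E" "l < j" for j l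
    using E[OF that(1)] E[OF that(2)] that(3) by presburger
  have id1: "(1 - of_real (sg A j) * W A k) * S j k =
      (1 - t j k) * S j k - (\<Sum>l\<in>{l \<in> E. l < j}. of_real (sg A j * sg A l) * ((1 - t (l + 2) k) * S j k - (1 - t l k) * S j k))"
    if j: "j \<in> E" for A j k
  proof -
    have "W A k * S j k = (\<Sum>l\<in>E. of_real (sg A l) * (\<Phi> l k * S j k))" by (simp add: W_def sum_distrib_right mult.assoc)
    also have "\<dots> = (\<Sum>l\<in>E. (if l = j then of_real (sg A j) * (t j k * S j k) else 0) + (if l < j then of_real (sg A l) * (\<Phi> l k * S j k) else 0))"
    proof (intro sum.cong refl)
      fix l assume l: "l \<in> E"
      consider "l = j" | "l < j" | "j < l" by linarith
      then show "of_real (sg A l) * (\<Phi> l k * S j k) = (if l = j then of_real (sg A j) * (t j k * S j k) else 0) + (if l < j then of_real (sg A l) * (\<Phi> l k * S j k) else 0)"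
      proof cases
        case 1 then show ?thesis using vanish[OF j, of "j + 2" k] by (simp add: \<Phi>_def left_diff_distrib)
      next
        case 3
        then have "j + 2 \<le> l" by (rule par[OF l j])
        then show ?thesis using 3 vanish[OF j, of l k] vanish[OF j, of "l + 2" k] by (auto simp: \<Phi>_def left_diff_distrib)
      qed simp
    qed
    also have "\<dots> = of_real (sg A j) * (t j k * S j k) + (\<Sum>l\<in>{l \<in> E. l < j}. of_real (sg A l) * (\<Phi> l k * S j k))"
      using finE j by (simp add: sum.distrib sum.inter_filter)
    finally have *: "W A k * S j k = of_real (sg A j) * (t j k * S j k) + (\<Sum>l\<in>{l \<in> E. l < j}. of_real (sg A l) * (\<Phi> l k * S j k))" .
    have sg1: "complex_of_real (sg A j) * of_real (sg A j) = 1" by (metis abs_sg(2) of_real_1 of_real_mult)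
    have "(1 - of_real (sg A j) * W A k) * S j k = S j k - of_real (sg A j) * (W A k * S j k)" by (simp add: algebra_simps)
    also have "\<dots> = S j k - (of_real (sg A j) * of_real (sg A j)) * (t j k * S j k) - (\<Sum>l\<in>{l \<in> E. l < j}. of_real (sg A j * sg A l) * (\<Phi> l k * S j k))"
      unfolding * by (simp add: distrib_left sum_distrib_left mult.assoc)
    finally show ?thesis unfolding sg1 by (simp add: \<Phi>_def algebra_simps)
  qed
  have b1: "mult_bound (2 * H) p (R * \<eta> j * (1 + 2 * real j)) (\<lambda>k. (1 - of_real (sg A j) * W A k) * S j k)" if j: "j \<in> E" for A j
  proof -
    have "mult_bound (2 * H) p (R * \<eta> j + (\<Sum>l\<in>{l \<in> E. l < j}. cmod (of_real (sg A j * sg A l)) * (R * \<eta> j + R * \<eta> j))) (\<lambda>k. (1 - of_real (sg A j) * W A k) * S j k)"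
      unfolding id1[OF j]
      using par[OF j] j p1 by (intro mult_bound_diff mult_bound_sum mult_bound_scale err) auto
    moreover have "R * \<eta> j + (\<Sum>l\<in>{l \<in> E. l < j}. cmod (of_real (sg A j * sg A l)) * (R * \<eta> j + R * \<eta> j)) \<le> R * \<eta> j * (1 + 2 * real j)"
    proof -
      have "cmod (complex_of_real (sg A j * sg A l)) = 1" for l unfolding norm_of_real abs_mult by simp
      then have "(\<Sum>l\<in>{l \<in> E. l < j}. cmod (complex_of_real (sg A j * sg A l)) * (R * \<eta> j + R * \<eta> j)) = real (card {l \<in> E. l < j}) * (2 * (R * \<eta> j))" by simp
      also have "\<dots> \<le> real j * (2 * (R * \<eta> j))"
        using R0 card_mono[of "{..<j}" "{l \<in> E. l < j}"] by (intro mult_right_mono) (auto simp: \<eta>_def)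
      finally show ?thesis by (simp add: algebra_simps)
    qed
    ultimately show ?thesis by (rule mult_bound_mono)
  qed
  have b2: "mult_bound (2 * H) p C2 (\<lambda>k. \<Sum>j\<in>E. c j * ((1 - of_real (sg A j) * W A k) * S j k))" for A
  proof -
    have "mult_bound (2 * H) p (\<Sum>j\<in>E. cmod (c j) * (R * \<eta> j * (1 + 2 * real j))) (\<lambda>k. \<Sum>j\<in>E. c j * ((1 - of_real (sg A j) * W A k) * S j k))"
      using p1 by (intro mult_bound_sum mult_bound_scale b1) auto
    moreover have "(\<Sum>j\<in>E. cmod (c j) * (R * \<eta> j * (1 + 2 * real j))) \<le> (\<Sum>j\<in>E. R * \<eta> j * (1 + 2 * real j))"
      using c R0 by (intro sum_mono mult_left_le_one_le) (auto simp: \<eta>_def)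
    ultimately show ?thesis using sum_eta by (meson mult_bound_mono order_trans)
  qed
  have b3: "mult_bound (2 * H) p C2 (\<lambda>k. \<Sum>j\<in>E. of_real (sg A j) * c j * ((1 - \<Phi> j k) * S j k))" for A
  proof -
    have eq: "(1 - \<Phi> j k) * S j k = (1 - t j k) * S j k" if "j \<in> E" for j k
      using vanish[OF that, of "j + 2" k] by (simp add: \<Phi>_def algebra_simps)
    have "mult_bound (2 * H) p (\<Sum>j\<in>E. cmod (of_real (sg A j) * c j) * (R * \<eta> j)) (\<lambda>k. \<Sum>j\<in>E. of_real (sg A j) * c j * ((1 - t j k) * S j k))"
      using p1 by (intro mult_bound_sum mult_bound_scale err) auto
    moreover have "(\<Sum>j\<in>E. cmod (of_real (sg A j) * c j) * (R * \<eta> j)) \<le> (\<Sum>j\<in>E. R * \<eta> j * (1 + 2 * real j))"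
    proof (rule sum_mono)
      fix j
      have "cmod (of_real (sg A j) * c j) * (R * \<eta> j) \<le> 1 * (R * \<eta> j)" using c[of j] R0 by (intro mult_right_mono) (auto simp: norm_mult \<eta>_def)
      also have "\<dots> \<le> R * \<eta> j * (1 + 2 * real j)" using R0 by (simp add: \<eta>_def algebra_simps)
      finally show "cmod (of_real (sg A j) * c j) * (R * \<eta> j) \<le> R * \<eta> j * (1 + 2 * real j)" .
    qed
    ultimately have "mult_bound (2 * H) p C2 (\<lambda>k. \<Sum>j\<in>E. of_real (sg A j) * c j * ((1 - t j k) * S j k))"
      using sum_eta by (meson mult_bound_mono order_trans)
    then show ?thesis by (simp add: eq cong: sum.cong)
  qed
  define half where "half = (arcm (2 * H) i 0 (int H) :: int ^ 'n \<Rightarrow> complex)"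
  have per: "periodic (2 * H) half" "periodic (2 * H) (\<lambda>k. 1 - half k)"
    unfolding half_def arcm_def diff_0_right by (rule periodic_coord, simp)+
  have half1: "mult_bound (2 * H) p R half" unfolding half_def R_def by (rule mult_bound_arcm[OF M pq])
  have "mult_bound (2 * H) p (cmod 1 + R) (\<lambda>k. 1 - half k)"
    by (intro mult_bound_diff half1 mult_bound_const M p1)
  then have half: "mult_bound (2 * H) p R half" "mult_bound (2 * H) p (1 + R) (\<lambda>k. 1 - half k)"
    using half1 by simp_all
  have S_half: "S j k = half (k - axis i (u j)) * (1 - half (k - axis i (v j)))" if j: "j \<in> E" for j k
  proof -
    define X where "X = (k $ i - u j) mod (2 * int H)"
    have x: "0 \<le> X" "X < 2 * int H" using H by (simp_all add: X_def)
    have e: "- int H \<le> u j" "u j \<le> v j" "v j \<le> int H" "v j - u j \<le> int H" using ends[OF j] by auto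
    have "k $ i - v j = k $ i - u j - (v j - u j)" by simp
    then have "(k $ i - v j) mod (2 * int H) = (X - (v j - u j)) mod (2 * int H)" unfolding X_def by (simp only: mod_diff_left_eq)
    also have "\<dots> = (if X - (v j - u j) < 0 then X - (v j - u j) + 2 * int H else X - (v j - u j))"
      using x e H by (intro mod_pos_neg) auto
    finally have "(k $ i - v j) mod (2 * int H) = (if X - (v j - u j) < 0 then X - (v j - u j) + 2 * int H else X - (v j - u j))" .
    moreover have "S j k = (if X < v j - u j then 1 else 0)"
      by (simp add: S_def carc_arcm[OF H e(1-3)] arcm_def X_def)
    moreover have "half (k - axis i (u j)) = (if X < int H then 1 else 0)" by (simp add: half_def arcm_def X_def)
    moreover have "half (k - axis i (v j)) = (if (k $ i - v j) mod (2 * int H) < int H then 1 else 0)" by (simp add: half_def arcm_def)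
    ultimately show ?thesis using x e by auto
  qed
  show ?thesis
    unfolding mult_bound_def pq[symmetric]
  proof
    fix f :: "int ^ 'n \<Rightarrow> complex"
    let ?m = "\<lambda>k. \<Sum>j\<in>E. c j * carc H i (u j) (v j) k"
    define X where "X A x = (\<Sum>j\<in>E. sg A j *\<^sub>R (c j * mult_op (2 * H) (S j) (mult_op (2 * H) (\<Phi> j) f) x))" for A x
    have "\<exists>A\<subseteq>E. psum (2 * H) r (X A) \<le> rav E (\<lambda>A. psum (2 * H) r (X A))"
    proof (rule ccontr)
      assume "\<not> ?thesis"
      then have "(\<Sum>A\<in>Pow E. rav E (\<lambda>A. psum (2 * H) r (X A))) < (\<Sum>A\<in>Pow E. psum (2 * H) r (X A))"
        using finE by (intro sum_strict_mono) auto
      then show False using finE by (simp add: rav_def card_Pow)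
    qed
    then obtain A where A: "psum (2 * H) r (X A) \<le> rav E (\<lambda>A. psum (2 * H) r (X A))" by blast
    also have "\<dots> = rnorm (2 * H) r E (\<lambda>j x. c j * mult_op (2 * H) (S j) (mult_op (2 * H) (\<Phi> j) f) x)"
      by (simp add: rnorm_def X_def[abs_def])
    also have "\<dots> \<le> Kh r * rnorm (2 * H) r E (\<lambda>j. mult_op (2 * H) (S j) (mult_op (2 * H) (\<Phi> j) f))"
      using c by (intro rnorm_contraction finE) (auto simp: norm_mult intro!: mult_left_le_one_le)
    also have "rnorm (2 * H) r E (\<lambda>j. mult_op (2 * H) (S j) (mult_op (2 * H) (\<Phi> j) f)) =
       rnorm (2 * H) r E (\<lambda>j. mult_op (2 * H) (\<lambda>k. half (k - axis i (u j))) (mult_op (2 * H) (\<lambda>k. 1 - half (k - axis i (v j))) (mult_op (2 * H) (\<Phi> j) f)))"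
      unfolding mult_op_mult[OF M, of "\<lambda>k. half (k - axis i (u _))", symmetric]
      by (intro rnorm_cong mult_op_cong refl) (simp add: S_half)
    also have "\<dots> \<le> Kh r * Kh r * R ^ (2 * r) * rnorm (2 * H) r E (\<lambda>j. mult_op (2 * H) (\<lambda>k. 1 - half (k - axis i (v j))) (mult_op (2 * H) (\<Phi> j) f))"
      using R0 by (intro rnorm_mult_op_shift M finE r per half(1)[unfolded p_def]) auto
    also have "rnorm (2 * H) r E (\<lambda>j. mult_op (2 * H) (\<lambda>k. 1 - half (k - axis i (v j))) (mult_op (2 * H) (\<Phi> j) f)) \<le>
        Kh r * Kh r * (1 + R) ^ (2 * r) * rnorm (2 * H) r E (\<lambda>j. mult_op (2 * H) (\<Phi> j) f)"
      using R0 by (intro rnorm_mult_op_shift[where m = "\<lambda>k. 1 - half k"] M finE r per half(2)[unfolded p_def]) auto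
    also have "rnorm (2 * H) r E (\<lambda>j. mult_op (2 * H) (\<Phi> j) f) \<le> rav E (\<lambda>A. C0 ^ (2 * r) * psum (2 * H) r f)"
      unfolding rnorm_def
    proof (intro rav_mono finE)
      fix A
      have "(\<lambda>x. \<Sum>j\<in>E. sg A j *\<^sub>R mult_op (2 * H) (\<Phi> j) f x) = mult_op (2 * H) (W A) f"
        by (simp add: W_def[abs_def] mult_op_sum mult_op_scale scaleR_conv_of_real fun_eq_iff)
      then show "psum (2 * H) r (\<lambda>x. \<Sum>j\<in>E. sg A j *\<^sub>R mult_op (2 * H) (\<Phi> j) f x) \<le> C0 ^ (2 * r) * psum (2 * H) r f"
        using Wb[of A] C0 unfolding p_def by (subst (asm) mult_bound_psum[OF r(1)]) auto
    qed
    finally have "psum (2 * H) r (X A) \<le> Kh r * (Kh r * Kh r * R ^ (2 * r) * (Kh r * Kh r * (1 + R) ^ (2 * r) * (C0 ^ (2 * r) * psum (2 * H) r f)))"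
      using Kh_ge_1[of r] R0 finE by (simp add: mult_left_mono)
    also have "\<dots> = Kh r ^ 5 * ((R * (1 + R) * C0) ^ (2 * r) * psum (2 * H) r f)"
      by (simp add: power_mult_distrib eval_nat_numeral mult_ac)
    also have "\<dots> \<le> (Kh r ^ 5) ^ (2 * r) * ((R * (1 + R) * C0) ^ (2 * r) * psum (2 * H) r f)"
    proof (rule mult_right_mono)
      show "Kh r ^ 5 \<le> (Kh r ^ 5) ^ (2 * r)" using Kh_ge_1[of r] r by (intro self_le_power) auto
    qed simp
    finally have "psum (2 * H) r (X A) \<le> (Kh r ^ 5 * (R * (1 + R) * C0)) ^ (2 * r) * psum (2 * H) r f"
      by (simp add: power_mult_distrib mult_ac)
    then have X: "nrm (2 * H) p (X A) \<le> Kh r ^ 5 * (R * (1 + R) * C0) * nrm (2 * H) p f"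
      unfolding psum_nrm[OF r(1)] power_mult_distrib[symmetric] p_def
      using Kh_ge_1[of r] R0 C0 r by (subst (asm) power_mono_iff) auto
    define Y where "Y = mult_op (2 * H) (\<lambda>k. \<Sum>j\<in>E. of_real (sg A j) * c j * S j k) f"
    have Y: "Y x = X A x + mult_op (2 * H) (\<lambda>k. \<Sum>j\<in>E. of_real (sg A j) * c j * ((1 - \<Phi> j k) * S j k)) f x" for x
    proof -
      have "X A x = mult_op (2 * H) (\<lambda>k. \<Sum>j\<in>E. of_real (sg A j) * c j * (S j k * \<Phi> j k)) f x"
        unfolding X_def mult_op_mult[OF M, symmetric] by (simp add: mult_op_sum mult_op_scale scaleR_conv_of_real mult.assoc)
      then show ?thesis
        unfolding Y_def by (simp add: mult_op_add[symmetric] sum.distrib[symmetric] algebra_simps)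
    qed
    have "nrm (2 * H) p Y \<le> nrm (2 * H) p (X A) + C2 * nrm (2 * H) p f"
      using nrm_triangle[OF p1(1), of "2 * H" "X A" "mult_op (2 * H) (\<lambda>k. \<Sum>j\<in>E. of_real (sg A j) * c j * ((1 - \<Phi> j k) * S j k)) f"]
        mult_boundD[OF b3, of A f] by (simp add: Y[symmetric])
    with X have Yb: "nrm (2 * H) p Y \<le> (Kh r ^ 5 * (R * (1 + R) * C0) + C2) * nrm (2 * H) p f" by (simp add: algebra_simps)
    define Z where "Z = mult_op (2 * H) (\<lambda>k. \<Sum>j\<in>E. c j * ((1 - of_real (sg A j) * W A k) * S j k)) f"
    have eqZ: "mult_op (2 * H) ?m f x = mult_op (2 * H) (W A) Y x + Z x" for x
      unfolding Z_def Y_def mult_op_mult[OF M, symmetric] mult_op_add[symmetric]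
      by (simp add: sum_distrib_left sum.distrib[symmetric] S_def[symmetric] algebra_simps)
    have "nrm (2 * H) p (mult_op (2 * H) ?m f) = nrm (2 * H) p (\<lambda>x. mult_op (2 * H) (W A) Y x + Z x)"
      by (intro nrm_cong) (simp only: eqZ)
    also have "\<dots> \<le> nrm (2 * H) p (mult_op (2 * H) (W A) Y) + nrm (2 * H) p Z"
      by (rule nrm_triangle[OF p1(1)])
    also have "\<dots> \<le> C0 * ((Kh r ^ 5 * (R * (1 + R) * C0) + C2) * nrm (2 * H) p f) + C2 * nrm (2 * H) p f"
      using C0 by (intro add_mono order_trans[OF mult_boundD[OF Wb]] mult_left_mono Yb mult_boundD[OF b2, folded Z_def]) (auto simp: Z_def intro: mult_boundD[OF b2])
    also have "\<dots> = ringC q * nrm (2 * H) p f"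
      unfolding ringC_def C2_def C0_def R_def r_def by (simp add: algebra_simps)
    finally show "nrm (2 * H) p (mult_op (2 * H) ?m f) \<le> ringC q * nrm (2 * H) p f" .
  qed
qed

definition lac_breaks :: "nat \<Rightarrow> nat \<Rightarrow> int set" where
  "lac_breaks s L = lw s ` {1..L} \<union> uminus ` lw s ` {1..L}"

definition lac :: "nat \<Rightarrow> nat \<Rightarrow> nat \<Rightarrow> 'n \<Rightarrow> int ^ 'n \<Rightarrow> int set" where
  "lac H s L i k = {b \<in> lac_breaks s L. b \<le> cen H (k $ i)}"

definition lacC :: "nat \<Rightarrow> real" where
  "lacC q = 4 * ringC q + 3 * (cotlar q + 2)"

lemma ring_sum:
  fixes w :: "nat \<Rightarrow> int" and \<gamma> :: "nat \<Rightarrow> complex"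
  assumes w: "\<And>j l. j \<le> l \<Longrightarrow> w l \<le> w j" and L: "L \<ge> 1"
  shows "n < w L \<or> w 1 \<le> n \<Longrightarrow> (\<Sum>j<L - 1. \<gamma> j * (if w (j + 2) \<le> n \<and> n < w (j + 1) then 1 else 0)) = 0"
    and "w L \<le> n \<Longrightarrow> n < w 1 \<Longrightarrow> \<exists>j<L - 1. w (j + 2) \<le> n \<and> n < w (j + 1) \<and>
       (\<Sum>j<L - 1. \<gamma> j * (if w (j + 2) \<le> n \<and> n < w (j + 1) then 1 else 0)) = \<gamma> j"
proof -
  assume n: "n < w L \<or> w 1 \<le> n"
  show "(\<Sum>j<L - 1. \<gamma> j * (if w (j + 2) \<le> n \<and> n < w (j + 1) then 1 else 0)) = 0"
  proof (rule sum.neutral, rule ballI)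
    fix j assume "j \<in> {..<L - 1}"
    then have "w L \<le> w (j + 2)" "w (j + 1) \<le> w 1" by (auto intro!: w)
    then show "\<gamma> j * (if w (j + 2) \<le> n \<and> n < w (j + 1) then 1 else 0) = 0" using n by auto
  qed
next
  assume n: "w L \<le> n" "n < w 1"
  define l where "l = (LEAST l. 1 \<le> l \<and> w l \<le> n)"
  have l: "1 \<le> l" "w l \<le> n" "l \<le> L"
    unfolding l_def using LeastI[of "\<lambda>l. 1 \<le> l \<and> w l \<le> n" L] Least_le[of "\<lambda>l. 1 \<le> l \<and> w l \<le> n" L] n L by auto
  have l2: "l \<ge> 2" using l n by (cases "l = 1") auto
  have "l - 1 < l" using l2 by simp
  then have "\<not> (1 \<le> l - 1 \<and> w (l - 1) \<le> n)" unfolding l_def by (rule not_less_Least)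
  then have lt: "n < w (l - 1)" using l2 by auto
  define j where "j = l - 2"
  have j: "j < L - 1" "w (j + 2) \<le> n" "n < w (j + 1)" 
  proof -
    have "j + 2 = l" "j + 1 = l - 1" using l2 by (auto simp: j_def)
    then show "j < L - 1" "w (j + 2) \<le> n" "n < w (j + 1)" using l lt by auto
  qed
  have "(\<Sum>i<L - 1. \<gamma> i * (if w (i + 2) \<le> n \<and> n < w (i + 1) then 1 else 0)) = (\<Sum>i<L - 1. if i = j then \<gamma> j else 0)"
  proof (intro sum.cong refl)
    fix i
    consider "i = j" | "i < j" | "j < i" by linarith
    then show "\<gamma> i * (if w (i + 2) \<le> n \<and> n < w (i + 1) then 1 else 0) = (if i = j then \<gamma> j else 0)"
    proof cases
      case 2
      then have "w (j + 1) \<le> w (i + 2)" by (intro w) auto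
      then show ?thesis using j 2 by auto
    next
      case 3
      then have "w (i + 1) \<le> w (j + 2)" by (intro w) auto
      then show ?thesis using j 3 by auto
    qed (use j in simp)
  qed
  then show "\<exists>j<L - 1. w (j + 2) \<le> n \<and> n < w (j + 1) \<and>
       (\<Sum>j<L - 1. \<gamma> j * (if w (j + 2) \<le> n \<and> n < w (j + 1) then 1 else 0)) = \<gamma> j"
    using j by (intro exI[of _ j]) simp
qed

lemma ringC_nonneg: "ringC q \<ge> 0"
  using cotlar_ge_1[of q] lpC_ge_1[of "2 ^ q"] Kh_ge_1[of "2 ^ q"] by (simp add: ringC_def)

lemma lacC_nonneg: "lacC q \<ge> 0"
  using cotlar_ge_1[of q] ringC_nonneg[of q] by (simp add: lacC_def)

lemma lp_partition_lac:
  assumes H: "H > 0" and s: "2 ^ s \<le> H" and q: "q \<ge> 1" and L: "L\<^sup>2 \<le> s" "L \<ge> 1"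
  shows "lp_partition (2 * H) (real (2 * 2 ^ q)) (lacC q) (lac H s L i :: int ^ 'n::finite \<Rightarrow> int set)"
  unfolding lp_partition_def
proof (intro allI impI)
  fix c :: "int set \<Rightarrow> complex" assume c: "\<forall>z. cmod (c z) \<le> 1"
  define p where "p = real (2 * 2 ^ q)"
  have p1: "p \<ge> 1" using one_le_power[of "2::real" "Suc q"] by (simp add: p_def)
  define w where "w = lw s"
  define val where "val n = c {b \<in> lac_breaks s L. b \<le> n}" for n
  have val1: "cmod (val n) \<le> 1" for n using c by (simp add: val_def)
  have wpos: "w j > 0" for j by (simp add: w_def)
  have w: "w l \<le> w j" if "j \<le> l" for j l using that unfolding w_def by (rule lw_antimono)
  have wH: "w j \<le> int H" for j
  proof -
    have "lw s j \<le> 2 ^ s" unfolding lw_def by (intro power_increasing) auto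
    also have "\<dots> \<le> int H" using s by (metis of_nat_le_iff of_nat_numeral of_nat_power)
    finally show ?thesis by (simp add: w_def)
  qed
  have breaks: "b \<in> lac_breaks s L \<longleftrightarrow> (\<exists>l. 1 \<le> l \<and> l \<le> L \<and> (b = w l \<or> b = - w l))" for b
    by (auto simp: lac_breaks_def w_def)
  have val_eq: "val n = val u" if "u \<le> n" "\<And>l. 1 \<le> l \<Longrightarrow> l \<le> L \<Longrightarrow> w l \<le> n \<Longrightarrow> w l \<le> u" "\<And>l. 1 \<le> l \<Longrightarrow> l \<le> L \<Longrightarrow> - w l \<le> n \<Longrightarrow> - w l \<le> u" for n u
  proof -
    have "b \<le> n \<longleftrightarrow> b \<le> u" if "b \<in> lac_breaks s L" for b
      using that \<open>u \<le> n\<close> that(1) \<open>\<And>l. 1 \<le> l \<Longrightarrow> l \<le> L \<Longrightarrow> w l \<le> n \<Longrightarrow> w l \<le> u\<close> \<open>\<And>l. 1 \<le> l \<Longrightarrow> l \<le> L \<Longrightarrow> - w l \<le> n \<Longrightarrow> - w l \<le> u\<close>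
      unfolding breaks by (metis order_trans)
    then have "{b \<in> lac_breaks s L. b \<le> n} = {b \<in> lac_breaks s L. b \<le> u}" by auto
    then show ?thesis by (simp add: val_def)
  qed
  define RR where "RR k = (\<Sum>j<L - 1. val (w (j + 2)) * carc H i (w (j + 2)) (w (j + 1)) k)" for k :: "int ^ 'n"
  define RL where "RL k = (\<Sum>j<L - 1. val (- w (j + 1)) * carc H i (- w (j + 1)) (- w (j + 2)) k)" for k :: "int ^ 'n"
  define OC where "OC k = val (w 1) * carc H i (w 1) (int H) k + val (- w L) * carc H i (- w L) (w L) k + val (- int H) * carc H i (- int H) (- w 1) k" for k :: "int ^ 'n"
  have id: "c (lac H s L i k) = RR k + RL k + OC k" for k
  proof -
    define n where "n = cen H (k $ i)"
    have nb: "- int H \<le> n" "n < int H" using cen_bounds[OF H] by (auto simp: n_def)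
    have wL: "w L \<le> w 1" using L by (intro w) auto
    have RRn: "RR k = (\<Sum>j<L - 1. val (w (j + 2)) * (if w (j + 2) \<le> n \<and> n < w (j + 1) then 1 else 0))"
      by (simp add: RR_def carc_def n_def)
    have RLn: "RL k = (\<Sum>j<L - 1. val (- w (j + 1)) * (if w (j + 2) \<le> - n - 1 \<and> - n - 1 < w (j + 1) then 1 else 0))"
    proof -
      have "(- w (j + 1) \<le> n \<and> n < - w (j + 2)) = (w (j + 2) \<le> - n - 1 \<and> - n - 1 < w (j + 1))" for j by auto
      then show ?thesis by (simp add: RL_def carc_def n_def)
    qed
    have OCn: "OC k = (if w 1 \<le> n then val (w 1) else 0) + (if - w L \<le> n \<and> n < w L then val (- w L) else 0) + (if n < - w 1 then val (- int H) else 0)"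
      using nb by (simp add: OC_def carc_def n_def)
    have lhs: "c (lac H s L i k) = val n" by (simp add: lac_def val_def n_def)
    consider "w 1 \<le> n" | "w L \<le> n" "n < w 1" | "- w L \<le> n" "n < w L" | "- w 1 \<le> n" "n < - w L" | "n < - w 1" by linarith
    then show ?thesis
    proof cases
      case 1
      have "val n = val (w 1)"
      proof (rule val_eq)
        fix l assume l: "1 \<le> l" "l \<le> L"
        show "w l \<le> w 1" using l by (intro w)
        show "- w l \<le> w 1" using wpos[of l] wpos[of 1] by linarith
      qed (use 1 in simp)
      moreover have "RR k = 0" unfolding RRn by (rule ring_sum(1)[OF w L(2)]) (use 1 in auto)
      moreover have "RL k = 0" unfolding RLn by (rule ring_sum(1)[OF w L(2)]) (use 1 wpos[of 1] wpos[of L] in auto)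
      ultimately show ?thesis unfolding lhs OCn using 1 wL wpos[of 1] wpos[of L] by auto
    next
      case 2
      obtain j where j: "j < L - 1" "w (j + 2) \<le> n" "n < w (j + 1)" "RR k = val (w (j + 2))"
        unfolding RRn using ring_sum(2)[OF w L(2) 2, of "\<lambda>j. val (w (j + 2))"] by blast
      have "val n = val (w (j + 2))"
      proof (rule val_eq[OF j(2)])
        fix l assume l: "1 \<le> l" "l \<le> L"
        show "w l \<le> w (j + 2)" if "w l \<le> n"
        proof -
          have "\<not> l \<le> j + 1" using w[of l "j + 1"] that j(3) by auto
          then show ?thesis by (intro w) simp
        qed
        show "- w l \<le> w (j + 2)" using wpos[of l] wpos[of "j + 2"] by linarith
      qed
      moreover have "RL k = 0" unfolding RLn by (rule ring_sum(1)[OF w L(2)]) (use 2 wpos[of 1] wpos[of L] in auto)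
      ultimately show ?thesis unfolding lhs OCn j(4) using 2 wpos[of 1] wpos[of L] by auto
    next
      case 3
      have "val n = val (- w L)"
      proof (rule val_eq[OF 3(1)])
        fix l assume l: "1 \<le> l" "l \<le> L"
        show "w l \<le> - w L" if "w l \<le> n" using w[of l L] l that 3 by auto
        show "- w l \<le> - w L" using w[of l L] l by auto
      qed
      moreover have "RR k = 0" unfolding RRn by (rule ring_sum(1)[OF w L(2)]) (use 3 in auto)
      moreover have "RL k = 0" unfolding RLn by (rule ring_sum(1)[OF w L(2)]) (use 3 in auto)
      ultimately show ?thesis unfolding lhs OCn using 3 wL wpos[of 1] wpos[of L] by auto
    next
      case 4
      then have n': "w L \<le> - n - 1" "- n - 1 < w 1" by auto
      obtain j where j: "j < L - 1" "w (j + 2) \<le> - n - 1" "- n - 1 < w (j + 1)" "RL k = val (- w (j + 1))"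
        unfolding RLn using ring_sum(2)[OF w L(2) n', of "\<lambda>j. val (- w (j + 1))"] by blast
      have "val n = val (- w (j + 1))"
      proof (rule val_eq)
        show "- w (j + 1) \<le> n" using j(3) by simp
        fix l assume l: "1 \<le> l" "l \<le> L"
        show "w l \<le> - w (j + 1)" if "w l \<le> n" using that 4 wpos[of l] wpos[of L] by linarith
        show "- w l \<le> - w (j + 1)" if "- w l \<le> n"
        proof -
          have "\<not> j + 2 \<le> l" using w[of "j + 2" l] that j(2) by auto
          then have "w (j + 1) \<le> w l" by (intro w) simp
          then show ?thesis by simp
        qed
      qed
      moreover have "RR k = 0" unfolding RRn by (rule ring_sum(1)[OF w L(2)]) (use 4 wpos[of L] in auto)
      ultimately show ?thesis unfolding lhs OCn j(4) using 4 wpos[of 1] wpos[of L] by auto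
    next
      case 5
      have "val n = val (- int H)"
      proof (rule val_eq[OF nb(1)])
        fix l assume l: "1 \<le> l" "l \<le> L"
        show "w l \<le> - int H" if "w l \<le> n" using that 5 wpos[of l] wpos[of 1] by linarith
        show "- w l \<le> - int H" if "- w l \<le> n" using that 5 w[of 1 l] l by linarith
      qed
      moreover have "RR k = 0" unfolding RRn by (rule ring_sum(1)[OF w L(2)]) (use 5 wpos[of 1] wpos[of L] in auto)
      moreover have "RL k = 0" unfolding RLn by (rule ring_sum(1)[OF w L(2)]) (use 5 in auto)
      ultimately show ?thesis unfolding lhs OCn using 5 wL wpos[of 1] wpos[of L] by auto
    qed
  qed
  have fam: "mult_bound (2 * H) p (ringC q) (\<lambda>k :: int ^ 'n. \<Sum>j\<in>{j. j < L - 1 \<and> even (j + e)}. \<gamma> j * carc H i (u j) (v j) k)"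
    if "\<And>j. cmod (\<gamma> j) \<le> 1" "\<And>j. u j = w (j + 2) \<and> v j = w (j + 1) \<or> u j = - w (j + 1) \<and> v j = - w (j + 2)" for \<gamma> u v e
    unfolding p_def using that L by (intro ring_family[OF H s q L(1)]) (auto simp: w_def)
  have split: "(\<Sum>j<L - 1. F j) = (\<Sum>j\<in>{j. j < L - 1 \<and> even (j + 0)}. F j) + (\<Sum>j\<in>{j. j < L - 1 \<and> even (j + 1)}. F j)" for F :: "nat \<Rightarrow> complex"
    by (subst sum.union_disjoint[symmetric]) (auto intro!: sum.cong)
  have bRR: "mult_bound (2 * H) p (ringC q + ringC q) RR"
    unfolding RR_def[abs_def] split by (intro mult_bound_add[OF p1] fam val1) auto
  have bRL: "mult_bound (2 * H) p (ringC q + ringC q) RL"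
    unfolding RL_def[abs_def] split by (intro mult_bound_add[OF p1] fam val1) auto
  have one: "mult_bound (2 * H) p (cotlar q + 2) (\<lambda>k :: int ^ 'n. val n * carc H i u v k)" if "- int H \<le> u" "u \<le> v" "v \<le> int H" for n u v
  proof -
    have "mult_bound (2 * H) p (cmod (val n) * (cotlar q + 2)) (\<lambda>k :: int ^ 'n. val n * carc H i u v k)"
      using p1 that by (intro mult_bound_scale mult_bound_carc H) (auto simp: p_def)
    moreover have "cmod (val n) * (cotlar q + 2) \<le> cotlar q + 2"
      using val1[of n] cotlar_ge_1[of q] by (intro mult_left_le_one_le) auto
    ultimately show ?thesis by (rule mult_bound_mono)
  qed
  have bOC: "mult_bound (2 * H) p ((cotlar q + 2) + (cotlar q + 2) + (cotlar q + 2)) OC"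
    unfolding OC_def[abs_def] using wH[of 1] wH[of L] wpos[of 1] wpos[of L]
    by (intro mult_bound_add[OF p1] one) auto
  have "mult_bound (2 * H) p ((ringC q + ringC q) + (ringC q + ringC q) + ((cotlar q + 2) + (cotlar q + 2) + (cotlar q + 2))) (\<lambda>k. RR k + RL k + OC k)"
    by (intro mult_bound_add[OF p1] bRR bRL bOC)
  then show "mult_bound (2 * H) (real (2 * 2 ^ q)) (lacC q) (\<lambda>k. c (lac H s L i k))"
    unfolding id lacC_def p_def by (simp add: algebra_simps)
qed

lemma periodic_lac: "periodic (2 * H) (lac H s L i)"
  unfolding periodic_def
proof (intro allI impI)
  fix x y :: "int ^ 'a" assume "\<forall>i. x $ i mod int (2 * H) = y $ i mod int (2 * H)"
  then have "cen H (x $ i) = cen H (y $ i)" by (intro cen_cong) simp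
  then show "lac H s L i x = lac H s L i y" by (simp add: lac_def)
qed

fun genC :: "nat \<Rightarrow> nat \<Rightarrow> real" where
  "genC q 0 = 1"
| "genC q (Suc t) = Kh (2 ^ q) ^ 4 * (genC q t * lacC q)\<^sup>2"

lemma genC_nonneg: "genC q t \<ge> 0"
  using Kh_ge_1[of "2 ^ q"] by (cases t) auto

lemma lp_generations:
  fixes cell :: "nat \<Rightarrow> int \<Rightarrow> int" and \<nu> :: "'n::finite \<Rightarrow> nat"
  assumes H: "H > 0" and q: "q \<ge> 1"
    and par: "\<And>n. n < N \<Longrightarrow> 2 ^ s n \<le> H \<and> (L n)\<^sup>2 \<le> s n \<and> L n \<ge> 1"
    and cell0: "\<And>x y. x \<in> {0..<2 * int H} \<Longrightarrow> y \<in> {0..<2 * int H} \<Longrightarrow> cell 0 x = cell 0 y"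
    and cellS: "\<And>n x y. n < N \<Longrightarrow> x \<in> {0..<2 * int H} \<Longrightarrow> y \<in> {0..<2 * int H} \<Longrightarrow> cell n x = cell n y \<Longrightarrow>
       {b \<in> lac_breaks (s n) (L n). b \<le> cen H (x - a n (cell n x))} = {b \<in> lac_breaks (s n) (L n). b \<le> cen H (y - a n (cell n y))} \<Longrightarrow>
       cell (Suc n) x = cell (Suc n) y"
    and \<nu>: "\<And>i. \<nu> i \<le> N"
  shows "lp_partition (2 * H) (real (2 * 2 ^ q)) (genC q (\<Sum>i\<in>UNIV. \<nu> i)) (\<lambda>k :: int ^ 'n. \<lambda>i. cell (\<nu> i) (k $ i))"
  using \<nu>
proof (induction "\<Sum>i\<in>UNIV. \<nu> i" arbitrary: \<nu>)
  case 0
  have M: "2 * H > 0" using H by simp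
  have p: "real (2 * 2 ^ q) > 0" by simp
  from 0 have \<nu>0: "\<nu> i = 0" for i by simp
  show ?case
    unfolding lp_partition_def
  proof (intro allI impI)
    fix c :: "('n \<Rightarrow> int) \<Rightarrow> complex" assume c: "\<forall>z. cmod (c z) \<le> 1"
    have "mult_bound (2 * H) (real (2 * 2 ^ q)) (cmod (c (\<lambda>i. cell 0 0))) (\<lambda>k :: int ^ 'n. c (\<lambda>i. cell 0 0))"
      by (rule mult_bound_const[OF M p])
    moreover have "c (\<lambda>i. cell 0 0) = c (\<lambda>i. cell (\<nu> i) (k $ i))" if "k \<in> grid (2 * H)" for k :: "int ^ 'n"
      unfolding \<nu>0 using that H by (intro arg_cong[where f=c] ext cell0) (auto simp: grid_def)
    ultimately have "mult_bound (2 * H) (real (2 * 2 ^ q)) (cmod (c (\<lambda>i. cell 0 0))) (\<lambda>k :: int ^ 'n. c (\<lambda>i. cell (\<nu> i) (k $ i)))"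
      by (rule mult_bound_cong)
    then show "mult_bound (2 * H) (real (2 * 2 ^ q)) (genC q (\<Sum>i\<in>UNIV. \<nu> i)) (\<lambda>k :: int ^ 'n. c (\<lambda>i. cell (\<nu> i) (k $ i)))"
      using c \<nu>0 by (auto intro: mult_bound_mono)
  qed
next
  case (Suc t)
  have M: "2 * H > 0" using H by simp
  obtain i where i: "\<nu> i > 0" using Suc(2) by (metis not_gr_zero sum.neutral old.nat.distinct(1))
  define n where "n = \<nu> i - 1"
  have n: "\<nu> i = Suc n" "n < N" using i Suc(3)[of i] by (auto simp: n_def)
  define \<nu>' where "\<nu>' = \<nu>(i := n)"
  have "(\<Sum>j\<in>UNIV. \<nu> j) = Suc (\<Sum>j\<in>UNIV. \<nu>' j)"
    using sum.remove[of UNIV i \<nu>] sum.remove[of UNIV i \<nu>'] n by (simp add: \<nu>'_def)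
  then have t: "t = (\<Sum>j\<in>UNIV. \<nu>' j)" using Suc(2) by simp
  have \<nu>'N: "\<nu>' j \<le> N" for j using Suc(3)[of j] n by (auto simp: \<nu>'_def)
  have IH: "lp_partition (2 * H) (real (2 * 2 ^ q)) (genC q t) (\<lambda>k :: int ^ 'n. \<lambda>i. cell (\<nu>' i) (k $ i))"
    using Suc(1)[OF t \<nu>'N] t by simp
  let ?\<pi> = "\<lambda>k :: int ^ 'n. \<lambda>i. cell (\<nu>' i) (k $ i)"
  let ?a = "\<lambda>z. axis i (a n (z i)) :: int ^ 'n"
  have "lp_partition (2 * H) (real (2 * 2 ^ q)) (Kh (2 ^ q) ^ 4 * (genC q t * lacC q)\<^sup>2)
    (\<lambda>k. (?\<pi> k, lac H (s n) (L n) i (k - ?a (?\<pi> k))))"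
    using par[OF n(2)] q
    by (intro lp_partition_refine[OF M] IH lp_partition_lac H periodic_lac genC_nonneg lacC_nonneg) auto
  then have "lp_partition (2 * H) (real (2 * 2 ^ q)) (Kh (2 ^ q) ^ 4 * (genC q t * lacC q)\<^sup>2) (\<lambda>k :: int ^ 'n. \<lambda>i. cell (\<nu> i) (k $ i))"
  proof (rule lp_partition_coarsen)
    fix k l :: "int ^ 'n" assume k: "k \<in> grid (2 * H)" and l: "l \<in> grid (2 * H)"
      and eq: "(?\<pi> k, lac H (s n) (L n) i (k - ?a (?\<pi> k))) = (?\<pi> l, lac H (s n) (L n) i (l - ?a (?\<pi> l)))"
    have kl: "k $ j \<in> {0..<2 * int H}" "l $ j \<in> {0..<2 * int H}" for j using k l by (auto simp: grid_def)
    have cells: "cell (\<nu>' j) (k $ j) = cell (\<nu>' j) (l $ j)" for j using eq by (metis prod.inject)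
    show "(\<lambda>i. cell (\<nu> i) (k $ i)) = (\<lambda>i. cell (\<nu> i) (l $ i))"
    proof
      fix j
      show "cell (\<nu> j) (k $ j) = cell (\<nu> j) (l $ j)"
      proof (cases "j = i")
        case True
        have "cell n (k $ i) = cell n (l $ i)" using cells[of i] by (simp add: \<nu>'_def)
        moreover have "{b \<in> lac_breaks (s n) (L n). b \<le> cen H (k $ i - a n (cell n (k $ i)))} = {b \<in> lac_breaks (s n) (L n). b \<le> cen H (l $ i - a n (cell n (l $ i)))}"
          using eq by (simp add: lac_def \<nu>'_def)
        ultimately show ?thesis unfolding True n(1) by (intro cellS n kl)
      next
        case False then show ?thesis using cells[of j] by (simp add: \<nu>'_def)
      qed
    qed
  qed
  then show ?case using Suc(2) by (metis genC.simps(2))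
qed

section \<open>The homeomorphism of the circle\<close>

lemma nested_partition_function:
  fixes e :: "nat \<Rightarrow> int \<Rightarrow> real" and N :: "nat \<Rightarrow> nat" and B :: "nat \<Rightarrow> nat"
  assumes strict: "\<And>n k. e n k < e n (k + 1)" and per: "\<And>n k. e n (k + int (N n)) = e n k + 1"
    and e0: "\<And>k. e 0 k = of_int k" and N0: "N 0 = 1" and NS: "\<And>n. N (Suc n) = N n * B n" and B: "\<And>n. B n \<ge> 2"
    and nest: "\<And>n k. e (Suc n) (k * int (B n)) = e n k" and mesh: "\<And>n k. e n (k + 1) - e n k \<le> (1/2) ^ n"
  obtains h :: "real \<Rightarrow> real" where "strict_mono h" "continuous_on UNIV h" "\<And>x. h (x + 1) = h x + 1"
    "\<And>n k. h (e n k) = of_int k / real (N n)"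
proof -
  have Npow: "N n \<ge> 2 ^ n" for n
  proof (induction n)
    case (Suc n)
    have "2 ^ n * 2 \<le> N n * B n" using Suc B by (intro mult_mono) auto
    then show ?case by (simp add: NS mult.commute)
  qed (simp add: N0)
  have Npos: "N n > 0" for n using Npow[of n] by (metis gr0I le_zero_eq power_not_zero zero_neq_numeral)
  have mono: "e n k < e n l" if "k < l" for n k l
    using that
  proof (induction l rule: int_gr_induct)
    case base then show ?case by (rule strict)
  next
    case (step l) then show ?case using strict[of n l] by simp
  qed
  have less_iff: "e n k < e n l \<longleftrightarrow> k < l" for n k l using mono by (metis less_asym linorder_neqE_linordered_idom less_irrefl)
  have le_iff: "e n k \<le> e n l \<longleftrightarrow> k \<le> l" for n k l using less_iff by (metis linorder_not_le)
  have lift: "\<exists>c>0. N (n + d) = N n * c \<and> (\<forall>k. e n k = e (n + d) (k * int c))" for n d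
  proof (induction d)
    case 0 show ?case by (rule exI[of _ 1]) simp
  next
    case (Suc d)
    then obtain c where c: "c > 0" "N (n + d) = N n * c" "\<And>k. e n k = e (n + d) (k * int c)" by blast
    have "c * B (n + d) > 0" using c(1) B[of "n + d"] by simp
    moreover have "e n k = e (n + Suc d) (k * int (c * B (n + d)))" for k
      using nest[of "n + d" "k * int c"] c(3)[of k] by (simp add: mult.assoc)
    ultimately show ?case using c(2) NS[of "n + d"] by (intro exI[of _ "c * B (n + d)"]) (auto simp: mult.assoc)
  qed
  have cmp: "e n k \<le> e m l \<longleftrightarrow> real_of_int k / real (N n) \<le> real_of_int l / real (N m)" for n k m l
  proof -
    obtain c where c: "c > 0" "N (n + m) = N n * c" "\<And>k. e n k = e (n + m) (k * int c)" using lift[of n m] by blast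
    obtain d where d: "d > 0" "N (n + m) = N m * d" "\<And>k. e m k = e (n + m) (k * int d)" using lift[of m n] by (auto simp: add.commute)
    have "e n k \<le> e m l \<longleftrightarrow> k * int c \<le> l * int d" using c(3) d(3) le_iff by simp
    also have "\<dots> \<longleftrightarrow> real_of_int (k * int c) \<le> real_of_int (l * int d)" by (simp only: of_int_le_iff)
    also have "\<dots> \<longleftrightarrow> real_of_int (k * int c) / real (N (n + m)) \<le> real_of_int (l * int d) / real (N (n + m))"
      using Npos[of "n + m"] by (simp add: divide_le_cancel)
    also have "real_of_int (k * int c) / real (N (n + m)) = real_of_int k / real (N n)" using c by simp
    also have "real_of_int (l * int d) / real (N (n + m)) = real_of_int l / real (N m)" using d by simp
    finally show ?thesis .
  qed
  have cmp': "e n k < e m l \<longleftrightarrow> real_of_int k / real (N n) < real_of_int l / real (N m)" for n k m l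
    using cmp[of m l n k] by (simp add: not_le[symmetric])
  define S where "S x = {real_of_int k / real (N n) | n k. e n k \<le> x}" for x
  define h where "h x = Sup (S x)" for x
  have S_mem: "real_of_int k / real (N n) \<in> S x" if "e n k \<le> x" for n k x using that by (auto simp: S_def)
  have S_ne: "S x \<noteq> {}" for x using S_mem[of 0 "\<lfloor>x\<rfloor>" x] e0 by auto
  have S_ub: "y \<le> real_of_int l / real (N m)" if "y \<in> S x" "x \<le> e m l" for x y m l
  proof -
    obtain n k where y: "y = real_of_int k / real (N n)" "e n k \<le> x" using \<open>y \<in> S x\<close> unfolding S_def by blast
    then have "e n k \<le> e m l" using that(2) by simp
    then show ?thesis using cmp y(1) by simp
  qed
  have S_bdd: "bdd_above (S x)" for x
  proof (rule bdd_aboveI)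
    fix y assume "y \<in> S x"
    then show "y \<le> real_of_int (\<lfloor>x\<rfloor> + 1) / real (N 0)" by (rule S_ub) (use e0[of "\<lfloor>x\<rfloor> + 1"] in linarith)
  qed
  have h_e: "h (e n k) = real_of_int k / real (N n)" for n k
    unfolding h_def by (rule cSup_eq_maximum) (auto intro: S_mem S_ub)
  have h_mono: "h x \<le> h y" if "x \<le> y" for x y
    unfolding h_def by (rule cSup_subset_mono[OF S_ne S_bdd]) (use that in \<open>force simp: S_def\<close>)
  have e_int: "e n (j * int (N n)) = of_int j" for n j
  proof -
    obtain c where c: "N (0 + n) = N 0 * c" "\<And>k. e 0 k = e (0 + n) (k * int c)" using lift[of 0 n] by blast
    then show ?thesis using e0[of j] N0 by simp
  qed
  have bracket: "\<exists>k. e n k \<le> x \<and> x < e n (k + 1)" for n x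
  proof -
    define f where "f i = e n (\<lfloor>x\<rfloor> * int (N n) + int i)" for i
    have "x < f (N n)" unfolding f_def per e_int by linarith
    define i where "i = (LEAST i. x < f i)"
    have i: "x < f i" unfolding i_def using \<open>x < f (N n)\<close> by (rule LeastI)
    have "f 0 \<le> x" by (simp add: f_def e_int)
    then obtain i' where i': "i = Suc i'" using i by (cases i) auto
    then have "\<not> x < f i'" unfolding i_def by (metis lessI not_less_Least)
    then show ?thesis using i i' by (intro exI[of _ "\<lfloor>x\<rfloor> * int (N n) + int i'"]) (auto simp: f_def add.assoc add.commute[of 1])
  qed
  have small: "\<exists>n. c / real (N n) < \<epsilon> \<and> c * (1/2) ^ n < \<epsilon>" if "\<epsilon> > 0" "c > 0" for \<epsilon> c :: real
  proof -
    have "\<epsilon> / c > 0" using that by simp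
    then obtain n where n: "(1/2::real) ^ n < \<epsilon> / c" using real_arch_pow_inv[of "\<epsilon> / c" "1/2"] by auto
    have "(2::real) ^ n \<le> real (N n)" using Npow[of n] by (metis of_nat_le_iff of_nat_numeral of_nat_power)
    then have "c / real (N n) \<le> c / 2 ^ n" using that Npos[of n] by (intro divide_left_mono) auto
    also have "\<dots> = c * (1/2) ^ n" by (simp add: power_one_over)
    also have "\<dots> < \<epsilon>" using n that by (simp add: field_simps)
    finally show ?thesis using n that by (auto simp: field_simps)
  qed
  have strictm: "strict_mono h"
  proof (rule strict_monoI)
    fix x y :: real assume xy: "x < y"
    obtain n where n: "2 * (1/2) ^ n < y - x" using small[of "y - x" 2] xy by auto
    obtain k where k: "e n k \<le> x" "x < e n (k + 1)" using bracket by blast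
    have "e n (k + 2) \<le> y" proof -
      have "k + 1 + 1 = k + 2" by simp
      then show ?thesis using mesh[of n k] mesh[of n "k + 1"] n k by (simp only:)
    qed
    then have "h (e n (k + 2)) \<le> h y" by (rule h_mono)
    moreover have "h x \<le> h (e n (k + 1))" using k by (intro h_mono) simp
    moreover have "h (e n (k + 1)) < h (e n (k + 2))" using Npos[of n] by (simp add: h_e divide_strict_right_mono)
    ultimately show "h x < h y" by linarith
  qed
  have h_br: "of_int k / real (N n) \<le> h x \<and> h x \<le> (of_int k + 1) / real (N n)" if "e n k \<le> x" "x \<le> e n (k + 1)" for n k x
    using h_mono[OF that(1)] h_mono[OF that(2)] by (simp add: h_e)
  have cont: "continuous_on UNIV h"
    unfolding continuous_on_iff
  proof (intro ballI allI impI)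
    fix x \<epsilon> :: real assume \<epsilon>: "\<epsilon> > 0"
    obtain n where n: "2 / real (N n) < \<epsilon>" using small[of \<epsilon> 2] \<epsilon> by auto
    obtain k where k: "e n k \<le> x" "x < e n (k + 1)" using bracket by blast
    have k1: "e n (k - 1) < e n k" using strict[of n "k - 1"] by simp
    define \<delta> where "\<delta> = min (x - e n (k - 1)) (e n (k + 1) - x)"
    have \<delta>: "\<delta> > 0" using k k1 by (auto simp: \<delta>_def)
    have "dist (h y) (h x) < \<epsilon>" if "dist y x < \<delta>" for y
    proof -
      have y: "e n (k - 1) \<le> y" "y \<le> e n (k + 1)" using that by (auto simp: \<delta>_def dist_real_def)
      have "(of_int k - 1) / real (N n) \<le> h y" "h y \<le> (of_int k + 1) / real (N n)"
        using h_mono[OF y(1)] h_mono[OF y(2)] by (simp_all add: h_e)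
      moreover have "of_int k / real (N n) \<le> h x" "h x \<le> (of_int k + 1) / real (N n)" using h_br k by auto
      ultimately show ?thesis using n unfolding dist_real_def by (simp add: diff_divide_distrib add_divide_distrib)
    qed
    then show "\<exists>d>0. \<forall>x'\<in>UNIV. dist x' x < d \<longrightarrow> dist (h x') (h x) < \<epsilon>" using \<delta> by blast
  qed
  have shift: "h (x + 1) = h x + 1" for x
  proof (rule ccontr)
    assume "h (x + 1) \<noteq> h x + 1"
    then have "\<bar>h (x + 1) - h x - 1\<bar> > 0" by simp
    then obtain n where n: "1 / real (N n) < \<bar>h (x + 1) - h x - 1\<bar>" using small[of "\<bar>h (x + 1) - h x - 1\<bar>" 1] by auto
    obtain k where k: "e n k \<le> x" "x < e n (k + 1)" using bracket by blast
    have "e n (k + int (N n)) \<le> x + 1" "x + 1 \<le> e n (k + int (N n) + 1)"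
      using k per[of n k] per[of n "k + 1"] by (simp_all add: algebra_simps)
    from h_br[OF this] h_br[of n k x] k Npos[of n]
    have "of_int k / real (N n) + 1 \<le> h (x + 1)" "h (x + 1) \<le> of_int k / real (N n) + 1 + 1 / real (N n)"
      "of_int k / real (N n) \<le> h x" "h x \<le> of_int k / real (N n) + 1 / real (N n)"
      by (simp_all add: add_divide_distrib)
    then show False using n by linarith
  qed
  show ?thesis by (rule that[OF strictm cont shift h_e])
qed

fun gN :: "(nat \<Rightarrow> nat) \<Rightarrow> nat \<Rightarrow> nat" where
  "gN L 0 = 1"
| "gN L (Suc n) = gN L n * (2 * L n + 1)"

fun gR :: "(nat \<Rightarrow> nat) \<Rightarrow> nat \<Rightarrow> nat" where
  "gR L 0 = 0"
| "gR L (Suc n) = gR L n + 1 + (L n)\<^sup>2"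

definition goff :: "nat \<Rightarrow> int \<Rightarrow> int" where
  "goff l j = (if j \<le> int l then - (2 ^ (l\<^sup>2 - (nat j)\<^sup>2)) else 2 ^ (l\<^sup>2 - (nat (2 * int l + 1 - j))\<^sup>2))"

text \<open>The break points of the generation \<open>n\<close>, in units of \<open>2 ^ - gR L n\<close>.\<close>

fun gE :: "(nat \<Rightarrow> nat) \<Rightarrow> nat \<Rightarrow> int \<Rightarrow> int" where
  "gE L 0 k = k"
| "gE L (Suc n) k =
    (let b = 2 * int (L n) + 1; i = k div b; j = k mod b; Q = 2 ^ ((L n)\<^sup>2)
     in if j = 0 then 2 * Q * gE L n i else Q * (gE L n i + gE L n (i + 1)) + goff (L n) j)"

lemma goff_bounds:
  assumes l: "l \<ge> 1" and j: "1 \<le> j" "j \<le> 2 * int l"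
  shows "- (2 ^ (l\<^sup>2)) < goff l j" "goff l j < 2 ^ (l\<^sup>2)" 
proof -
  have less: "(2::int) ^ (l\<^sup>2 - i\<^sup>2) < 2 ^ (l\<^sup>2)" if "i \<ge> 1" for i
    using that l by (intro power_strict_increasing) auto
  have pos: "(0::int) < 2 ^ m" for m by simp
  have j_nat: "1 \<le> nat j" "1 \<le> nat (2 * int l + 1 - j)" using j by auto
  show "- (2 ^ (l\<^sup>2)) < goff l j" "goff l j < 2 ^ (l\<^sup>2)"
    using less[of "nat j"] less[of "nat (2 * int l + 1 - j)"] j_nat pos[of "l\<^sup>2 - (nat j)\<^sup>2"] pos[of "l\<^sup>2 - (nat (2 * int l + 1 - j))\<^sup>2"] pos[of "l\<^sup>2"]
    unfolding goff_def by (cases "j \<le> int l"; simp only: if_True if_False; linarith)+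
qed

lemma goff_step:
  assumes l: "l \<ge> 1" and j: "1 \<le> j" "j < 2 * int l"
  shows "goff l j < goff l (j + 1)" "goff l (j + 1) - goff l j \<le> 2 ^ (l\<^sup>2)"
proof -
  have step: "(2::int) ^ (l\<^sup>2 - (i + 1)\<^sup>2) < 2 ^ (l\<^sup>2 - i\<^sup>2)" if "i + 1 \<le> l" for i
  proof -
    have "(i + 1)\<^sup>2 \<le> l\<^sup>2" using that by (intro power_mono) auto
    moreover have "i\<^sup>2 < (i + 1)\<^sup>2" by (intro power_strict_mono) auto
    ultimately have "l\<^sup>2 - (i + 1)\<^sup>2 < l\<^sup>2 - i\<^sup>2" by linarith
    then show ?thesis by (intro power_strict_increasing) auto
  qed
  have le: "(2::int) ^ (l\<^sup>2 - i) \<le> 2 ^ (l\<^sup>2)" for i by (intro power_increasing) auto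
  have pos: "(0::int) < 2 ^ m" for m by simp
  consider "j + 1 \<le> int l" | "j = int l" | "int l < j" by linarith
  then have "goff l j < goff l (j + 1) \<and> goff l (j + 1) - goff l j \<le> 2 ^ (l\<^sup>2)"
  proof cases
    case 1
    have n: "nat (j + 1) = nat j + 1" using j by simp
    have "nat j + 1 \<le> l" using 1 j by linarith
    moreover have "goff l j = - (2 ^ (l\<^sup>2 - (nat j)\<^sup>2))" "goff l (j + 1) = - (2 ^ (l\<^sup>2 - (nat j + 1)\<^sup>2))"
      using 1 n by (simp_all add: goff_def)
    ultimately show ?thesis using step[of "nat j"] le[of "(nat j)\<^sup>2"] pos[of "l\<^sup>2 - (nat j + 1)\<^sup>2"] by linarith
  next
    case 2
    have "(2::int) \<le> 2 ^ (l\<^sup>2)" using l self_le_power[of "2::int" "l\<^sup>2"] by simp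
    then show ?thesis using 2 unfolding goff_def by (simp add: nat_diff_distrib)
  next
    case 3
    define i where "i = nat (2 * int l + 1 - (j + 1))"
    have i: "nat (2 * int l + 1 - j) = i + 1" "i + 1 \<le> l" using 3 j by (auto simp: i_def)
    have "goff l j = 2 ^ (l\<^sup>2 - (i + 1)\<^sup>2)" "goff l (j + 1) = 2 ^ (l\<^sup>2 - i\<^sup>2)"
      using 3 i by (simp_all add: goff_def i_def)
    then show ?thesis using step[OF i(2)] le[of "i\<^sup>2"] pos[of "l\<^sup>2 - (i + 1)\<^sup>2"] by linarith
  qed
  then show "goff l j < goff l (j + 1)" "goff l (j + 1) - goff l j \<le> 2 ^ (l\<^sup>2)" by auto
qed

lemma gE_step:
  assumes L: "\<And>n. L n \<ge> 1"
  shows "gE L n k < gE L n (k + 1) \<and> (gE L n (k + 1) - gE L n k) * 2 ^ n \<le> 2 ^ gR L n"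
proof (induction n arbitrary: k)
  case (Suc n)
  define b where "b = 2 * int (L n) + 1"
  define Q where "Q = (2::int) ^ ((L n)\<^sup>2)"
  define i j where "i = k div b" and "j = k mod b"
  define D where "D = gE L n (i + 1) - gE L n i"
  have b: "b \<ge> 3" using L[of n] by (simp add: b_def)
  have j: "0 \<le> j" "j < b" using b by (simp_all add: j_def)
  have k: "k = i * b + j" by (simp add: i_def j_def)
  have D: "D \<ge> 1" "D * 2 ^ n \<le> 2 ^ gR L n" using Suc[of i] by (auto simp: D_def)
  have Q: "Q \<ge> 2" using L[of n] self_le_power[of "2::int" "(L n)\<^sup>2"] by (simp add: Q_def)
  have QD: "Q \<le> Q * D" using Q D by simp
  define pos where "pos t = (if t = 0 then 0 else if t = b then 2 * Q * D else Q * D + goff (L n) t)" for t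
  have val: "gE L (Suc n) (i * b + t) = 2 * Q * gE L n i + pos t" if "0 \<le> t" "t \<le> b" for t
  proof (cases "t = b")
    case True
    have "(i * b + t) div b = i + 1" "(i * b + t) mod b = 0" using True b by (auto simp: algebra_simps)
    then show ?thesis using True b by (simp only: gE.simps Let_def b_def[symmetric] Q_def[symmetric]) (simp add: pos_def D_def algebra_simps)
  next
    case False
    then have "(i * b + t) div b = i" "(i * b + t) mod b = t" using that by auto
    then show ?thesis using False by (simp only: gE.simps Let_def b_def[symmetric] Q_def[symmetric]) (simp add: pos_def D_def algebra_simps)
  qed
  have st: "pos t < pos (t + 1) \<and> pos (t + 1) - pos t \<le> Q * D" if "0 \<le> t" "t < b" for t
  proof -
    have Ln: "1 \<le> L n" by (rule L)
    have g: "- Q < goff (L n) u" "goff (L n) u < Q" if "1 \<le> u" "u \<le> 2 * int (L n)" for u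
      using goff_bounds[OF Ln that] by (simp_all add: Q_def)
    consider "t = 0" | "t = b - 1" | "1 \<le> t" "t < b - 1" using \<open>0 \<le> t\<close> \<open>t < b\<close> by linarith
    then show ?thesis
    proof cases
      case 1
      have "goff (L n) 1 < 0" using Ln by (simp add: goff_def)
      moreover have "pos t = 0" "pos (t + 1) = Q * D + goff (L n) 1" using 1 b by (simp_all add: pos_def)
      ultimately show ?thesis using g[of 1] Ln QD by linarith
    next
      case 2
      have e: "goff (L n) (b - 1) > 0" using Ln by (simp add: goff_def b_def)
      moreover have "pos t = Q * D + goff (L n) (b - 1)" "pos (t + 1) = 2 * Q * D" using 2 b by (simp_all add: pos_def)
      moreover have "goff (L n) (b - 1) < Q" using b by (intro g) (auto simp: b_def)
      ultimately show ?thesis using QD by linarith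
    next
      case 3
      then have "goff (L n) t < goff (L n) (t + 1)" "goff (L n) (t + 1) - goff (L n) t \<le> Q"
        using goff_step[OF Ln, of t] by (auto simp: b_def Q_def)
      moreover have "pos t = Q * D + goff (L n) t" "pos (t + 1) = Q * D + goff (L n) (t + 1)" using 3 by (simp_all add: pos_def)
      ultimately show ?thesis using QD by linarith
    qed
  qed
  have step: "gE L (Suc n) k < gE L (Suc n) (k + 1) \<and> gE L (Suc n) (k + 1) - gE L (Suc n) k \<le> Q * D"
    using val[of j] val[of "j + 1"] st[of j] j unfolding k add.assoc by simp
  have "(gE L (Suc n) (k + 1) - gE L (Suc n) k) * 2 ^ Suc n \<le> (Q * D) * 2 ^ Suc n"
    using step by (intro mult_right_mono) auto
  also have "\<dots> = 2 * Q * (D * 2 ^ n)" by simp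
  also have "\<dots> \<le> 2 * Q * 2 ^ gR L n" using D Q by (intro mult_left_mono) auto
  also have "\<dots> = 2 ^ gR L (Suc n)" by (simp add: Q_def power_add)
  finally show ?case using step by simp
qed simp

lemma gE_nest: "gE L (Suc n) (k * (2 * int (L n) + 1)) = 2 ^ (1 + (L n)\<^sup>2) * gE L n k"
  by (simp add: Let_def)

lemma gE_period: "gE L n (k + int (gN L n)) = gE L n k + 2 ^ gR L n"
proof (induction n arbitrary: k)
  case (Suc n)
  define b where "b = 2 * int (L n) + 1"
  have b: "b > 0" by (simp add: b_def)
  have N: "int (gN L (Suc n)) = int (gN L n) * b" by (simp add: b_def algebra_simps)
  have dm: "(k + int (gN L n) * b) div b = k div b + int (gN L n)" "(k + int (gN L n) * b) mod b = k mod b" using b by auto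
  have c: "k div b + int (gN L n) + 1 = (k div b + 1) + int (gN L n)" by simp
  show ?case
    unfolding N
    by (simp only: gE.simps Let_def b_def[symmetric] dm Suc c) (simp add: power_add algebra_simps)
qed simp

lemma gE_inner:
  assumes "1 \<le> j" "j \<le> 2 * int (L n)"
  shows "gE L (Suc n) (i * (2 * int (L n) + 1) + j) = 2 ^ ((L n)\<^sup>2) * (gE L n i + gE L n (i + 1)) + goff (L n) j"
proof -
  have "(i * (2 * int (L n) + 1) + j) div (2 * int (L n) + 1) = i" "(i * (2 * int (L n) + 1) + j) mod (2 * int (L n) + 1) = j"
    using assms by auto
  then show ?thesis using assms by (simp only: gE.simps Let_def) auto
qed

lemma goff_lw:
  assumes "1 \<le> j" "j \<le> 2 * int l" "s \<ge> l\<^sup>2"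
  shows "goff l j * 2 ^ (s - l\<^sup>2) \<in> lac_breaks s l"
proof -
  have e: "2 ^ (l\<^sup>2 - i\<^sup>2) * 2 ^ (s - l\<^sup>2) = lw s i" if "i \<le> l" for i
  proof -
    have "i\<^sup>2 \<le> l\<^sup>2" using that by (intro power_mono) auto
    then have "l\<^sup>2 - i\<^sup>2 + (s - l\<^sup>2) = s - i\<^sup>2" using assms(3) by simp
    then show ?thesis by (simp add: lw_def power_add[symmetric])
  qed
  show ?thesis
  proof (cases "j \<le> int l")
    case True
    then have "goff l j * 2 ^ (s - l\<^sup>2) = - lw s (nat j)" using e[of "nat j"] assms by (simp add: goff_def)
    moreover have "nat j \<in> {1..l}" using True assms by auto
    ultimately show ?thesis by (auto simp: lac_breaks_def)
  next
    case False
    define i where "i = nat (2 * int l + 1 - j)"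
    have i: "i \<in> {1..l}" using False assms by (auto simp: i_def)
    then have "goff l j * 2 ^ (s - l\<^sup>2) = lw s i" using e[of i] False by (simp add: goff_def i_def)
    then show ?thesis using i by (auto simp: lac_breaks_def)
  qed
qed

lemma gR_mono: "m \<le> n \<Longrightarrow> gR L m \<le> gR L n"
  by (induction n) (auto simp: le_Suc_eq)

theorem lacunary_homeomorphism:
  assumes L: "\<And>n. L n \<ge> 1"
  obtains h :: "real \<Rightarrow> real" where "strict_mono h" "continuous_on UNIV h" "\<And>x. h (x + 1) = h x + 1" "h 0 = 0"
    "\<And>q n \<rho>. q \<ge> 1 \<Longrightarrow> \<rho> \<ge> 1 \<Longrightarrow> gR L n \<le> \<rho> \<Longrightarrow>
       lp_partition (2 ^ \<rho>) (real (2 * 2 ^ q)) (genC q (CARD('n) * n)) (\<lambda>k :: int ^ 'n::finite. \<lambda>i. \<lfloor>real (gN L n) * h (real_of_int (k $ i) / 2 ^ \<rho>)\<rfloor>)"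
proof -
  define e where "e n k = real_of_int (gE L n k) / 2 ^ gR L n" for n k
  obtain h :: "real \<Rightarrow> real" where h: "strict_mono h" "continuous_on UNIV h" "\<And>x. h (x + 1) = h x + 1"
    and he: "\<And>n k. h (e n k) = of_int k / real (gN L n)"
  proof (rule nested_partition_function[of e "gN L" "\<lambda>n. 2 * L n + 1"])
    fix n k
    show "e n k < e n (k + 1)" using gE_step[of L n k, OF L] by (simp add: e_def divide_strict_right_mono)
    show "e n (k + int (gN L n)) = e n k + 1" by (simp add: e_def gE_period add_divide_distrib)
    show "e (Suc n) (k * int (2 * L n + 1)) = e n k"
    proof -
      have "int (2 * L n + 1) = 2 * int (L n) + 1" by simp
      then show ?thesis unfolding e_def by (simp only: gE_nest gR.simps) (simp add: power_add)
    qed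
    show "e n (k + 1) - e n k \<le> (1/2) ^ n"
    proof -
      have "real_of_int ((gE L n (k + 1) - gE L n k) * 2 ^ n) \<le> real_of_int (2 ^ gR L n)"
        using gE_step[of L n k, OF L] by (simp only: of_int_le_iff)
      then show ?thesis by (simp add: e_def diff_divide_distrib[symmetric] power_one_over field_simps)
    qed
  qed (use L in \<open>auto simp: e_def intro: that\<close>)
  have h0: "h 0 = 0" using he[of 0 0] by (simp add: e_def)
  have lp: "lp_partition (2 ^ \<rho>) (real (2 * 2 ^ q)) (genC q (CARD('n) * n)) (\<lambda>k :: int ^ 'n::finite. \<lambda>i. \<lfloor>real (gN L n) * h (real_of_int (k $ i) / 2 ^ \<rho>)\<rfloor>)"
    if q: "q \<ge> 1" and \<rho>: "\<rho> \<ge> 1" "gR L n \<le> \<rho>" for q n \<rho>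
  proof -
    define H where "H = (2::nat) ^ (\<rho> - 1)"
    have H: "H > 0" "2 * H = 2 ^ \<rho>" using \<rho>(1) power_Suc[of "2::nat" "\<rho> - 1"] by (auto simp: H_def)
    have Hr: "2 * real H = 2 ^ \<rho>" using H(2) by (metis of_nat_mult of_nat_numeral of_nat_power)
    have Hi: "2 * int H = 2 ^ \<rho>" using H(2) by (metis of_nat_mult of_nat_numeral of_nat_power)
    define cell where "cell m x = \<lfloor>real (gN L m) * h (real_of_int x / 2 ^ \<rho>)\<rfloor>" for m x
    define s where "s m = \<rho> - gR L m - 1" for m
    define a where "a m i = 2 ^ s m * (gE L m i + gE L m (i + 1))" for m i
    have "gN L m > 0" for m by (induction m) auto
    then have Npos: "real (gN L m) > 0" for m by simp
    have cell_le: "k \<le> cell m x \<longleftrightarrow> e m k \<le> real_of_int x / 2 ^ \<rho>" for m x k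
    proof -
      have "k \<le> cell m x \<longleftrightarrow> real_of_int k / real (gN L m) \<le> h (real_of_int x / 2 ^ \<rho>)"
        using Npos[of m] by (simp add: cell_def le_floor_iff divide_le_eq mult.commute)
      also have "\<dots> \<longleftrightarrow> h (e m k) \<le> h (real_of_int x / 2 ^ \<rho>)" by (simp add: he)
      also have "\<dots> \<longleftrightarrow> e m k \<le> real_of_int x / 2 ^ \<rho>" by (rule strict_mono_less_eq[OF h(1)])
      finally show ?thesis .
    qed
    have cell_le': "k \<le> cell m x \<longleftrightarrow> gE L m k * 2 ^ (\<rho> - gR L m) \<le> x" if "gR L m \<le> \<rho>" for m x k
    proof -
      have "(2::real) ^ \<rho> = 2 ^ gR L m * 2 ^ (\<rho> - gR L m)" using that by (simp add: power_add[symmetric])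
      then have "e m k \<le> real_of_int x / 2 ^ \<rho> \<longleftrightarrow> real_of_int (gE L m k * 2 ^ (\<rho> - gR L m)) \<le> real_of_int x"
        by (simp add: e_def field_simps)
      then show ?thesis unfolding cell_le by (simp only: of_int_le_iff)
    qed
    have "lp_partition (2 * H) (real (2 * 2 ^ q)) (genC q (\<Sum>i\<in>(UNIV :: 'n set). n)) (\<lambda>k :: int ^ 'n. \<lambda>i. cell n (k $ i))"
    proof (rule lp_generations[where s = s and L = L and N = n and a = a, OF H(1) q])
      fix m assume m: "m < n"
      then have R: "gR L m + 1 + (L m)\<^sup>2 \<le> \<rho>" using gR_mono[of "Suc m" n L] \<rho>(2) by simp
      show "2 ^ s m \<le> H \<and> (L m)\<^sup>2 \<le> s m \<and> 1 \<le> L m"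
        using R L[of m] unfolding H_def s_def by (auto intro!: power_increasing)
    next
      fix x y assume "x \<in> {0..<2 * int H}" "y \<in> {0..<2 * int H}"
      moreover have "cell 0 z = 0" if "z \<in> {0..<2 * int H}" for z
      proof -
        have "gR L 0 \<le> \<rho>" by simp
        from cell_le'[OF this, of 0 z] cell_le'[OF this, of 1 z] have "0 \<le> cell 0 z" "\<not> 1 \<le> cell 0 z" using that Hi by auto
        then show ?thesis by simp
      qed
      ultimately show "cell 0 x = cell 0 y" by simp
    next
      fix m x y assume m: "m < n" and x: "x \<in> {0..<2 * int H}" and y: "y \<in> {0..<2 * int H}" and xy: "cell m x = cell m y"
        and lac: "{b \<in> lac_breaks (s m) (L m). b \<le> cen H (x - a m (cell m x))} = {b \<in> lac_breaks (s m) (L m). b \<le> cen H (y - a m (cell m y))}"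
      define I where "I = cell m x"
      define b where "b = 2 * int (L m) + 1"
      have Rm: "gR L m + 1 + (L m)\<^sup>2 \<le> \<rho>" using m gR_mono[of "Suc m" n L] \<rho>(2) by simp
      then have R1: "gR L m \<le> \<rho>" "gR L (Suc m) \<le> \<rho>" and sm: "\<rho> - gR L m = Suc (s m)" "(L m)\<^sup>2 \<le> s m" "s m - (L m)\<^sup>2 = \<rho> - gR L (Suc m)"
        by (auto simp: s_def)
      have cen: "cen H (z - a m I) = z - a m I" if z: "cell m z = I" for z
      proof (rule cen_id)
        have lo: "gE L m I * (2 * 2 ^ s m) \<le> z" using cell_le'[OF R1(1), of I z] z sm(1) by simp
        have hi: "z < gE L m (I + 1) * (2 * 2 ^ s m)" using cell_le'[OF R1(1), of "I + 1" z] z sm(1) by simp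
        define D where "D = gE L m (I + 1) - gE L m I"
        have "D * 2 ^ m \<le> 2 ^ gR L m" "D > 0" using gE_step[of L m I, OF L] by (auto simp: D_def)
        moreover have "D * 1 \<le> D * 2 ^ m" using \<open>D > 0\<close> by (intro mult_left_mono) auto
        ultimately have "D \<le> 2 ^ gR L m" by linarith
        then have "D * 2 ^ s m \<le> 2 ^ gR L m * 2 ^ s m" by (intro mult_right_mono) auto
        also have "\<dots> = int H" unfolding H_def power_add[symmetric] using Rm by (simp add: s_def)
        finally have DH: "D * 2 ^ s m \<le> int H" .
        show "- int H \<le> z - a m I" "z - a m I < int H"
          using lo hi DH by (auto simp: a_def D_def algebra_simps)
      qed
      have cx: "cell m x = I" and cy: "cell m y = I" using xy by (auto simp: I_def)
      have "{c \<in> lac_breaks (s m) (L m). c \<le> x - a m I} = {c \<in> lac_breaks (s m) (L m). c \<le> y - a m I}"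
        using lac by (simp only: cx cy cen[OF cx] cen[OF cy])
      then have lac': "c \<le> x - a m I \<longleftrightarrow> c \<le> y - a m I" if "c \<in> lac_breaks (s m) (L m)" for c
        using that by blast
      have iff: "k \<le> cell (Suc m) x \<longleftrightarrow> k \<le> cell (Suc m) y" for k
      proof -
        define i j where "i = k div b" and "j = k mod b"
        have b: "b > 0" by (simp add: b_def)
        have k: "k = i * b + j" and j: "0 \<le> j" "j < b" using b by (simp_all add: i_def j_def)
        have mult: "i * b \<le> cell (Suc m) z \<longleftrightarrow> i \<le> cell m z" for i z
        proof -
          have "e (Suc m) (i * b) = e m i" unfolding e_def b_def by (simp only: gE_nest gR.simps) (simp add: power_add)
          then show ?thesis by (simp add: cell_le)
        qed
        consider "i < I" | "I < i" | "i = I" "j = 0" | "i = I" "1 \<le> j" using j by linarith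
        then show ?thesis
        proof cases
          case 1
          have "k \<le> I * b"
          proof -
            have "(i + 1) * b \<le> I * b" using 1 b by (intro mult_right_mono) auto
            then show ?thesis using j unfolding k by (simp add: algebra_simps)
          qed
          moreover have "I * b \<le> cell (Suc m) x" "I * b \<le> cell (Suc m) y" unfolding mult using xy by (auto simp: I_def)
          ultimately show ?thesis by simp
        next
          case 2
          have "(I + 1) * b \<le> k"
          proof -
            have "(I + 1) * b \<le> i * b" using 2 b by (intro mult_right_mono) auto
            then show ?thesis using j(1) unfolding k by linarith
          qed
          moreover have "\<not> (I + 1) * b \<le> cell (Suc m) x" "\<not> (I + 1) * b \<le> cell (Suc m) y" unfolding mult using xy by (auto simp: I_def)
          ultimately show ?thesis by linarith
        next
          case 3
          then have "k = I * b" using k by simp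
          moreover have "I * b \<le> cell (Suc m) x" "I * b \<le> cell (Suc m) y" unfolding mult using xy by (auto simp: I_def)
          ultimately show ?thesis by simp
        next
          case 4
          have j2: "1 \<le> j" "j \<le> 2 * int (L m)" using 4 j by (auto simp: b_def)
          define c where "c = goff (L m) j * 2 ^ (s m - (L m)\<^sup>2)"
          have cl: "c \<in> lac_breaks (s m) (L m)" unfolding c_def by (rule goff_lw[OF j2 sm(2)])
          have "gE L (Suc m) k * 2 ^ (\<rho> - gR L (Suc m)) = a m I + c"
          proof -
            have "(2::int) ^ (L m)\<^sup>2 * 2 ^ (s m - (L m)\<^sup>2) = 2 ^ s m" using sm(2) by (simp add: power_add[symmetric])
            then have "2 ^ (L m)\<^sup>2 * u * 2 ^ (s m - (L m)\<^sup>2) = 2 ^ s m * u" for u :: int by (metis mult.assoc mult.commute)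
            then show ?thesis
              unfolding k 4(1) b_def gE_inner[of j L m, OF j2] sm(3)[symmetric] by (simp add: a_def c_def distrib_right)
          qed
          then have "k \<le> cell (Suc m) z \<longleftrightarrow> c \<le> z - a m I" for z
            unfolding cell_le'[OF R1(2)] by auto
          then show ?thesis using lac'[OF cl] by simp
        qed
      qed
      show "cell (Suc m) x = cell (Suc m) y" using iff[of "cell (Suc m) x"] iff[of "cell (Suc m) y"] by simp
    qed simp
    then show ?thesis unfolding H(2) cell_def by simp
  qed
  show ?thesis by (rule that[OF h h0 lp])
qed

section \<open>Interpolation and duality\<close>

lemma nrm_Hoelder:
  fixes a b :: "int ^ 'n::finite \<Rightarrow> complex"
  assumes pq: "p > 1" "q > 1" "1 / p + 1 / q = (1::real)"
  shows "(\<Sum>x\<in>grid M. cmod (a x) * cmod (b x)) \<le> nrm M p a * nrm M q b"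
proof (cases "nrm M p a = 0 \<or> nrm M q b = 0")
  case True
  then have "(\<Sum>x\<in>grid M. cmod (a x) * cmod (b x)) = 0" by (intro sum.neutral) (auto dest: nrm_eq_0)
  then show ?thesis by simp
next
  case False
  define A B where "A = nrm M p a" and "B = nrm M q b"
  have pos: "A > 0" "B > 0" using False nrm_nonneg[of M p a] nrm_nonneg[of M q b] by (auto simp: A_def B_def less_le)
  have "(\<Sum>x\<in>grid M. (cmod (a x) / A) * (cmod (b x) / B)) \<le> (\<Sum>x\<in>grid M. (cmod (a x) / A) powr p / p + (cmod (b x) / B) powr q / q)"
    using pq pos by (intro sum_mono Youngs_inequality) auto
  also have "\<dots> = (\<Sum>x\<in>grid M. cmod (a x) powr p) / (A powr p * p) + (\<Sum>x\<in>grid M. cmod (b x) powr q) / (B powr q * q)"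
    using pos by (simp add: sum.distrib sum_divide_distrib powr_divide)
  also have "(\<Sum>x\<in>grid M. cmod (a x) powr p) = A powr p" using pq by (simp add: A_def nrm_powr)
  also have "(\<Sum>x\<in>grid M. cmod (b x) powr q) = B powr q" using pq by (simp add: B_def nrm_powr)
  also have "A powr p / (A powr p * p) + B powr q / (B powr q * q) = 1" using pos pq by simp
  finally have "(\<Sum>x\<in>grid M. cmod (a x) * cmod (b x)) / (A * B) \<le> 1" by (simp add: sum_divide_distrib)
  then show ?thesis using pos by (simp add: A_def B_def)
qed

lemma mult_op_adjoint:
  fixes a b :: "int ^ 'n::finite \<Rightarrow> complex"
  assumes M: "M > 0"
  shows "(\<Sum>x\<in>grid M. mult_op M m a x * cnj (b x)) = (\<Sum>x\<in>grid M. a x * cnj (mult_op M (\<lambda>k. cnj (m k)) b x))"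
proof -
  have "(\<Sum>x\<in>grid M. a x * cnj (mult_op M (\<lambda>k. cnj (m k)) b x)) = (\<Sum>x\<in>grid M. mult_op M (\<lambda>_. 1) a x * cnj (mult_op M (\<lambda>k. cnj (m k)) b x))"
    by (simp add: mult_op_one[OF M])
  then show ?thesis unfolding inner_mult_op by (simp add: dft_mult_op[OF M] mult_ac cong: sum.cong)
qed

lemma mult_bound_dual:
  fixes m :: "int ^ 'n::finite \<Rightarrow> complex"
  assumes M: "M > 0" and pq: "p > 1" "q > 1" "1 / p + 1 / q = (1::real)" and b: "mult_bound M p C (\<lambda>k. cnj (m k))"
  shows "mult_bound M q C m"
  unfolding mult_bound_def
proof
  fix a :: "int ^ 'n \<Rightarrow> complex"
  define u where "u = mult_op M m a"
  define S where "S = (\<Sum>x\<in>grid M. cmod (u x) powr q)"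
  define v where "v x = u x * of_real (cmod (u x) powr (q - 2))" for x
  have qp: "(q - 1) * p = q" using pq by (simp add: field_simps)
  have nv: "cmod (v x) = cmod (u x) powr (q - 1)" for x
  proof (cases "u x = 0")
    case False
    have "cmod (v x) = cmod (u x) * cmod (u x) powr (q - 2)" by (simp add: v_def norm_mult)
    then show ?thesis using False powr_add[of "cmod (u x)" 1 "q - 2"] by simp
  qed (simp add: v_def)
  have uv: "u x * cnj (v x) = of_real (cmod (u x) powr q)" for x
  proof (cases "u x = 0")
    case False
    have "u x * cnj (v x) = of_real ((cmod (u x))\<^sup>2 * cmod (u x) powr (q - 2))"
      unfolding v_def of_real_mult complex_norm_square by simp
    also have "(cmod (u x))\<^sup>2 * cmod (u x) powr (q - 2) = cmod (u x) powr q"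
      using False powr_add[of "cmod (u x)" 2 "q - 2"] by simp
    finally show ?thesis .
  qed (simp add: v_def)
  have S0: "S \<ge> 0" by (simp add: S_def sum_nonneg)
  show "nrm M q u \<le> C * nrm M q a"
  proof (cases "S = 0")
    case True
    then have "nrm M q u = 0" by (simp add: nrm_def S_def)
    have "nrm M p (mult_op M (\<lambda>k. cnj (m k)) f) \<le> C * nrm M p f" for f using b by (rule mult_boundD)
    from this[of "\<lambda>x. if x = 0 then 1 else 0"] have "0 \<le> C * nrm M p (\<lambda>x :: int ^ 'n. if x = 0 then 1 else 0)"
      using nrm_nonneg order_trans by blast
    moreover have "nrm M p (\<lambda>x :: int ^ 'n. if x = 0 then 1 else 0) > 0"
    proof -
      have "(0 :: int ^ 'n) \<in> grid M" using M by (simp add: grid_def)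
      then have "nrm M p (\<lambda>x :: int ^ 'n. if x = 0 then 1 else 0) \<noteq> 0" using nrm_eq_0[of M p "\<lambda>x :: int ^ 'n. if x = 0 then 1 else 0" 0] by auto
      then show ?thesis by (simp add: less_le)
    qed
    ultimately have "C \<ge> 0" by (simp add: zero_le_mult_iff)
    then show ?thesis using \<open>nrm M q u = 0\<close> by simp
  next
    case False
    with S0 have S: "S > 0" by simp
    have "complex_of_real S = (\<Sum>x\<in>grid M. u x * cnj (v x))" by (simp add: S_def uv)
    also have "\<dots> = (\<Sum>x\<in>grid M. a x * cnj (mult_op M (\<lambda>k. cnj (m k)) v x))"
      unfolding u_def by (rule mult_op_adjoint[OF M])
    finally have "S = cmod (\<Sum>x\<in>grid M. a x * cnj (mult_op M (\<lambda>k. cnj (m k)) v x))" using S0 by (metis abs_of_nonneg norm_of_real)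
    also have "\<dots> \<le> (\<Sum>x\<in>grid M. cmod (a x) * cmod (mult_op M (\<lambda>k. cnj (m k)) v x))"
      by (rule sum_norm_le) (simp add: norm_mult)
    also have "\<dots> \<le> nrm M q a * nrm M p (mult_op M (\<lambda>k. cnj (m k)) v)"
      using pq by (intro nrm_Hoelder) (auto simp: add.commute)
    also have "\<dots> \<le> nrm M q a * (C * nrm M p v)" by (intro mult_left_mono mult_boundD[OF b]) simp
    also have "nrm M p v = S powr (1 / p)"
      by (simp add: nrm_def nv powr_powr qp S_def)
    finally have "S \<le> (C * nrm M q a) * S powr (1 / p)" by (simp add: mult_ac)
    moreover have "S = S powr (1 / q) * S powr (1 / p)" using S pq by (simp add: powr_add[symmetric] add.commute)
    ultimately have "S powr (1 / q) \<le> C * nrm M q a" using S by (metis mult_le_cancel_right_pos powr_gt_zero less_imp_neq)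
    then show ?thesis by (simp add: nrm_def S_def)
  qed
qed

lemma mult_bound_powr:
  assumes "p > 0" "C \<ge> 0"
  shows "mult_bound M p C m \<longleftrightarrow> (\<forall>a. (\<Sum>x\<in>grid M. cmod (mult_op M m a x) powr p) \<le> C powr p * (\<Sum>x\<in>grid M. cmod (a x) powr p))"
proof -
  have "nrm M p (mult_op M m a) \<le> C * nrm M p a \<longleftrightarrow> nrm M p (mult_op M m a) powr p \<le> (C * nrm M p a) powr p" for a
  proof -
    have iff: "x \<le> y \<longleftrightarrow> x powr p \<le> y powr p" if "0 \<le> x" "0 \<le> y" for x y :: real
    proof
      assume "x \<le> y" then show "x powr p \<le> y powr p" using that assms(1) by (intro powr_mono2) auto
    next
      assume le: "x powr p \<le> y powr p"
      show "x \<le> y"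
      proof (rule ccontr)
        assume "\<not> x \<le> y"
        then have "y powr p < x powr p" using that assms(1) by (intro powr_less_mono2) auto
        with le show False by simp
      qed
    qed
    show ?thesis by (rule iff) (use assms in auto)
  qed
  then show ?thesis using assms by (simp add: mult_bound_def powr_mult nrm_powr)
qed

lemma geometric_below:
  assumes "\<theta> > 0" "\<alpha> > 0"
  shows "(\<Sum>j<(N::nat). if 2 powr (real j - c) < \<alpha> then (2 powr (real j - c)) powr \<theta> else 0) \<le> \<alpha> powr \<theta> / (1 - 2 powr - \<theta>)"
proof -
  have d: "1 - 2 powr - \<theta> > 0" using assms powr_less_mono[of "- \<theta>" 0 "2::real"] by simp
  define t where "t j = 2 powr (real j - c)" for j
  define f where "f j = (min \<alpha> (t j / 2)) powr \<theta>" for j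
  have tS: "t (Suc j) / 2 = t j" for j by (simp add: t_def powr_add powr_diff field_simps)
  have "(1 - 2 powr - \<theta>) * (if t j < \<alpha> then t j powr \<theta> else 0) \<le> f (Suc j) - f j" for j
  proof (cases "t j < \<alpha>")
    case True
    have tp: "t j > 0" by (simp add: t_def)
    have "f (Suc j) = t j powr \<theta>" using True by (simp add: f_def tS)
    moreover have "f j = t j powr \<theta> * 2 powr - \<theta>" using True tp by (simp add: f_def powr_divide powr_minus_divide)
    ultimately show ?thesis using True by (simp add: algebra_simps)
  next
    case False
    have "f j \<le> f (Suc j)" proof -
      have "t j > 0" by (simp add: t_def)
      then show ?thesis unfolding f_def tS using assms by (intro powr_mono2) auto
    qed
    then show ?thesis using False by simp
  qed
  then have "(\<Sum>j<N. (1 - 2 powr - \<theta>) * (if t j < \<alpha> then t j powr \<theta> else 0)) \<le> (\<Sum>j<N. f (Suc j) - f j)"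
    by (intro sum_mono)
  also have "\<dots> = f N - f 0" by (rule sum_lessThan_telescope)
  also have "\<dots> \<le> \<alpha> powr \<theta>"
  proof -
    have "f N \<le> \<alpha> powr \<theta>" unfolding f_def using assms by (intro powr_mono2) (auto simp: t_def)
    moreover have "f 0 \<ge> 0" by (simp add: f_def)
    ultimately show ?thesis by simp
  qed
  finally have "(1 - 2 powr - \<theta>) * (\<Sum>j<N. if t j < \<alpha> then t j powr \<theta> else 0) \<le> \<alpha> powr \<theta>"
    by (simp add: sum_distrib_left)
  then show ?thesis using d unfolding t_def by (simp add: pos_le_divide_eq mult.commute)
qed

lemma geometric_above:
  assumes "\<theta> > 0" "\<alpha> > 0"
  shows "(\<Sum>j<(N::nat). if \<alpha> \<le> 2 powr (real j - c) then (2 powr (real j - c)) powr - \<theta> else 0) \<le> \<alpha> powr - \<theta> / (1 - 2 powr - \<theta>)"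
proof -
  have d: "1 - 2 powr - \<theta> > 0" using assms powr_less_mono[of "- \<theta>" 0 "2::real"] by simp
  define t where "t j = 2 powr (real j - c)" for j
  define f where "f j = (max \<alpha> (t j)) powr - \<theta>" for j
  have tS: "t (Suc j) = 2 * t j" for j by (simp add: t_def powr_add powr_diff field_simps)
  have "(1 - 2 powr - \<theta>) * (if \<alpha> \<le> t j then t j powr - \<theta> else 0) \<le> f j - f (Suc j)" for j
  proof (cases "\<alpha> \<le> t j")
    case True
    have tp: "t j > 0" by (simp add: t_def)
    have "f j = t j powr - \<theta>" using True by (simp add: f_def max_def)
    moreover have "f (Suc j) = t j powr - \<theta> * 2 powr - \<theta>" using True tp by (simp add: f_def tS max_def powr_mult)
    ultimately show ?thesis using True by (simp add: algebra_simps)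
  next
    case False
    have "f (Suc j) \<le> f j" proof -
      have "t j > 0" by (simp add: t_def)
      then show ?thesis unfolding f_def tS using assms by (intro powr_mono2') (auto simp: max_def)
    qed
    then show ?thesis using False by simp
  qed
  then have "(\<Sum>j<N. (1 - 2 powr - \<theta>) * (if \<alpha> \<le> t j then t j powr - \<theta> else 0)) \<le> (\<Sum>j<N. f j - f (Suc j))"
    by (intro sum_mono)
  also have "\<dots> = f 0 - f N" by (rule sum_lessThan_telescope')
  also have "\<dots> \<le> \<alpha> powr - \<theta>"
  proof -
    have "f 0 \<le> \<alpha> powr - \<theta>" unfolding f_def using assms by (intro powr_mono2') auto
    moreover have "f N \<ge> 0" by (simp add: f_def)
    ultimately show ?thesis by simp
  qed
  finally have "(1 - 2 powr - \<theta>) * (\<Sum>j<N. if \<alpha> \<le> t j then t j powr - \<theta> else 0) \<le> \<alpha> powr - \<theta>"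
    by (simp add: sum_distrib_left)
  then show ?thesis using d unfolding t_def by (simp add: pos_le_divide_eq mult.commute)
qed

definition marC :: "real \<Rightarrow> real \<Rightarrow> real" where
  "marC p P = 4 * (1 / (1 - 2 powr - (p - 2)) + 1 / (1 - 2 powr - (P - p))) powr (1 / p)"

lemma level_sum:
  fixes u C p c :: real
  assumes C: "C > 0" and p: "p > 0" and u: "0 \<le> u" "u \<le> 4 * C * 2 powr (real N - c)"
  shows "u powr p \<le> (4 * C) powr p * (\<Sum>j<Suc N. if 2 * C * 2 powr (real j - c) < u then (2 powr (real j - c)) powr p else 0) + (2 * C * 2 powr (- c)) powr p"
proof -
  define t where "t j = 2 powr (real j - c)" for j
  let ?s = "\<Sum>j<Suc N. if 2 * C * t j < u then t j powr p else 0"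
  have s0: "?s \<ge> 0" by (intro sum_nonneg) auto
  have "u powr p \<le> (4 * C) powr p * ?s + (2 * C * t 0) powr p"
  proof (cases "u \<le> 2 * C * t 0")
    case True
    then have "u powr p \<le> (2 * C * t 0) powr p" using u p by (intro powr_mono2) auto
    moreover have "(4 * C) powr p * ?s \<ge> 0" using s0 by simp
    ultimately show ?thesis by linarith
  next
    case False
    define j where "j = Max {j. j \<le> N \<and> 2 * C * t j < u}"
    have fin: "finite {j. j \<le> N \<and> 2 * C * t j < u}" by simp
    have "0 \<in> {j. j \<le> N \<and> 2 * C * t j < u}" using False by simp
    then have j: "j \<le> N" "2 * C * t j < u" using Max_in[OF fin] unfolding j_def by blast+
    have "u \<le> 4 * C * t j"
    proof (cases "j = N")
      case True then show ?thesis using u by (simp add: t_def)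
    next
      case False
      have "\<not> (Suc j \<le> N \<and> 2 * C * t (Suc j) < u)"
      proof
        assume "Suc j \<le> N \<and> 2 * C * t (Suc j) < u"
        then have "Suc j \<in> {j. j \<le> N \<and> 2 * C * t j < u}" by simp
        from Max_ge[OF fin this] show False unfolding j_def[symmetric] by simp
      qed
      moreover have "t (Suc j) = 2 * t j" by (simp add: t_def powr_add powr_diff field_simps)
      ultimately show ?thesis using False j by simp
    qed
    then have "u powr p \<le> (4 * C * t j) powr p" using u p by (intro powr_mono2) auto
    also have "\<dots> = (4 * C) powr p * t j powr p" using C by (simp add: powr_mult t_def)
    also have "\<dots> \<le> (4 * C) powr p * ?s"
    proof (intro mult_left_mono)
      have "(if 2 * C * t j < u then t j powr p else 0) \<le> ?s" using j by (intro member_le_sum) auto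
      then show "t j powr p \<le> ?s" using j by simp
    qed simp
    finally show ?thesis by (simp add: add_increasing2)
  qed
  then show ?thesis unfolding t_def by (simp only: of_nat_0 diff_0)
qed

lemma mult_bound_interpolate:
  fixes m :: "int ^ 'n::finite \<Rightarrow> complex"
  assumes M: "M > 0" and C: "C > 0" and p: "2 < p" "p < P" and b2: "mult_bound M 2 C m" and bP: "mult_bound M P C m"
  shows "mult_bound M p (marC p P * C) m"
proof -
  let ?X = "grid M :: (int ^ 'n) set"
  define G1 where "G1 = 1 / (1 - 2 powr - (p - 2))"
  define G2 where "G2 = 1 / (1 - 2 powr - (P - p))"
  have G: "G1 > 0" "G2 > 0"
    using p powr_less_mono[of "- (p - 2)" 0 "2::real"] powr_less_mono[of "- (P - p)" 0 "2::real"] by (auto simp: G1_def G2_def)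
  have mar: "marC p P = 4 * (G1 + G2) powr (1 / p)" "marC p P \<ge> 0" by (simp_all add: marC_def G1_def G2_def)
  have main: "(\<Sum>x\<in>?X. cmod (mult_op M m a x) powr p) \<le> (4 * C) powr p * ((G1 + G2) * (\<Sum>x\<in>?X. cmod (a x) powr p))" for a
  proof -
    define u where "u x = cmod (mult_op M m a x)" for x
    define U where "U = (\<Sum>x\<in>?X. u x)"
    define al where "al x = cmod (a x)" for x
    have uU: "u x \<le> U" if "x \<in> ?X" for x unfolding U_def using that by (intro member_le_sum) (auto simp: u_def)
    have est: "(\<Sum>x\<in>?X. u x powr p) \<le> (4 * C) powr p * ((G1 + G2) * (\<Sum>x\<in>?X. al x powr p)) + real (card ?X) * (2 * C * 2 powr (- real n)) powr p"
      if n: "U \<le> 4 * C * 2 powr real n" for n :: nat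
    proof -
      define t where "t j = 2 powr (real j - real n)" for j
      have t0: "t j > 0" for j by (simp add: t_def)
      have level: "(\<Sum>x\<in>?X. if 2 * C * t j < u x then 1 else 0) \<le>
         (\<Sum>x\<in>?X. (if t j < al x then t j powr - 2 * al x powr 2 else 0) + (if al x \<le> t j then t j powr - P * al x powr P else 0))" for j
      proof -
        define a1 where "a1 x = (if t j < al x then a x else 0)" for x
        define a2 where "a2 x = (if al x \<le> t j then a x else 0)" for x
        have aa: "mult_op M m a x = mult_op M m a1 x + mult_op M m a2 x" for x
          unfolding mult_op_add_arg[symmetric] by (intro mult_op_cong) (auto simp: a1_def a2_def)
        have pt: "(if 2 * C * t j < u x then 1 else 0) \<le> (C * t j) powr - 2 * cmod (mult_op M m a1 x) powr 2 + (C * t j) powr - P * cmod (mult_op M m a2 x) powr P" for x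
        proof (cases "2 * C * t j < u x")
          case True
          have big: "1 \<le> (C * t j) powr - r * v powr r" if "C * t j \<le> v" "r > 0" for v r
          proof -
            have "(C * t j) powr r \<le> v powr r" using that C t0[of j] by (intro powr_mono2) auto
            then have "(C * t j) powr - r * (C * t j) powr r \<le> (C * t j) powr - r * v powr r" by (intro mult_left_mono) auto
            then show ?thesis using C t0[of j] by (simp add: powr_add[symmetric])
          qed
          have "u x \<le> cmod (mult_op M m a1 x) + cmod (mult_op M m a2 x)" unfolding u_def aa by (rule norm_triangle_ineq)
          then have "C * t j \<le> cmod (mult_op M m a1 x) \<or> C * t j \<le> cmod (mult_op M m a2 x)" using True by linarith
          then show ?thesis
          proof
            assume "C * t j \<le> cmod (mult_op M m a1 x)"
            then have "1 \<le> (C * t j) powr - 2 * cmod (mult_op M m a1 x) powr 2" by (intro big) auto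
            then show ?thesis using True by (simp add: add_increasing2)
          next
            assume "C * t j \<le> cmod (mult_op M m a2 x)"
            then have "1 \<le> (C * t j) powr - P * cmod (mult_op M m a2 x) powr P" using p by (intro big) auto
            then show ?thesis using True by (simp add: add_increasing)
          qed
        qed simp
        have "(\<Sum>x\<in>?X. if 2 * C * t j < u x then 1 else 0) \<le> (\<Sum>x\<in>?X. (C * t j) powr - 2 * cmod (mult_op M m a1 x) powr 2 + (C * t j) powr - P * cmod (mult_op M m a2 x) powr P)"
          by (intro sum_mono pt)
        also have "\<dots> = (C * t j) powr - 2 * (\<Sum>x\<in>?X. cmod (mult_op M m a1 x) powr 2) + (C * t j) powr - P * (\<Sum>x\<in>?X. cmod (mult_op M m a2 x) powr P)"
          by (simp only: sum.distrib sum_distrib_left)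
        also have "\<dots> \<le> (C * t j) powr - 2 * (C powr 2 * (\<Sum>x\<in>?X. cmod (a1 x) powr 2)) + (C * t j) powr - P * (C powr P * (\<Sum>x\<in>?X. cmod (a2 x) powr P))"
          using mult_bound_powr[of 2 C M m] mult_bound_powr[of P C M m] b2 bP C p
          by (intro add_mono mult_left_mono) (auto simp del: powr_numeral)
        also have "\<dots> = t j powr - 2 * (\<Sum>x\<in>?X. cmod (a1 x) powr 2) + t j powr - P * (\<Sum>x\<in>?X. cmod (a2 x) powr P)"
        proof -
          have "(C * t j) powr - r * (C powr r * z) = t j powr - r * z" for r z
          proof -
            have "C powr - r * C powr r = 1" using C by (simp add: powr_add[symmetric])
            have b: "(C * t j) powr - r = C powr - r * t j powr - r" using C t0[of j] by (simp add: powr_mult)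
            have "(C * t j) powr - r * (C powr r * z) = (C powr - r * C powr r) * (t j powr - r * z)" unfolding b by (simp only: mult_ac)
            with \<open>C powr - r * C powr r = 1\<close> show ?thesis by simp
          qed
          then show ?thesis by (simp only:)
        qed
        also have "\<dots> = (\<Sum>x\<in>?X. (if t j < al x then t j powr - 2 * al x powr 2 else 0) + (if al x \<le> t j then t j powr - P * al x powr P else 0))"
        proof -
          have "t j powr - 2 * cmod (a1 x) powr 2 = (if t j < al x then t j powr - 2 * al x powr 2 else 0)" for x by (simp add: a1_def al_def del: powr_numeral)
          moreover have "t j powr - P * cmod (a2 x) powr P = (if al x \<le> t j then t j powr - P * al x powr P else 0)" for x by (simp add: a2_def al_def)
          ultimately show ?thesis by (simp only: sum.distrib sum_distrib_left)
        qed
        finally show ?thesis .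
      qed
      have g: "(\<Sum>j<Suc (2 * n). t j powr p * ((if t j < al x then t j powr - 2 * al x powr 2 else 0) + (if al x \<le> t j then t j powr - P * al x powr P else 0))) \<le> (G1 + G2) * al x powr p" for x
      proof (cases "al x = 0")
        case True
        have "\<not> t j < 0" for j using t0[of j] by simp
        then show ?thesis using True by (simp add: if_distrib cong: if_cong)
      next
        case False
        then have a0: "al x > 0" by (simp add: al_def)
        have "(\<Sum>j<Suc (2 * n). t j powr p * ((if t j < al x then t j powr - 2 * al x powr 2 else 0) + (if al x \<le> t j then t j powr - P * al x powr P else 0))) =
          al x powr 2 * (\<Sum>j<Suc (2 * n). if t j < al x then t j powr (p - 2) else 0) + al x powr P * (\<Sum>j<Suc (2 * n). if al x \<le> t j then t j powr - (P - p) else 0)"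
        proof -
          have "t j powr p * ((if t j < al x then t j powr - 2 * al x powr 2 else 0) + (if al x \<le> t j then t j powr - P * al x powr P else 0)) =
            al x powr 2 * (if t j < al x then t j powr (p - 2) else 0) + al x powr P * (if al x \<le> t j then t j powr - (P - p) else 0)" for j
          proof -
            have "t j powr p * t j powr - 2 = t j powr (p - 2)" "t j powr p * t j powr - P = t j powr - (P - p)"
              by (simp_all add: powr_add[symmetric])
            then show ?thesis by (auto simp: mult_ac simp del: powr_numeral)
          qed
          then show ?thesis by (simp only: sum.distrib sum_distrib_left)
        qed
        also have "\<dots> \<le> al x powr 2 * (al x powr (p - 2) / (1 - 2 powr - (p - 2))) + al x powr P * (al x powr - (P - p) / (1 - 2 powr - (P - p)))"
          unfolding t_def using p a0 by (intro add_mono mult_left_mono geometric_below geometric_above) auto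
        also have "\<dots> = (G1 + G2) * al x powr p"
        proof -
          have "al x powr 2 * al x powr (p - 2) = al x powr p" "al x powr P * al x powr - (P - p) = al x powr p"
            unfolding powr_add[symmetric] by simp_all
          then show ?thesis by (simp add: G1_def G2_def algebra_simps del: powr_numeral) 
        qed
        finally show ?thesis .
      qed
      have "(\<Sum>x\<in>?X. u x powr p) \<le> (\<Sum>x\<in>?X. (4 * C) powr p * (\<Sum>j<Suc (2 * n). if 2 * C * t j < u x then t j powr p else 0) + (2 * C * 2 powr (- real n)) powr p)"
      proof (rule sum_mono)
        fix x assume "x \<in> ?X"
        then have "u x \<le> 4 * C * 2 powr (real (2 * n) - real n)" using uU n by fastforce
        then show "u x powr p \<le> (4 * C) powr p * (\<Sum>j<Suc (2 * n). if 2 * C * t j < u x then t j powr p else 0) + (2 * C * 2 powr (- real n)) powr p"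
          unfolding t_def using level_sum[OF C, of p "u x" "2 * n" "real n"] p by (simp add: u_def)
      qed
      also have "\<dots> = (4 * C) powr p * (\<Sum>j<Suc (2 * n). t j powr p * (\<Sum>x\<in>?X. if 2 * C * t j < u x then 1 else 0)) + real (card ?X) * (2 * C * 2 powr (- real n)) powr p"
      proof -
        have "(\<Sum>x\<in>?X. \<Sum>j<Suc (2 * n). if 2 * C * t j < u x then t j powr p else 0) = (\<Sum>j<Suc (2 * n). t j powr p * (\<Sum>x\<in>?X. if 2 * C * t j < u x then 1 else 0))"
          unfolding sum_distrib_left by (subst sum.swap) (auto intro!: sum.cong)
        then show ?thesis by (simp only: sum.distrib sum_distrib_left[symmetric] sum_constant of_nat_mult)
      qed
      also have "\<dots> \<le> (4 * C) powr p * (\<Sum>j<Suc (2 * n). t j powr p * (\<Sum>x\<in>?X. (if t j < al x then t j powr - 2 * al x powr 2 else 0) + (if al x \<le> t j then t j powr - P * al x powr P else 0))) + real (card ?X) * (2 * C * 2 powr (- real n)) powr p"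
        by (intro add_right_mono mult_left_mono sum_mono level) auto
      also have "(\<Sum>j<Suc (2 * n). t j powr p * (\<Sum>x\<in>?X. (if t j < al x then t j powr - 2 * al x powr 2 else 0) + (if al x \<le> t j then t j powr - P * al x powr P else 0))) =
         (\<Sum>x\<in>?X. \<Sum>j<Suc (2 * n). t j powr p * ((if t j < al x then t j powr - 2 * al x powr 2 else 0) + (if al x \<le> t j then t j powr - P * al x powr P else 0)))"
        unfolding sum_distrib_left by (rule sum.swap)
      also have "(4 * C) powr p * \<dots> + real (card ?X) * (2 * C * 2 powr (- real n)) powr p \<le> (4 * C) powr p * (\<Sum>x\<in>?X. (G1 + G2) * al x powr p) + real (card ?X) * (2 * C * 2 powr (- real n)) powr p"
        by (intro add_right_mono mult_left_mono sum_mono g) auto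
      finally show ?thesis by (simp only: sum_distrib_left[symmetric])
    qed
    let ?R = "(4 * C) powr p * ((G1 + G2) * (\<Sum>x\<in>?X. al x powr p))"
    have "(\<lambda>n::nat. ?R + real (card ?X) * (2 * C * 2 powr (- real n)) powr p) \<longlonglongrightarrow> ?R + real (card ?X) * 0"
    proof (intro tendsto_add tendsto_const tendsto_mult)
      have "(\<lambda>n::nat. (2 * C * 2 powr (- real n)) powr p) = (\<lambda>n. (2 * C) powr p * (2 powr (- p)) ^ n)"
      proof
        fix n :: nat
        have "(2 * C * 2 powr (- real n)) powr p = (2 * C) powr p * 2 powr (- real n * p)" using C by (simp add: powr_mult powr_powr)
        also have "2 powr (- real n * p) = (2 powr (- p)) ^ n" by (simp add: powr_realpow[symmetric] powr_powr mult.commute)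
        finally show "(2 * C * 2 powr (- real n)) powr p = (2 * C) powr p * (2 powr (- p)) ^ n" .
      qed
      moreover have "(\<lambda>n. (2 * C) powr p * (2 powr (- p)) ^ n) \<longlonglongrightarrow> (2 * C) powr p * 0"
        using p powr_less_mono[of "- p" 0 "2::real"] by (intro tendsto_mult tendsto_const LIMSEQ_power_zero) auto
      ultimately show "(\<lambda>n::nat. (2 * C * 2 powr (- real n)) powr p) \<longlonglongrightarrow> 0" by simp
    qed
    then have lim: "(\<lambda>n::nat. ?R + real (card ?X) * (2 * C * 2 powr (- real n)) powr p) \<longlonglongrightarrow> ?R" by simp
    have "eventually (\<lambda>n::nat. U \<le> 4 * C * 2 powr real n) sequentially"
    proof -
      obtain n0 where n0: "U / (4 * C) < 2 ^ n0" using real_arch_pow[of 2 "U / (4 * C)"] by auto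
      have "U \<le> 4 * C * 2 powr real n" if "n \<ge> n0" for n
      proof -
        have "(2::real) ^ n0 \<le> 2 ^ n" using that by (intro power_increasing) auto
        then have "U / (4 * C) \<le> 2 ^ n" using n0 by linarith
        then show ?thesis using C by (simp add: powr_realpow field_simps)
      qed
      then show ?thesis unfolding eventually_sequentially by blast
    qed
    then have "eventually (\<lambda>n::nat. (\<Sum>x\<in>?X. u x powr p) \<le> ?R + real (card ?X) * (2 * C * 2 powr (- real n)) powr p) sequentially"
      by (rule eventually_mono) (rule est)
    then have "(\<Sum>x\<in>?X. u x powr p) \<le> ?R" by (intro tendsto_lowerbound[OF lim]) auto
    then show ?thesis by (simp add: u_def al_def)
  qed
  have e: "(marC p P * C) powr p = (4 * C) powr p * (G1 + G2)"
    using G C p by (simp add: mar(1) powr_mult powr_powr mult_ac)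
  show ?thesis
    using mult_bound_powr[of p "marC p P * C" M m] p mar(2) C main by (simp add: e mult.assoc)
qed

lemma mult_bound_real_exponent:
  assumes p: "1 < (p::real)"
  obtains K :: real and k :: nat where "K > 0"
    "\<And>M C (m :: int ^ 'n::finite \<Rightarrow> complex). M > 0 \<Longrightarrow> C > 0 \<Longrightarrow> k \<ge> 1 \<Longrightarrow>
       (\<And>l. l \<in> {0, k} \<Longrightarrow> mult_bound M (real (2 * 2 ^ l)) C m \<and> mult_bound M (real (2 * 2 ^ l)) C (\<lambda>x. cnj (m x))) \<Longrightarrow>
       mult_bound M p (K * C) m" "k \<ge> 1"
proof -
  have big: "\<exists>k\<ge>1. q < real (2 * 2 ^ k)" for q :: real
  proof -
    obtain k where "q < 2 ^ k" using real_arch_pow[of 2 q] by auto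
    moreover have "(2::real) ^ k > 0" by simp
    ultimately have "q < real (2 * 2 ^ Suc k)" by (simp, linarith)
    then show ?thesis by (intro exI[of _ "Suc k"]) auto
  qed
  have marpos: "marC q P > 0" if "2 < q" "q < P" for q P
  proof -
    have "0 < 1 / (1 - 2 powr - (q - 2))" "0 < 1 / (1 - 2 powr - (P - q))"
      using that powr_less_mono[of "- (q - 2)" 0 "2::real"] powr_less_mono[of "- (P - q)" 0 "2::real"] by auto
    from add_pos_pos[OF this] show ?thesis unfolding marC_def by (intro mult_pos_pos) (simp, metis less_irrefl powr_gt_zero)
  qed
  consider "p = 2" | "p > 2" | "p < 2" by linarith
  then show ?thesis
  proof cases
    case 1
    show ?thesis
    proof (rule that[of 1 1])
      fix M and C :: real and m :: "int ^ 'n \<Rightarrow> complex"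
      assume "\<And>l. l \<in> {0, 1} \<Longrightarrow> mult_bound M (real (2 * 2 ^ l)) C m \<and> mult_bound M (real (2 * 2 ^ l)) C (\<lambda>x. cnj (m x))"
      from this[of 0] show "mult_bound M p (1 * C) m" using 1 by simp
    qed auto
  next
    case 2
    obtain k where k: "k \<ge> 1" "p < real (2 * 2 ^ k)" using big by blast
    show ?thesis
    proof (rule that[of "marC p (real (2 * 2 ^ k))" k])
      fix M and C :: real and m :: "int ^ 'n \<Rightarrow> complex"
      assume M: "M > 0" and C: "C > 0" and b: "\<And>l. l \<in> {0, k} \<Longrightarrow> mult_bound M (real (2 * 2 ^ l)) C m \<and> mult_bound M (real (2 * 2 ^ l)) C (\<lambda>x. cnj (m x))"
      show "mult_bound M p (marC p (real (2 * 2 ^ k)) * C) m"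
        using b[of 0] b[of k] by (intro mult_bound_interpolate M C 2 k) auto
    qed (rule marpos[OF 2 k(2)], rule k(1))
  next
    case 3
    define q where "q = p / (p - 1)"
    have q: "q > 2" "1 / q + 1 / p = 1"
    proof -
      show "q > 2" using 3 p by (simp add: q_def pos_less_divide_eq)
      show "1 / q + 1 / p = 1" using p by (simp add: q_def diff_divide_distrib)
    qed
    obtain k where k: "k \<ge> 1" "q < real (2 * 2 ^ k)" using big by blast
    show ?thesis
    proof (rule that[of "marC q (real (2 * 2 ^ k))" k])
      fix M and C :: real and m :: "int ^ 'n \<Rightarrow> complex"
      assume M: "M > 0" and C: "C > 0" and b: "\<And>l. l \<in> {0, k} \<Longrightarrow> mult_bound M (real (2 * 2 ^ l)) C m \<and> mult_bound M (real (2 * 2 ^ l)) C (\<lambda>x. cnj (m x))"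
      have q1: "q > 1" using q by simp
      have d: "mult_bound M q (marC q (real (2 * 2 ^ k)) * C) (\<lambda>x. cnj (m x))"
        using b[of 0] b[of k] by (intro mult_bound_interpolate M C q k) auto
      show "mult_bound M p (marC q (real (2 * 2 ^ k)) * C) m"
        by (rule mult_bound_dual[OF M q1 p q(2) d])
    qed (rule marpos[OF q(1) k(2)], rule k(1))
  qed
qed

section \<open>Riemann sums on the torus\<close>

lemma dist_abs_circle_le: "dist (abs_circle x) (abs_circle y) \<le> \<bar>x - y\<bar>"
  using circle_dist_le[of x y 0] by (simp add: dist_circle.abs_eq)

lemma abs_circle_eq_iff: "abs_circle x = abs_circle y \<longleftrightarrow> (\<exists>k::int. x - y = 2 * pi * of_int k)"
  by (simp add: circle.abs_eq_iff circle_rel_def)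

lemma dist_abs_circle_attained:
  obtains y' where "abs_circle y' = abs_circle y" "\<bar>x - y'\<bar> = dist (abs_circle x) (abs_circle y)"
proof -
  define k where "k = round ((x - y) / (2 * pi))"
  have "abs_circle (y + 2 * pi * of_int k) = abs_circle y" by (auto simp: abs_circle_eq_iff)
  moreover have "\<bar>x - (y + 2 * pi * of_int k)\<bar> = dist (abs_circle x) (abs_circle y)"
    unfolding dist_circle.abs_eq circle_dist_attained[of x y] k_def by (simp add: algebra_simps)
  ultimately show ?thesis by (rule that)
qed

lemma circle_rep: "\<exists>x. 0 \<le> x \<and> x < 2 * pi \<and> t = abs_circle x"
proof -
  obtain y where y: "t = abs_circle y" by (metis Quotient_abs_rep[OF Quotient_circle])
  define k where "k = \<lfloor>y / (2 * pi)\<rfloor>"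
  have "of_int k \<le> y / (2 * pi)" "y / (2 * pi) < of_int k + 1" by (auto simp: k_def floor_correct)
  then have "2 * pi * of_int k \<le> y" "y < 2 * pi * (of_int k + 1)"
    by (simp_all add: pos_le_divide_eq pos_divide_less_eq mult_ac)
  moreover have "abs_circle (y - 2 * pi * of_int k) = t" unfolding y abs_circle_eq_iff by (rule exI[of _ "- k"]) simp
  ultimately show ?thesis by (intro exI[of _ "y - 2 * pi * of_int k"]) (auto simp: algebra_simps)
qed

lemma continuous_torus_proj: "continuous_on A (torus_proj :: real ^ 'n::finite \<Rightarrow> 'n torus)"
  unfolding torus_proj_def
  by (intro continuous_on_vec_lambda continuous_on_compose2[OF continuous_on_abs_circle[of UNIV]] continuous_intros) auto

lemma torus_proj_surj: "\<exists>x. (\<forall>i. 0 \<le> x $ i \<and> x $ i < 2 * pi) \<and> t = torus_proj x" for t :: "'n::finite torus"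
proof -
  have "\<forall>i. \<exists>x. 0 \<le> x \<and> x < 2 * pi \<and> t $ i = abs_circle x" using circle_rep by blast
  from choice[OF this] obtain f where f: "\<And>i. 0 \<le> f i \<and> f i < 2 * pi \<and> t $ i = abs_circle (f i)" by blast
  then show ?thesis by (intro exI[of _ "\<chi> i. f i"]) (simp add: torus_proj_def vec_eq_iff)
qed

lemma compact_torus: "compact (UNIV :: ('n::finite) torus set)"
proof -
  have "compact (torus_proj ` (cbox 0 (\<chi> i. 2 * pi) :: (real ^ 'n) set))"
    by (intro compact_continuous_image continuous_torus_proj compact_cbox)
  moreover have "torus_proj ` (cbox 0 (\<chi> i. 2 * pi) :: (real ^ 'n) set) = UNIV"
  proof -
    have "t \<in> torus_proj ` (cbox 0 (\<chi> i. 2 * pi) :: (real ^ 'n) set)" for t :: "'n torus"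
    proof -
      obtain x :: "real ^ 'n" where "\<forall>i. 0 \<le> x $ i \<and> x $ i < 2 * pi" "t = torus_proj x" using torus_proj_surj by blast
      then show ?thesis by (intro image_eqI[of _ _ x]) (auto simp: mem_box_cart less_imp_le)
    qed
    then show ?thesis by blast
  qed
  ultimately show ?thesis by simp
qed

definition fund :: "(real ^ 'n) set" where
  "fund = {x. \<forall>i. 0 \<le> x $ i \<and> x $ i < 2 * pi}"

definition cell_box :: "nat \<Rightarrow> int ^ 'n \<Rightarrow> (real ^ 'n) set" where
  "cell_box M k = {x. \<forall>i. 2 * pi * of_int (k $ i) / real M \<le> x $ i \<and> x $ i < 2 * pi * (of_int (k $ i) + 1) / real M}"

definition gpt :: "nat \<Rightarrow> int ^ 'n \<Rightarrow> 'n torus" where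
  "gpt M k = torus_proj (\<chi> i. 2 * pi * of_int (k $ i) / real M)"

lemma halfopen_sets [measurable]: "{x :: real ^ 'n::finite. \<forall>i. a i \<le> x $ i \<and> x $ i < b i} \<in> sets borel"
proof -
  have "{x :: real ^ 'n. \<forall>i. a i \<le> x $ i \<and> x $ i < b i} = (\<Inter>i. {x. a i \<le> x $ i} \<inter> {x. x $ i < b i})" by auto
  also have "\<dots> \<in> sets borel"
  proof (intro sets.countable_INT'' sets.Int)
    fix i
    show "{x :: real ^ 'n. a i \<le> x $ i} \<in> sets borel" by (intro borel_closed closed_Collect_le continuous_intros)
    show "{x :: real ^ 'n. x $ i < b i} \<in> sets borel" by (intro borel_open open_Collect_less continuous_intros)
  qed auto
  finally show ?thesis .
qed

lemma emeasure_halfopen: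
  assumes ab: "\<And>i. a $ i \<le> b $ i"
  shows "emeasure lborel {x :: real ^ 'n::finite. \<forall>i. a $ i \<le> x $ i \<and> x $ i < b $ i} = ennreal (\<Prod>i\<in>UNIV. b $ i - a $ i)"
proof -
  let ?S = "{x :: real ^ 'n. \<forall>i. a $ i \<le> x $ i \<and> x $ i < b $ i}"
  have prod: "(\<Prod>c\<in>Basis. (b - a) \<bullet> c) = (\<Prod>i\<in>UNIV. b $ i - a $ i)"
  proof -
    have B: "(Basis :: (real ^ 'n) set) = (\<lambda>i. axis i 1) ` UNIV" by (auto simp: Basis_vec_def)
    have "inj (\<lambda>i :: 'n. axis i (1::real))" by (simp add: inj_on_def axis_eq_axis)
    then show ?thesis unfolding B by (simp add: prod.reindex inner_axis)
  qed
  have "box a b \<subseteq> ?S" "?S \<subseteq> cbox a b" by (auto simp: mem_box_cart less_imp_le)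
  moreover have "?S \<in> sets lborel" using halfopen_sets[of "\<lambda>i. a $ i" "\<lambda>i. b $ i"] by simp
  moreover have "\<And>c. c \<in> Basis \<Longrightarrow> a \<bullet> c \<le> b \<bullet> c" using ab by (auto simp: Basis_vec_def inner_axis)
  ultimately have "emeasure lborel ?S \<le> ennreal (\<Prod>i\<in>UNIV. b $ i - a $ i)" "ennreal (\<Prod>i\<in>UNIV. b $ i - a $ i) \<le> emeasure lborel ?S"
    using emeasure_mono[of ?S "cbox a b" lborel] emeasure_mono[of "box a b" ?S lborel] prod
    by (simp_all add: emeasure_lborel_cbox emeasure_lborel_box)
  then show ?thesis by (rule antisym)
qed

lemma cell_box_sets [measurable]: "cell_box M k \<in> sets borel"
  unfolding cell_box_def by (rule halfopen_sets)

lemma fund_sets [measurable]: "fund \<in> sets borel"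
  unfolding fund_def by (rule halfopen_sets)

lemma emeasure_cell_box:
  "M > 0 \<Longrightarrow> emeasure lborel (cell_box M k :: (real ^ 'n::finite) set) = ennreal ((2 * pi / real M) ^ CARD('n))"
  using emeasure_halfopen[of "\<chi> i. 2 * pi * of_int (k $ i) / real M" "\<chi> i. 2 * pi * (of_int (k $ i) + 1) / real M"]
  by (simp add: cell_box_def divide_right_mono diff_divide_distrib[symmetric] algebra_simps)

definition dvol :: "'n::finite itself \<Rightarrow> real" where
  "dvol _ = (2 * pi) ^ CARD('n)"

lemma dvol_pos: "dvol TYPE('n::finite) > 0"
  by (simp add: dvol_def)

lemma emeasure_fund: "emeasure lborel (fund :: (real ^ 'n::finite) set) = ennreal (dvol TYPE('n))"
  using emeasure_halfopen[of "0 :: real ^ 'n" "\<chi> i. 2 * pi"] by (simp add: fund_def dvol_def)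

definition fmeas :: "(real ^ 'n) measure" where
  "fmeas = restrict_space lborel fund"

lemma space_fmeas [simp]: "space fmeas = (fund :: (real ^ 'n::finite) set)"
  by (simp add: fmeas_def space_restrict_space)

lemma emeasure_fmeas: "A \<in> sets borel \<Longrightarrow> A \<subseteq> fund \<Longrightarrow> emeasure fmeas A = emeasure lborel A"
  unfolding fmeas_def by (subst emeasure_restrict_space) auto

lemma finite_fmeas: "finite_measure (fmeas :: (real ^ 'n::finite) measure)"
  by (rule finite_measureI) (simp add: emeasure_fmeas emeasure_fund)

lemma sets_fmeas: "A \<in> sets borel \<Longrightarrow> A \<subseteq> fund \<Longrightarrow> A \<in> sets fmeas"
  unfolding fmeas_def by (subst sets_restrict_space_iff) auto

lemma measurable_fmeas: "f \<in> borel_measurable borel \<Longrightarrow> f \<in> borel_measurable fmeas"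
  unfolding fmeas_def by (rule measurable_restrict_space1) simp

lemma measurable_proj_fmeas: "(torus_proj :: real ^ 'n::finite \<Rightarrow> 'n torus) \<in> borel_measurable fmeas"
  by (rule measurable_fmeas[OF torus_proj_measurable])

lemma torus_measure_fmeas: "torus_measure = distr fmeas borel (torus_proj :: real ^ 'n::finite \<Rightarrow> 'n torus)"
  by (simp add: torus_measure_def fmeas_def fund_def)

lemma space_torus_measure [simp]: "space torus_measure = UNIV"
  by (simp add: torus_measure_def)

lemma sets_torus_measure [simp, measurable_cong]: "sets torus_measure = sets borel"
  by (simp add: torus_measure_def)

lemma emeasure_torus_measure: "emeasure torus_measure (UNIV :: 'n::finite torus set) = ennreal (dvol TYPE('n))"
  unfolding torus_measure_fmeas
  by (subst emeasure_distr) (auto simp: measurable_proj_fmeas emeasure_fmeas emeasure_fund)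

lemma finite_torus_measure: "finite_measure (torus_measure :: ('n::finite) torus measure)"
  by (rule finite_measureI) (simp add: emeasure_torus_measure)

lemma measure_torus_measure: "measure torus_measure (UNIV :: 'n::finite torus set) = dvol TYPE('n)"
  using dvol_pos[where 'n='n] by (simp add: measure_def emeasure_torus_measure less_imp_le)

lemma continuous_measurable_torus:
  fixes G :: "('n::finite) torus \<Rightarrow> 'b::topological_space"
  assumes "continuous_on UNIV G" shows "G \<in> borel_measurable torus_measure"
  using borel_measurable_continuous_onI[OF assms] by (simp add: measurable_cong_sets[OF sets_torus_measure refl])

lemma continuous_bounded_torus:
  fixes G :: "('n::finite) torus \<Rightarrow> 'b::real_normed_vector"
  assumes "continuous_on UNIV G"
  obtains B where "B > 0" "\<And>t. norm (G t) \<le> B"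
proof -
  have "bounded (G ` UNIV)" using compact_continuous_image[OF assms compact_torus] by (rule compact_imp_bounded)
  then show ?thesis using that unfolding bounded_pos by auto
qed

lemma bounded_integrable_torus:
  fixes G :: "('n::finite) torus \<Rightarrow> complex"
  assumes "G \<in> borel_measurable torus_measure" "\<And>t. cmod (G t) \<le> B"
  shows "integrable torus_measure G"
  using assms by (intro finite_measure.integrable_const_bound[OF finite_torus_measure]) auto

lemma cell_unique:
  assumes M: "M > 0"
  shows "x \<in> cell_box M k \<longleftrightarrow> k = (\<chi> i. \<lfloor>x $ i * real M / (2 * pi)\<rfloor>)"
proof -
  have "2 * pi * of_int (k $ i) / real M \<le> x $ i \<and> x $ i < 2 * pi * (of_int (k $ i) + 1) / real M \<longleftrightarrow> k $ i = \<lfloor>x $ i * real M / (2 * pi)\<rfloor>" for i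
  proof -
    have "2 * pi * of_int (k $ i) / real M \<le> x $ i \<longleftrightarrow> of_int (k $ i) \<le> x $ i * real M / (2 * pi)"
      using M by (simp add: field_simps)
    moreover have "x $ i < 2 * pi * (of_int (k $ i) + 1) / real M \<longleftrightarrow> x $ i * real M / (2 * pi) < of_int (k $ i) + 1"
      using M by (simp add: field_simps)
    ultimately show ?thesis using floor_eq_iff[of "x $ i * real M / (2 * pi)" "k $ i"] by auto
  qed
  then show ?thesis by (auto simp: cell_box_def vec_eq_iff)
qed

lemma cell_in_grid:
  assumes M: "M > 0" and x: "x \<in> fund"
  shows "(\<chi> i. \<lfloor>x $ i * real M / (2 * pi)\<rfloor>) \<in> grid M"
proof -
  have "0 \<le> \<lfloor>x $ i * real M / (2 * pi)\<rfloor> \<and> \<lfloor>x $ i * real M / (2 * pi)\<rfloor> < int M" for i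
  proof -
    have "0 \<le> x $ i" "x $ i < 2 * pi" using x by (auto simp: fund_def)
    then have "0 \<le> x $ i * real M / (2 * pi)" "x $ i * real M / (2 * pi) < real M"
      using M by (auto simp: pos_divide_less_eq mult.commute)
    then show ?thesis by (auto simp: floor_less_iff)
  qed
  then show ?thesis by (simp add: grid_def)
qed

lemma cell_sub_fund:
  assumes M: "M > 0" and k: "k \<in> grid M"
  shows "cell_box M k \<subseteq> fund"
proof
  fix x assume x: "x \<in> cell_box M k"
  show "x \<in> fund" unfolding fund_def
  proof (intro CollectI allI)
    fix i
    have "0 \<le> k $ i" "k $ i < int M" using k by (auto simp: grid_def)
    then have "0 \<le> real_of_int (k $ i)" "real_of_int (k $ i) + 1 \<le> real M" by linarith+
    then have "0 \<le> 2 * pi * of_int (k $ i) / real M" "2 * pi * (of_int (k $ i) + 1) / real M \<le> 2 * pi"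
      using M by (auto simp: pos_divide_le_eq)
    then show "0 \<le> x $ i \<and> x $ i < 2 * pi" using x unfolding cell_box_def by (smt (verit) mem_Collect_eq)
  qed
qed

lemma integral_torus:
  fixes G :: "('n::finite) torus \<Rightarrow> complex"
  assumes "G \<in> borel_measurable borel"
  shows "(\<integral>t. G t \<partial>torus_measure) = (\<integral>x. G (torus_proj x) \<partial>fmeas)"
  unfolding torus_measure_fmeas by (rule integral_distr[OF measurable_proj_fmeas assms])

theorem riemann_sums:
  fixes G :: "('n::finite) torus \<Rightarrow> complex"
  assumes G: "continuous_on UNIV G"
  shows "(\<lambda>M. (\<Sum>k\<in>grid (Suc M). G (gpt (Suc M) k)) / of_nat (card (grid (Suc M) :: (int ^ 'n) set))) \<longlonglongrightarrow> (\<integral>t. G t \<partial>torus_measure) / of_real (dvol TYPE('n))"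
proof -
  obtain B where B: "\<And>t. cmod (G t) \<le> B" using continuous_bounded_torus[OF G] by blast
  have Gm: "G \<in> borel_measurable borel" by (rule borel_measurable_continuous_onI[OF G])
  define \<phi> where "\<phi> M x = (\<Sum>k\<in>grid M. indicat_real (cell_box M k) x *\<^sub>R G (gpt M k))" for M and x :: "real ^ 'n"
  have \<phi>_eq: "\<phi> M x = G (gpt M (\<chi> i. \<lfloor>x $ i * real M / (2 * pi)\<rfloor>))" if M: "M > 0" and x: "x \<in> fund" for M x
  proof -
    let ?k = "\<chi> i. \<lfloor>x $ i * real M / (2 * pi)\<rfloor>"
    have "\<phi> M x = (\<Sum>k\<in>grid M. if k = ?k then G (gpt M ?k) else 0)"
      unfolding \<phi>_def by (intro sum.cong refl) (auto simp: indicator_def cell_unique[OF M])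
    then show ?thesis using cell_in_grid[OF M x] by simp
  qed
  have int\<phi>: "(\<integral>x. \<phi> M x \<partial>fmeas) = of_real ((2 * pi / real M) ^ CARD('n)) * (\<Sum>k\<in>grid M. G (gpt M k))" if M: "M > 0" for M
  proof -
    have em: "emeasure fmeas (cell_box M k :: (real ^ 'n) set) = ennreal ((2 * pi / real M) ^ CARD('n))" if "k \<in> grid M" for k
      using emeasure_fmeas[OF cell_box_sets cell_sub_fund[OF M that]] emeasure_cell_box[OF M, of k] by simp
    have "(\<integral>x. \<phi> M x \<partial>fmeas) = (\<Sum>k\<in>grid M. (\<integral>x. indicat_real (cell_box M k) x *\<^sub>R G (gpt M k) \<partial>fmeas))"
      unfolding \<phi>_def
      by (intro Bochner_Integration.integral_sum integrable_scaleR_left integrable_real_indicator)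
         (auto simp: em sets_fmeas[OF cell_box_sets cell_sub_fund[OF M]])
    also have "\<dots> = (\<Sum>k\<in>grid M. ((2 * pi / real M) ^ CARD('n)) *\<^sub>R G (gpt M k))"
    proof (intro sum.cong refl)
      fix k :: "int ^ 'n" assume k: "k \<in> grid M"
      have "cell_box M k \<in> sets fmeas" by (rule sets_fmeas[OF cell_box_sets cell_sub_fund[OF M k]])
      moreover have "measure fmeas (cell_box M k) = (2 * pi / real M) ^ CARD('n)"
        using em[OF k] by (simp add: measure_def)
      ultimately show "(\<integral>x. indicat_real (cell_box M k) x *\<^sub>R G (gpt M k) \<partial>fmeas) = ((2 * pi / real M) ^ CARD('n)) *\<^sub>R G (gpt M k)"
        using em[OF k] by (simp add: integral_scaleR_left integrable_real_indicator cell_sub_fund[OF M k] Int_absorb2)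
    qed
    finally show ?thesis by (simp add: scaleR_conv_of_real sum_distrib_left)
  qed
  have "(\<lambda>M. \<integral>x. \<phi> (Suc M) x \<partial>fmeas) \<longlonglongrightarrow> (\<integral>x. G (torus_proj x) \<partial>fmeas)"
  proof (rule integral_dominated_convergence[where w = "\<lambda>_. B"])
    show "(\<lambda>x. G (torus_proj x)) \<in> borel_measurable fmeas" by (rule measurable_compose[OF measurable_proj_fmeas Gm])
    show "\<phi> (Suc M) \<in> borel_measurable fmeas" for M
      unfolding \<phi>_def[abs_def] by (intro measurable_fmeas borel_measurable_sum borel_measurable_scaleR borel_measurable_indicator) auto
    show "integrable fmeas (\<lambda>_ :: real ^ 'n. B)" using finite_measure.integrable_const[OF finite_fmeas] by blast
    show "AE x in fmeas. norm (\<phi> (Suc M) x) \<le> B" for M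
      by (rule AE_I2) (simp add: \<phi>_eq B)
    show "AE x in fmeas. (\<lambda>M. \<phi> (Suc M) x) \<longlonglongrightarrow> G (torus_proj x)"
    proof (rule AE_I2)
      fix x :: "real ^ 'n" assume "x \<in> space fmeas"
      then have x: "x \<in> fund" by simp
      define y where "y M = (\<chi> i. 2 * pi * of_int \<lfloor>x $ i * real (Suc M) / (2 * pi)\<rfloor> / real (Suc M))" for M
      have "y \<longlonglongrightarrow> x"
      proof (rule vec_tendstoI)
        fix i
        have "(\<lambda>M. 2 * pi / real (Suc M)) \<longlonglongrightarrow> 0" by (intro LIMSEQ_Suc lim_const_over_n)
        moreover have "\<bar>y M $ i - x $ i\<bar> \<le> 2 * pi / real (Suc M)" for M
        proof -
          let ?z = "x $ i * real (Suc M) / (2 * pi)"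
          have "x $ i = 2 * pi / real (Suc M) * ?z" by (simp del: of_nat_Suc)
          moreover have "y M $ i = 2 * pi / real (Suc M) * of_int \<lfloor>?z\<rfloor>" by (simp add: y_def del: of_nat_Suc)
          ultimately have "y M $ i - x $ i = 2 * pi / real (Suc M) * (of_int \<lfloor>?z\<rfloor> - ?z)"
            by (simp only: right_diff_distrib)
          then have "\<bar>y M $ i - x $ i\<bar> = \<bar>2 * pi / real (Suc M)\<bar> * \<bar>of_int \<lfloor>?z\<rfloor> - ?z\<bar>"
            by (simp only: abs_mult)
          also have "\<dots> = 2 * pi / real (Suc M) * \<bar>of_int \<lfloor>?z\<rfloor> - ?z\<bar>" by (simp del: of_nat_Suc)
          also have "\<dots> \<le> 2 * pi / real (Suc M) * 1" by (intro mult_left_mono) (auto simp: abs_le_iff, linarith+)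
          finally show ?thesis by simp
        qed
        ultimately show "(\<lambda>M. y M $ i) \<longlonglongrightarrow> x $ i"
          using tendsto_rabs_zero_cancel[of "\<lambda>M. y M $ i - x $ i"] 
          by (intro LIM_zero_cancel[of "\<lambda>M. y M $ i"] Lim_null_comparison[of "\<lambda>M. y M $ i - x $ i" "\<lambda>M. 2 * pi / real (Suc M)"]) auto
      qed
      then have "(\<lambda>M. G (torus_proj (y M))) \<longlonglongrightarrow> G (torus_proj x)"
        using continuous_on_compose2[OF G continuous_torus_proj[of UNIV]]
        by (intro continuous_on_tendsto_compose[where f = "\<lambda>x. G (torus_proj x)" and s = UNIV]) auto
      then show "(\<lambda>M. \<phi> (Suc M) x) \<longlonglongrightarrow> G (torus_proj x)"
        by (simp add: \<phi>_eq[OF _ x] gpt_def y_def del: of_nat_Suc)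
    qed
  qed
  then have "(\<lambda>M. (\<integral>x. \<phi> (Suc M) x \<partial>fmeas) / of_real (dvol TYPE('n))) \<longlonglongrightarrow> (\<integral>t. G t \<partial>torus_measure) / of_real (dvol TYPE('n))"
    unfolding integral_torus[OF Gm] by (intro tendsto_divide tendsto_const) (use dvol_pos[where 'n='n] in auto)
  moreover have "(\<integral>x. \<phi> (Suc M) x \<partial>fmeas) / of_real (dvol TYPE('n)) = (\<Sum>k\<in>grid (Suc M). G (gpt (Suc M) k)) / of_nat (card (grid (Suc M) :: (int ^ 'n) set))" for M
    using dvol_pos[where 'n='n] by (simp add: int\<phi> card_grid dvol_def power_divide del: of_nat_Suc)
  ultimately show ?thesis by simp
qed

lemma circle_character_abs: "circle_character k (abs_circle x) = cis (of_int k * x)"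
  by (rule circle_character.abs_eq)

lemma torus_character_proj: "torus_character k (torus_proj x) = cis (\<Sum>i\<in>UNIV. of_int (k $ i) * x $ i)"
proof -
  have "(\<Prod>i\<in>A. cis (f i)) = cis (\<Sum>i\<in>A. f i)" for A and f :: "'a \<Rightarrow> real"
    by (induction A rule: infinite_finite_induct) (auto simp: cis_mult)
  then show ?thesis by (simp add: torus_character_def torus_proj_def circle_character_abs)
qed

lemma torus_character_add: "torus_character (k + l) t = torus_character k t * torus_character l t"
proof -
  obtain x where "t = torus_proj x" using torus_proj_surj by blast
  then show ?thesis by (simp add: torus_character_proj cis_mult sum.distrib[symmetric] algebra_simps)
qed

lemma torus_character_minus: "torus_character (- k) t = cnj (torus_character k t)"
proof -
  obtain x where "t = torus_proj x" using torus_proj_surj by blast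
  then show ?thesis by (simp add: torus_character_proj cis_cnj sum_negf)
qed

lemma norm_torus_character [simp]: "cmod (torus_character k t) = 1"
proof -
  obtain x where "t = torus_proj x" using torus_proj_surj by blast
  then show ?thesis by (simp add: torus_character_proj)
qed

lemma torus_character_0 [simp]: "torus_character 0 t = 1"
proof -
  obtain x where "t = torus_proj x" using torus_proj_surj by blast
  then show ?thesis by (simp add: torus_character_proj)
qed

lemma torus_character_gpt: "torus_character x (gpt M k) = chr M k x"
  by (simp add: gpt_def torus_character_proj chr_def sum_distrib_left sum_divide_distrib mult_ac)

lemma continuous_circle_character: "continuous_on UNIV (circle_character k)"
  unfolding continuous_on_iff
proof (intro ballI allI impI)
  fix t :: circle and e :: real assume e: "e > 0"
  obtain x where x: "t = abs_circle x" using circle_rep by blast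
  have "continuous_on UNIV (\<lambda>x. cis (of_int k * x))" by (intro continuous_intros)
  then obtain d where d: "d > 0" "\<And>y. dist y x < d \<Longrightarrow> dist (cis (of_int k * y)) (cis (of_int k * x)) < e"
    using e unfolding continuous_on_iff by (metis UNIV_I)
  have "dist (circle_character k s) (circle_character k t) < e" if s: "dist s t < d" for s
  proof -
    obtain z where z: "s = abs_circle z" using circle_rep by blast
    obtain y where y: "abs_circle y = abs_circle z" "\<bar>x - y\<bar> = dist (abs_circle x) (abs_circle z)"
      using dist_abs_circle_attained by blast
    then have "dist y x < d" using s x z by (simp add: dist_real_def dist_commute abs_minus_commute)
    then show ?thesis using d(2)[of y] y(1) by (simp add: x z circle_character_abs[symmetric])
  qed
  then show "\<exists>d>0. \<forall>x'\<in>UNIV. dist x' t < d \<longrightarrow> dist (circle_character k x') (circle_character k t) < e"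
    using d(1) by blast
qed

lemma continuous_torus_character [continuous_intros]: "continuous_on A (torus_character k)"
  unfolding torus_character_def
  by (intro continuous_on_prod continuous_on_compose2[OF continuous_circle_character] continuous_intros) auto

lemma integral_torus_character:
  "(\<integral>t. torus_character k t \<partial>torus_measure) = (if k = 0 then of_real (dvol TYPE('n)) else 0)" for k :: "int ^ 'n::finite"
proof (cases "k = 0")
  case True
  then show ?thesis by (simp add: measure_torus_measure scaleR_conv_of_real)
next
  case False
  then obtain i where i: "k $ i \<noteq> 0" by (auto simp: vec_eq_iff)
  have "(\<Sum>x\<in>grid (Suc M). torus_character k (gpt (Suc M) x)) = 0" if "M \<ge> nat \<bar>k $ i\<bar>" for M
  proof -
    have "\<not> int (Suc M) dvd k $ i"
    proof
      assume "int (Suc M) dvd k $ i"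
      then have "int (Suc M) \<le> \<bar>k $ i\<bar>" using i by (intro zdvd_imp_le) auto
      then show False using that by linarith
    qed
    then show ?thesis using sum_chr[of "Suc M" k] by (auto simp: torus_character_gpt)
  qed
  then have "eventually (\<lambda>M. (\<Sum>x\<in>grid (Suc M). torus_character k (gpt (Suc M) x)) / of_nat (card (grid (Suc M) :: (int ^ 'n) set)) = 0) sequentially"
    unfolding eventually_sequentially by (intro exI[of _ "nat \<bar>k $ i\<bar>"]) simp
  then have "(\<lambda>M. (\<Sum>x\<in>grid (Suc M). torus_character k (gpt (Suc M) x)) / of_nat (card (grid (Suc M) :: (int ^ 'n) set))) \<longlonglongrightarrow> 0"
    by (rule tendsto_eventually)
  from LIMSEQ_unique[OF riemann_sums[OF continuous_torus_character] this]
  have "(\<integral>t. torus_character k t \<partial>torus_measure) / of_real (dvol TYPE('n)) = 0" .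
  then show ?thesis using dvol_pos[where 'n='n] False by simp
qed

section \<open>Square-integrable functions on the torus\<close>

definition trig_poly :: "(int ^ 'n) set \<Rightarrow> (int ^ 'n \<Rightarrow> complex) \<Rightarrow> 'n::finite torus \<Rightarrow> complex" where
  "trig_poly A a t = (\<Sum>k\<in>A. a k * torus_character (- k) t)"

definition fourier_coeff :: "('n::finite torus \<Rightarrow> complex) \<Rightarrow> int ^ 'n \<Rightarrow> complex" where
  "fourier_coeff G k = (\<integral>t. G t * torus_character k t \<partial>torus_measure) / of_real (dvol TYPE('n))"

definition energy :: "('n::finite torus \<Rightarrow> complex) \<Rightarrow> ennreal" where
  "energy G = (\<integral>\<^sup>+ t. ennreal ((cmod (G t))\<^sup>2) \<partial>torus_measure)"

definition sq_int :: "('n::finite torus \<Rightarrow> complex) \<Rightarrow> bool" where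
  "sq_int G \<longleftrightarrow> G \<in> borel_measurable torus_measure \<and> energy G < \<infinity>"

lemma continuous_trig_poly: "continuous_on S (trig_poly A a)"
  unfolding trig_poly_def by (intro continuous_intros)

lemma measurable_torus_character [measurable]: "torus_character k \<in> borel_measurable torus_measure"
  by (rule continuous_measurable_torus[OF continuous_torus_character])

lemma measurable_trig_poly [measurable]: "trig_poly A a \<in> borel_measurable torus_measure"
  by (rule continuous_measurable_torus[OF continuous_trig_poly])

lemma energy_le_bound:
  assumes "\<And>t. cmod (G t) \<le> B"
  shows "energy (G :: 'n::finite torus \<Rightarrow> complex) \<le> ennreal (B\<^sup>2 * dvol TYPE('n))"
proof -
  have "energy G \<le> (\<integral>\<^sup>+ t. ennreal (B\<^sup>2) \<partial>(torus_measure :: 'n torus measure))"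
    unfolding energy_def using assms by (intro nn_integral_mono ennreal_leI power_mono) auto
  also have "\<dots> = ennreal (B\<^sup>2 * dvol TYPE('n))"
    using dvol_pos[where 'n='n] by (simp add: emeasure_torus_measure ennreal_mult)
  finally show ?thesis .
qed

lemma sq_int_bounded:
  assumes "G \<in> borel_measurable torus_measure" "\<And>t. cmod (G t) \<le> B"
  shows "sq_int G"
  using energy_le_bound[of G B] assms by (auto simp: sq_int_def intro: le_less_trans)

lemma sq_int_trig_poly: "sq_int (trig_poly A a)"
  using continuous_bounded_torus[OF continuous_trig_poly[of UNIV A a]] sq_int_bounded[OF measurable_trig_poly] by metis

lemma energy_add:
  assumes [measurable]: "G \<in> borel_measurable torus_measure" "H \<in> borel_measurable torus_measure"
  shows "energy (\<lambda>t. G t + H t) \<le> 2 * energy G + 2 * energy H"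
proof -
  have "(cmod (G t + H t))\<^sup>2 \<le> 2 * (cmod (G t))\<^sup>2 + 2 * (cmod (H t))\<^sup>2" for t
  proof -
    have "(cmod (G t + H t))\<^sup>2 \<le> (cmod (G t) + cmod (H t))\<^sup>2" by (intro power_mono norm_triangle_ineq) auto
    also have "\<dots> \<le> 2 * (cmod (G t))\<^sup>2 + 2 * (cmod (H t))\<^sup>2"
      using zero_le_power2[of "cmod (G t) - cmod (H t)"] by (simp add: power2_sum power2_diff)
    finally show ?thesis .
  qed
  then have "energy (\<lambda>t. G t + H t) \<le> (\<integral>\<^sup>+ t. ennreal (2 * (cmod (G t))\<^sup>2 + 2 * (cmod (H t))\<^sup>2) \<partial>torus_measure)"
    unfolding energy_def by (intro nn_integral_mono ennreal_leI)
  also have "\<dots> = 2 * energy G + 2 * energy H"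
    unfolding energy_def by (simp add: ennreal_mult nn_integral_add nn_integral_cmult)
  finally show ?thesis .
qed

lemma energy_mult_le:
  assumes [measurable]: "H \<in> borel_measurable torus_measure" and "\<And>t. cmod (m t) \<le> B"
  shows "energy (\<lambda>t. m t * H t) \<le> ennreal (B\<^sup>2) * energy H"
proof -
  have "energy (\<lambda>t. m t * H t) \<le> (\<integral>\<^sup>+ t. ennreal (B\<^sup>2) * ennreal ((cmod (H t))\<^sup>2) \<partial>torus_measure)"
    unfolding energy_def using assms(2)
    by (intro nn_integral_mono) (auto simp: ennreal_mult[symmetric] norm_mult power_mult_distrib intro!: ennreal_leI mult_right_mono power_mono)
  then show ?thesis by (simp add: nn_integral_cmult energy_def)
qed

lemma sq_int_add: "sq_int G \<Longrightarrow> sq_int H \<Longrightarrow> sq_int (\<lambda>t. G t + H t)"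
  using energy_add[of G H] by (auto simp: sq_int_def ennreal_mult_less_top intro: le_less_trans)

lemma sq_int_mult:
  assumes "sq_int H" "m \<in> borel_measurable torus_measure" "\<And>t. cmod (m t) \<le> B"
  shows "sq_int (\<lambda>t. m t * H t)"
  using energy_mult_le[of H m B] assms by (auto simp: sq_int_def ennreal_mult_less_top intro: le_less_trans)

lemma sq_int_diff: "sq_int G \<Longrightarrow> sq_int H \<Longrightarrow> sq_int (\<lambda>t. G t - H t)"
  using sq_int_add[of G "\<lambda>t. - 1 * H t"] sq_int_mult[of H "\<lambda>_. - 1" 1] by simp

lemma sq_int_integrable_square:
  assumes "sq_int G" shows "integrable torus_measure (\<lambda>t. (cmod (G t))\<^sup>2)"
  using assms unfolding sq_int_def energy_def by (intro integrableI_bounded) auto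

lemma sq_int_integrable_mult:
  assumes G: "sq_int G" and m: "m \<in> borel_measurable torus_measure" "\<And>t. cmod (m t) \<le> B"
  shows "integrable torus_measure (\<lambda>t. G t * m t)"
proof (rule Bochner_Integration.integrable_bound)
  have [measurable]: "G \<in> borel_measurable torus_measure" using G by (simp add: sq_int_def)
  show "integrable torus_measure (\<lambda>t. (cmod (G t))\<^sup>2 + B\<^sup>2)"
    by (intro Bochner_Integration.integrable_add sq_int_integrable_square G finite_measure.integrable_const finite_torus_measure)
  show "(\<lambda>t. G t * m t) \<in> borel_measurable torus_measure" using m by measurable
  have "cmod (G t * m t) \<le> (cmod (G t))\<^sup>2 + B\<^sup>2" for t
  proof -
    have "cmod (G t * m t) \<le> cmod (G t) * B" unfolding norm_mult by (intro mult_left_mono m) auto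
    also have "\<dots> \<le> (cmod (G t))\<^sup>2 + B\<^sup>2" using zero_le_power2[of "cmod (G t) - B"] zero_le_power2[of "cmod (G t) + B"] by (simp add: power2_sum power2_diff)
    finally show ?thesis .
  qed
  then show "AE t in torus_measure. norm (G t * m t) \<le> norm ((cmod (G t))\<^sup>2 + B\<^sup>2)" by auto
qed

lemma energy_eq_integral: "sq_int G \<Longrightarrow> energy G = ennreal (\<integral>t. (cmod (G t))\<^sup>2 \<partial>torus_measure)"
  unfolding energy_def by (intro nn_integral_eq_integral sq_int_integrable_square) auto

lemma integral_cnj_trig_poly:
  assumes G: "sq_int G" and A: "finite A"
  shows "integrable torus_measure (\<lambda>t. cnj (trig_poly A b t) * G t)"
    and "(\<integral>t. cnj (trig_poly A b t) * G t \<partial>torus_measure) = of_real (dvol TYPE('n)) * (\<Sum>k\<in>A. cnj (b k) * fourier_coeff (G :: 'n::finite torus \<Rightarrow> complex) k)"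
proof -
  have eq: "cnj (trig_poly A b t) * G t = (\<Sum>k\<in>A. cnj (b k) * (G t * torus_character k t))" for t
    by (simp add: trig_poly_def sum_distrib_left sum_distrib_right torus_character_minus mult_ac)
  have int: "integrable torus_measure (\<lambda>t. G t * torus_character k t)" for k
    by (rule sq_int_integrable_mult[OF G, where B = 1]) auto
  show "integrable torus_measure (\<lambda>t. cnj (trig_poly A b t) * G t)"
    unfolding eq by (intro Bochner_Integration.integrable_sum Bochner_Integration.integrable_mult_right int)
  show "(\<integral>t. cnj (trig_poly A b t) * G t \<partial>torus_measure) = of_real (dvol TYPE('n)) * (\<Sum>k\<in>A. cnj (b k) * fourier_coeff G k)"
    unfolding eq using dvol_pos[where 'n='n]
    by (subst Bochner_Integration.integral_sum) (auto simp: int fourier_coeff_def sum_distrib_left)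
qed

lemma fourier_coeff_trig_poly:
  fixes k :: "int ^ 'n::finite"
  assumes A: "finite A" shows "fourier_coeff (trig_poly A b) k = (if k \<in> A then b k else 0)"
proof -
  have "(\<integral>t. trig_poly A b t * torus_character k t \<partial>torus_measure) = (\<Sum>l\<in>A. b l * (\<integral>t. torus_character (k - l) t \<partial>torus_measure))"
  proof -
    have "trig_poly A b t * torus_character k t = (\<Sum>l\<in>A. b l * torus_character (k - l) t)" for t
      using torus_character_add[of _ k] by (simp add: trig_poly_def sum_distrib_right mult.assoc[symmetric] torus_character_add[of "- _" k, symmetric] mult.assoc)
    moreover have "integrable torus_measure (\<lambda>t. torus_character (k - l) t)" for l
      by (rule bounded_integrable_torus[where B = 1]) auto
    ultimately show ?thesis by simp
  qed
  also have "\<dots> = (\<Sum>l\<in>A. if l = k then b k * of_real (dvol TYPE('n)) else 0)"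
    by (intro sum.cong refl) (auto simp: integral_torus_character)
  finally show ?thesis using A dvol_pos[where 'n='n] by (simp add: fourier_coeff_def)
qed

theorem best_approximation:
  fixes G :: "'n::finite torus \<Rightarrow> complex"
  assumes G: "sq_int G" and A: "finite A"
  shows "(\<integral>t. (cmod (G t - trig_poly A b t))\<^sup>2 \<partial>torus_measure)
    = (\<integral>t. (cmod (G t))\<^sup>2 \<partial>torus_measure) - dvol TYPE('n) * (\<Sum>k\<in>A. (cmod (fourier_coeff G k))\<^sup>2)
      + dvol TYPE('n) * (\<Sum>k\<in>A. (cmod (b k - fourier_coeff G k))\<^sup>2)"
proof -
  let ?T = "trig_poly A b" and ?c = "fourier_coeff G"
  note T = sq_int_trig_poly[of A b]
  have ex: "(cmod (z - w))\<^sup>2 = (cmod z)\<^sup>2 + (cmod w)\<^sup>2 - 2 * Re (cnj w * z)" for z w :: complex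
    unfolding cmod_power2 by (simp add: power2_eq_square algebra_simps)
  have T2: "(\<integral>t. (cmod (?T t))\<^sup>2 \<partial>torus_measure) = dvol TYPE('n) * (\<Sum>k\<in>A. (cmod (b k))\<^sup>2)"
  proof -
    have "complex_of_real (\<integral>t. (cmod (?T t))\<^sup>2 \<partial>torus_measure) = (\<integral>t. cnj (?T t) * ?T t \<partial>torus_measure)"
      unfolding integral_complex_of_real[symmetric] by (simp only: complex_norm_square mult.commute)
    also have "\<dots> = of_real (dvol TYPE('n)) * (\<Sum>k\<in>A. cnj (b k) * b k)"
      unfolding integral_cnj_trig_poly(2)[OF T A] by (simp add: fourier_coeff_trig_poly[OF A])
    also have "\<dots> = complex_of_real (dvol TYPE('n) * (\<Sum>k\<in>A. (cmod (b k))\<^sup>2))"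
      unfolding of_real_mult of_real_sum complex_norm_square by (simp add: mult.commute)
    finally show ?thesis unfolding of_real_eq_iff .
  qed
  have "(\<integral>t. (cmod (G t - ?T t))\<^sup>2 \<partial>torus_measure)
    = (\<integral>t. (cmod (G t))\<^sup>2 \<partial>torus_measure) + (\<integral>t. (cmod (?T t))\<^sup>2 \<partial>torus_measure) - 2 * Re (\<integral>t. cnj (?T t) * G t \<partial>torus_measure)"
  proof -
    note i = integral_cnj_trig_poly(1)[OF G A, of b]
    have "integrable torus_measure (\<lambda>t. Re (cnj (?T t) * G t))" using i by (rule integrable_Re)
    moreover have "Re (\<integral>t. cnj (?T t) * G t \<partial>torus_measure) = (\<integral>t. Re (cnj (?T t) * G t) \<partial>torus_measure)"
      using integral_Re[OF i] by simp
    ultimately show ?thesis unfolding ex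
      by (simp only: sq_int_integrable_square[OF G] sq_int_integrable_square[OF T] Bochner_Integration.integral_diff
          Bochner_Integration.integral_add Bochner_Integration.integrable_add integrable_mult_right integral_mult_right_zero)
  qed
  also have "\<dots> = (\<integral>t. (cmod (G t))\<^sup>2 \<partial>torus_measure) + dvol TYPE('n) * (\<Sum>k\<in>A. (cmod (b k))\<^sup>2 - 2 * Re (cnj (b k) * ?c k))"
    unfolding T2 integral_cnj_trig_poly(2)[OF G A] by (simp add: sum_subtractf sum_distrib_left algebra_simps)
  also have "(\<Sum>k\<in>A. (cmod (b k))\<^sup>2 - 2 * Re (cnj (b k) * ?c k)) = (\<Sum>k\<in>A. (cmod (b k - ?c k))\<^sup>2 - (cmod (?c k))\<^sup>2)"
    by (intro sum.cong refl) (simp add: ex)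
  finally show ?thesis by (simp add: sum_subtractf right_diff_distrib)
qed

lemma bessel:
  assumes G: "sq_int (G :: 'n::finite torus \<Rightarrow> complex)" and A: "finite A"
  shows "dvol TYPE('n) * (\<Sum>k\<in>A. (cmod (fourier_coeff G k))\<^sup>2) \<le> (\<integral>t. (cmod (G t))\<^sup>2 \<partial>torus_measure)"
proof -
  have "0 \<le> (\<integral>t. (cmod (G t - trig_poly A (fourier_coeff G) t))\<^sup>2 \<partial>torus_measure)" by (rule Bochner_Integration.integral_nonneg) simp
  then show ?thesis using best_approximation[OF G A, of "fourier_coeff G"] by simp
qed

lemma energy_best_approximation:
  assumes G: "sq_int (G :: 'n::finite torus \<Rightarrow> complex)" and A: "finite A" and BA: "B \<subseteq> A"
  shows "energy (\<lambda>t. G t - trig_poly A (fourier_coeff G) t) \<le> energy (\<lambda>t. G t - trig_poly B b t)"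
proof -
  have "trig_poly B b = trig_poly A (\<lambda>k. if k \<in> B then b k else 0)"
    using A BA unfolding trig_poly_def by (intro ext sum.mono_neutral_cong_left) auto
  moreover have "(\<integral>t. (cmod (G t - trig_poly A (fourier_coeff G) t))\<^sup>2 \<partial>torus_measure) \<le> (\<integral>t. (cmod (G t - trig_poly A b' t))\<^sup>2 \<partial>torus_measure)" for b'
    unfolding best_approximation[OF G A] using dvol_pos[where 'n='n]
    by (simp add: sum_nonneg)
  ultimately show ?thesis
    by (simp add: energy_eq_integral sq_int_diff[OF G sq_int_trig_poly])
qed

definition approximable :: "('n::finite torus \<Rightarrow> complex) \<Rightarrow> bool" where
  "approximable G \<longleftrightarrow> sq_int G \<and> (\<forall>e>0. \<exists>A b. finite A \<and> energy (\<lambda>t. G t - trig_poly A b t) < ennreal e)"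

lemma energy_trig_poly:
  assumes "finite A" shows "energy (trig_poly A b :: 'n::finite torus \<Rightarrow> complex) = ennreal (dvol TYPE('n) * (\<Sum>k\<in>A. (cmod (b k))\<^sup>2))"
proof -
  have "sq_int (\<lambda>t::'n torus. 0)" by (rule sq_int_bounded[where B = 0]) auto
  from best_approximation[OF this assms, of b]
  have "(\<integral>t. (cmod (trig_poly A b (t :: 'n torus)))\<^sup>2 \<partial>torus_measure) = dvol TYPE('n) * (\<Sum>k\<in>A. (cmod (b k))\<^sup>2)"
    by (simp add: fourier_coeff_def)
  then show ?thesis by (simp add: energy_eq_integral[OF sq_int_trig_poly])
qed

theorem is_fourier_transform_coeff:
  assumes "approximable (G :: 'n::finite torus \<Rightarrow> complex)" shows "is_fourier_transform (fourier_coeff G) G"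
proof -
  have G: "sq_int G" using assms by (simp add: approximable_def)
  have "fourier_coeff G \<in> lp_space 2"
  proof -
    have "(\<lambda>k. (cmod (fourier_coeff G k))\<^sup>2) summable_on UNIV"
    proof (rule nonneg_bdd_above_summable_on)
      show "bdd_above (sum (\<lambda>k. (cmod (fourier_coeff G k))\<^sup>2) ` {F. F \<subseteq> UNIV \<and> finite F})"
        using bessel[OF G] dvol_pos[where 'n='n]
        by (intro bdd_aboveI2[where M = "(\<integral>t. (cmod (G t))\<^sup>2 \<partial>torus_measure) / dvol TYPE('n)"]) (auto simp: field_simps)
    qed auto
    then show ?thesis by (simp add: lp_space_def)
  qed
  moreover have "((\<lambda>A. energy (\<lambda>t. trig_poly A (fourier_coeff G) t - G t)) \<longlongrightarrow> 0) (finite_subsets_at_top UNIV)"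
  proof (rule order_tendstoI)
    fix e :: ennreal assume e: "0 < e"
    obtain e' where e': "e' > 0" "ennreal e' < e"
    proof -
      obtain x where x: "0 < x" "x < e" using dense[OF e] by blast
      then obtain r where "r \<ge> 0" "x = ennreal r" by (cases x) (auto simp: top_unique)
      then show thesis using x by (intro that[of r]) auto
    qed
    obtain B b where B: "finite B" "energy (\<lambda>t. G t - trig_poly B b t) < ennreal e'"
      using assms e'(1) unfolding approximable_def by blast
    have "eventually (\<lambda>A. finite A \<and> B \<subseteq> A) (finite_subsets_at_top UNIV)"
      using B(1) by (auto simp: eventually_finite_subsets_at_top intro!: exI[of _ B])
    then show "eventually (\<lambda>A. energy (\<lambda>t. trig_poly A (fourier_coeff G) t - G t) < e) (finite_subsets_at_top UNIV)"
    proof (rule eventually_mono)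
      fix A assume A: "finite A \<and> B \<subseteq> A"
      have "energy (\<lambda>t. trig_poly A (fourier_coeff G) t - G t) = energy (\<lambda>t. G t - trig_poly A (fourier_coeff G) t)"
        by (simp add: energy_def norm_minus_commute)
      also have "\<dots> \<le> energy (\<lambda>t. G t - trig_poly B b t)" using A by (intro energy_best_approximation G) auto
      also have "\<dots> < e" using B(2) e'(2) by (rule less_trans)
      finally show "energy (\<lambda>t. trig_poly A (fourier_coeff G) t - G t) < e" .
    qed
  qed auto
  ultimately show ?thesis using G by (simp add: is_fourier_transform_def sq_int_def energy_def trig_poly_def)
qed

lemma approximable_fourier_transform:
  assumes F: "is_fourier_transform a F" shows "approximable F"
proof -
  have [measurable]: "F \<in> borel_measurable torus_measure" and s: "sq_int F"
    using F by (auto simp: is_fourier_transform_def sq_int_def energy_def)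
  have "\<exists>A b. finite A \<and> energy (\<lambda>t. F t - trig_poly A b t) < ennreal e" if e: "e > 0" for e
  proof -
    have "((\<lambda>A. energy (\<lambda>t. F t - trig_poly A a t)) \<longlongrightarrow> 0) (finite_subsets_at_top UNIV)"
      using F by (simp add: is_fourier_transform_def energy_def trig_poly_def norm_minus_commute)
    then have "eventually (\<lambda>A. energy (\<lambda>t. F t - trig_poly A a t) < ennreal e) (finite_subsets_at_top UNIV)"
      by (rule order_tendstoD) (use e in simp)
    moreover have "eventually (\<lambda>A. finite A) (finite_subsets_at_top (UNIV :: (int ^ 'a) set))"
      by (auto simp: eventually_finite_subsets_at_top)
    ultimately have "eventually (\<lambda>A. finite A \<and> energy (\<lambda>t. F t - trig_poly A a t) < ennreal e) (finite_subsets_at_top UNIV)"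
      by eventually_elim auto
    then show ?thesis using eventually_happens finite_subsets_at_top_neq_bot by fast
  qed
  then show ?thesis using s by (simp add: approximable_def)
qed

definition trigonometric :: "('n::finite torus \<Rightarrow> complex) \<Rightarrow> bool" where
  "trigonometric G \<longleftrightarrow> (\<exists>A b. finite A \<and> (\<forall>t. G t = trig_poly A b t))"

lemma trigonometric_monomial: "trigonometric (\<lambda>t. c * torus_character k t)"
  unfolding trigonometric_def by (intro exI[of _ "{- k}"] exI[of _ "\<lambda>_. c"]) (simp add: trig_poly_def)

lemma trigonometric_const: "trigonometric (\<lambda>t. c)"
  using trigonometric_monomial[of c 0] by simp

lemma trigonometric_add:
  assumes "trigonometric G" "trigonometric H" shows "trigonometric (\<lambda>t. G t + H t)"
proof -
  obtain A a where A: "finite A" "\<And>t. G t = trig_poly A a t" using assms(1) by (auto simp: trigonometric_def)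
  obtain B b where B: "finite B" "\<And>t. H t = trig_poly B b t" using assms(2) by (auto simp: trigonometric_def)
  have "trig_poly A a t + trig_poly B b t = trig_poly (A \<union> B) (\<lambda>k. (if k \<in> A then a k else 0) + (if k \<in> B then b k else 0)) t" for t
  proof -
    have "trig_poly A a t = (\<Sum>k\<in>A \<union> B. (if k \<in> A then a k else 0) * torus_character (- k) t)"
      unfolding trig_poly_def using A(1) B(1) by (intro sum.mono_neutral_cong_left) auto
    moreover have "trig_poly B b t = (\<Sum>k\<in>A \<union> B. (if k \<in> B then b k else 0) * torus_character (- k) t)"
      unfolding trig_poly_def using A(1) B(1) by (intro sum.mono_neutral_cong_left) auto
    ultimately show ?thesis by (simp only: trig_poly_def sum.distrib[symmetric] distrib_right)
  qed
  then show ?thesis unfolding trigonometric_def using A B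
    by (intro exI[of _ "A \<union> B"] exI[of _ "\<lambda>k. (if k \<in> A then a k else 0) + (if k \<in> B then b k else 0)"]) simp
qed

lemma trigonometric_sum:
  "finite A \<Longrightarrow> (\<And>x. x \<in> A \<Longrightarrow> trigonometric (G x)) \<Longrightarrow> trigonometric (\<lambda>t. \<Sum>x\<in>A. G x t)"
  by (induction A rule: finite_induct) (auto intro: trigonometric_const trigonometric_add)

lemma trigonometric_mult:
  assumes "trigonometric G" "trigonometric H" shows "trigonometric (\<lambda>t. G t * H t)"
proof -
  obtain A a where A: "finite A" "\<And>t. G t = trig_poly A a t" using assms(1) by (auto simp: trigonometric_def)
  obtain B b where B: "finite B" "\<And>t. H t = trig_poly B b t" using assms(2) by (auto simp: trigonometric_def)
  have "G t * H t = (\<Sum>k\<in>A. \<Sum>l\<in>B. (a k * b l) * torus_character (- k + - l) t)" for t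
    unfolding A B trig_poly_def sum_product torus_character_add by (simp add: mult_ac)
  then show ?thesis using A(1) B(1) by (auto intro!: trigonometric_sum trigonometric_monomial)
qed

lemma trigonometric_continuous: "trigonometric G \<Longrightarrow> continuous_on S G"
proof -
  assume "trigonometric G"
  then obtain A b where "G = trig_poly A b" by (auto simp: trigonometric_def fun_eq_iff)
  then show ?thesis by (simp add: continuous_trig_poly)
qed

lemma trigonometric_dense_real:
  fixes f :: "'n::finite torus \<Rightarrow> real"
  assumes f: "continuous_on UNIV f" and e: "e > 0"
  shows "\<exists>g. trigonometric (\<lambda>t. complex_of_real (g t)) \<and> (\<forall>t. \<bar>f t - g t\<bar> < e)"
proof -
  let ?P = "\<lambda>g :: 'n torus \<Rightarrow> real. trigonometric (\<lambda>t. complex_of_real (g t))"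
  have "\<exists>g. ?P g \<and> (\<forall>t\<in>UNIV. \<bar>f t - g t\<bar> < e)"
  proof (rule Stone_Weierstrass_HOL[OF compact_torus _ _ _ _ _ f e])
    show "?P (\<lambda>x. c)" for c by (rule trigonometric_const)
    show "continuous_on UNIV g" if "?P g" for g
      using continuous_on_Re[OF trigonometric_continuous[OF that, of UNIV]] by simp
    show "?P (\<lambda>x. g x + h x)" if "?P g \<and> ?P h" for g h using that trigonometric_add by auto
    show "?P (\<lambda>x. g x * h x)" if "?P g \<and> ?P h" for g h using that trigonometric_mult by auto
    show "\<exists>g. ?P g \<and> g s \<noteq> g t" if st: "s \<in> UNIV \<and> t \<in> UNIV \<and> s \<noteq> t" for s t
    proof -
      obtain i where i: "s $ i \<noteq> t $ i" using st by (auto simp: vec_eq_iff)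
      let ?k = "axis i 1 :: int ^ 'n"
      obtain x where x: "s = torus_proj x" using torus_proj_surj by blast
      obtain y where y: "t = torus_proj y" using torus_proj_surj by blast
      have ch: "torus_character ?k (torus_proj z) = cis (z $ i)" for z :: "real ^ 'n"
      proof -
        have "(\<Sum>j\<in>UNIV. of_int (?k $ j) * z $ j) = (\<Sum>j\<in>UNIV. if j = i then z $ i else 0)"
          by (intro sum.cong refl) (auto simp: axis_def)
        then show ?thesis by (simp add: torus_character_proj)
      qed
      have "cis (x $ i) \<noteq> cis (y $ i)"
      proof
        assume eq: "cis (x $ i) = cis (y $ i)"
        have "cis (x $ i - y $ i) = 1" by (simp add: cis_divide[symmetric] eq)
        then have "cos (x $ i - y $ i) = 1" by (simp add: complex_eq_iff)
        then obtain k :: int where "x $ i - y $ i = of_int k * 2 * pi" unfolding cos_one_2pi_int by blast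
        then show False using i by (auto simp: x y torus_proj_def abs_circle_eq_iff mult_ac)
      qed
      then have "Re (torus_character ?k s) \<noteq> Re (torus_character ?k t) \<or> Im (torus_character ?k s) \<noteq> Im (torus_character ?k t)"
        by (simp add: x y ch complex_eq_iff)
      moreover have "?P (\<lambda>t. Re (torus_character ?k t))"
      proof -
        have "complex_of_real (Re (torus_character ?k t)) = 1/2 * torus_character ?k t + 1/2 * torus_character (- ?k) t" for t
          by (simp add: torus_character_minus complex_eq_iff)
        then show ?thesis by (simp only: trigonometric_add[OF trigonometric_monomial trigonometric_monomial])
      qed
      moreover have "?P (\<lambda>t. Im (torus_character ?k t))"
      proof -
        have "complex_of_real (Im (torus_character ?k t)) = (- \<i>/2) * torus_character ?k t + (\<i>/2) * torus_character (- ?k) t" for t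
          by (simp add: torus_character_minus complex_eq_iff)
        then show ?thesis by (simp only: trigonometric_add[OF trigonometric_monomial trigonometric_monomial])
      qed
      ultimately show ?thesis
        by (elim disjE) (rule exI[of _ "\<lambda>t. Re (torus_character ?k t)"], simp, rule exI[of _ "\<lambda>t. Im (torus_character ?k t)"], simp)
    qed
  qed
  then show ?thesis by simp
qed

lemma trigonometric_dense:
  fixes f :: "'n::finite torus \<Rightarrow> complex"
  assumes f: "continuous_on UNIV f" and e: "e > 0"
  obtains g where "trigonometric g" "\<And>t. cmod (f t - g t) < e"
proof -
  obtain g where g: "trigonometric (\<lambda>t. complex_of_real (g t))" "\<And>t. \<bar>Re (f t) - g t\<bar> < e / 2"
    using trigonometric_dense_real[OF continuous_on_Re[OF f], of "e / 2"] e by auto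
  obtain h where h: "trigonometric (\<lambda>t. complex_of_real (h t))" "\<And>t. \<bar>Im (f t) - h t\<bar> < e / 2"
    using trigonometric_dense_real[OF continuous_on_Im[OF f], of "e / 2"] e by auto
  show ?thesis
  proof (rule that[of "\<lambda>t. of_real (g t) + \<i> * of_real (h t)"])
    show "trigonometric (\<lambda>t. of_real (g t) + \<i> * of_real (h t))"
      by (intro trigonometric_add g trigonometric_mult[OF trigonometric_const h(1)])
    show "cmod (f t - (of_real (g t) + \<i> * of_real (h t))) < e" for t
      using cmod_le[of "f t - (of_real (g t) + \<i> * of_real (h t))"] g(2)[of t] h(2)[of t] by simp
  qed
qed

lemma approximable_mult:
  fixes F m :: "'n::finite torus \<Rightarrow> complex"
  assumes F: "approximable F" and m: "continuous_on UNIV m"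
  shows "approximable (\<lambda>t. m t * F t)"
proof -
  obtain B where B: "B > 0" "\<And>t. cmod (m t) \<le> B" using continuous_bounded_torus[OF m] by blast
  note mm [measurable] = continuous_measurable_torus[OF m]
  have sF: "sq_int F" using F by (simp add: approximable_def)
  then have [measurable]: "F \<in> borel_measurable torus_measure" by (simp add: sq_int_def)
  have "\<exists>A b. finite A \<and> energy (\<lambda>t. m t * F t - trig_poly A b t) < ennreal e" if e: "e > 0" for e
  proof -
    obtain A b where A: "finite A" "energy (\<lambda>t. F t - trig_poly A b t) < ennreal (e / (4 * B\<^sup>2))"
      using F e B(1) unfolding approximable_def by (metis divide_pos_pos mult_pos_pos zero_less_numeral zero_less_power)
    obtain C where C: "C > 0" "\<And>t. cmod (trig_poly A b t) \<le> C"
      using continuous_bounded_torus[OF continuous_trig_poly[of UNIV A b]] by blast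
    define d where "d = sqrt (e / (8 * C\<^sup>2 * dvol TYPE('n)))"
    have d: "d > 0" using e C dvol_pos[where 'n='n] by (simp add: d_def)
    obtain g where g: "trigonometric g" "\<And>t. cmod (m t - g t) < d" using trigonometric_dense[OF m d] by blast
    have [measurable]: "g \<in> borel_measurable torus_measure"
      by (rule continuous_measurable_torus[OF trigonometric_continuous[OF g(1)]])
    have "trigonometric (\<lambda>t. g t * trig_poly A b t)"
      by (intro trigonometric_mult g) (use A(1) in \<open>auto simp: trigonometric_def\<close>)
    then obtain A' b' where A': "finite A'" "\<And>t. g t * trig_poly A b t = trig_poly A' b' t" by (auto simp: trigonometric_def)
    have "energy (\<lambda>t. m t * (F t - trig_poly A b t)) \<le> ennreal (B\<^sup>2) * energy (\<lambda>t. F t - trig_poly A b t)"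
      by (rule energy_mult_le[OF _ B(2)]) measurable
    also have "\<dots> < ennreal (B\<^sup>2) * ennreal (e / (4 * B\<^sup>2))" using A(2) B(1) by (intro ennreal_mult_strict_left_mono) auto
    also have "\<dots> = ennreal (e / 4)" using B(1) e by (simp add: ennreal_mult[symmetric])
    finally have 1: "energy (\<lambda>t. m t * (F t - trig_poly A b t)) < ennreal (e / 4)" .
    have "cmod ((m t - g t) * trig_poly A b t) \<le> d * C" for t
      unfolding norm_mult using g(2)[of t] C d by (intro mult_mono) (auto simp: less_imp_le)
    then have "energy (\<lambda>t. (m t - g t) * trig_poly A b t) \<le> ennreal ((d * C)\<^sup>2 * dvol TYPE('n))" by (rule energy_le_bound)
    also have "(d * C)\<^sup>2 * dvol TYPE('n) = e / 8" using e C(1) dvol_pos[where 'n='n] by (simp add: d_def power_mult_distrib)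
    finally have 2: "energy (\<lambda>t. (m t - g t) * trig_poly A b t) \<le> ennreal (e / 8)" .
    have "energy (\<lambda>t. m t * F t - trig_poly A' b' t) = energy (\<lambda>t. m t * (F t - trig_poly A b t) + (m t - g t) * trig_poly A b t)"
      unfolding A'(2)[symmetric] by (simp add: algebra_simps)
    also have "\<dots> \<le> 2 * energy (\<lambda>t. m t * (F t - trig_poly A b t)) + 2 * energy (\<lambda>t. (m t - g t) * trig_poly A b t)"
      by (rule energy_add) measurable
    also have "\<dots> \<le> 2 * ennreal (e / 4) + 2 * ennreal (e / 8)" using 1 2 by (intro add_mono mult_left_mono) auto
    also have "\<dots> = ennreal (3 / 4 * e)"
    proof -
      have "2 * ennreal (e / 4) + 2 * ennreal (e / 8) = ennreal (2 * (e / 4)) + ennreal (2 * (e / 8))"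
        using e by (subst (1 2) ennreal_mult) auto
      also have "\<dots> = ennreal (2 * (e / 4) + 2 * (e / 8))" using e by (intro ennreal_plus[symmetric]) auto
      finally show ?thesis by simp
    qed
    also have "\<dots> < ennreal e" using e by (simp add: ennreal_less_iff)
    finally show ?thesis using A'(1) by blast
  qed
  then show ?thesis using sq_int_mult[OF sF mm B(2)] by (simp add: approximable_def)
qed

lemma norm_fourier_coeff_le:
  fixes G :: "'n::finite torus \<Rightarrow> complex"
  assumes "sq_int G"
  shows "ennreal (dvol TYPE('n) * (cmod (fourier_coeff G k))\<^sup>2) \<le> energy G"
  unfolding energy_eq_integral[OF assms] using bessel[OF assms, of "{k}"] by (intro ennreal_leI) simp

lemma energy_trig_poly_diff:
  fixes a :: "int ^ 'n::finite \<Rightarrow> complex"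
  assumes "finite A" "finite B" "\<And>C. finite C \<Longrightarrow> C \<inter> D = {} \<Longrightarrow> (\<Sum>k\<in>C. (cmod (a k))\<^sup>2) \<le> e" "D \<subseteq> A" "D \<subseteq> B"
  shows "energy (\<lambda>t. trig_poly A a t - trig_poly B a t :: complex) \<le> ennreal (dvol TYPE('n) * e)"
proof -
  let ?C = "(A - B) \<union> (B - A)"
  let ?b = "\<lambda>k. if k \<in> A then a k else - a k"
  have "trig_poly A a t - trig_poly B a t = trig_poly ?C ?b t" for t
  proof -
    have "trig_poly A a t = trig_poly (A \<inter> B) a t + trig_poly (A - B) a t"
      unfolding trig_poly_def using assms(1) by (subst sum.Int_Diff[of A _ B]) auto
    moreover have "trig_poly B a t = trig_poly (A \<inter> B) a t + trig_poly (B - A) a t"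
      unfolding trig_poly_def using assms(2) by (subst sum.Int_Diff[of B _ A]) (auto simp: Int_commute)
    moreover have "trig_poly ?C ?b t = trig_poly (A - B) a t - trig_poly (B - A) a t"
      unfolding trig_poly_def using assms(1,2) by (subst sum.union_disjoint) (auto simp: sum_negf)
    ultimately show ?thesis by simp
  qed
  then have "energy (\<lambda>t. trig_poly A a t - trig_poly B a t) = ennreal (dvol TYPE('n) * (\<Sum>k\<in>?C. (cmod (?b k))\<^sup>2))"
    using energy_trig_poly[of ?C ?b] assms(1,2) by (simp add: fun_eq_iff[symmetric] cong: if_cong)
  also have "\<dots> \<le> ennreal (dvol TYPE('n) * e)"
  proof (intro ennreal_leI mult_left_mono)
    have "(\<Sum>k\<in>?C. (cmod (?b k))\<^sup>2) = (\<Sum>k\<in>?C. (cmod (a k))\<^sup>2)" by (intro sum.cong refl) auto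
    also have "\<dots> \<le> e" using assms by (intro assms(3)) auto
    finally show "(\<Sum>k\<in>?C. (cmod (?b k))\<^sup>2) \<le> e" .
  qed (use dvol_pos[where 'n='n] in simp)
  finally show ?thesis .
qed

lemma square_summable_tail:
  assumes a: "a \<in> lp_space 2" and e: "e > 0"
  obtains D where "finite D" "\<And>C. finite C \<Longrightarrow> C \<inter> D = {} \<Longrightarrow> (\<Sum>k\<in>C. (cmod (a k))\<^sup>2) \<le> e"
proof -
  let ?f = "\<lambda>k. (cmod (a k))\<^sup>2"
  have s: "?f summable_on UNIV" using a by (simp add: lp_space_def)
  obtain D where D: "finite D" "\<bar>sum ?f D - infsum ?f UNIV\<bar> < e"
  proof -
    have "(sum ?f \<longlongrightarrow> infsum ?f UNIV) (finite_subsets_at_top UNIV)" using infsum_tendsto[OF s] .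
    then have "eventually (\<lambda>F. dist (sum ?f F) (infsum ?f UNIV) < e) (finite_subsets_at_top UNIV)" using e by (rule tendstoD)
    then show thesis using that by (auto simp: eventually_finite_subsets_at_top dist_real_def)
  qed
  show ?thesis
  proof (rule that[OF D(1)])
    fix C assume C: "finite C" "C \<inter> D = {}"
    have "sum ?f C + sum ?f D = sum ?f (C \<union> D)" using C D(1) by (simp add: sum.union_disjoint)
    also have "\<dots> \<le> infsum ?f UNIV" by (rule finite_sum_le_infsum[OF s]) (use C D in auto)
    finally show "sum ?f C \<le> e" using D(2) by linarith
  qed
qed

theorem riesz_fischer:
  fixes a :: "int ^ 'n::finite \<Rightarrow> complex"
  assumes a: "a \<in> lp_space 2"
  obtains F where "is_fourier_transform a F"
proof -
  let ?d = "dvol TYPE('n)"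
  have "\<forall>n. \<exists>D. finite D \<and> (\<forall>C. finite C \<longrightarrow> C \<inter> D = {} \<longrightarrow> (\<Sum>k\<in>C. (cmod (a k))\<^sup>2) \<le> (1/4)^n)"
    using square_summable_tail[OF a] by (metis zero_less_divide_1_iff zero_less_numeral zero_less_power)
  from choice[OF this] obtain D where D: "\<And>n. finite (D n)"
    "\<And>n C. finite C \<Longrightarrow> C \<inter> D n = {} \<Longrightarrow> (\<Sum>k\<in>C. (cmod (a k))\<^sup>2) \<le> (1/4)^n" by blast
  define A where "A n = (\<Union>j\<le>n. D j)" for n
  have finA: "finite (A n)" and DA: "j \<le> n \<Longrightarrow> D j \<subseteq> A n" for j n using D(1) by (auto simp: A_def)
  define S where "S n = trig_poly (A n) a" for n
  have [measurable]: "S n \<in> borel_measurable torus_measure" for n by (simp add: S_def)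
  have close: "energy (\<lambda>t. trig_poly B a t - S n t) \<le> ennreal (?d * (1/4)^j)" if "finite B" "D j \<subseteq> B" "j \<le> n" for B j n
    unfolding S_def using energy_trig_poly_diff[OF that(1) finA D(2) that(2) DA[OF that(3)]] .
  have L1: "(\<integral>\<^sup>+ t. ennreal (cmod (S (Suc n) t - S n t)) \<partial>torus_measure) \<le> ennreal (2 * ?d * (1/2)^n)" for n
  proof -
    have "cmod z \<le> 2^n * (cmod z)\<^sup>2 + (1/2)^n" for z :: complex
    proof -
      define w where "w = 2^n * cmod z"
      have "w \<ge> 0" by (simp add: w_def)
      then have "w \<le> w\<^sup>2 + 1" using zero_le_power2[of "w - 1"] by (simp add: power2_diff)
      moreover have "(2::real)^n * (1/2)^n = 1" by (simp add: power_one_over)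
      moreover have "w\<^sup>2 = 2^n * (2^n * (cmod z)\<^sup>2)" by (simp only: w_def power2_eq_square mult_ac)
      ultimately have "2^n * cmod z \<le> 2^n * (2^n * (cmod z)\<^sup>2 + (1/2)^n)" by (simp only: w_def distrib_left)
      then show ?thesis by (simp only: mult_le_cancel_left_pos zero_less_power zero_less_numeral)
    qed
    then have "(\<integral>\<^sup>+ t. ennreal (cmod (S (Suc n) t - S n t)) \<partial>torus_measure)
      \<le> (\<integral>\<^sup>+ t. ennreal (2^n) * ennreal ((cmod (S (Suc n) t - S n t))\<^sup>2) + ennreal ((1/2)^n) \<partial>torus_measure)"
      by (intro nn_integral_mono) (auto simp: ennreal_mult[symmetric] ennreal_plus[symmetric] simp del: ennreal_plus intro!: ennreal_leI)
    also have "\<dots> = ennreal (2^n) * energy (\<lambda>t. S (Suc n) t - S n t) + ennreal ((1/2)^n) * ennreal ?d"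
      by (simp add: nn_integral_add nn_integral_cmult energy_def emeasure_torus_measure)
    also have "\<dots> \<le> ennreal (2^n) * ennreal (?d * (1/4)^n) + ennreal ((1/2)^n) * ennreal ?d"
      using close[of "A (Suc n)" n n] finA DA[of n "Suc n"] unfolding S_def by (intro add_mono mult_left_mono) auto
    also have "\<dots> = ennreal (2^n * (?d * (1/4)^n) + (1/2)^n * ?d)"
      using dvol_pos[where 'n='n] by (simp add: ennreal_mult ennreal_plus)
    also have "2^n * (?d * (1/4)^n) + (1/2)^n * ?d = 2 * ?d * (1/2)^n"
    proof -
      have "(2::real)^n * (1/4)^n = (1/2)^n" unfolding power_mult_distrib[symmetric] by simp
      then show ?thesis by (simp add: mult_ac)
    qed
    finally show ?thesis .
  qed
  have "(\<integral>\<^sup>+ t. (\<Sum>n. ennreal (cmod (S (Suc n) t - S n t))) \<partial>torus_measure) \<le> (\<Sum>n. ennreal (2 * ?d * (1/2)^n))"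
    by (subst nn_integral_suminf) (auto intro!: suminf_le L1)
  also have "\<dots> < \<infinity>"
    using dvol_pos[where 'n='n] by (subst suminf_ennreal2) (auto intro!: summable_mult summable_geometric)
  finally have "AE t in torus_measure. (\<Sum>n. ennreal (cmod (S (Suc n) t - S n t))) \<noteq> \<infinity>"
    by (intro nn_integral_PInf_AE) auto
  then have conv: "AE t in torus_measure. convergent (\<lambda>n. S n t)"
  proof (rule AE_mp, intro AE_I2 impI)
    fix t assume "(\<Sum>n. ennreal (cmod (S (Suc n) t - S n t))) \<noteq> \<infinity>"
    then have "summable (\<lambda>n. cmod (S (Suc n) t - S n t))"
      by (intro summable_suminf_not_top) auto
    then have "summable (\<lambda>n. S (Suc n) t - S n t)" by (rule summable_norm_cancel)
    then have "convergent (\<lambda>n. \<Sum>i<n. S (Suc i) t - S i t)" unfolding summable_iff_convergent .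
    then have "convergent (\<lambda>n. S n t - S 0 t)" by (simp only: sum_lessThan_telescope[of "\<lambda>n. S n t"])
    then show "convergent (\<lambda>n. S n t)" using convergent_add[OF _ convergent_const[of "S 0 t"]] by fastforce
  qed
  define F where "F t = lim (\<lambda>n. S n t)" for t
  have [measurable]: "F \<in> borel_measurable torus_measure"
    unfolding F_def[abs_def] by (rule borel_measurable_lim_metric) measurable
  have lim: "AE t in torus_measure. (\<lambda>n. S n t) \<longlonglongrightarrow> F t"
    using conv by eventually_elim (simp add: F_def convergent_LIMSEQ_iff)
  have near: "energy (\<lambda>t. trig_poly B a t - F t) \<le> ennreal (?d * (1/4)^j)" if B: "finite B" "D j \<subseteq> B" for B j
  proof -
    have "energy (\<lambda>t. trig_poly B a t - F t) = (\<integral>\<^sup>+ t. liminf (\<lambda>n. ennreal ((cmod (trig_poly B a t - S n t))\<^sup>2)) \<partial>torus_measure)"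
      unfolding energy_def
    proof (rule nn_integral_cong_AE, use lim in eventually_elim)
      fix t assume "(\<lambda>n. S n t) \<longlonglongrightarrow> F t"
      then have "(\<lambda>n. ennreal ((cmod (trig_poly B a t - S n t))\<^sup>2)) \<longlonglongrightarrow> ennreal ((cmod (trig_poly B a t - F t))\<^sup>2)"
        by (intro tendsto_intros)
      then show "ennreal ((cmod (trig_poly B a t - F t))\<^sup>2) = liminf (\<lambda>n. ennreal ((cmod (trig_poly B a t - S n t))\<^sup>2))"
        by (intro lim_imp_Liminf[symmetric]) auto
    qed
    also have "\<dots> \<le> liminf (\<lambda>n. energy (\<lambda>t. trig_poly B a t - S n t))"
      unfolding energy_def by (rule nn_integral_liminf) measurable
    also have "\<dots> \<le> ennreal (?d * (1/4)^j)"
      by (rule Liminf_le) (use close[OF B] in \<open>auto simp: eventually_sequentially\<close>)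
    finally show ?thesis .
  qed
  have "energy F \<le> 2 * energy (\<lambda>t. trig_poly (D 0) a t) + 2 * energy (\<lambda>t. - 1 * (trig_poly (D 0) a t - F t))"
    using energy_add[of "\<lambda>t. trig_poly (D 0) a t" "\<lambda>t. - 1 * (trig_poly (D 0) a t - F t)"] by simp
  also have "energy (\<lambda>t. - 1 * (trig_poly (D 0) a t - F t)) = energy (\<lambda>t. trig_poly (D 0) a t - F t)"
    by (simp add: energy_def norm_minus_commute)
  also have "2 * energy (\<lambda>t. trig_poly (D 0) a t) + 2 * energy (\<lambda>t. trig_poly (D 0) a t - F t) < \<infinity>"
    using sq_int_trig_poly[of "D 0" a] near[OF D(1) order_refl, of 0] by (auto simp: sq_int_def ennreal_mult_less_top intro: le_less_trans)
  finally have fin: "energy F < \<infinity>" .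
  have "((\<lambda>B. energy (\<lambda>t. trig_poly B a t - F t)) \<longlongrightarrow> 0) (finite_subsets_at_top UNIV)"
  proof (rule order_tendstoI)
    fix e :: ennreal assume e: "0 < e"
    have "(\<lambda>j. ennreal (?d * (1/4)^j)) \<longlonglongrightarrow> ennreal (?d * 0)"
      by (intro tendsto_intros LIMSEQ_power_zero) auto
    then have "eventually (\<lambda>j. ennreal (?d * (1/4)^j) < e) sequentially" by (rule order_tendstoD) (use e in simp)
    then obtain j where j: "ennreal (?d * (1/4)^j) < e" by (auto simp: eventually_sequentially)
    show "eventually (\<lambda>B. energy (\<lambda>t. trig_poly B a t - F t) < e) (finite_subsets_at_top UNIV)"
      unfolding eventually_finite_subsets_at_top
      by (intro exI[of _ "D j"]) (use D(1) near j in \<open>auto intro: le_less_trans\<close>)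
  qed auto
  then have "is_fourier_transform a F"
    using a fin by (simp add: is_fourier_transform_def energy_def trig_poly_def)
  then show ?thesis by (rule that)
qed

section \<open>Transference\<close>

lemma mult_op_translate:
  fixes x w :: "int ^ 'n::finite"
  assumes "M > 0" "finite A" "\<And>y. y \<in> A \<Longrightarrow> y + w \<in> grid M"
  shows "mult_op M m (\<lambda>y. if y - w \<in> A then a (y - w) else 0) (x + w)
    = (\<Sum>k\<in>grid M. m k * (torus_character x (gpt M k) * trig_poly A a (gpt M k))) / of_nat (card (grid M :: (int ^ 'n) set))"
proof -
  have "(\<Sum>y\<in>grid M. m k * chr M k (x + w - y) * (if y - w \<in> A then a (y - w) else 0))
    = m k * (torus_character x (gpt M k) * trig_poly A a (gpt M k))" for k
  proof -
    have "(\<Sum>y\<in>grid M. m k * chr M k (x + w - y) * (if y - w \<in> A then a (y - w) else 0))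
      = (\<Sum>y\<in>(\<lambda>y. y + w) ` A. m k * chr M k (x + w - y) * a (y - w))"
      using assms(3) by (intro sum.mono_neutral_cong_right) (auto intro: image_eqI[of _ _ "_ - w"])
    also have "\<dots> = (\<Sum>y\<in>A. m k * chr M k (x - y) * a y)"
      by (subst sum.reindex) (auto simp: inj_on_def algebra_simps)
    also have "\<dots> = (\<Sum>y\<in>A. m k * (torus_character x (gpt M k) * (a y * torus_character (- y) (gpt M k))))"
      by (simp add: torus_character_gpt chr_diff_right chr_minus mult_ac)
    finally show ?thesis by (simp add: trig_poly_def sum_distrib_left)
  qed
  then show ?thesis by (simp add: mult_op_def)
qed

theorem transference:
  fixes m :: "'n::finite torus \<Rightarrow> complex" and a :: "int ^ 'n \<Rightarrow> complex"
  assumes p: "p > 0" and C: "C \<ge> 0" and m: "continuous_on UNIV m"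
    and bnd: "\<And>\<rho>. \<rho> \<ge> 1 \<Longrightarrow> mult_bound (2 ^ \<rho>) p C (g \<rho>)"
    and apx: "\<And>\<rho> k. k \<in> grid (2 ^ \<rho>) \<Longrightarrow> cmod (g \<rho> k - m (gpt (2 ^ \<rho>) k)) \<le> \<delta> \<rho>"
    and \<delta>: "\<delta> \<longlonglongrightarrow> 0"
    and A: "finite A" and X: "finite X"
  shows "(\<Sum>x\<in>X. cmod (fourier_coeff (\<lambda>t. m t * trig_poly A a t) x) powr p) \<le> C powr p * (\<Sum>y\<in>A. cmod (a y) powr p)"
proof -
  let ?N = "\<lambda>\<rho>. of_nat (card (grid (2 ^ \<rho>) :: (int ^ 'n) set)) :: complex"
  let ?T = "trig_poly A a"
  define U where "U \<mu> \<rho> x = (\<Sum>k\<in>grid (2 ^ \<rho>). \<mu> k * (torus_character x (gpt (2 ^ \<rho>) k) * ?T (gpt (2 ^ \<rho>) k))) / ?N \<rho>" for \<mu> \<rho> x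
  obtain W :: nat where W: "\<And>y i. y \<in> A \<union> X \<Longrightarrow> \<bar>y $ i\<bar> \<le> int W"
  proof -
    let ?S = "(\<lambda>(y, i). nat \<bar>y $ i\<bar>) ` ((A \<union> X) \<times> UNIV)"
    have "nat \<bar>y $ i\<bar> \<le> Max ?S" if "y \<in> A \<union> X" for y i
      using that A X by (intro Max_ge) (auto intro!: image_eqI[of _ _ "(y, i)"])
    then show thesis by (intro that[of "Max ?S"]) (simp add: nat_le_iff)
  qed
  let ?w = "\<chi> i. int W"
  have ev: "eventually (\<lambda>\<rho>. (\<Sum>x\<in>X. cmod (U (g \<rho>) \<rho> x) powr p) \<le> C powr p * (\<Sum>y\<in>A. cmod (a y) powr p)) sequentially"
    unfolding eventually_sequentially
  proof (intro exI[of _ "2 * W + 1"] allI impI)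
    fix \<rho> assume \<rho>: "2 * W + 1 \<le> \<rho>"
    have "2 * W < 2 ^ \<rho>" using \<rho> less_exp[of \<rho>] by linarith
    then have big: "2 * int W < 2 ^ \<rho>" using of_nat_less_iff[of "2 * W" "2 ^ \<rho>", where 'a = int] by simp
    have gr: "y + ?w \<in> grid (2 ^ \<rho>)" if "y \<in> A \<union> X" for y
    proof -
      have "0 \<le> y $ i + int W \<and> y $ i + int W < 2 ^ \<rho>" for i using W[OF that, of i] big by linarith
      then show ?thesis by (simp add: grid_def)
    qed
    let ?a = "\<lambda>y. if y - ?w \<in> A then a (y - ?w) else 0"
    have "(\<Sum>x\<in>X. cmod (U (g \<rho>) \<rho> x) powr p) = (\<Sum>x\<in>X. cmod (mult_op (2 ^ \<rho>) (g \<rho>) ?a (x + ?w)) powr p)"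
      unfolding U_def using gr A by (subst mult_op_translate) auto
    also have "\<dots> = (\<Sum>x\<in>(\<lambda>x. x + ?w) ` X. cmod (mult_op (2 ^ \<rho>) (g \<rho>) ?a x) powr p)"
      by (subst sum.reindex) (auto simp: inj_on_def)
    also have "\<dots> \<le> (\<Sum>x\<in>grid (2 ^ \<rho>). cmod (mult_op (2 ^ \<rho>) (g \<rho>) ?a x) powr p)"
      using gr by (intro sum_mono2) auto
    also have "\<dots> \<le> C powr p * (\<Sum>y\<in>grid (2 ^ \<rho>). cmod (?a y) powr p)"
      using bnd[of \<rho>] \<rho> mult_bound_powr[OF p C, of "2 ^ \<rho>" "g \<rho>"] by auto
    also have "(\<Sum>y\<in>grid (2 ^ \<rho>). cmod (?a y) powr p) = (\<Sum>y\<in>(\<lambda>y. y + ?w) ` A. cmod (a (y - ?w)) powr p)"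
      using gr by (intro sum.mono_neutral_cong_right) (auto intro: image_eqI[of _ _ "_ - ?w"])
    also have "\<dots> = (\<Sum>y\<in>A. cmod (a y) powr p)" by (subst sum.reindex) (auto simp: inj_on_def)
    finally show "(\<Sum>x\<in>X. cmod (U (g \<rho>) \<rho> x) powr p) \<le> C powr p * (\<Sum>y\<in>A. cmod (a y) powr p)" .
  qed
  have lim: "(\<lambda>\<rho>. U (g \<rho>) \<rho> x) \<longlonglongrightarrow> fourier_coeff (\<lambda>t. m t * ?T t) x" for x
  proof -
    obtain B where B: "B > 0" "\<And>t. cmod (?T t) \<le> B" using continuous_bounded_torus[OF continuous_trig_poly[of UNIV A a]] by blast
    have "continuous_on UNIV (\<lambda>t. m t * ?T t * torus_character x t)"
      by (intro continuous_intros m continuous_trig_poly)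
    from riemann_sums[OF this]
    have "(\<lambda>M. (\<Sum>k\<in>grid (Suc M). m (gpt (Suc M) k) * ?T (gpt (Suc M) k) * torus_character x (gpt (Suc M) k)) / of_nat (card (grid (Suc M) :: (int ^ 'n) set))) \<longlonglongrightarrow> fourier_coeff (\<lambda>t. m t * ?T t) x"
      by (simp add: fourier_coeff_def)
    moreover have "strict_mono (\<lambda>\<rho>. 2 ^ \<rho> - 1 :: nat)"
      by (rule strict_monoI_Suc) (simp add: less_diff_iff)
    ultimately have "(\<lambda>\<rho>. U (\<lambda>k. m (gpt (2 ^ \<rho>) k)) \<rho> x) \<longlonglongrightarrow> fourier_coeff (\<lambda>t. m t * ?T t) x"
      using LIMSEQ_subseq_LIMSEQ by (fastforce simp: U_def o_def mult_ac)
    moreover have "(\<lambda>\<rho>. U (g \<rho>) \<rho> x - U (\<lambda>k. m (gpt (2 ^ \<rho>) k)) \<rho> x) \<longlonglongrightarrow> 0"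
    proof (rule Lim_null_comparison)
      show "eventually (\<lambda>\<rho>. norm (U (g \<rho>) \<rho> x - U (\<lambda>k. m (gpt (2 ^ \<rho>) k)) \<rho> x) \<le> \<delta> \<rho> * B) sequentially"
      proof (intro always_eventually allI)
        fix \<rho>
        have pos: "real (card (grid (2 ^ \<rho>) :: (int ^ 'n) set)) > 0" by (simp add: card_grid)
        have "U (g \<rho>) \<rho> x - U (\<lambda>k. m (gpt (2 ^ \<rho>) k)) \<rho> x
          = (\<Sum>k\<in>grid (2 ^ \<rho>). (g \<rho> k - m (gpt (2 ^ \<rho>) k)) * (torus_character x (gpt (2 ^ \<rho>) k) * ?T (gpt (2 ^ \<rho>) k))) / ?N \<rho>"
          unfolding U_def by (simp add: diff_divide_distrib[symmetric] sum_subtractf[symmetric] left_diff_distrib)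
        then have "norm (U (g \<rho>) \<rho> x - U (\<lambda>k. m (gpt (2 ^ \<rho>) k)) \<rho> x)
          = norm (\<Sum>k\<in>grid (2 ^ \<rho>). (g \<rho> k - m (gpt (2 ^ \<rho>) k)) * (torus_character x (gpt (2 ^ \<rho>) k) * ?T (gpt (2 ^ \<rho>) k))) / real (card (grid (2 ^ \<rho>) :: (int ^ 'n) set))"
          by (simp add: norm_divide)
        also have "\<dots> \<le> (\<Sum>k\<in>(grid (2 ^ \<rho>) :: (int ^ 'n) set). \<delta> \<rho> * B) / real (card (grid (2 ^ \<rho>) :: (int ^ 'n) set))"
        proof (intro divide_right_mono sum_norm_le)
          fix k :: "int ^ 'n" assume k: "k \<in> grid (2 ^ \<rho>)"
          have "0 \<le> \<delta> \<rho>" using apx[OF k] norm_ge_zero order_trans by blast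
          then show "norm ((g \<rho> k - m (gpt (2 ^ \<rho>) k)) * (torus_character x (gpt (2 ^ \<rho>) k) * ?T (gpt (2 ^ \<rho>) k))) \<le> \<delta> \<rho> * B"
            unfolding norm_mult norm_torus_character mult_1_left by (intro mult_mono apx[OF k] B) auto
        qed simp
        also have "\<dots> = \<delta> \<rho> * B" using pos by auto
        finally show "norm (U (g \<rho>) \<rho> x - U (\<lambda>k. m (gpt (2 ^ \<rho>) k)) \<rho> x) \<le> \<delta> \<rho> * B" .
      qed
      show "(\<lambda>\<rho>. \<delta> \<rho> * B) \<longlonglongrightarrow> 0" using tendsto_mult[OF \<delta> tendsto_const[of B]] by simp
    qed
    ultimately show ?thesis using tendsto_add by fastforce
  qed
  have "(\<lambda>\<rho>. \<Sum>x\<in>X. cmod (U (g \<rho>) \<rho> x) powr p) \<longlonglongrightarrow> (\<Sum>x\<in>X. cmod (fourier_coeff (\<lambda>t. m t * ?T t) x) powr p)"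
    using p by (intro tendsto_sum tendsto_powr' tendsto_norm lim tendsto_const) auto
  then show ?thesis using ev by (intro tendsto_upperbound[of _ _ sequentially]) auto
qed

lemma fourier_coeff_limit:
  fixes m :: "'n::finite torus \<Rightarrow> complex"
  assumes F: "is_fourier_transform a F" and m: "continuous_on UNIV m"
  shows "((\<lambda>A. fourier_coeff (\<lambda>t. m t * trig_poly A a t) x) \<longlongrightarrow> fourier_coeff (\<lambda>t. m t * F t) x) (finite_subsets_at_top UNIV)"
proof -
  let ?d = "dvol TYPE('n)"
  obtain B where B: "B > 0" "\<And>t. cmod (m t) \<le> B" using continuous_bounded_torus[OF m] by blast
  note mm [measurable] = continuous_measurable_torus[OF m]
  have sF: "sq_int F" using F by (auto simp: is_fourier_transform_def sq_int_def energy_def)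
  have Fm [measurable]: "F \<in> borel_measurable torus_measure" using sF by (simp add: sq_int_def)
  define D where "D A = fourier_coeff (\<lambda>t. m t * trig_poly A a t) x - fourier_coeff (\<lambda>t. m t * F t) x" for A
  have D: "D A = fourier_coeff (\<lambda>t. m t * (trig_poly A a t - F t)) x" for A
  proof -
    have "integrable torus_measure (\<lambda>t. m t * trig_poly A a t * torus_character x t)"
      by (rule sq_int_integrable_mult[OF sq_int_mult[OF sq_int_trig_poly mm B(2)], where B = 1]) auto
    moreover have "integrable torus_measure (\<lambda>t. m t * F t * torus_character x t)"
      by (rule sq_int_integrable_mult[OF sq_int_mult[OF sF mm B(2)], where B = 1]) auto
    ultimately show ?thesis
      by (simp add: D_def fourier_coeff_def right_diff_distrib left_diff_distrib diff_divide_distrib)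
  qed
  have le: "ennreal (?d * (cmod (D A))\<^sup>2) \<le> ennreal (B\<^sup>2) * energy (\<lambda>t. trig_poly A a t - F t)" for A
    unfolding D by (rule order_trans[OF norm_fourier_coeff_le[OF sq_int_mult[OF sq_int_diff[OF sq_int_trig_poly sF] mm B(2)]] energy_mult_le[OF _ B(2)]]) measurable
  have "((\<lambda>A. energy (\<lambda>t. trig_poly A a t - F t)) \<longlongrightarrow> 0) (finite_subsets_at_top UNIV)"
    using F by (simp add: is_fourier_transform_def energy_def trig_poly_def)
  then have "((\<lambda>A. ennreal (B\<^sup>2) * energy (\<lambda>t. trig_poly A a t - F t)) \<longlongrightarrow> ennreal (B\<^sup>2) * 0) (finite_subsets_at_top UNIV)"
    by (intro ennreal_tendsto_cmult) auto
  then have lim: "((\<lambda>A. ennreal (B\<^sup>2) * energy (\<lambda>t. trig_poly A a t - F t)) \<longlongrightarrow> 0) (finite_subsets_at_top UNIV)"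
    by simp
  have "((\<lambda>A. ennreal (?d * (cmod (D A))\<^sup>2)) \<longlongrightarrow> 0) (finite_subsets_at_top UNIV)"
    by (rule tendsto_sandwich[OF always_eventually always_eventually tendsto_const lim]) (simp, intro allI le)
  then have "((\<lambda>A. ?d * (cmod (D A))\<^sup>2) \<longlongrightarrow> 0) (finite_subsets_at_top UNIV)"
    using dvol_pos[where 'n='n] by (intro tendsto_ennrealD) auto
  then have "((\<lambda>A. sqrt (?d * (cmod (D A))\<^sup>2 / ?d)) \<longlongrightarrow> sqrt (0 / ?d)) (finite_subsets_at_top UNIV)"
    using dvol_pos[where 'n='n] by (intro tendsto_intros) auto
  then have "((\<lambda>A. cmod (D A)) \<longlongrightarrow> 0) (finite_subsets_at_top UNIV)" using dvol_pos[where 'n='n] by simp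
  then have "(D \<longlongrightarrow> 0) (finite_subsets_at_top UNIV)" by (rule tendsto_norm_zero_cancel)
  then show ?thesis unfolding D_def[abs_def] by (rule LIM_zero_cancel)
qed

theorem Lp_multipliersI:
  fixes m :: "'n::finite torus \<Rightarrow> complex"
  assumes p: "p > 0" and C: "C > 0" and m: "continuous_on UNIV m"
    and bnd: "\<And>A X a. finite A \<Longrightarrow> finite X \<Longrightarrow>
      (\<Sum>x\<in>X. cmod (fourier_coeff (\<lambda>t. m t * trig_poly A a t) x) powr p) \<le> C powr p * (\<Sum>y\<in>A. cmod (a y) powr p)"
  shows "m \<in> Lp_multipliers p"
proof -
  obtain B where B: "B > 0" "\<And>t. cmod (m t) \<le> B" using continuous_bounded_torus[OF m] by blast
  note mm [measurable] = continuous_measurable_torus[OF m]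
  define \<Phi> where "\<Phi> a = (SOME F. is_fourier_transform a F)" for a :: "int ^ 'n \<Rightarrow> complex"
  have \<Phi>: "is_fourier_transform a (\<Phi> a)" if "a \<in> lp_space 2" for a
    using riesz_fischer[OF that] unfolding \<Phi>_def by (metis someI)
  define Q where "Q a = fourier_coeff (\<lambda>t. m t * \<Phi> a t)" for a
  have Qt: "is_fourier_transform (Q a) (\<lambda>t. m t * \<Phi> a t)" if "a \<in> lp_space 2" for a
    unfolding Q_def by (intro is_fourier_transform_coeff approximable_mult m approximable_fourier_transform[OF \<Phi>[OF that]])
  have bound: "Q a \<in> lp_space p \<and> lp_norm p (Q a) \<le> C * lp_norm p a" if a: "a \<in> lp_space p \<inter> lp_space 2" for a
  proof -
    let ?f = "\<lambda>k. cmod (a k) powr p" and ?q = "\<lambda>k. cmod (Q a k) powr p"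
    have s: "?f summable_on UNIV" using a by (simp add: lp_space_def)
    have fin: "sum ?q X \<le> C powr p * infsum ?f UNIV" if X: "finite X" for X
    proof (rule tendsto_upperbound[of _ _ "finite_subsets_at_top UNIV"])
      show "((\<lambda>A. \<Sum>x\<in>X. cmod (fourier_coeff (\<lambda>t. m t * trig_poly A a t) x) powr p) \<longlongrightarrow> sum ?q X) (finite_subsets_at_top UNIV)"
        unfolding Q_def using p a by (intro tendsto_sum tendsto_powr' tendsto_norm fourier_coeff_limit[OF \<Phi> m] tendsto_const) auto
      have "eventually (\<lambda>A. finite A) (finite_subsets_at_top (UNIV :: (int ^ 'n) set))"
        by (auto simp: eventually_finite_subsets_at_top)
      then show "eventually (\<lambda>A. (\<Sum>x\<in>X. cmod (fourier_coeff (\<lambda>t. m t * trig_poly A a t) x) powr p) \<le> C powr p * infsum ?f UNIV) (finite_subsets_at_top UNIV)"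
      proof eventually_elim
        case (elim A)
        have "(\<Sum>x\<in>X. cmod (fourier_coeff (\<lambda>t. m t * trig_poly A a t) x) powr p) \<le> C powr p * sum ?f A" by (rule bnd[OF elim X])
        also have "\<dots> \<le> C powr p * infsum ?f UNIV"
          by (intro mult_left_mono finite_sum_le_infsum s elim) auto
        finally show ?case .
      qed
    qed simp
    have sq: "?q summable_on UNIV"
      by (rule nonneg_bdd_above_summable_on) (auto intro!: bdd_aboveI2[where M = "C powr p * infsum ?f UNIV"] fin)
    have "infsum ?q UNIV \<le> C powr p * infsum ?f UNIV"
      by (rule infsum_le_finite_sums[OF sq]) (use fin in auto)
    then have "infsum ?q UNIV powr (1 / p) \<le> (C powr p * infsum ?f UNIV) powr (1 / p)"
      using p by (intro powr_mono2) (auto intro: infsum_nonneg)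
    also have "\<dots> = C * infsum ?f UNIV powr (1 / p)"
      using p C by (simp add: powr_mult infsum_nonneg powr_powr)
    finally show ?thesis using sq by (simp add: lp_norm_def lp_space_def)
  qed
  have "m \<in> L_infinity" unfolding L_infinity_def using B(2) by auto
  moreover have "(\<forall>a \<in> lp_space p \<inter> lp_space 2. \<exists>F. is_fourier_transform a F \<and> is_fourier_transform (Q a) (\<lambda>t. m t * F t))"
    using \<Phi> Qt by blast
  moreover have "\<exists>c>0. \<forall>a \<in> lp_space p \<inter> lp_space 2. Q a \<in> lp_space p \<and> lp_norm p (Q a) \<le> c * lp_norm p a"
    using C bound by blast
  ultimately show ?thesis unfolding Lp_multipliers_def by blast
qed

section \<open>Homeomorphisms of the torus\<close>

lemma circle_lift:
  assumes h: "strict_mono h" "continuous_on UNIV h" "\<And>x :: real. h (x + 1) = h x + 1"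
  obtains \<phi> where "\<And>x. \<phi> (abs_circle (2 * pi * x)) = abs_circle (2 * pi * h x)" "continuous_on UNIV \<phi>" "bij \<phi>"
proof -
  have hnat: "h (x + real n) = h x + real n" for x n
  proof (induction n)
    case (Suc n)
    then show ?case using h(3)[of "x + real n"] by (simp add: ac_simps)
  qed simp
  have hint: "h (x + of_int k) = h x + of_int k" for x k
  proof (cases "k \<ge> 0")
    case True
    then show ?thesis using hnat[of x "nat k"] by simp
  next
    case False
    then show ?thesis using hnat[of "x + of_int k" "nat (- k)"] by simp
  qed
  have rep: "\<exists>x. t = abs_circle (2 * pi * x)" for t
  proof -
    obtain x where "t = abs_circle x" using circle_rep by blast
    then show ?thesis by (intro exI[of _ "x / (2 * pi)"]) simp
  qed
  have eq: "abs_circle (2 * pi * x) = abs_circle (2 * pi * y) \<longleftrightarrow> (\<exists>k::int. x = y + of_int k)" for x y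
  proof -
    have "2 * pi * x - 2 * pi * y = 2 * pi * of_int k \<longleftrightarrow> x = y + of_int k" for k
    proof -
      have "2 * pi * x - 2 * pi * y = 2 * pi * of_int k \<longleftrightarrow> 2 * pi * (x - y) = 2 * pi * of_int k" by (simp add: right_diff_distrib)
      also have "\<dots> \<longleftrightarrow> x - y = of_int k" by simp
      finally show ?thesis by auto
    qed
    then show ?thesis by (simp add: abs_circle_eq_iff)
  qed
  define \<phi> where "\<phi> t = abs_circle (2 * pi * h (SOME x. t = abs_circle (2 * pi * x)))" for t
  have \<phi>: "\<phi> (abs_circle (2 * pi * x)) = abs_circle (2 * pi * h x)" for x
  proof -
    define y where "y = (SOME y. abs_circle (2 * pi * x) = abs_circle (2 * pi * y))"
    have "abs_circle (2 * pi * x) = abs_circle (2 * pi * y)" unfolding y_def by (rule someI) (rule refl)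
    then obtain k :: int where "x = y + of_int k" unfolding eq by blast
    then have "abs_circle (2 * pi * h y) = abs_circle (2 * pi * h x)"
      unfolding eq by (intro exI[of _ "- k"]) (simp add: hint)
    then show ?thesis by (simp add: \<phi>_def y_def)
  qed
  have "continuous_on UNIV \<phi>"
    unfolding continuous_on_iff
  proof (intro ballI allI impI)
    fix t :: circle and e :: real assume e: "e > 0"
    obtain x where x: "t = abs_circle (2 * pi * x)" using rep by blast
    obtain d where d: "d > 0" "\<And>y. dist y x < d \<Longrightarrow> dist (h y) (h x) < e / (2 * pi)"
      using h(2) e unfolding continuous_on_iff by (metis UNIV_I divide_pos_pos pi_gt_zero zero_less_mult_iff zero_less_numeral)
    have "dist (\<phi> s) (\<phi> t) < e" if s: "dist s t < 2 * pi * d" for s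
    proof -
      obtain z where z: "s = abs_circle z" using circle_rep by blast
      obtain y where y: "abs_circle y = abs_circle z" "\<bar>2 * pi * x - y\<bar> = dist (abs_circle (2 * pi * x)) (abs_circle z)"
        using dist_abs_circle_attained by blast
      define u where "u = y / (2 * pi)"
      have yu: "y = 2 * pi * u" by (simp add: u_def)
      have "2 * pi * \<bar>x - u\<bar> = \<bar>2 * pi * x - y\<bar>" by (simp add: yu right_diff_distrib[symmetric] abs_mult)
      also have "\<dots> < 2 * pi * d" using s y(2) by (simp add: x z dist_commute)
      finally have "\<bar>h u - h x\<bar> < e / (2 * pi)" using d(2)[of u] by (simp add: dist_real_def abs_minus_commute)
      then have "2 * pi * \<bar>h u - h x\<bar> < e" by (simp add: pos_less_divide_eq mult.commute)
      moreover have "dist (\<phi> s) (\<phi> t) \<le> 2 * pi * \<bar>h u - h x\<bar>"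
        using dist_abs_circle_le[of "2 * pi * h u" "2 * pi * h x"]
        by (simp add: z y(1)[symmetric] yu x \<phi> right_diff_distrib[symmetric] abs_mult)
      ultimately show ?thesis by simp
    qed
    then show "\<exists>d>0. \<forall>x'\<in>UNIV. dist x' t < d \<longrightarrow> dist (\<phi> x') (\<phi> t) < e"
      using d(1) by (intro exI[of _ "2 * pi * d"]) auto
  qed
  moreover have "bij \<phi>"
  proof (rule bijI)
    show "inj \<phi>"
    proof (rule injI)
      fix s t assume st: "\<phi> s = \<phi> t"
      obtain x where x: "s = abs_circle (2 * pi * x)" using rep by blast
      obtain y where y: "t = abs_circle (2 * pi * y)" using rep by blast
      obtain k :: int where "h x = h y + of_int k" using st unfolding x y \<phi> eq by blast
      then have "h x = h (y + of_int k)" by (simp add: hint)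
      then have "x = y + of_int k" using strict_mono_eq[OF h(1)] by blast
      then show "s = t" unfolding x y eq by blast
    qed
    have "t \<in> range \<phi>" for t
    proof -
      obtain v where v: "t = abs_circle (2 * pi * v)" using rep by blast
      define k where "k = \<lfloor>v - h 0\<rfloor>"
      have k: "of_int k \<le> v - h 0" "v - h 0 < of_int k + 1" by (auto simp: k_def floor_correct)
      have "h (of_int k) = h 0 + of_int k" "h (of_int k + 1) = h 0 + of_int k + 1"
        using hint[of 0 k] h(3)[of "of_int k"] by auto
      then have "\<exists>x\<ge>of_int k. x \<le> of_int k + 1 \<and> h x = v"
        using k by (intro IVT') (auto intro: continuous_on_subset[OF h(2)])
      then obtain x where "h x = v" by blast
      then have "t = \<phi> (abs_circle (2 * pi * x))" by (simp add: \<phi> v)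
      then show ?thesis by blast
    qed
    then show "surj \<phi>" by blast
  qed
  ultimately show ?thesis using that \<phi> by blast
qed

lemma torus_lift:
  assumes h: "strict_mono h" "continuous_on UNIV h" "\<And>x :: real. h (x + 1) = h x + 1"
  obtains H :: "('n::finite) torus \<Rightarrow> 'n torus" where "self_homeomorphism H" "continuous_on UNIV H"
    "\<And>M k. H (gpt M k) = torus_proj (\<chi> i. 2 * pi * h (of_int (k $ i) / real M))"
proof -
  obtain \<phi> where \<phi>: "\<And>x. \<phi> (abs_circle (2 * pi * x)) = abs_circle (2 * pi * h x)" "continuous_on UNIV \<phi>" "bij \<phi>"
    using circle_lift[OF h] by blast
  define H where "H t = (\<chi> i. \<phi> (t $ i))" for t :: "'n torus"
  have cont: "continuous_on UNIV H"
    unfolding H_def by (intro continuous_on_vec_lambda continuous_on_compose2[OF \<phi>(2)] continuous_intros) auto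
  have "inj H"
  proof (rule injI)
    fix s t assume "H s = H t"
    then show "s = t" using bij_is_inj[OF \<phi>(3)] by (auto simp: H_def vec_eq_iff inj_eq)
  qed
  moreover have "t \<in> range H" for t
    using bij_is_surj[OF \<phi>(3)] by (intro image_eqI[of _ _ "\<chi> i. inv \<phi> (t $ i)"]) (auto simp: H_def vec_eq_iff surj_f_inv_f)
  then have "range H = UNIV" by blast
  ultimately have "self_homeomorphism H"
    unfolding self_homeomorphism_def by (intro homeomorphism_compact compact_torus cont) auto
  moreover have "H (gpt M k) = torus_proj (\<chi> i. 2 * pi * h (of_int (k $ i) / real M))" for M k
    using \<phi>(1)[of "of_int (k $ _) / real M"] by (simp add: H_def gpt_def torus_proj_def)
  ultimately show ?thesis using that cont by blast
qed

lemma dist_torus_proj_le: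
  fixes x y :: "real ^ 'n::finite"
  assumes "\<And>i. \<bar>x $ i - y $ i\<bar> \<le> e"
  shows "dist (torus_proj x) (torus_proj y) \<le> real CARD('n) * e"
proof -
  have "dist (torus_proj x) (torus_proj y) \<le> (\<Sum>i\<in>UNIV. dist (torus_proj x $ i) (torus_proj y $ i))"
    unfolding dist_vec_def by (rule L2_set_le_sum) simp
  also have "\<dots> \<le> (\<Sum>i\<in>(UNIV :: 'n set). e)"
    using assms by (intro sum_mono) (auto simp: torus_proj_def intro: order_trans[OF dist_abs_circle_le])
  finally show ?thesis by simp
qed

lemma uniformly_equicontinuousD:
  fixes K :: "('n::finite torus \<Rightarrow> complex) set"
  assumes K: "uniformly_equicontinuous K" and e: "e > 0"
  obtains d where "d > 0" "\<And>f s t. f \<in> K \<Longrightarrow> dist s t \<le> d \<Longrightarrow> cmod (f s - f t) \<le> e"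
proof -
  have "eventually (\<lambda>d. family_modulus_of_continuity K d < ennreal e) (at_right 0)"
    using K e unfolding uniformly_equicontinuous_def by (intro order_tendstoD) auto
  then obtain b where b: "b > 0" "\<And>d. 0 < d \<Longrightarrow> d < b \<Longrightarrow> family_modulus_of_continuity K d < ennreal e"
    by (auto simp: eventually_at_right_field)
  show ?thesis
  proof (rule that[of "b / 2"])
    fix f and s t :: "'n torus" assume f: "f \<in> K" and st: "dist s t \<le> b / 2"
    have "ennreal (cmod (f s - f t)) \<le> modulus_of_continuity f (b / 2)"
      unfolding modulus_of_continuity_def using st by (intro SUP_upper2[of "(s, t)"]) auto
    also have "\<dots> \<le> family_modulus_of_continuity K (b / 2)"
      unfolding family_modulus_of_continuity_def by (rule SUP_upper[OF f])
    also have "\<dots> < ennreal e" using b by auto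
    finally show "cmod (f s - f t) \<le> e" using e by (simp add: ennreal_less_iff)
  qed (use b in simp)
qed

lemma uniformly_equicontinuous_singleton:
  fixes f :: "'n::finite torus \<Rightarrow> complex"
  assumes f: "continuous_on UNIV f"
  shows "uniformly_equicontinuous {f}"
  unfolding uniformly_equicontinuous_def
proof (rule order_tendstoI)
  fix e :: ennreal assume e: "0 < e"
  obtain e' where e': "e' > 0" "ennreal e' < e"
  proof -
    obtain x where x: "0 < x" "x < e" using dense[OF e] by blast
    then obtain r where "r \<ge> 0" "x = ennreal r" by (cases x) (auto simp: top_unique)
    then show thesis using x by (intro that[of r]) auto
  qed
  have "uniformly_continuous_on UNIV f" by (rule compact_uniformly_continuous[OF f compact_torus])
  then obtain d where d: "d > 0" "\<And>s t. dist s t < d \<Longrightarrow> dist (f s) (f t) < e'"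
    unfolding uniformly_continuous_on_def using e'(1) by (metis UNIV_I)
  have "family_modulus_of_continuity {f} x < e" if "x < d" for x
  proof -
    have "family_modulus_of_continuity {f} x \<le> ennreal e'"
      unfolding family_modulus_of_continuity_def modulus_of_continuity_def
      using d(2) that by (auto intro!: SUP_least ennreal_leI simp: dist_norm[symmetric] less_imp_le le_less_trans)
    then show ?thesis using e'(2) by (rule le_less_trans)
  qed
  then show "eventually (\<lambda>x. family_modulus_of_continuity {f} x < e) (at_right 0)"
    unfolding eventually_at_right_field using d(1) by auto
qed auto

lemma telescoping_multiplier:
  fixes F :: "int ^ 'n::finite \<Rightarrow> complex" and \<pi> :: "nat \<Rightarrow> int ^ 'n \<Rightarrow> 'z"
  assumes refine: "\<forall>n k k'. \<pi> (Suc n) k = \<pi> (Suc n) k' \<longrightarrow> \<pi> n k = \<pi> n k'"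
    and osc: "\<forall>n k k'. \<pi> n k = \<pi> n k' \<longrightarrow> cmod (F k - F k') \<le> \<eta> n"
    and B: "\<And>k. cmod (F k) \<le> B"
  obtains g where "\<And>k. k \<in> grid M \<Longrightarrow> cmod (g k - F k) \<le> \<eta> N" "\<And>k. cmod (g k) \<le> B"
    "\<And>p G. p \<ge> 1 \<Longrightarrow> (\<And>n. n \<le> N \<Longrightarrow> lp_partition M p (G n) (\<pi> n)) \<Longrightarrow>
       mult_bound M p (B * G 0 + (\<Sum>n<N. \<eta> n * G (Suc n))) g \<and> mult_bound M p (B * G 0 + (\<Sum>n<N. \<eta> n * G (Suc n))) (\<lambda>k. cnj (g k))"
proof -
  note refine = refine[rule_format] and osc = osc[rule_format]
  define r where "r n z = (SOME k. k \<in> grid M \<and> \<pi> n k = z)" for n z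
  have r: "r n (\<pi> n k) \<in> grid M" "\<pi> n (r n (\<pi> n k)) = \<pi> n k" if "k \<in> grid M" for n k
    using someI[of "\<lambda>k'. k' \<in> grid M \<and> \<pi> n k' = \<pi> n k" k] that by (auto simp: r_def)
  have scaled: "mult_bound M p (b * G) (\<lambda>k. c (\<pi> n k))"
    if p: "p \<ge> 1" and part: "lp_partition M p G (\<pi> n)" and c: "\<And>k. k \<in> grid M \<Longrightarrow> cmod (c (\<pi> n k)) \<le> b" and b: "b \<ge> 0" for p G n b c
  proof -
    define c' where "c' z = (if cmod (c z) \<le> b then c z / of_real b else 0)" for z
    have "cmod (c' z) \<le> 1" for z using b by (auto simp: c'_def norm_divide divide_le_eq_1)
    then have "mult_bound M p G (\<lambda>k. c' (\<pi> n k))" using part by (simp add: lp_partition_def)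
    then have "mult_bound M p (cmod (of_real b) * G) (\<lambda>k. of_real b * c' (\<pi> n k))" using p by (intro mult_bound_scale) auto
    moreover have "of_real b * c' (\<pi> n k) = c (\<pi> n k)" if "k \<in> grid M" for k
      using c[OF that] by (cases "b = 0") (auto simp: c'_def)
    ultimately show ?thesis using b mult_bound_cong by fastforce
  qed
  define g where "g n k = F (r n (\<pi> n k))" for n k
  show ?thesis
  proof (rule that[of "g N"])
    show "cmod (g N k - F k) \<le> \<eta> N" if "k \<in> grid M" for k
      unfolding g_def using r[OF that] that by (intro osc) auto
    show "cmod (g N k) \<le> B" for k by (simp add: g_def B)
    fix p and G :: "nat \<Rightarrow> real" assume p: "p \<ge> 1" and part: "\<And>n. n \<le> N \<Longrightarrow> lp_partition M p (G n) (\<pi> n)"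
    have B0: "B \<ge> 0" using B norm_ge_zero order_trans by blast
    have main: "mult_bound M p (B * G 0 + (\<Sum>n<N. \<eta> n * G (Suc n))) (\<lambda>k. s (g N k))"
      if s: "\<And>z w. s (z - w) = s z - s w" "\<And>z. cmod (s z) = cmod z" for s
    proof -
      have "n \<le> N \<Longrightarrow> mult_bound M p (B * G 0 + (\<Sum>j<n. \<eta> j * G (Suc j))) (\<lambda>k. s (g n k))" for n
      proof (induction n)
        case 0
        show ?case using scaled[OF p part[of 0], of "\<lambda>z. s (F (r 0 z))" B] B B0 by (simp add: g_def s(2))
      next
        case (Suc n)
        define c where "c z = s (g (Suc n) (r (Suc n) z)) - s (g n (r (Suc n) z))" for z
        have c: "c (\<pi> (Suc n) k) = s (g (Suc n) k) - s (g n k)" if "k \<in> grid M" for k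
        proof -
          have "\<pi> (Suc n) (r (Suc n) (\<pi> (Suc n) k)) = \<pi> (Suc n) k" using r[OF that] by simp
          moreover from refine[OF this] have "\<pi> n (r (Suc n) (\<pi> (Suc n) k)) = \<pi> n k" .
          ultimately show ?thesis by (simp add: c_def g_def)
        qed
        have cb: "cmod (c (\<pi> (Suc n) k)) \<le> \<eta> n" if k: "k \<in> grid M" for k
        proof -
          have "\<pi> n (r (Suc n) (\<pi> (Suc n) k)) = \<pi> n (r n (\<pi> n k))" using refine r[OF k] by metis
          then show ?thesis unfolding c[OF k] s(1)[symmetric] s(2) g_def using r[OF k] by (intro osc) auto
        qed
        show ?case
        proof (cases "grid M = ({} :: (int ^ 'n) set)")
          case True
          then show ?thesis by (simp add: mult_bound_def nrm_def)
        next
          case False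
          then obtain k0 :: "int ^ 'n" where "k0 \<in> grid M" by blast
          then have "\<eta> n \<ge> 0" using cb norm_ge_zero order_trans by blast
          then have "mult_bound M p (\<eta> n * G (Suc n)) (\<lambda>k. c (\<pi> (Suc n) k))"
            using Suc.prems by (intro scaled p part cb) auto
          then have "mult_bound M p (B * G 0 + (\<Sum>j<n. \<eta> j * G (Suc j)) + \<eta> n * G (Suc n)) (\<lambda>k. s (g n k) + c (\<pi> (Suc n) k))"
            using Suc by (intro mult_bound_add p) auto
          then show ?thesis by (rule mult_bound_cong[OF mult_bound_mono]) (auto simp: c)
        qed
      qed
      then show ?thesis by simp
    qed
    show "mult_bound M p (B * G 0 + (\<Sum>n<N. \<eta> n * G (Suc n))) (g N) \<and> mult_bound M p (B * G 0 + (\<Sum>n<N. \<eta> n * G (Suc n))) (\<lambda>k. cnj (g N k))"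
      using main[of "\<lambda>z. z"] main[of cnj] by simp
  qed
qed

lemma gN_pos: "gN L n > 0"
  by (induction n) auto

lemma floor_refine:
  assumes "a > 0"
  shows "\<lfloor>real N * x\<rfloor> = \<lfloor>real (N * a) * x\<rfloor> div int a"
proof -
  have "real N * x = real (N * a) * x / real_of_int (int a)" using assms by simp
  then show ?thesis using floor_divide_real_eq_div[of "int a" "real (N * a) * x"] by simp
qed

theorem equicontinuous_multipliers:
  fixes K :: "(('n::finite) torus \<Rightarrow> complex) set"
  assumes cont: "\<And>f. f \<in> K \<Longrightarrow> continuous_on UNIV f" and K: "uniformly_equicontinuous K"
  obtains H where "self_homeomorphism H" "\<And>f p. f \<in> K \<Longrightarrow> p > (1::real) \<Longrightarrow> f \<circ> H \<in> Lp_multipliers p"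
proof -
  let ?d = "CARD('n)"
  define s where "s n = 1 + (\<Sum>q\<le>n. genC q (?d * Suc n))" for n
  have s1: "s n \<ge> 1" for n by (simp add: s_def sum_nonneg genC_nonneg)
  define \<eta> where "\<eta> n = (1/2) ^ n / s n" for n
  have \<eta>: "\<eta> n > 0" "\<eta> n \<le> (1/2) ^ n" for n
    using s1[of n] by (auto simp: \<eta>_def divide_le_eq intro: mult_left_mono[of 1, simplified])
  have \<eta>G: "\<eta> n * genC q (?d * Suc n) \<le> (1/2) ^ n" if "q \<le> n" for n q
  proof -
    have "genC q (?d * Suc n) \<le> (\<Sum>q\<le>n. genC q (?d * Suc n))" using that by (intro member_le_sum genC_nonneg) auto
    then have "genC q (?d * Suc n) \<le> s n" by (simp add: s_def)
    then have "(1/2) ^ n * genC q (?d * Suc n) \<le> (1/2) ^ n * s n" by (intro mult_left_mono) auto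
    then show ?thesis using s1[of n] by (simp add: \<eta>_def pos_divide_le_eq)
  qed
  have "\<forall>n. \<exists>l\<ge>1. \<forall>f\<in>K. \<forall>s t. dist s t \<le> real ?d * (2 * pi / real l) \<longrightarrow> cmod (f s - f t) \<le> \<eta> (Suc n)"
  proof
    fix n
    obtain \<delta> where \<delta>: "\<delta> > 0" "\<And>f s t. f \<in> K \<Longrightarrow> dist s t \<le> \<delta> \<Longrightarrow> cmod (f s - f t) \<le> \<eta> (Suc n)"
      using uniformly_equicontinuousD[OF K \<eta>(1)[of "Suc n"]] by blast
    obtain l :: nat where l: "real ?d * (2 * pi) / \<delta> \<le> real l" using real_arch_simple by blast
    moreover have "0 < real ?d * (2 * pi) / \<delta>" using \<delta>(1) by simp
    ultimately have l1: "l \<ge> 1" by (metis less_le_trans less_one not_le of_nat_0 order_less_irrefl)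
    have "real ?d * (2 * pi / real l) \<le> \<delta>" using l l1 \<delta>(1) by (simp add: field_simps)
    then show "\<exists>l\<ge>1. \<forall>f\<in>K. \<forall>s t. dist s t \<le> real ?d * (2 * pi / real l) \<longrightarrow> cmod (f s - f t) \<le> \<eta> (Suc n)"
      using \<delta>(2) l1 by (meson order_trans)
  qed
  from choice[OF this] obtain L where L: "\<And>n. L n \<ge> 1"
    and LK: "\<And>n f s t. f \<in> K \<Longrightarrow> dist s t \<le> real ?d * (2 * pi / real (L n)) \<Longrightarrow> cmod (f s - f t) \<le> \<eta> (Suc n)" by blast
  obtain h :: "real \<Rightarrow> real" where h: "strict_mono h" "continuous_on UNIV h" "\<And>x. h (x + 1) = h x + 1" "h 0 = 0"
    and part: "\<And>q n \<rho>. q \<ge> 1 \<Longrightarrow> \<rho> \<ge> 1 \<Longrightarrow> gR L n \<le> \<rho> \<Longrightarrow>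
       lp_partition (2 ^ \<rho>) (real (2 * 2 ^ q)) (genC q (?d * n)) (\<lambda>k :: int ^ 'n. \<lambda>i. \<lfloor>real (gN L n) * h (real_of_int (k $ i) / 2 ^ \<rho>)\<rfloor>)"
    by (fact lacunary_homeomorphism[where L = L and 'n='n, OF L])
  obtain H :: "'n torus \<Rightarrow> 'n torus" where H: "self_homeomorphism H" "continuous_on UNIV H"
    "\<And>M k. H (gpt M k) = torus_proj (\<chi> i. 2 * pi * h (of_int (k $ i) / real M))"
    using torus_lift[OF h(1-3)] by blast
  define \<pi> where "\<pi> \<rho> n k = (\<lambda>i. \<lfloor>real (gN L n) * h (real_of_int (k $ i) / 2 ^ \<rho>)\<rfloor>)" for \<rho> n and k :: "int ^ 'n"
  have refine: "\<pi> \<rho> n k = \<pi> \<rho> n k'" if "\<pi> \<rho> (Suc n) k = \<pi> \<rho> (Suc n) k'" for \<rho> n k k'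
  proof -
    have "\<pi> \<rho> n k = (\<lambda>i. \<pi> \<rho> (Suc n) k i div int (2 * L n + 1))" for k
      unfolding \<pi>_def gN.simps by (intro ext floor_refine) simp
    then show ?thesis using that by simp
  qed
  define \<nu> where "\<nu> \<rho> = Max {n. n \<le> \<rho> \<and> gR L n \<le> \<rho>}" for \<rho>
  have \<nu>: "gR L (\<nu> \<rho>) \<le> \<rho>" for \<rho>
    using Max_in[of "{n. n \<le> \<rho> \<and> gR L n \<le> \<rho>}"] by (fastforce simp: \<nu>_def intro: exI[of _ 0])
  have \<nu>_ge: "n \<le> \<nu> \<rho>" if "n \<le> \<rho>" "gR L n \<le> \<rho>" for n \<rho>
    unfolding \<nu>_def using that by (intro Max_ge) auto
  have \<nu>_lim: "filterlim \<nu> at_top sequentially"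
    unfolding filterlim_at_top
  proof
    fix n
    show "eventually (\<lambda>\<rho>. n \<le> \<nu> \<rho>) sequentially"
      unfolding eventually_sequentially by (intro exI[of _ "max n (gR L n)"]) (auto intro: \<nu>_ge)
  qed
  have "f \<circ> H \<in> Lp_multipliers p" if f: "f \<in> K" and p: "p > 1" for f p
  proof -
    have cf: "continuous_on UNIV (f \<circ> H)"
      by (rule continuous_on_compose[OF H(2) continuous_on_subset[OF cont[OF f]]]) simp
    obtain B where B: "B > 0" "\<And>t. cmod (f t) \<le> B" using continuous_bounded_torus[OF cont[OF f]] by blast
    obtain q :: nat and R :: real where R: "R > 0" and
      interp: "\<And>M C (m :: int ^ 'n \<Rightarrow> complex). M > 0 \<Longrightarrow> C > 0 \<Longrightarrow> q \<ge> 1 \<Longrightarrow>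
       (\<And>l. l \<in> {0, q} \<Longrightarrow> mult_bound M (real (2 * 2 ^ l)) C m \<and> mult_bound M (real (2 * 2 ^ l)) C (\<lambda>x. cnj (m x))) \<Longrightarrow>
       mult_bound M p (R * C) m" and q: "q \<ge> 1"
      by (fact mult_bound_real_exponent[OF p, where 'n='n])
    define \<eta>' where "\<eta>' n = (if n = 0 then 2 * B else \<eta> n)" for n
    let ?G = "\<lambda>n. genC q (?d * n)"
    define C where "C = B + B * ?G 0 + ((\<Sum>n<Suc q. \<eta>' n * ?G (Suc n)) + 2)"
    have \<eta>'0: "\<eta>' n \<ge> 0" for n using \<eta>(1)[of n] B(1) by (simp add: \<eta>'_def less_imp_le)
    have C: "C \<ge> B" "B * ?G 0 + (\<Sum>n<N. \<eta>' n * ?G (Suc n)) \<le> C" for N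
    proof -
      have nn: "\<eta>' n * ?G (Suc n) \<ge> 0" for n by (intro mult_nonneg_nonneg \<eta>'0 genC_nonneg)
      have "0 \<le> B * ?G 0" using B(1) by (intro mult_nonneg_nonneg genC_nonneg) simp
      moreover have "0 \<le> (\<Sum>n<Suc q. \<eta>' n * ?G (Suc n))" by (intro sum_nonneg nn)
      ultimately show "C \<ge> B" unfolding C_def by linarith
      have "(\<Sum>n<N. \<eta>' n * ?G (Suc n)) \<le> (\<Sum>n\<in>{..<Suc q} \<union> {Suc q..<N}. \<eta>' n * ?G (Suc n))"
        by (intro sum_mono2 nn) auto
      also have "\<dots> = (\<Sum>n<Suc q. \<eta>' n * ?G (Suc n)) + (\<Sum>n\<in>{Suc q..<N}. \<eta>' n * ?G (Suc n))"
        by (intro sum.union_disjoint) auto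
      also have "(\<Sum>n\<in>{Suc q..<N}. \<eta>' n * ?G (Suc n)) \<le> (\<Sum>n\<in>{Suc q..<N}. (1/2) ^ n)"
      proof (rule sum_mono)
        fix n assume "n \<in> {Suc q..<N}"
        then have "q \<le> n" "n \<noteq> 0" by auto
        then show "\<eta>' n * ?G (Suc n) \<le> (1/2) ^ n" using \<eta>G[of q n] by (simp only: \<eta>'_def if_False)
      qed
      also have "\<dots> \<le> (\<Sum>n<N. (1/2::real) ^ n)" by (intro sum_mono2) auto
      also have "\<dots> \<le> 2" by (simp add: sum_gp_strict)
      finally show "B * ?G 0 + (\<Sum>n<N. \<eta>' n * ?G (Suc n)) \<le> C" using B(1) unfolding C_def by linarith
    qed
    then have C0: "C > 0" using B(1) by linarith
    have osc: "cmod (f (H (gpt (2 ^ \<rho>) k)) - f (H (gpt (2 ^ \<rho>) k'))) \<le> \<eta>' n" if eq: "\<pi> \<rho> n k = \<pi> \<rho> n k'" for \<rho> n k k'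
    proof (cases n)
      case 0
      have "cmod (f (H (gpt (2 ^ \<rho>) k)) - f (H (gpt (2 ^ \<rho>) k'))) \<le> B + B" by (intro order_trans[OF norm_triangle_ineq4] add_mono B)
      then show ?thesis using 0 by (simp add: \<eta>'_def)
    next
      case (Suc j)
      have N: "real (L j) \<le> real (gN L n)" "real (L j) > 0"
      proof -
        have "1 * L j \<le> gN L j * (2 * L j + 1)" using gN_pos[of L j] by (intro mult_le_mono) auto
        then show "real (L j) \<le> real (gN L n)" unfolding Suc gN.simps of_nat_le_iff mult_1 .
        show "real (L j) > 0" using L[of j] by simp
      qed
      have "\<bar>2 * pi * h (of_int (k $ i) / 2 ^ \<rho>) - 2 * pi * h (of_int (k' $ i) / 2 ^ \<rho>)\<bar> \<le> 2 * pi / real (L j)" for i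
      proof -
        let ?x = "h (of_int (k $ i) / 2 ^ \<rho>)" and ?y = "h (of_int (k' $ i) / 2 ^ \<rho>)"
        have "\<lfloor>real (gN L n) * ?x\<rfloor> = \<lfloor>real (gN L n) * ?y\<rfloor>" using fun_cong[OF eq, of i] by (simp add: \<pi>_def)
        then have "\<bar>real (gN L n) * ?x - real (gN L n) * ?y\<bar> \<le> 1"
          using floor_correct[of "real (gN L n) * ?x"] floor_correct[of "real (gN L n) * ?y"] by linarith
        then have "real (gN L n) * \<bar>?x - ?y\<bar> \<le> 1" by (simp add: right_diff_distrib[symmetric] abs_mult)
        then have "real (L j) * \<bar>?x - ?y\<bar> \<le> 1" using mult_right_mono[OF N(1), of "\<bar>?x - ?y\<bar>"] by simp
        then have "\<bar>?x - ?y\<bar> \<le> 1 / real (L j)" using N(2) by (simp add: pos_le_divide_eq mult.commute)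
        then have "2 * pi * \<bar>?x - ?y\<bar> \<le> 2 * pi * (1 / real (L j))" by (intro mult_left_mono) auto
        then show ?thesis by (simp add: right_diff_distrib[symmetric] abs_mult)
      qed
      then have "dist (H (gpt (2 ^ \<rho>) k)) (H (gpt (2 ^ \<rho>) k')) \<le> real ?d * (2 * pi / real (L j))"
        unfolding H(3) by (intro dist_torus_proj_le) simp
      from LK[OF f this] show ?thesis by (simp add: \<eta>'_def Suc)
    qed
    have "\<forall>\<rho>. \<exists>g. (\<forall>k\<in>grid (2 ^ \<rho>). cmod (g k - (f \<circ> H) (gpt (2 ^ \<rho>) k)) \<le> \<eta>' (\<nu> \<rho>)) \<and> (\<rho> \<ge> 1 \<longrightarrow> mult_bound (2 ^ \<rho>) p (R * C) g)"
    proof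
      fix \<rho>
      have ref: "\<forall>n k k'. \<pi> \<rho> (Suc n) k = \<pi> \<rho> (Suc n) k' \<longrightarrow> \<pi> \<rho> n k = \<pi> \<rho> n k'"
        by (intro allI impI) (rule refine)
      have osc': "\<forall>n k k'. \<pi> \<rho> n k = \<pi> \<rho> n k' \<longrightarrow> cmod (f (H (gpt (2 ^ \<rho>) k)) - f (H (gpt (2 ^ \<rho>) k'))) \<le> \<eta>' n"
        by (intro allI impI) (rule osc)
      obtain g :: "int ^ 'n \<Rightarrow> complex" where g: "\<And>k. k \<in> grid (2 ^ \<rho>) \<Longrightarrow> cmod (g k - f (H (gpt (2 ^ \<rho>) k))) \<le> \<eta>' (\<nu> \<rho>)" "\<And>k. cmod (g k) \<le> B"
        and mb: "\<And>p G. p \<ge> 1 \<Longrightarrow> (\<And>n. n \<le> \<nu> \<rho> \<Longrightarrow> lp_partition (2 ^ \<rho>) p (G n) (\<pi> \<rho> n)) \<Longrightarrow>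
          mult_bound (2 ^ \<rho>) p (B * G 0 + (\<Sum>n<\<nu> \<rho>. \<eta>' n * G (Suc n))) g \<and> mult_bound (2 ^ \<rho>) p (B * G 0 + (\<Sum>n<\<nu> \<rho>. \<eta>' n * G (Suc n))) (\<lambda>k. cnj (g k))"
        by (fact telescoping_multiplier[of "\<pi> \<rho>" "\<lambda>k. f (H (gpt (2 ^ \<rho>) k))" \<eta>' B "2 ^ \<rho>" "\<nu> \<rho>", OF ref osc' B(2)])
      have "mult_bound (2 ^ \<rho>) p (R * C) g" if \<rho>: "\<rho> \<ge> 1"
      proof (rule interp)
        fix l assume "l \<in> {0, q}"
        then consider "l = 0" | "l = q" by blast
        then show "mult_bound (2 ^ \<rho>) (real (2 * 2 ^ l)) C g \<and> mult_bound (2 ^ \<rho>) (real (2 * 2 ^ l)) C (\<lambda>x. cnj (g x))"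
        proof cases
          case 1
          have "cmod (g k) \<le> C" for k using g(2)[of k] C(1) by linarith
          then show ?thesis using 1 C0 mult_bound_2[of "2 ^ \<rho>" C g] mult_bound_2[of "2 ^ \<rho>" C "\<lambda>x. cnj (g x)"] by simp
        next
          case 2
          have "lp_partition (2 ^ \<rho>) (real (2 * 2 ^ q)) (?G n) (\<pi> \<rho> n)" if "n \<le> \<nu> \<rho>" for n
            unfolding \<pi>_def using gR_mono[OF that, of L] \<nu>[of \<rho>] by (intro part q \<rho>) linarith
          moreover have "1 \<le> real (2 * 2 ^ q)" using one_le_power[of "2::real" q] unfolding of_nat_mult of_nat_power of_nat_numeral by linarith
          ultimately show ?thesis unfolding 2 using mb[of "real (2 * 2 ^ q)" ?G] C(2)[of "\<nu> \<rho>"] mult_bound_mono by blast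
        qed
      qed (use C0 q in auto)
      then show "\<exists>g. (\<forall>k\<in>grid (2 ^ \<rho>). cmod (g k - (f \<circ> H) (gpt (2 ^ \<rho>) k)) \<le> \<eta>' (\<nu> \<rho>)) \<and> (\<rho> \<ge> 1 \<longrightarrow> mult_bound (2 ^ \<rho>) p (R * C) g)"
        using g(1) by (intro exI[of _ g]) simp
    qed
    from choice[OF this] obtain g where g: "\<And>\<rho> k. k \<in> grid (2 ^ \<rho>) \<Longrightarrow> cmod (g \<rho> k - (f \<circ> H) (gpt (2 ^ \<rho>) k)) \<le> \<eta>' (\<nu> \<rho>)"
      "\<And>\<rho>. \<rho> \<ge> 1 \<Longrightarrow> mult_bound (2 ^ \<rho>) p (R * C) (g \<rho>)" by blast
    have "\<eta>' \<longlonglongrightarrow> 0"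
    proof (rule Lim_null_comparison)
      show "eventually (\<lambda>n. norm (\<eta>' n) \<le> (1/2) ^ n) sequentially"
        unfolding eventually_sequentially using \<eta> by (intro exI[of _ 1]) (auto simp: \<eta>'_def less_imp_le)
      show "(\<lambda>n. (1/2::real) ^ n) \<longlonglongrightarrow> 0" by (rule LIMSEQ_power_zero) simp
    qed
    then have "(\<lambda>\<rho>. \<eta>' (\<nu> \<rho>)) \<longlonglongrightarrow> 0" using \<nu>_lim by (rule filterlim_compose)
    then show ?thesis
      using p R C0 by (intro Lp_multipliersI[where C = "R * C"] transference[where g = g and \<delta> = "\<lambda>\<rho>. \<eta>' (\<nu> \<rho>)"] cf g) auto
  qed
  then show ?thesis using that H(1) by blast
qed

theorem theorem2:
  shows "(\<forall>f :: ('n::finite) torus \<Rightarrow> complex. continuous_on UNIV f \<longrightarrow>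
            (\<exists>h. self_homeomorphism h \<and>
               (\<forall>p::real. 1 < p \<longrightarrow> f \<circ> h \<in> Lp_multipliers p))) \<and>
         (\<forall>K :: ('n torus \<Rightarrow> complex) set.
            (\<forall>f\<in>K. continuous_on UNIV f) \<and> uniformly_equicontinuous K \<longrightarrow>
            (\<exists>h. self_homeomorphism h \<and>
               (\<forall>f\<in>K. \<forall>p::real. 1 < p \<longrightarrow> f \<circ> h \<in> Lp_multipliers p)))"
proof -
  have K: "\<exists>h. self_homeomorphism h \<and> (\<forall>f\<in>K. \<forall>p::real. 1 < p \<longrightarrow> f \<circ> h \<in> Lp_multipliers p)"
    if "\<forall>f\<in>K. continuous_on UNIV f" "uniformly_equicontinuous K" for K :: "('n torus \<Rightarrow> complex) set"
    using equicontinuous_multipliers[of K] that by metis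
  have "\<exists>h. self_homeomorphism h \<and> (\<forall>p::real. 1 < p \<longrightarrow> f \<circ> h \<in> Lp_multipliers p)"
    if "continuous_on UNIV f" for f :: "'n torus \<Rightarrow> complex"
    using K[of "{f}"] that uniformly_equicontinuous_singleton[OF that] by simp
  then show ?thesis using K by blast
qed

end
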